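(* Let $\Omega$ be a compact metric space, $T:\Omega\to\Omega$ a minimal homeomorphism, and $D,V:\Omega\to S(l,\mathbb{R})$ continuous with $\det D(\omega)\ne0$ for all $\omega\in\Omega$. For $\omega\in\Omega$ let $H^\phi_{\omega,+}$ be the half-line Dirichlet operator on $\ell^2(\mathbb{N};\mathbb{C}^l)$ given by $(H^\phi_{\omega,+}\mathbf{u})_n=D(T^{n-1}\omega)\mathbf{u}_{n-1}+D(T^n\omega)\mathbf{u}_{n+1}+V(T^n\omega)\mathbf{u}_n$ for $n\ge1$, with $\mathbf{u}_0=0$. Then for all $\omega_0,\omega_1\in\Omega$ and all $k\in\{1,\dots,l\}$, $$\sigma_{ac,k}(H^\phi_{\omega_0,+})=\sigma_{ac,k}(H^\phi_{\omega_1,+}).$$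
   Context: $S(l,\mathbb{R})$ is the space of real symmetric $l\times l$ matrices. $T$ is minimal if for every $\omega\in\Omega$ the forward orbit $\{T^n\omega:n\ge0\}$ is dense in $\Omega$. Multiplicity: for a self-adjoint operator $T'$ on a separable Hilbert space, the absolutely continuous part of $T'$ is unitarily equivalent to multiplication by the variable on $\bigoplus_j L^2(\mathbb{R},\chi_{A_j}\,d\kappa)$ with Borel sets $A_1\supseteq A_2\supseteq\cdots$ ($\kappa$ = Lebesgue measure); the multiplicity function is $N_{T'}(x):=\#\{j:x\in A_j\}$ (up to $\kappa$-null sets), and $\sigma_{ac,r}(T')$ is the essential closure $\{x:\kappa((x-\epsilon,x+\epsilon)\cap\{N_{T'}=r\})>0\ \forall\epsilon>0\}$. *)

theory Defs
  imports "HOL-Analysis.Analysis"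
begin

definition cmv :: "real^'l^'l \<Rightarrow> complex^'l \<Rightarrow> complex^'l" where
  "cmv M u = (\<chi> i. \<Sum>j\<in>UNIV. complex_of_real (M $ i $ j) * u $ j)"

text \<open>The Hilbert space l^2(N; C^l): sequences indexed by n >= 1; the entry at 0 is
  the Dirichlet boundary value u_0 = 0.\<close>
definition l2seq :: "(nat \<Rightarrow> complex^'l) set" where
  "l2seq = {u. u 0 = 0 \<and> summable (\<lambda>n. (norm (u n))^2)}"

definition l2inner :: "(nat \<Rightarrow> complex^'l) \<Rightarrow> (nat \<Rightarrow> complex^'l) \<Rightarrow> complex" where
  "l2inner u v = (\<Sum>n. \<Sum>i\<in>UNIV. cnj (u n $ i) * v n $ i)"

definition l2normsq :: "(nat \<Rightarrow> complex^'l) \<Rightarrow> real" where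
  "l2normsq u = (\<Sum>n. (norm (u n))^2)"

definition jacobi_half ::
  "('a \<Rightarrow> real^'l^'l) \<Rightarrow> ('a \<Rightarrow> real^'l^'l) \<Rightarrow> ('a \<Rightarrow> 'a) \<Rightarrow> 'a
     \<Rightarrow> (nat \<Rightarrow> complex^'l) \<Rightarrow> (nat \<Rightarrow> complex^'l)" where
  "jacobi_half D V T \<omega> u = (\<lambda>n. if n = 0 then 0 else
      cmv (D ((T ^^ (n - 1)) \<omega>)) (u (n - 1)) + cmv (D ((T ^^ n) \<omega>)) (u (Suc n))
      + cmv (V ((T ^^ n) \<omega>)) (u n))"

text \<open>mu is the spectral measure of psi w.r.t. the bounded self-adjoint operator H
  (determined by its moments).\<close>
definition spectral_measure_of ::
  "((nat \<Rightarrow> complex^'l) \<Rightarrow> (nat \<Rightarrow> complex^'l)) \<Rightarrow> (nat \<Rightarrow> complex^'l) \<Rightarrow> real measure \<Rightarrow> bool" where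
  "spectral_measure_of H \<psi> \<mu> \<longleftrightarrow> finite_measure \<mu> \<and> sets \<mu> = sets borel \<and>
     (\<forall>n. integrable \<mu> (\<lambda>x. x ^ n) \<and>
          l2inner \<psi> ((H ^^ n) \<psi>) = complex_of_real (\<integral>x. x ^ n \<partial>\<mu>))"

definition ac_subspace ::
  "((nat \<Rightarrow> complex^'l) \<Rightarrow> (nat \<Rightarrow> complex^'l)) \<Rightarrow> (nat \<Rightarrow> complex^'l) set" where
  "ac_subspace H = {\<psi> \<in> l2seq. \<exists>\<mu>. spectral_measure_of H \<psi> \<mu> \<and> absolutely_continuous lborel \<mu>}"

text \<open>The direct sum of L^2(R, chi_{A_j} d kappa), represented by functions vanishing off A_j.\<close>
definition dsum_L2 :: "(nat \<Rightarrow> real set) \<Rightarrow> (nat \<Rightarrow> real \<Rightarrow> complex) set" where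
  "dsum_L2 A = {f. (\<forall>j. f j \<in> borel_measurable lborel \<and> (\<forall>x. x \<notin> A j \<longrightarrow> f j x = 0)) \<and>
      (\<Sum>j. \<integral>\<^sup>+ x. ennreal ((norm (f j x))^2) \<partial>lborel) < \<infinity>}"

definition ac_mult_rep ::
  "((nat \<Rightarrow> complex^'l) \<Rightarrow> (nat \<Rightarrow> complex^'l)) \<Rightarrow> (nat \<Rightarrow> real set) \<Rightarrow> bool" where
  "ac_mult_rep H A \<longleftrightarrow> (\<forall>j. A j \<in> sets borel \<and> A (Suc j) \<subseteq> A j) \<and>
    (\<exists>U :: (nat \<Rightarrow> complex^'l) \<Rightarrow> nat \<Rightarrow> real \<Rightarrow> complex.
       (\<forall>\<psi>\<in>ac_subspace H. U \<psi> \<in> dsum_L2 A \<and>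
           ennreal (l2normsq \<psi>) = (\<Sum>j. \<integral>\<^sup>+ x. ennreal ((norm (U \<psi> j x))^2) \<partial>lborel)) \<and>
       (\<forall>\<psi>\<in>ac_subspace H. \<forall>\<phi>\<in>ac_subspace H. \<forall>a b. \<forall>j.
           AE x in lborel. U (\<lambda>n. \<chi> i. a * \<psi> n $ i + b * \<phi> n $ i) j x
                            = a * U \<psi> j x + b * U \<phi> j x) \<and>
       (\<forall>\<psi>\<in>ac_subspace H. \<forall>j. AE x in lborel. U (H \<psi>) j x = complex_of_real x * U \<psi> j x) \<and>
       (\<forall>g\<in>dsum_L2 A. \<exists>\<psi>\<in>ac_subspace H. \<forall>j. AE x in lborel. U \<psi> j x = g j x))"

definition mult_fun :: "(nat \<Rightarrow> real set) \<Rightarrow> real \<Rightarrow> enat" where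
  "mult_fun A x = (if finite {j. x \<in> A j} then enat (card {j. x \<in> A j}) else \<infinity>)"

definition sigma_ac ::
  "((nat \<Rightarrow> complex^'l) \<Rightarrow> (nat \<Rightarrow> complex^'l)) \<Rightarrow> enat \<Rightarrow> real set" where
  "sigma_ac H r = {x. \<forall>\<epsilon>>0. emeasure lborel ({x - \<epsilon><..<x + \<epsilon>} \<inter>
       {y. mult_fun (SOME A. ac_mult_rep H A) y = r}) > 0}"

definition minimal_on :: "'a::topological_space set \<Rightarrow> ('a \<Rightarrow> 'a) \<Rightarrow> bool" where
  "minimal_on \<Omega> T \<longleftrightarrow> (\<forall>\<omega>\<in>\<Omega>. closure (range (\<lambda>n. (T ^^ n) \<omega>)) = \<Omega>)"

end

theory Submission
  imports Defs "HOL-Probability.Probability" "HOL-Complex_Analysis.Complex_Analysis" "HOL-Real_Asymp.Real_Asymp"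
begin

text \<open>
  Let the coefficients shifted by \<open>n i\<close> converge to those of a second operator; by minimality this
  happens in both directions. Cut the first operator off far to the right with an absorbing boundary
  condition. If its absolutely continuous spectrum has multiplicity greater than \<open>j\<close> on a set of
  positive measure, then \<open>j + 1\<close> bounded solutions and the constancy of the Wronskian keep the
  transmission through a block starting at \<open>n\<close> bounded below, uniformly in \<open>n\<close> and in the length of the
  block, along every frame of \<open>l - j\<close> initial vectors, off a set of small measure. This transmission
  is the spectral density of the shifted finite chain. Its moments stabilise as the block grows and
  converge along the shifts, so on compact sets it is bounded in the limit by the spectral measure
  of the second operator. If that operator had multiplicity at most \<open>j\<close> there, its density matrix
  would have kernel of dimension at least \<open>l - j\<close>, and a frame almost in the kernel would give a
  contradiction.

  The multiplicity sets are those of an explicit spectral representation, in which the density matrix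
  is factored by a measurable pivoted Cholesky decomposition; all others agree with them almost
  everywhere.
\<close>

section \<open>Jacobi operators and finite absorbing chains\<close>

text \<open>The operators at two points are linked only by convergence of shifted coefficients,
  under which spectral measures converge merely weakly. Weak limits preserve upper bounds on compact
  sets, for one vector at a time, while absolute continuity may be lost. Hence the lower bound is
  proved on finite chains, with a constant independent of shift and length, and the limit is used
  only from above. Absorption makes finite chains useful: with the term -i at the end, the resolvent
  extends continuously to the real axis, and the imaginary part of its quadratic form there is
  exactly the squared amplitude at the last site. So a finite chain already has a continuous
  spectral density, sharing with the half-line operator the moments up to an order growing with its
  length. Frames have \<open>l - j\<close> vectors because together with the data of
  \<open>j + 1\<close> solutions they exceed the dimension \<open>l\<close> by one, so the two spans
  meet. They are drawn from a countable dense set, and the exceptional set is exhausted by finitely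
  many compact pieces, so that one length and one shift serve all of them.\<close>

no_notation fps_nth (infixl "$" 75)

text \<open>The pairing without conjugation. The absorbing chains are complex symmetric rather than
  self-adjoint, so reciprocity of their Green functions (\<open>chain_res_sym\<close>) is a
  statement about \<open>bdot\<close>, while energies and norms use \<open>cdot\<close>.\<close>

definition bdot :: "complex^'l \<Rightarrow> complex^'l \<Rightarrow> complex" where
  "bdot u v = (\<Sum>i\<in>UNIV. u $ i * v $ i)"

definition vcnj :: "complex^'l \<Rightarrow> complex^'l" where
  "vcnj u = (\<chi> i. cnj (u $ i))"

definition cdot :: "complex^'l \<Rightarrow> complex^'l \<Rightarrow> complex" where
  "cdot u v = (\<Sum>i\<in>UNIV. cnj (u $ i) * v $ i)"

definition cvec :: "real^'l \<Rightarrow> complex^'l" where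
  "cvec v = (\<chi> i. complex_of_real (v $ i))"

lemma cvec_nth [simp]: "cvec v $ i = complex_of_real (v $ i)"
  by (simp add: cvec_def)

lemma vcnj_nth [simp]: "vcnj u $ i = cnj (u $ i)"
  by (simp add: vcnj_def)

lemma cdot_bdot: "cdot u v = bdot (vcnj u) v"
  by (simp add: cdot_def bdot_def)

lemma bdot_simps [simp]:
  "bdot 0 v = 0" "bdot u 0 = 0"
  "bdot (u + u') v = bdot u v + bdot u' v" "bdot u (v + v') = bdot u v + bdot u v'"
  "bdot (u - u') v = bdot u v - bdot u' v" "bdot u (v - v') = bdot u v - bdot u v'"
  "bdot (- u) v = - bdot u v" "bdot u (- v) = - bdot u v"
  "bdot (c *s u) v = c * bdot u v" "bdot u (c *s v) = c * bdot u v"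
  by (simp_all add: bdot_def algebra_simps sum.distrib sum_subtractf sum_negf sum_distrib_left)

lemma bdot_sum [simp]:
  "bdot (\<Sum>i\<in>A. f i) v = (\<Sum>i\<in>A. bdot (f i) v)" "bdot u (\<Sum>i\<in>A. g i) = (\<Sum>i\<in>A. bdot u (g i))"
  by (induction A rule: infinite_finite_induct) auto

lemma bdot_axis [simp]: "bdot (axis i 1) v = v $ i" "bdot v (axis i 1) = v $ i"
proof -
  have "bdot (axis i 1) v = (\<Sum>j\<in>UNIV. if j = i then v $ j else 0)"
    unfolding bdot_def by (rule sum.cong) (auto simp: axis_def)
  then show "bdot (axis i 1) v = v $ i" by simp
  have "bdot v (axis i 1) = (\<Sum>j\<in>UNIV. if j = i then v $ j else 0)"
    unfolding bdot_def by (rule sum.cong) (auto simp: axis_def)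
  then show "bdot v (axis i 1) = v $ i" by simp
qed

lemma vcnj_simps [simp]:
  "vcnj 0 = 0" "vcnj (u + v) = vcnj u + vcnj v" "vcnj (u - v) = vcnj u - vcnj v"
  "vcnj (- u) = - vcnj u" "vcnj (c *s u) = cnj c *s vcnj u" "vcnj (vcnj u) = u"
  "vcnj (cvec w) = cvec w"
  by (simp_all add: vec_eq_iff)

lemma bdot_commute: "bdot u v = bdot v u"
  by (simp add: bdot_def mult.commute)

lemma norm_vec_sq: "(norm (u :: complex^'l))\<^sup>2 = (\<Sum>i\<in>UNIV. (norm (u $ i))\<^sup>2)"
  by (simp add: norm_vec_def L2_set_def sum_nonneg)

lemma cdot_self: "cdot u u = complex_of_real ((norm u)\<^sup>2)"
  by (simp add: cdot_def norm_vec_sq complex_norm_square mult.commute del: of_real_power)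

lemma norm_cdot_le: "norm (cdot u v) \<le> norm u * norm v"
proof -
  have "norm (cdot u v) \<le> (\<Sum>i\<in>UNIV. \<bar>norm (u $ i)\<bar> * \<bar>norm (v $ i)\<bar>)"
    unfolding cdot_def by (rule order_trans[OF norm_sum]) (simp add: norm_mult)
  also have "\<dots> \<le> norm u * norm v"
    unfolding norm_vec_def by (rule L2_set_mult_ineq)
  finally show ?thesis .
qed

lemma norm_vcnj [simp]: "norm (vcnj u) = norm u"
  by (simp add: norm_vec_def)

lemma norm_bdot_le: "norm (bdot u v) \<le> norm u * norm v"
  using norm_cdot_le[of "vcnj u" v] by (simp add: cdot_bdot)

lemma norm_cvec [simp]: "norm (cvec v) = norm v"
  by (simp add: norm_vec_def)

lemma norm_smult_vec [simp]: "norm (c *s (u :: complex^'l)) = norm c * norm u"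
  by (simp add: norm_vec_def norm_mult L2_set_right_distrib)

lemma cdot_simps [simp]:
  "cdot 0 v = 0" "cdot u 0 = 0"
  "cdot (u + u') v = cdot u v + cdot u' v" "cdot u (v + v') = cdot u v + cdot u v'"
  "cdot (u - u') v = cdot u v - cdot u' v" "cdot u (v - v') = cdot u v - cdot u v'"
  "cdot (- u) v = - cdot u v" "cdot u (- v) = - cdot u v"
  "cdot (c *s u) v = cnj c * cdot u v" "cdot u (c *s v) = c * cdot u v"
  by (simp_all add: cdot_bdot)

lemma cdot_sum [simp]:
  "cdot (\<Sum>i\<in>A. f i) v = (\<Sum>i\<in>A. cdot (f i) v)" "cdot u (\<Sum>i\<in>A. g i) = (\<Sum>i\<in>A. cdot u (g i))"
  by (induction A rule: infinite_finite_induct; simp)+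

lemma cdot_commute: "cdot v u = cnj (cdot u v)"
  by (simp add: cdot_def mult.commute)

lemma cmv_simps [simp]:
  "cmv M 0 = 0" "cmv 0 u = 0"
  "cmv M (u + v) = cmv M u + cmv M v" "cmv M (u - v) = cmv M u - cmv M v"
  "cmv M (- u) = - cmv M u" "cmv M (c *s u) = c *s cmv M u"
  "cmv (mat 1) u = u"
  "cmv (A + B) u = cmv A u + cmv B u" "cmv (A - B) u = cmv A u - cmv B u"
  "cmv (r *\<^sub>R A) u = complex_of_real r *s cmv A u"
  by (simp_all add: vec_eq_iff cmv_def algebra_simps sum.distrib sum_subtractf sum_negf
      sum_distrib_left mat_def if_distrib if_distribR cong: if_cong)

lemma cmv_sum [simp]: "cmv M (\<Sum>i\<in>A. f i) = (\<Sum>i\<in>A. cmv M (f i))"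
  by (induction A rule: infinite_finite_induct) auto

lemma cmv_mult: "cmv (A ** B) u = cmv A (cmv B u)"
  unfolding cmv_def matrix_matrix_mult_def vec_eq_iff
  by (auto simp: sum_distrib_left sum_distrib_right mult.assoc intro: sum.swap)

lemma vcnj_cmv [simp]: "vcnj (cmv M u) = cmv M (vcnj u)"
  by (simp add: vec_eq_iff cmv_def)

lemma cmv_cvec: "cmv M (cvec v) = cvec (M *v v)"
  by (simp add: vec_eq_iff cmv_def matrix_vector_mult_def)

lemma bdot_cmv: "bdot u (cmv M v) = bdot (cmv (transpose M) u) v"
  unfolding bdot_def cmv_def transpose_def
  by (simp add: sum_distrib_left sum_distrib_right mult_ac, subst sum.swap, simp add: mult_ac)

lemma cdot_cmv: "cdot u (cmv M v) = cdot (cmv (transpose M) u) v"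
  by (simp add: cdot_bdot bdot_cmv)

text \<open>Truncated subtraction makes row 0 meaningless, and \<open>jop\<close> overrides it. In
  row 1 the coefficient \<open>a 0\<close> only meets \<open>u 0\<close>, which is 0 under the
  Dirichlet condition.\<close>

definition jrow :: "(nat \<Rightarrow> real^'l^'l) \<Rightarrow> (nat \<Rightarrow> real^'l^'l) \<Rightarrow> (nat \<Rightarrow> complex^'l) \<Rightarrow> nat \<Rightarrow> complex^'l" where
  "jrow a b u n = cmv (a (n - 1)) (u (n - 1)) + cmv (a n) (u (Suc n)) + cmv (b n) (u n)"

definition jop :: "(nat \<Rightarrow> real^'l^'l) \<Rightarrow> (nat \<Rightarrow> real^'l^'l) \<Rightarrow> (nat \<Rightarrow> complex^'l) \<Rightarrow> nat \<Rightarrow> complex^'l" where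
  "jop a b u = (\<lambda>n. if n = 0 then 0 else jrow a b u n)"

lemma jacobi_half_jop:
  "jacobi_half D V T \<omega> = jop (\<lambda>n. D ((T ^^ n) \<omega>)) (\<lambda>n. V ((T ^^ n) \<omega>))"
  by (simp add: jacobi_half_def jop_def jrow_def fun_eq_iff)

lemma jrow_simps [simp]:
  "jrow a b (\<lambda>n. u n + v n) n = jrow a b u n + jrow a b v n"
  "jrow a b (\<lambda>n. u n - v n) n = jrow a b u n - jrow a b v n"
  "jrow a b (\<lambda>n. c *s u n) n = c *s jrow a b u n"
  "jrow a b (\<lambda>n. vcnj (u n)) n = vcnj (jrow a b u n)"
  by (simp_all add: jrow_def vector_add_ldistrib)

text \<open>The finite chain on the sites \<open>1, \<dots>, N\<close> with the absorbing term \<open>- i\<close> added at its last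
  site; the value at \<open>N + 1\<close> only encodes that term.\<close>
definition chain_sol ::
  "(nat \<Rightarrow> real^'l^'l) \<Rightarrow> (nat \<Rightarrow> real^'l^'l) \<Rightarrow> nat \<Rightarrow> complex \<Rightarrow> (nat \<Rightarrow> complex^'l) \<Rightarrow> (nat \<Rightarrow> complex^'l) \<Rightarrow> bool" where
  "chain_sol a b N z f y \<longleftrightarrow> y 0 = 0 \<and> (\<forall>n\<in>{1..N}. jrow a b y n - z *s y n = f n)
     \<and> cmv (a N) (y (Suc N)) = - (\<i> *s y N)"

text \<open>The resolvent of the chain applied to \<open>f\<close>. Uniqueness
  (\<open>chain_sol_unique\<close>) determines its entries up to \<open>Suc N\<close> when the
  imaginary part of \<open>z\<close> is nonnegative; later entries are arbitrary, whence the index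
  bounds below.\<close>

definition chain_res ::
  "(nat \<Rightarrow> real^'l^'l) \<Rightarrow> (nat \<Rightarrow> real^'l^'l) \<Rightarrow> nat \<Rightarrow> complex \<Rightarrow> (nat \<Rightarrow> complex^'l) \<Rightarrow> (nat \<Rightarrow> complex^'l)" where
  "chain_res a b N z f = (SOME y. chain_sol a b N z f y)"

definition site :: "nat \<Rightarrow> complex^'l \<Rightarrow> nat \<Rightarrow> complex^'l" where
  "site n v = (\<lambda>m. if m = n then v else 0)"

lemma site_simps [simp]: "site n v n = v" "m \<noteq> n \<Longrightarrow> site n v m = 0"
  by (simp_all add: site_def)

locale jacobi_coeff =
  fixes a b :: "nat \<Rightarrow> real^'l^'l" and C :: real
  assumes sym_a: "transpose (a n) = a n" and sym_b: "transpose (b n) = b n"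
    and det_a: "det (a n) \<noteq> 0"
    and bound_a: "norm (cmv (a n) u) \<le> C * norm u"
    and bound_b: "norm (cmv (b n) u) \<le> C * norm u"
begin

lemma C_nonneg: "0 \<le> C"
  using order_trans[OF norm_ge_zero bound_a[of 0 "axis undefined 1"]]
  by (simp add: norm_axis_1)

lemma jacobi_shift: "jacobi_coeff (\<lambda>k. a (n + k)) (\<lambda>k. b (n + k)) C"
  by unfold_locales (simp_all add: sym_a sym_b det_a bound_a bound_b)

definition "ai n = (SOME M. a n ** M = mat 1 \<and> M ** a n = mat 1)"

lemma ai_mult: "a n ** ai n = mat 1" "ai n ** a n = mat 1"
proof -
  have "\<exists>M. a n ** M = mat 1 \<and> M ** a n = mat 1"
    using det_a[of n] unfolding invertible_det_nz[symmetric] invertible_def .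
  from someI_ex[OF this] show "a n ** ai n = mat 1" "ai n ** a n = mat 1"
    unfolding ai_def by auto
qed

lemma cmv_ai [simp]: "cmv (a n) (cmv (ai n) u) = u" "cmv (ai n) (cmv (a n) u) = u"
  by (simp_all add: cmv_mult[symmetric] ai_mult)

lemma cmv_a_0_iff: "cmv (a n) u = 0 \<longleftrightarrow> u = 0"
  by (metis cmv_ai(2) cmv_simps(1))

text \<open>Summation by parts. By symmetry of the coefficients everything telescopes to the
  Wronskian at \<open>N\<close>; the Dirichlet conditions remove the lower end.\<close>

lemma green:
  assumes "u 0 = 0" "y 0 = 0"
  shows "(\<Sum>n=1..N. bdot (u n) (jrow a b y n) - bdot (jrow a b u n) (y n))
       = bdot (u N) (cmv (a N) (y (Suc N))) - bdot (cmv (a N) (u (Suc N))) (y N)"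
proof (induction N)
  case 0
  then show ?case using assms by simp
next
  case (Suc N)
  have "bdot (u (Suc N)) (cmv (b (Suc N)) (y (Suc N))) = bdot (cmv (b (Suc N)) (u (Suc N))) (y (Suc N))"
    "bdot (u (Suc N)) (cmv (a N) (y N)) = bdot (cmv (a N) (u (Suc N))) (y N)"
    "bdot (u N) (cmv (a N) (y (Suc N))) = bdot (cmv (a N) (u N)) (y (Suc N))"
    by (simp_all add: bdot_cmv sym_a sym_b)
  then show ?case
    using Suc.IH by (simp add: sum.cl_ivl_Suc[of _ 1]) (simp add: jrow_def)
qed

lemma chain_sol_uminus_diff:
  assumes "chain_sol a b N z f y" "chain_sol a b N z g w"
  shows "chain_sol a b N z (\<lambda>n. f n - g n) (\<lambda>n. y n - w n)"
  using assms unfolding chain_sol_def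
  by (auto simp: algebra_simps vector_ssub_ldistrib)

lemma chain_sol_add:
  assumes "chain_sol a b N z f y" "chain_sol a b N z g w"
  shows "chain_sol a b N z (\<lambda>n. f n + g n) (\<lambda>n. y n + w n)"
  using assms unfolding chain_sol_def
  by (auto simp: algebra_simps vector_add_ldistrib)

lemma chain_sol_smult:
  assumes "chain_sol a b N z f y"
  shows "chain_sol a b N z (\<lambda>n. c *s f n) (\<lambda>n. c *s y n)"
proof -
  have "jrow a b (\<lambda>n. c *s y n) n - z *s (c *s y n) = c *s (jrow a b y n - z *s y n)" for n
    by (simp add: vector_ssub_ldistrib vector_smult_assoc mult.commute)
  note * = this
  show ?thesis unfolding chain_sol_def
  proof (intro conjI ballI)
    fix n assume "n \<in> {1..N}"
    then show "jrow a b (\<lambda>n. c *s y n) n - z *s (c *s y n) = c *s f n"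
      unfolding * using assms by (simp add: chain_sol_def)
  qed (use assms in \<open>simp_all add: chain_sol_def vector_smult_assoc mult.commute\<close>)
qed

text \<open>Green's formula for \<open>y\<close> and its conjugate. The absorbing condition turns
  the Wronskian into \<open>-2 * \<i>\<close> times the squared norm of \<open>y N\<close>, so at
  real \<open>z\<close> the imaginary part of the form is exactly the flux absorbed at the last
  site.\<close>

lemma chain_energy:
  assumes y: "chain_sol a b N z f y"
  shows "Im (\<Sum>n=1..N. cdot (f n) (y n)) = Im z * (\<Sum>n=1..N. (norm (y n))\<^sup>2) + (norm (y N))\<^sup>2"
proof -
  have y0: "y 0 = 0" and row: "\<And>n. n \<in> {1..N} \<Longrightarrow> jrow a b y n = f n + z *s y n"
    and bd: "cmv (a N) (y (Suc N)) = - (\<i> *s y N)"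
    using y by (auto simp: chain_sol_def algebra_simps)
  have "(\<Sum>n=1..N. cdot (y n) (f n) - cdot (f n) (y n) + (z - cnj z) * of_real ((norm (y n))\<^sup>2))
     = (\<Sum>n=1..N. bdot (vcnj (y n)) (jrow a b y n) - bdot (jrow a b (\<lambda>n. vcnj (y n)) n) (y n))"
    by (rule sum.cong) (auto simp: row cdot_bdot[symmetric] cdot_self algebra_simps)
  also have "\<dots> = - 2 * \<i> * of_real ((norm (y N))\<^sup>2)"
    using green[of "\<lambda>n. vcnj (y n)" y N] y0
    by (simp add: bd cdot_bdot[symmetric] cdot_self vcnj_cmv[symmetric] del: vcnj_cmv of_real_power)
  finally have *: "Im (\<Sum>n=1..N. cdot (y n) (f n) - cdot (f n) (y n) + (z - cnj z) * of_real ((norm (y n))\<^sup>2))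
      = - 2 * (norm (y N))\<^sup>2" by simp
  have "Im (cdot (y n) (f n)) = - Im (cdot (f n) (y n))" for n
    by (subst cdot_commute) simp
  then have "Im (\<Sum>n=1..N. cdot (y n) (f n) - cdot (f n) (y n) + (z - cnj z) * of_real ((norm (y n))\<^sup>2))
      = (\<Sum>n=1..N. - 2 * Im (cdot (f n) (y n)) + 2 * Im z * (norm (y n))\<^sup>2)"
    unfolding Im_sum by (intro sum.cong refl) (simp del: of_real_power)
  also have "\<dots> = - 2 * Im (\<Sum>n=1..N. cdot (f n) (y n)) + 2 * (Im z * (\<Sum>n=1..N. (norm (y n))\<^sup>2))"
    by (simp only: sum.distrib sum_distrib_left Im_sum mult.assoc)
  finally show ?thesis using * by linarith
qed

text \<open>The energy identity annihilates the last entry even at real \<open>z\<close>, the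
  boundary condition then annihilates the entry encoded after it, and invertibility of the
  \<open>a n\<close> carries zero back to the first site. So the chain has no eigenvalue in the
  closed upper half plane.\<close>

lemma chain_sol_zero:
  assumes y: "chain_sol a b N z (\<lambda>_. 0) y" and z: "Im z \<ge> 0" and N: "N \<ge> 1" and n: "n \<le> Suc N"
  shows "y n = 0"
proof -
  have bd: "cmv (a N) (y (Suc N)) = - (\<i> *s y N)" and row: "\<And>n. n \<in> {1..N} \<Longrightarrow> jrow a b y n = z *s y n"
    using y by (auto simp: chain_sol_def)
  have "Im z * (\<Sum>n=1..N. (norm (y n))\<^sup>2) + (norm (y N))\<^sup>2 = 0"
    using chain_energy[OF y] by simp
  moreover have "0 \<le> Im z * (\<Sum>n=1..N. (norm (y n))\<^sup>2)"
    using z by (simp add: sum_nonneg)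
  ultimately have "(norm (y N))\<^sup>2 = 0" by (smt (verit) zero_le_power2)
  then have yN: "y N = 0" by simp
  then have yS: "y (Suc N) = 0" using bd cmv_a_0_iff by auto
  have "k \<le> N \<Longrightarrow> y (N - k) = 0 \<and> y (Suc (N - k)) = 0" for k
  proof (induction k)
    case (Suc k)
    then have "y (N - k) = 0" "y (Suc (N - k)) = 0" "N - k \<in> {1..N}" "N - k - 1 = N - Suc k" by auto
    then have "cmv (a (N - Suc k)) (y (N - Suc k)) = 0" using row[of "N - k"] by (simp add: jrow_def)
    then show ?case using Suc \<open>y (N - k) = 0\<close> cmv_a_0_iff
      by (simp add: Suc_diff_Suc)
  qed (use yN yS in simp)
  from this[of "N - n"] show ?thesis using n yS by (cases "n = Suc N") auto
qed

lemma chain_sol_unique: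
  assumes "chain_sol a b N z f y" "chain_sol a b N z g w" "Im z \<ge> 0" "N \<ge> 1" "n \<le> Suc N"
    and "\<And>n. n \<in> {1..N} \<Longrightarrow> f n = g n"
  shows "y n = w n"
proof -
  have "chain_sol a b N z (\<lambda>_. 0) (\<lambda>n. y n - w n)"
    using chain_sol_uminus_diff[OF assms(1,2)] assms(6) by (simp add: chain_sol_def)
  from chain_sol_zero[OF this assms(3-5)] show ?thesis by simp
qed

section \<open>Solving the chain by shooting from its first site\<close>

fun fw :: "complex \<Rightarrow> (nat \<Rightarrow> complex^'l) \<Rightarrow> complex^'l \<Rightarrow> nat \<Rightarrow> complex^'l" where
  "fw z f c 0 = 0"
| "fw z f c (Suc 0) = c"
| "fw z f c (Suc (Suc n)) = cmv (ai (Suc n))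
     (f (Suc n) + z *s fw z f c (Suc n) - cmv (b (Suc n)) (fw z f c (Suc n)) - cmv (a n) (fw z f c n))"

lemma jrow_fw: "n \<ge> 1 \<Longrightarrow> jrow a b (fw z f c) n - z *s fw z f c n = f n"
  by (cases n) (simp_all add: jrow_def del: cmv_simps)

lemma fw_affine:
  "fw z f c n = fw z f 0 n + (\<Sum>j\<in>UNIV. c $ j *s fw z (\<lambda>_. 0) (axis j 1) n)"
proof (induction n rule: induct_nat_012)
  case 1
  then show ?case by (simp add: basis_expansion)
next
  case (ge2 n)
  show ?case
    by (simp add: ge2 sum.distrib sum_subtractf vector_add_ldistrib vector_ssub_ldistrib
        sum_distrib_left vec.scale_sum_right vector_smult_assoc mult.commute)
qed simp

lemma fw_holomorphic:
  fixes c :: "complex \<Rightarrow> complex^'l"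
  assumes "\<And>i. (\<lambda>z. c z $ i) holomorphic_on S"
  shows "(\<lambda>z. fw z f (c z) n $ i) holomorphic_on S"
proof (induction n arbitrary: i rule: induct_nat_012)
  case (ge2 n)
  show ?case
    unfolding fw.simps cmv_def by (auto intro!: holomorphic_intros ge2)
qed (auto simp: assms)

text \<open>The defect \<open>th\<close> of the shot solution in the absorbing condition is affine
  in the initial value, with an entire matrix \<open>A z\<close> that is injective for nonnegative
  imaginary part by \<open>chain_sol_zero\<close>. Solving for the initial value thus never meets a
  pole on the real axis, which yields continuity up to it.\<close>

lemma chain_solution_exists:
  assumes N: "N \<ge> 1"
  obtains y :: "complex \<Rightarrow> nat \<Rightarrow> complex^'l" where "\<And>z. Im z \<ge> 0 \<Longrightarrow> chain_sol a b N z f (y z)"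
    "\<And>n i. (\<lambda>z. y z n $ i) holomorphic_on {z. Im z > 0}"
    "\<And>n i. continuous_on {z. Im z \<ge> 0} (\<lambda>z. y z n $ i)"
proof -
  define th where "th z g c = cmv (a N) (fw z g c (Suc N)) + \<i> *s fw z g c N" for z g c
  define A where "A z = (\<chi> i j. th z (\<lambda>_. 0) (axis j 1) $ i)" for z
  have thA: "th z g c = th z g 0 + A z *v c" for z g c
    unfolding th_def A_def
    apply (subst (1 2) fw_affine)
    apply (simp add: vec_eq_iff matrix_vector_mult_def sum.distrib sum_distrib_left vector_add_ldistrib algebra_simps)
    done
  have sol: "chain_sol a b N z g (fw z g c)" if "th z g c = 0" for z g c
    using that jrow_fw unfolding chain_sol_def th_def by (auto simp: add_eq_0_iff2)
  have A0: "th z (\<lambda>_. 0) 0 = 0" for z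
  proof -
    have "fw z (\<lambda>_. 0) 0 n = 0" for n by (induction n rule: induct_nat_012) simp_all
    then show ?thesis by (simp add: th_def)
  qed
  have det: "det (A z) \<noteq> 0" if z: "Im z \<ge> 0" for z
  proof -
    have "c = 0" if "A z *v c = 0" for c
    proof -
      have "chain_sol a b N z (\<lambda>_. 0) (fw z (\<lambda>_. 0) c)"
        by (rule sol) (simp add: thA[of z _ c] A0 that)
      from chain_sol_zero[OF this z N, of 1] N show ?thesis by simp
    qed
    then have "invertible (A z)"
      using matrix_left_invertible_ker[of "A z"] invertible_left_inverse[of "A z"] by blast
    then show ?thesis by (simp add: invertible_det_nz)
  qed
  have Ahol: "(\<lambda>z. A z $ i $ j) holomorphic_on UNIV" for i j
    unfolding A_def th_def cmv_def by (auto intro!: holomorphic_intros fw_holomorphic)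
  have rhol: "(\<lambda>z. th z f 0 $ i) holomorphic_on UNIV" for i
    unfolding th_def cmv_def by (auto intro!: holomorphic_intros fw_holomorphic)
  \<comment> \<open>Cramer's formula, so that holomorphy in \<open>z\<close> can be read off from
    determinants.\<close>
  define c where "c z = (\<chi> k. det (\<chi> i j. if j = k then (- th z f 0) $ i else A z $ i $ j) / det (A z))" for z
  define O' where "O' = {z. det (A z) \<noteq> 0}"
  have c: "A z *v c z = - th z f 0" if "det (A z) \<noteq> 0" for z
    using cramer[OF that, of "c z" "- th z f 0"] by (simp add: c_def)
  have chol: "(\<lambda>z. c z $ i) holomorphic_on O'" for i
  proof -
    have d: "(\<lambda>z. det (M z)) holomorphic_on UNIV" if "\<And>i j. (\<lambda>z. M z $ i $ j) holomorphic_on UNIV"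
      for M :: "complex \<Rightarrow> complex^'l^'l"
      unfolding det_def by (intro holomorphic_intros that)
    have "(\<lambda>z. det (\<chi> i' j. if j = i then (- th z f 0) $ i' else A z $ i' $ j)) holomorphic_on UNIV"
    proof (rule d)
      show "(\<lambda>z. (\<chi> i' j. if j = i then (- th z f 0) $ i' else A z $ i' $ j) $ i' $ j) holomorphic_on UNIV" for i' j
        using rhol[of i'] Ahol[of i' j] by (cases "j = i") (auto intro!: holomorphic_intros)
    qed
    moreover have "(\<lambda>z. det (A z)) holomorphic_on UNIV" by (rule d) (rule Ahol)
    ultimately have "(\<lambda>z. det (\<chi> i' j. if j = i then (- th z f 0) $ i' else A z $ i' $ j) / det (A z)) holomorphic_on O'"
      by (intro holomorphic_on_divide) (auto simp: O'_def elim: holomorphic_on_subset)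
    then show ?thesis by (simp add: c_def)
  qed
  define y where "y z = fw z f (c z)" for z
  have yh: "(\<lambda>z. y z n $ i) holomorphic_on O'" for n i
    unfolding y_def by (rule fw_holomorphic) (rule chol)
  show ?thesis
  proof (rule that)
    fix z assume "Im z \<ge> 0"
    then show "chain_sol a b N z f (y z)"
      unfolding y_def by (intro sol) (subst thA, simp add: c det)
  next
    fix n i
    show "(\<lambda>z. y z n $ i) holomorphic_on {z. Im z > 0}"
      by (rule holomorphic_on_subset[OF yh]) (auto simp: O'_def intro!: det)
    show "continuous_on {z. Im z \<ge> 0} (\<lambda>z. y z n $ i)"
      by (rule continuous_on_subset[OF holomorphic_on_imp_continuous_on[OF yh]]) (auto simp: O'_def intro!: det)
  qed
qed

lemma chain_res_sol:
  assumes "N \<ge> 1" "Im z \<ge> 0"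
  shows "chain_sol a b N z f (chain_res a b N z f)"
  unfolding chain_res_def using chain_solution_exists[OF assms(1), of f] assms(2) by (metis someI_ex)

lemma chain_res_eqI:
  assumes "chain_sol a b N z f y" "N \<ge> 1" "Im z \<ge> 0" "n \<le> Suc N"
  shows "chain_res a b N z f n = y n"
  by (rule chain_sol_unique[OF chain_res_sol[OF assms(2,3)] assms(1,3,2,4)]) auto

lemma chain_res_regular:
  assumes N: "N \<ge> 1" and n: "n \<le> Suc N"
  shows "(\<lambda>z. chain_res a b N z f n $ i) holomorphic_on {z. Im z > 0}"
    "continuous_on {z. Im z \<ge> 0} (\<lambda>z. chain_res a b N z f n $ i)"
proof -
  obtain y :: "complex \<Rightarrow> nat \<Rightarrow> complex^'l" where y: "\<And>z. Im z \<ge> 0 \<Longrightarrow> chain_sol a b N z f (y z)"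
    "\<And>n i. (\<lambda>z. y z n $ i) holomorphic_on {z. Im z > 0}"
    "\<And>n i. continuous_on {z. Im z \<ge> 0} (\<lambda>z. y z n $ i)"
    using chain_solution_exists[OF N, of f] by metis
  have eq: "chain_res a b N z f n $ i = y z n $ i" if "Im z \<ge> 0" for z
    using chain_res_eqI[OF y(1)[OF that] N that n] by simp
  show "(\<lambda>z. chain_res a b N z f n $ i) holomorphic_on {z. Im z > 0}"
    using y(2)[of n i] by (rule holomorphic_transform) (simp add: eq)
  show "continuous_on {z. Im z \<ge> 0} (\<lambda>z. chain_res a b N z f n $ i)"
    using y(3)[of n i] by (subst continuous_on_cong[OF refl]) (auto simp: eq)
qed

end

section \<open>Boundary values of the chain resolvents\<close>

text \<open>Cauchy's theorem on the upper half disc. On the arc \<open>h\<close> is close to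
  \<open>- m / z\<close>, whose integral is \<open>- \<i> * pi * m\<close>; the error is at most the
  length \<open>pi * R\<close> of the arc times \<open>e\<close>.\<close>

lemma half_disc:
  fixes h :: "complex \<Rightarrow> complex"
  assumes cont: "continuous_on {z. Im z \<ge> 0} h" and hol: "h holomorphic_on {z. Im z > 0}"
    and R: "R > 0" and bound: "\<And>z. Im z \<ge> 0 \<Longrightarrow> norm z = R \<Longrightarrow> norm (h z + m / z) \<le> e"
  shows "norm (integral {-R..R} (\<lambda>x. h (of_real x)) - \<i> * pi * m) \<le> pi * R * e"
proof -
  let ?l = "linepath (- of_real R) (of_real R) :: real \<Rightarrow> complex" and ?c = "part_circlepath 0 R 0 pi"
  have arc: "Im z \<ge> 0 \<and> norm z = R" if "z \<in> path_image ?c" for z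
    using that R by (auto simp: path_image_part_circlepath' closed_segment_eq_real_ivl sin_ge_zero norm_mult)
  have line: "Im z \<ge> 0" if "z \<in> path_image ?l" for z
    using that by (auto simp: closed_segment_def)
  have conn: "pathfinish ?l = pathstart ?c" "pathfinish ?c = pathstart ?l" by (simp_all add: exp_Euler)
  have ci: "continuous_on (path_image ?c) h" "continuous_on (path_image ?l) h"
    by (rule continuous_on_subset[OF cont], use arc line in auto)+
  have i1: "h contour_integrable_on ?l" by (rule contour_integrable_continuous_linepath) (use ci in simp)
  have i2: "h contour_integrable_on ?c" by (rule contour_integrable_continuous_part_circlepath) (use ci in simp)
  have "interior {z. Im z \<ge> 0} = {z. Im z > 0}"
    using interior_halfspace_ge[of \<i> 0] by (simp add: inner_complex_def)
  then have "(h has_contour_integral 0) (?l +++ ?c)"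
    using hol arc line conn
    by (intro Cauchy_theorem_convex[OF cont convex_halfspace_Im_ge, of "{}"])
       (auto simp: path_image_join holomorphic_on_open open_halfspace_Im_gt field_differentiable_def valid_path_join)
  then have "contour_integral ?l h + contour_integral ?c h = 0"
    using contour_integral_unique contour_integral_join[OF i1 i2] by (metis conn(1) valid_path_linepath valid_path_part_circlepath)
  moreover have "contour_integral ?l h = integral {-R..R} (\<lambda>x. h (of_real x))"
    using contour_integral_linepath_Reals_eq[of "- of_real R" "of_real R" h] R by simp
  moreover have c0: "continuous_on (path_image ?c) (\<lambda>z. m / z)"
    using R arc by (intro continuous_intros) fastforce
  then have i3: "(\<lambda>z. m / z) contour_integrable_on ?c"
    by (rule contour_integrable_continuous_part_circlepath)
  have "contour_integral ?c (\<lambda>z. m / z) = integral {0..pi} (\<lambda>t. m * \<i>)"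
    using R by (subst contour_integral_part_circlepath_eq) (auto intro!: integral_cong simp: field_simps)
  then have c2: "contour_integral ?c (\<lambda>z. m / z) = \<i> * pi * m"
    by (simp add: scaleR_conv_of_real mult_ac)
  have "e \<ge> 0"
    using order_trans[OF norm_ge_zero bound[of "of_real R"]] R by simp
  then have "norm (contour_integral ?c (\<lambda>z. h z + m / z)) \<le> e * R * \<bar>pi - 0\<bar>"
    using R arc bound
    by (intro contour_integral_bound_part_circlepath contour_integrable_add i2 i3) auto
  moreover have "contour_integral ?c (\<lambda>z. h z + m / z) = contour_integral ?c h + contour_integral ?c (\<lambda>z. m / z)"
    by (rule contour_integral_add[OF i2 i3])
  ultimately have "norm (contour_integral ?c h + \<i> * pi * m) \<le> e * R * pi" "contour_integral ?l h = - contour_integral ?c h"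
    "contour_integral ?l h = integral {-R..R} (\<lambda>x. h (of_real x))"
    using c2 by (simp_all add: add_eq_0_iff2)
  moreover have "integral {-R..R} (\<lambda>x. h (of_real x)) - \<i> * pi * m = - (contour_integral ?c h + \<i> * pi * m)"
    using calculation by simp
  ultimately show ?thesis
    by (simp only: norm_minus_cancel) (simp add: mult_ac)
qed

lemma nn_integral_continuous_interval:
  fixes f :: "real \<Rightarrow> real"
  assumes "continuous_on UNIV f" "\<And>x. f x \<ge> 0"
  shows "(\<integral>\<^sup>+x. ennreal (f x) * indicator {u..v} x \<partial>lborel) = ennreal (integral {u..v} f)"
proof -
  have s: "set_integrable lborel {u..v} f"
    by (rule borel_integrable_atLeastAtMost') (rule continuous_on_subset[OF assms(1)], simp)
  have "(\<integral>\<^sup>+x. ennreal (f x) * indicator {u..v} x \<partial>lborel) = (\<integral>\<^sup>+x. ennreal (indicator {u..v} x *\<^sub>R f x) \<partial>lborel)"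
    by (intro nn_integral_cong) (auto simp: indicator_def)
  also have "\<dots> = ennreal (\<integral>x. indicator {u..v} x *\<^sub>R f x \<partial>lborel)"
    using s assms(2) by (intro nn_integral_eq_integral) (auto simp: set_integrable_def indicator_def)
  finally show ?thesis
    using set_borel_integral_eq_integral(2)[OF s] by (simp add: set_lebesgue_integral_def)
qed

lemma nn_integral_limit_intervals:
  fixes f :: "real \<Rightarrow> real"
  assumes "continuous_on UNIV f" "\<And>x. f x \<ge> 0" "(\<lambda>n. integral {- real n..real n} f) \<longlonglongrightarrow> L"
  shows "(\<integral>\<^sup>+x. ennreal (f x) \<partial>lborel) = ennreal L"
proof -
  have [measurable]: "f \<in> borel_measurable borel" using assms(1) by (rule borel_measurable_continuous_onI)
  have "(\<lambda>n. \<integral>\<^sup>+x. ennreal (f x) * indicator {- real n..real n} x \<partial>lborel) \<longlonglongrightarrow> (\<integral>\<^sup>+x. ennreal (f x) \<partial>lborel)"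
  proof (rule nn_integral_LIMSEQ)
    show "incseq (\<lambda>n x. ennreal (f x) * indicator {- real n..real n} x)"
      by (auto simp: incseq_def le_fun_def indicator_def)
    fix x
    obtain k where k: "\<bar>x\<bar> \<le> real k" using real_arch_simple by blast
    have "eventually (\<lambda>n. ennreal (f x) * indicator {- real n..real n} x = ennreal (f x)) sequentially"
      using eventually_ge_at_top[of k] by eventually_elim (use k in \<open>auto simp: indicator_def\<close>)
    then show "(\<lambda>n. ennreal (f x) * indicator {- real n..real n} x) \<longlonglongrightarrow> ennreal (f x)"
      by (rule tendsto_eventually)
  qed simp
  moreover have "(\<lambda>n. \<integral>\<^sup>+x. ennreal (f x) * indicator {- real n..real n} x \<partial>lborel) \<longlonglongrightarrow> ennreal L"
    unfolding nn_integral_continuous_interval[OF assms(1,2)] by (rule tendsto_ennrealI[OF assms(3)])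
  ultimately show ?thesis by (rule LIMSEQ_unique)
qed

section \<open>Quadratic forms of the chain resolvent as Herglotz functions\<close>

context jacobi_coeff
begin

definition cform :: "nat \<Rightarrow> (nat \<Rightarrow> complex^'l) \<Rightarrow> complex \<Rightarrow> complex" where
  "cform N f z = (\<Sum>n=1..N. cdot (f n) (chain_res a b N z f n))"

lemma cform_regular:
  assumes "N \<ge> 1"
  shows "cform N f holomorphic_on {z. Im z > 0}" "continuous_on {z. Im z \<ge> 0} (cform N f)"
proof -
  show "cform N f holomorphic_on {z. Im z > 0}"
    unfolding cform_def cdot_def
    by (intro holomorphic_intros chain_res_regular[OF assms]) auto
  show "continuous_on {z. Im z \<ge> 0} (cform N f)"
    unfolding cform_def cdot_def
    by (intro continuous_intros chain_res_regular[OF assms]) auto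
qed

lemma Im_cform:
  assumes "N \<ge> 1" "Im z \<ge> 0"
  shows "Im (cform N f z) = Im z * (\<Sum>n=1..N. (norm (chain_res a b N z f n))\<^sup>2) + (norm (chain_res a b N z f N))\<^sup>2"
  unfolding cform_def by (rule chain_energy[OF chain_res_sol[OF assms]])

lemma Im_cform_nonneg: "N \<ge> 1 \<Longrightarrow> Im z \<ge> 0 \<Longrightarrow> Im (cform N f z) \<ge> 0"
  by (simp add: Im_cform sum_nonneg)

text \<open>A bound for the chain operator in the l1 norm: \<open>C\<close> for each of the three
  coefficients of a row and 1 for the absorbing term. The l1 norm keeps all constants independent of
  the length \<open>N\<close>.\<close>

abbreviation "KB \<equiv> 3 * C + 1"

lemma chain_row_bound:
  assumes y: "chain_sol a b N z f y"
  shows "(\<Sum>n=1..N. norm (f n + z *s y n)) \<le> KB * (\<Sum>n=1..N. norm (y n))"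
proof -
  let ?S = "\<Sum>n=1..N. norm (y n)"
  have y0: "y 0 = 0" and row: "\<And>n. n \<in> {1..N} \<Longrightarrow> f n + z *s y n = jrow a b y n"
    and bd: "cmv (a N) (y (Suc N)) = - (\<i> *s y N)"
    using y by (auto simp: chain_sol_def algebra_simps)
  have "(\<Sum>n=1..N. norm (f n + z *s y n)) = (\<Sum>n=1..N. norm (jrow a b y n))"
    by (rule sum.cong) (simp_all add: row)
  also have "\<dots> \<le> (\<Sum>n=1..N. C * norm (y (n - 1)) + norm (cmv (a n) (y (Suc n))) + C * norm (y n))"
    unfolding jrow_def by (intro sum_mono order_trans[OF norm_triangle_ineq] add_mono bound_a bound_b order_refl)
  also have "\<dots> = C * (\<Sum>n=1..N. norm (y (n - 1))) + (\<Sum>n=1..N. norm (cmv (a n) (y (Suc n)))) + C * ?S"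
    by (simp add: sum.distrib sum_distrib_left)
  finally have fin: "(\<Sum>n=1..N. norm (f n + z *s y n)) \<le> C * (\<Sum>n=1..N. norm (y (n - 1))) + (\<Sum>n=1..N. norm (cmv (a n) (y (Suc n)))) + C * ?S" .
  have "(\<Sum>n=1..N. norm (y (n - 1))) + norm (y N) = ?S"
    by (induction N) (simp_all add: y0)
  then have "(\<Sum>n=1..N. norm (y (n - 1))) \<le> ?S" using norm_ge_zero[of "y N"] by linarith
  then have "C * (\<Sum>n=1..N. norm (y (n - 1))) \<le> C * ?S" by (rule mult_left_mono) (rule C_nonneg)
  moreover have "(\<Sum>n=1..N. norm (cmv (a n) (y (Suc n)))) \<le> C * ?S + ?S"
  proof (cases N)
    case (Suc M)
    have "(\<Sum>n=1..M. norm (cmv (a n) (y (Suc n)))) \<le> C * (\<Sum>n=1..M. norm (y (Suc n)))"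
      unfolding sum_distrib_left by (intro sum_mono bound_a)
    also have "(\<Sum>n=1..M. norm (y (Suc n))) = (\<Sum>n=2..N. norm (y n))"
      unfolding Suc by (simp only: sum.shift_bounds_cl_Suc_ivl numeral_2_eq_2 One_nat_def)
    also have "\<dots> \<le> ?S" by (rule sum_mono2) auto
    finally have "(\<Sum>n=1..M. norm (cmv (a n) (y (Suc n)))) \<le> C * ?S"
      using C_nonneg by (simp add: mult_left_mono)
    moreover have "norm (cmv (a N) (y (Suc N))) = norm (y N)" by (simp add: bd)
    moreover have "norm (y N) \<le> ?S" using Suc by (intro member_le_sum) auto
    ultimately show ?thesis unfolding Suc by (simp add: sum.cl_ivl_Suc[of _ 1])
  qed simp
  ultimately show ?thesis using fin by (simp add: algebra_simps)
qed

lemma chain_res_l1: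
  assumes "N \<ge> 1" "Im z \<ge> 0" "norm z > KB"
  shows "(\<Sum>n=1..N. norm (chain_res a b N z f n)) \<le> (\<Sum>n=1..N. norm (f n)) / (norm z - KB)"
proof -
  let ?y = "chain_res a b N z f"
  let ?S = "\<Sum>n=1..N. norm (?y n)"
  have "norm z * ?S = (\<Sum>n=1..N. norm (f n + z *s ?y n - f n))"
    by (simp add: sum_distrib_left)
  also have "\<dots> \<le> (\<Sum>n=1..N. norm (f n + z *s ?y n) + norm (f n))"
    by (intro sum_mono norm_triangle_ineq4)
  also have "\<dots> \<le> KB * ?S + (\<Sum>n=1..N. norm (f n))"
    using chain_row_bound[OF chain_res_sol[OF assms(1,2)]] by (simp add: sum.distrib)
  finally have "(norm z - KB) * ?S \<le> (\<Sum>n=1..N. norm (f n))" by (simp add: algebra_simps)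
  then show ?thesis using assms(3) by (simp add: field_simps)
qed

lemma sum_cdot_le:
  fixes N :: nat
  shows
  "norm (\<Sum>n=1..N. cdot (f n) (g n)) \<le> (\<Sum>n=1..N. norm (f n)) * (\<Sum>n=1..N. norm (g n))"
proof -
  have "norm (\<Sum>n=1..N. cdot (f n) (g n)) \<le> (\<Sum>n=1..N. norm (f n) * norm (g n))"
    by (rule order_trans[OF norm_sum]) (intro sum_mono norm_cdot_le)
  also have "\<dots> \<le> (\<Sum>n=1..N. norm (f n) * (\<Sum>n=1..N. norm (g n)))"
    by (intro sum_mono mult_left_mono member_le_sum) auto
  finally show ?thesis by (simp add: sum_distrib_right)
qed

lemma cform_bound:
  assumes "N \<ge> 1" "Im z \<ge> 0" "norm z > KB"
  shows "norm (cform N f z) \<le> (\<Sum>n=1..N. norm (f n))\<^sup>2 / (norm z - KB)"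
proof -
  have "norm (cform N f z) \<le> (\<Sum>n=1..N. norm (f n)) * ((\<Sum>n=1..N. norm (f n)) / (norm z - KB))"
    unfolding cform_def
    by (rule order_trans[OF sum_cdot_le]) (intro mult_left_mono chain_res_l1 assms sum_nonneg, simp)
  then show ?thesis by (simp add: power2_eq_square)
qed

text \<open>Multiplied by \<open>z\<close>, the left side is the pairing of \<open>f\<close> with
  \<open>f + z *s y\<close>, that is, with the chain operator applied to the solution
  \<open>y\<close>. The row bound and the l1 bound of the resolvent then apply.\<close>

lemma cform_asymp:
  assumes "N \<ge> 1" "Im z \<ge> 0" "norm z > KB"
  shows "norm (cform N f z + of_real (\<Sum>n=1..N. (norm (f n))\<^sup>2) / z)
     \<le> (\<Sum>n=1..N. norm (f n))\<^sup>2 * KB / ((norm z - KB) * norm z)"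
proof -
  let ?y = "chain_res a b N z f" and ?F = "\<Sum>n=1..N. norm (f n)"
  have z: "z \<noteq> 0" "norm z > 0" using assms(3) C_nonneg by auto
  have "z * cform N f z + of_real (\<Sum>n=1..N. (norm (f n))\<^sup>2) = (\<Sum>n=1..N. cdot (f n) (f n + z *s ?y n))"
    by (simp add: cform_def sum.distrib sum_distrib_left cdot_self)
  also have "norm \<dots> \<le> ?F * (\<Sum>n=1..N. norm (f n + z *s ?y n))" by (rule sum_cdot_le)
  also have "\<dots> \<le> ?F * (KB * (?F / (norm z - KB)))"
    using C_nonneg
    by (intro mult_left_mono order_trans[OF chain_row_bound[OF chain_res_sol[OF assms(1,2)]]] chain_res_l1 assms)
       (auto intro: sum_nonneg)
  finally have "norm (z * cform N f z + of_real (\<Sum>n=1..N. (norm (f n))\<^sup>2)) / norm z \<le> ?F * (KB * (?F / (norm z - KB))) / norm z"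
    using z by (intro divide_right_mono) auto
  moreover have "norm (z * cform N f z + of_real (\<Sum>n=1..N. (norm (f n))\<^sup>2)) / norm z
     = norm (cform N f z + of_real (\<Sum>n=1..N. (norm (f n))\<^sup>2) / z)"
    using z by (simp add: norm_divide[symmetric] add_divide_distrib)
  ultimately show ?thesis by (simp add: power2_eq_square mult_ac)
qed

lemma cform_real_cont: "N \<ge> 1 \<Longrightarrow> continuous_on UNIV (\<lambda>x::real. cform N f (of_real x))"
  by (rule continuous_on_compose2[OF cform_regular(2)]) (auto intro!: continuous_intros)

lemma integral_Im:
  "continuous_on UNIV h \<Longrightarrow> integral {u..v} (\<lambda>x::real. Im (h x)) = Im (integral {u..v} h)"
  "continuous_on UNIV h \<Longrightarrow> integral {u..v} (\<lambda>x::real. Re (h x)) = Re (integral {u..v} h)"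
proof -
  assume "continuous_on UNIV h"
  then have "h integrable_on {u..v}" by (intro integrable_continuous_real) (rule continuous_on_subset, auto)
  then show "integral {u..v} (\<lambda>x::real. Im (h x)) = Im (integral {u..v} h)"
    "integral {u..v} (\<lambda>x::real. Re (h x)) = Re (integral {u..v} h)"
    using integral_linear[of h _ Im] integral_linear[of h _ Re]
    by (auto simp: o_def bounded_linear_Im bounded_linear_Re)
qed

text \<open>At real \<open>x\<close> the integrand is the imaginary part of \<open>cform\<close>,
  and \<open>cform\<close> behaves like minus the squared norm of \<open>f\<close> over
  \<open>z\<close> at infinity. Up to the factor \<open>pi\<close>, the amplitude at the absorbing
  end is therefore an isometric transform of \<open>f\<close>.\<close>

lemma resolvent_moment:
  assumes N: "N \<ge> 1"
  shows "(\<integral>\<^sup>+x. ennreal ((norm (chain_res a b N (of_real x) f N))\<^sup>2) \<partial>lborel)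
       = ennreal (pi * (\<Sum>n=1..N. (norm (f n))\<^sup>2))"
proof (rule nn_integral_limit_intervals)
  let ?g = "\<lambda>x::real. cform N f (of_real x)"
  have eq: "(\<lambda>x::real. (norm (chain_res a b N (of_real x) f N))\<^sup>2) = (\<lambda>x. Im (?g x))"
    using N by (simp add: Im_cform)
  show "continuous_on UNIV (\<lambda>x::real. (norm (chain_res a b N (of_real x) f N))\<^sup>2)"
    unfolding eq by (intro continuous_intros cform_real_cont N)
  define m where "m = (\<Sum>n=1..N. (norm (f n))\<^sup>2)"
  define B where "B = (\<Sum>n=1..N. norm (f n))\<^sup>2 * KB"
  have ev: "\<forall>\<^sub>F n in sequentially. norm (integral {- real n..real n} (\<lambda>x. Im (?g x)) - pi * m) \<le> pi * B / (real n - KB)"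
  proof -
    have "\<forall>\<^sub>F n in sequentially. real n > KB" by real_asymp
    then show ?thesis
    proof eventually_elim
      case (elim n)
      then have n: "real n > 0" using C_nonneg by linarith
      have "norm (integral {- real n..real n} ?g - \<i> * pi * of_real m) \<le> pi * real n * (B / ((real n - KB) * real n))"
      proof (rule half_disc)
        fix z assume z: "Im z \<ge> 0" "norm z = real n"
        show "norm (cform N f z + of_real m / z) \<le> B / ((real n - KB) * real n)"
          using cform_asymp[OF N z(1), of f] elim unfolding z(2) m_def B_def by blast
      qed (use cform_regular[OF N] n in auto)
      moreover have "\<bar>Im (integral {- real n..real n} ?g - \<i> * pi * of_real m)\<bar> \<le> norm (integral {- real n..real n} ?g - \<i> * pi * of_real m)"
        by (rule abs_Im_le_cmod)
      moreover have "Im (integral {- real n..real n} ?g) = integral {- real n..real n} (\<lambda>x. Im (?g x))"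
        by (subst integral_Im) (use cform_real_cont[OF N] in auto)
      moreover have "pi * real n * (B / ((real n - KB) * real n)) = pi * B / (real n - KB)"
        using n by simp
      ultimately show ?case by simp
    qed
  qed
  have "(\<lambda>n. pi * B / (real n - KB)) \<longlonglongrightarrow> 0" by real_asymp
  then have "(\<lambda>n. integral {- real n..real n} (\<lambda>x. Im (?g x)) - pi * m) \<longlonglongrightarrow> 0"
    by (rule Lim_null_comparison[OF ev])
  then show "(\<lambda>n. integral {- real n..real n} (\<lambda>x. (norm (chain_res a b N (of_real x) f N))\<^sup>2)) \<longlonglongrightarrow> pi * (\<Sum>n=1..N. (norm (f n))\<^sup>2)"
    unfolding eq m_def by (simp add: LIM_zero_iff)
qed simp

text \<open>A weak-type bound for boundary values of a Herglotz function \<open>g\<close>: the function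
  \<open>w / (1 + w)\<close> with \<open>w = - i t g\<close> has nonnegative real part, at least \<open>1/4\<close> where \<open>\<bar>g\<bar> \<ge> 1 / t\<close>.\<close>
lemma Re_cayley:
  assumes "Re w \<ge> 0"
  shows "0 \<le> Re (w / (1 + w))" "norm (w / (1 + w)) \<le> norm w" "norm w \<ge> 1 \<Longrightarrow> 1/4 \<le> Re (w / (1 + w))" "1 + w \<noteq> 0"
proof -
  show nz: "1 + w \<noteq> 0"
    using assms by (metis add.commute add_nonneg_pos less_irrefl one_complex.simps(1) plus_complex.simps(1) zero_complex.simps(1) zero_less_one)
  have n1: "(norm (1 + w))\<^sup>2 = 1 + 2 * Re w + (norm w)\<^sup>2"
    unfolding cmod_power2 by (simp add: power2_eq_square algebra_simps)
  have p: "(norm (1 + w))\<^sup>2 > 0" using nz by simp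
  have re: "Re (w / (1 + w)) = (Re w + (norm w)\<^sup>2) / (norm (1 + w))\<^sup>2"
    unfolding Re_divide cmod_power2 by (rule arg_cong2[where f = "(/)"]) (simp_all add: power2_eq_square algebra_simps)
  show "0 \<le> Re (w / (1 + w))" unfolding re using assms by simp
  have "1 \<le> (norm (1 + w))\<^sup>2" using assms unfolding n1 by simp
  then have "1 \<le> norm (1 + w)" using power2_le_imp_le[of 1 "norm (1 + w)"] by simp
  then have "norm w / norm (1 + w) \<le> norm w / 1" by (intro divide_left_mono) auto
  then show "norm (w / (1 + w)) \<le> norm w" by (simp add: norm_divide)
  assume "norm w \<ge> 1"
  then have "1 \<le> (norm w)\<^sup>2" by simp
  then have "(norm (1 + w))\<^sup>2 \<le> 4 * (Re w + (norm w)\<^sup>2)" unfolding n1 using assms by simp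
  then show "1/4 \<le> Re (w / (1 + w))" unfolding re using p by (simp add: field_simps)
qed

text \<open>The transformed function \<open>q\<close> decays like
  \<open>F\<^sup>2 / (lam * norm z)\<close>, so \<open>half_disc\<close> with \<open>m = 0\<close>
  bounds the integral of its nonnegative real part by \<open>pi * F\<^sup>2 / lam\<close> in the
  limit of large discs. The factor 4 pays for the value \<open>1/4\<close> on the set. Nothing
  depends on \<open>N\<close>.\<close>

lemma cform_weak_type:
  assumes N: "N \<ge> 1" and lam: "lam > 0" and F: "(\<Sum>n=1..N. norm (f n)) \<le> F"
  shows "emeasure lborel {x\<in>{-R0..R0}. norm (cform N f (of_real x)) \<ge> lam} \<le> ennreal (4 * pi * F\<^sup>2 / lam)"
proof -
  define S where "S = {x\<in>{-R0..R0}. norm (cform N f (of_real x)) \<ge> lam}"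
  define q where "q z = - \<i> * of_real (1 / lam) * cform N f z / (1 + - \<i> * of_real (1 / lam) * cform N f z)" for z
  have Re0: "Re (- \<i> * of_real (1 / lam) * cform N f z) \<ge> 0" if "Im z \<ge> 0" for z
    using Im_cform_nonneg[OF N that, of f] lam by simp
  note cay = Re_cayley[OF Re0]
  have qc: "continuous_on {z. Im z \<ge> 0} q"
    unfolding q_def by (intro continuous_intros cform_regular[OF N]) (use cay in auto)
  have qh: "q holomorphic_on {z. Im z > 0}"
    unfolding q_def by (intro holomorphic_intros cform_regular[OF N]) (use cay(4) in force)
  have qrc: "continuous_on UNIV (\<lambda>x::real. q (of_real x))"
    by (rule continuous_on_compose2[OF qc]) (auto intro!: continuous_intros)
  have qpos: "Re (q (of_real x)) \<ge> 0" for x :: real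
    unfolding q_def by (rule cay(1)) simp
  have Smeas[measurable]: "S \<in> sets borel"
  proof -
    have "S = {-R0..R0} \<inter> {x. norm (cform N f (of_real x)) \<ge> lam}" by (auto simp: S_def)
    moreover have "closed {x::real. norm (cform N f (of_real x)) \<ge> lam}"
      by (intro closed_Collect_le continuous_intros cform_real_cont N)
    ultimately have "closed S" by auto
    then show ?thesis by (rule borel_closed)
  qed
  have main: "emeasure lborel S \<le> ennreal (4 * (pi * real n * ((1/lam) * (F\<^sup>2 / (real n - KB)))))"
    if n: "real n > KB" "real n \<ge> R0" for n
  proof -
    have n0: "real n > 0" using n C_nonneg by linarith
    have Fsq: "(\<Sum>n=1..N. norm (f n))\<^sup>2 \<le> F\<^sup>2" by (rule power_mono[OF F]) (simp add: sum_nonneg)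
    have "norm (integral {-real n..real n} (\<lambda>x. q (of_real x)) - \<i> * pi * 0) \<le> pi * real n * ((1/lam) * (F\<^sup>2 / (real n - KB)))"
    proof (rule half_disc[OF qc qh n0])
      fix z assume z: "0 \<le> Im z" "cmod z = real n"
      have "norm (q z) \<le> norm (- \<i> * of_real (1 / lam) * cform N f z)"
        unfolding q_def by (rule cay(2)[OF z(1)])
      also have "\<dots> = (1 / lam) * norm (cform N f z)" using lam by (simp add: norm_mult norm_divide)
      also have "\<dots> \<le> (1 / lam) * (F\<^sup>2 / (real n - KB))"
      proof (intro mult_left_mono)
        have "norm (cform N f z) \<le> (\<Sum>n=1..N. norm (f n))\<^sup>2 / (real n - KB)"
          using cform_bound[OF N z(1), of f] n unfolding z(2) by blast
        also have "\<dots> \<le> F\<^sup>2 / (real n - KB)" using Fsq n by (intro divide_right_mono) linarith+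
        finally show "norm (cform N f z) \<le> F\<^sup>2 / (real n - KB)" .
      qed (use lam in simp)
      finally show "norm (q z + 0 / z) \<le> (1 / lam) * (F\<^sup>2 / (real n - KB))" by simp
    qed
    then have "Re (integral {-real n..real n} (\<lambda>x. q (of_real x))) \<le> pi * real n * ((1/lam) * (F\<^sup>2 / (real n - KB)))"
      using complex_Re_le_cmod order_trans by fastforce
    then have I: "integral {-real n..real n} (\<lambda>x. Re (q (of_real x))) \<le> pi * real n * ((1/lam) * (F\<^sup>2 / (real n - KB)))"
      by (subst integral_Im(2)[OF qrc])
    have "emeasure lborel S = (\<integral>\<^sup>+x. indicator S x \<partial>lborel)" by simp
    also have "\<dots> \<le> (\<integral>\<^sup>+x. 4 * (ennreal (Re (q (of_real x))) * indicator {-real n..real n} x) \<partial>lborel)"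
    proof (intro nn_integral_mono)
      fix x :: real
      show "indicator S x \<le> 4 * (ennreal (Re (q (of_real x))) * indicator {-real n..real n} x)"
      proof (cases "x \<in> S")
        case True
        then have "norm (- \<i> * of_real (1 / lam) * cform N f (of_real x)) \<ge> 1"
          using lam by (simp add: S_def norm_mult norm_divide field_simps)
        then have "Re (q (of_real x)) \<ge> 1/4" unfolding q_def using cay(3)[of "of_real x"] by simp
        then have "4 * ennreal (1/4) \<le> 4 * ennreal (Re (q (of_real x)))"
          by (intro mult_left_mono ennreal_leI) auto
        moreover have "4 * ennreal (1/4) = 1" by (simp flip: ennreal_numeral ennreal_mult)
        ultimately show ?thesis using True n by (auto simp: S_def indicator_def)
      qed simp
    qed
    also have "\<dots> = 4 * ennreal (integral {-real n..real n} (\<lambda>x. Re (q (of_real x))))"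
    proof (subst nn_integral_cmult)
      show "(\<lambda>x. ennreal (Re (q (complex_of_real x))) * indicator {- real n..real n} x) \<in> borel_measurable lborel"
        using borel_measurable_continuous_onI[OF qrc] by measurable
      show "4 * (\<integral>\<^sup>+x. ennreal (Re (q (of_real x))) * indicator {-real n..real n} x \<partial>lborel) = 4 * ennreal (integral {-real n..real n} (\<lambda>x. Re (q (of_real x))))"
        using qrc qpos by (subst nn_integral_continuous_interval) (auto intro!: continuous_intros)
    qed
    also have "\<dots> \<le> 4 * ennreal (pi * real n * ((1/lam) * (F\<^sup>2 / (real n - KB))))"
      using I by (intro mult_left_mono ennreal_leI) auto
    finally show ?thesis using lam n
      by (subst ennreal_mult') (auto simp: ennreal_numeral)
  qed
  have "(\<lambda>n. ennreal (4 * (pi * real n * ((1/lam) * (F\<^sup>2 / (real n - KB)))))) \<longlonglongrightarrow> ennreal (4 * pi * F\<^sup>2 / lam)"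
  proof (rule tendsto_ennrealI)
    have "(\<lambda>n. real n / (real n - KB)) \<longlonglongrightarrow> 1" by real_asymp
    from tendsto_mult[OF tendsto_const[of "4 * pi * F\<^sup>2 / lam"] this]
    show "(\<lambda>n. 4 * (pi * real n * ((1/lam) * (F\<^sup>2 / (real n - KB))))) \<longlonglongrightarrow> 4 * pi * F\<^sup>2 / lam"
      by (simp add: field_simps)
  qed
  moreover have "\<forall>\<^sub>F n in sequentially. emeasure lborel S \<le> ennreal (4 * (pi * real n * ((1/lam) * (F\<^sup>2 / (real n - KB)))))"
  proof -
    have "\<forall>\<^sub>F n in sequentially. real n > KB" "\<forall>\<^sub>F n in sequentially. real n \<ge> R0" by real_asymp+
    then show ?thesis by eventually_elim (rule main)
  qed
  ultimately have "emeasure lborel S \<le> ennreal (4 * pi * F\<^sup>2 / lam)"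
    by (intro tendsto_lowerbound[OF _ _ sequentially_bot])
  then show ?thesis unfolding S_def .
qed

end

section \<open>Spectral densities of the chains\<close>

lemma emeasure_UN_le_card:
  assumes "finite I" "\<And>i. i \<in> I \<Longrightarrow> A i \<in> sets M" "\<And>i. i \<in> I \<Longrightarrow> emeasure M (A i) \<le> ennreal r" "r \<ge> 0"
  shows "emeasure M (\<Union>i\<in>I. A i) \<le> ennreal (real (card I) * r)"
proof -
  have "emeasure M (\<Union>i\<in>I. A i) \<le> (\<Sum>i\<in>I. emeasure M (A i))"
    by (rule emeasure_subadditive_finite) (use assms in auto)
  also have "\<dots> \<le> (\<Sum>i\<in>I. ennreal r)" by (intro sum_mono assms)
  also have "\<dots> = ennreal (real (card I) * r)"
    using assms(4) by (simp add: ennreal_mult ennreal_of_nat_eq_real_of_nat)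
  finally show ?thesis .
qed

lemma cvec_simps [simp]:
  "cvec 0 = 0" "cvec (u + v) = cvec u + cvec v" "cvec (u - v) = cvec u - cvec v"
  "cvec (- v) = - cvec v" "cvec (r *\<^sub>R v) = of_real r *s cvec v" "cvec (r *s v) = of_real r *s cvec v"
  by (simp_all add: vec_eq_iff)

lemma cvec_sum [simp]: "cvec (\<Sum>i\<in>A. f i) = (\<Sum>i\<in>A. cvec (f i))"
  by (induction A rule: infinite_finite_induct) auto

lemma vec_expand: "v = (\<Sum>j\<in>UNIV. v $ j *s axis j (1::complex))"
  by (simp add: basis_expansion)

lemma norm_vec_le_l1: "norm (v :: complex^'l) \<le> (\<Sum>i\<in>UNIV. norm (v $ i))"
  unfolding norm_vec_def by (rule L2_set_le_sum) simp

lemma cdot_axis [simp]: "cdot (axis i 1) v = v $ i"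
proof -
  have "vcnj (axis i 1) = axis i 1" by (simp add: vec_eq_iff axis_def)
  then show ?thesis by (simp add: cdot_bdot)
qed

section \<open>Weak-type bounds for Green functions, matrix orthogonal polynomials and
  moments\<close>

context jacobi_coeff
begin

lemma chain_res_add_smult:
  assumes "N \<ge> 1" "Im z \<ge> 0" "m \<le> Suc N"
  shows "chain_res a b N z (\<lambda>n. f n + c *s g n) m = chain_res a b N z f m + c *s chain_res a b N z g m"
  by (rule chain_res_eqI[OF chain_sol_add[OF chain_res_sol chain_sol_smult[OF chain_res_sol]]]) (use assms in auto)

lemma chain_res_zero:
  assumes "N \<ge> 1" "Im z \<ge> 0" "m \<le> Suc N"
  shows "chain_res a b N z (\<lambda>n. 0) m = 0"
  by (rule chain_res_eqI[of _ _ _ "\<lambda>_. 0", simplified]) (use assms in \<open>auto simp: chain_sol_def jrow_def\<close>)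

lemma chain_res_sum:
  assumes "N \<ge> 1" "Im z \<ge> 0" "m \<le> Suc N"
  shows "chain_res a b N z (\<lambda>n. \<Sum>j\<in>A. c j *s g j n) m = (\<Sum>j\<in>A. c j *s chain_res a b N z (g j) m)"
proof (induction A rule: infinite_finite_induct)
  case (insert j A)
  then have "(\<lambda>n. \<Sum>j\<in>insert j A. c j *s g j n) = (\<lambda>n. (\<Sum>j\<in>A. c j *s g j n) + c j *s g j n)"
    by (simp add: add.commute)
  then have "chain_res a b N z (\<lambda>n. \<Sum>j\<in>insert j A. c j *s g j n) m
     = chain_res a b N z (\<lambda>n. \<Sum>j\<in>A. c j *s g j n) m + c j *s chain_res a b N z (g j) m"
    by (simp only: chain_res_add_smult[OF assms])
  then show ?case using insert by (simp add: add.commute)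
qed (auto simp: chain_res_zero[OF assms])

lemma chain_res_site_expand:
  assumes "N \<ge> 1" "Im z \<ge> 0" "m \<le> Suc N"
  shows "chain_res a b N z (site n v) m = (\<Sum>j\<in>UNIV. v $ j *s chain_res a b N z (site n (axis j 1)) m)"
proof -
  have "site n v = (\<lambda>k. \<Sum>j\<in>UNIV. v $ j *s site n (axis j 1) k)"
    using vec_expand[of v] by (auto simp: site_def fun_eq_iff)
  then show ?thesis using chain_res_sum[OF assms, where A = UNIV and c = "\<lambda>j. v $ j" and g = "\<lambda>j. site n (axis j 1)"] by simp
qed

text \<open>Both solutions satisfy the same absorbing condition, so their Wronskian at
  \<open>N\<close> vanishes in Green's formula.\<close>

lemma chain_res_sym:
  assumes "N \<ge> 1" "Im z \<ge> 0"
  shows "(\<Sum>n=1..N. bdot (f n) (chain_res a b N z g n)) = (\<Sum>n=1..N. bdot (chain_res a b N z f n) (g n))"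
proof -
  let ?u = "chain_res a b N z f" and ?y = "chain_res a b N z g"
  have u: "?u 0 = 0" "\<And>n. n \<in> {1..N} \<Longrightarrow> jrow a b ?u n = f n + z *s ?u n" "cmv (a N) (?u (Suc N)) = - (\<i> *s ?u N)"
    using chain_res_sol[OF assms, of f] by (auto simp: chain_sol_def algebra_simps)
  have y: "?y 0 = 0" "\<And>n. n \<in> {1..N} \<Longrightarrow> jrow a b ?y n = g n + z *s ?y n" "cmv (a N) (?y (Suc N)) = - (\<i> *s ?y N)"
    using chain_res_sol[OF assms, of g] by (auto simp: chain_sol_def algebra_simps)
  have "(\<Sum>n=1..N. bdot (?u n) (g n) - bdot (f n) (?y n)) = (\<Sum>n=1..N. bdot (?u n) (jrow a b ?y n) - bdot (jrow a b ?u n) (?y n))"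
    by (rule sum.cong) (auto simp: u y)
  also have "\<dots> = 0" using green[of ?u ?y N] u(1) y(1) by (simp add: u y)
  finally show ?thesis by (simp add: sum_subtractf)
qed

text \<open>Polarisation reduces an entry to four quadratic forms at \<open>A + w *s B\<close> with
  \<open>w\<close> a fourth root of unity. Each argument has l1 norm at most 2, so each form
  contributes \<open>4 * pi * 2\<^sup>2 / lam\<close>.\<close>

lemma weak_type_entry:
  assumes N: "N \<ge> 1" and n: "n \<in> {1..N}" and lam: "lam > 0"
  shows "{x\<in>{-R0..R0}. norm (chain_res a b N (of_real x) (site n (axis j 1)) 1 $ i) \<ge> lam} \<in> sets lborel"
    "emeasure lborel {x\<in>{-R0..R0}. norm (chain_res a b N (of_real x) (site n (axis j 1)) 1 $ i) \<ge> lam}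
       \<le> ennreal (64 * pi / lam)"
proof -
  define h where "h x = chain_res a b N (of_real x) (site n (axis j 1)) 1 $ i" for x :: real
  define A :: "nat \<Rightarrow> complex^'l" where "A = site 1 (axis i 1)"
  define B :: "nat \<Rightarrow> complex^'l" where "B = site n (axis j 1)"
  define u where "u w = (\<lambda>k. A k + w *s B k)" for w
  define W where "W = {1, -1, \<i>, -\<i>}"
  define S where "S lam f = {x\<in>{-R0..R0}. norm (cform N f (of_real x)) \<ge> lam}" for f lam
  have cont: "continuous_on UNIV h" unfolding h_def
    by (rule continuous_on_compose2[OF chain_res_regular(2)[OF N, of 1]]) (auto intro!: continuous_intros)
  have "closed ({-R0..R0} \<inter> {x. norm (h x) \<ge> lam})"
    by (intro closed_Int closed_Collect_le continuous_intros cont)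
  also have "{-R0..R0} \<inter> {x. norm (h x) \<ge> lam} = {x\<in>{-R0..R0}. norm (h x) \<ge> lam}" by auto
  finally show "{x\<in>{-R0..R0}. norm (chain_res a b N (of_real x) (site n (axis j 1)) 1 $ i) \<ge> lam} \<in> sets lborel"
    unfolding h_def by simp
  have S_meas: "S lam f \<in> sets lborel" for f
  proof -
    have "closed ({-R0..R0} \<inter> {x::real. norm (cform N f (of_real x)) \<ge> lam})"
      by (intro closed_Int closed_Collect_le continuous_intros cform_real_cont N)
    also have "{-R0..R0} \<inter> {x::real. norm (cform N f (of_real x)) \<ge> lam} = S lam f" by (auto simp: S_def)
    finally show ?thesis by simp
  qed
  have bound: "emeasure lborel (S lam (u w)) \<le> ennreal (16 * pi / lam)" if w: "w \<in> W" for w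
  proof -
    have nw: "norm w = 1" using w by (auto simp: W_def)
    have "(\<Sum>k=1..N. norm (u w k)) \<le> (\<Sum>k=1..N. (if k = 1 then 1 else 0) + (if k = n then 1 else 0))"
    proof (rule sum_mono)
      fix k
      have "norm (u w k) \<le> norm (A k) + norm (w *s B k)" unfolding u_def by (rule norm_triangle_ineq)
      also have "\<dots> \<le> (if k = 1 then 1 else 0) + (if k = n then 1 else 0)"
        using nw by (auto simp: A_def B_def site_def norm_axis_1)
      finally show "norm (u w k) \<le> (if k = 1 then 1 else 0) + (if k = n then 1 else 0)" .
    qed
    also have "\<dots> \<le> 2" using n N by (simp add: sum.distrib)
    finally have "emeasure lborel (S lam (u w)) \<le> ennreal (4 * pi * 2\<^sup>2 / lam)"
      unfolding S_def by (rule cform_weak_type[OF N lam])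
    then show ?thesis by simp
  qed
  have sub: "{x\<in>{-R0..R0}. norm (h x) \<ge> lam} \<subseteq> (\<Union>w\<in>W. S lam (u w))"
  proof
    fix x assume x: "x \<in> {x\<in>{-R0..R0}. norm (h x) \<ge> lam}"
    define q where "q f g = (\<Sum>k=1..N. cdot (f k) (chain_res a b N (of_real x) g k))" for f g
    have q: "cform N (u w) (of_real x) = q A A + w * q A B + cnj w * q B A + cnj w * w * q B B" for w
    proof -
      have "chain_res a b N (of_real x) (u w) k = chain_res a b N (of_real x) A k + w *s chain_res a b N (of_real x) B k" if "k \<in> {1..N}" for k
        unfolding u_def using N that by (intro chain_res_add_smult) auto
      then have "cform N (u w) (of_real x) = (\<Sum>k=1..N. cdot (A k + w *s B k) (chain_res a b N (of_real x) A k + w *s chain_res a b N (of_real x) B k))"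
        unfolding cform_def by (intro sum.cong refl) (simp add: u_def del: cdot_simps)
      also have "\<dots> = q A A + w * q A B + cnj w * q B A + cnj w * w * q B B"
        by (simp add: q_def sum.distrib sum_distrib_left algebra_simps)
      finally show ?thesis .
    qed
    have "q A B = (\<Sum>k\<in>{1}. cdot (A k) (chain_res a b N (of_real x) B k))"
      unfolding q_def A_def using N by (intro sum.mono_neutral_right) (auto simp: site_def)
    then have hq: "h x = q A B" by (simp add: A_def B_def h_def)
    \<comment> \<open>The sums of \<open>cnj w\<close> and of \<open>(cnj w)\<^sup>2\<close> over
      the four roots vanish, so only the mixed term \<open>q A B\<close> survives.\<close>
    have "4 * h x = (\<Sum>w\<in>W. cnj w * cform N (u w) (of_real x))"
      unfolding hq by (simp add: W_def q complex_eq_iff)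
    then have "4 * norm (h x) = norm (\<Sum>w\<in>W. cnj w * cform N (u w) (of_real x))"
      by (metis norm_mult norm_numeral)
    also have "\<dots> \<le> (\<Sum>w\<in>W. norm (cform N (u w) (of_real x)))"
      by (rule order_trans[OF norm_sum]) (rule sum_mono, auto simp: W_def norm_mult)
    finally have le: "4 * lam \<le> (\<Sum>w\<in>W. norm (cform N (u w) (of_real x)))" using x by simp
    have "\<exists>w\<in>W. norm (cform N (u w) (of_real x)) \<ge> lam"
    proof (rule ccontr)
      assume "\<not> ?thesis"
      then have "(\<Sum>w\<in>W. norm (cform N (u w) (of_real x))) < (\<Sum>w\<in>W. lam)"
        by (intro sum_strict_mono) (auto simp: W_def)
      also have "\<dots> = 4 * lam" by (simp add: W_def complex_eq_iff)
      finally show False using le by simp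
    qed
    then show "x \<in> (\<Union>w\<in>W. S lam (u w))" using x by (auto simp: S_def)
  qed
  have "card W = 4" "finite W" by (simp_all add: W_def complex_eq_iff)
  have "emeasure lborel {x\<in>{-R0..R0}. norm (h x) \<ge> lam} \<le> emeasure lborel (\<Union>w\<in>W. S lam (u w))"
    by (rule emeasure_mono[OF sub]) (intro sets.finite_UN \<open>finite W\<close> S_meas)
  also have "\<dots> \<le> ennreal (real (card W) * (16 * pi / lam))"
    by (rule emeasure_UN_le_card) (use S_meas bound lam in \<open>auto simp: W_def\<close>)
  finally show "emeasure lborel {x\<in>{-R0..R0}. norm (chain_res a b N (of_real x) (site n (axis j 1)) 1 $ i) \<ge> lam}
       \<le> ennreal (64 * pi / lam)"
    using \<open>card W = 4\<close> unfolding h_def by simp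
qed

text \<open>Each of the \<open>l^2\<close> entries gets the threshold \<open>k / l^2\<close>:
  summing entries and columns restores \<open>k\<close>, while the measures of the exceptional sets
  add up to \<open>l^2 * (64 * pi * l^2 / k)\<close>.\<close>

lemma weak_type_green:
  assumes N: "N \<ge> 1" and n: "n \<in> {1..N}" and k: "k > 0"
  obtains Bad where "Bad \<in> sets lborel" "emeasure lborel Bad \<le> ennreal (64 * pi * real CARD('l) ^ 4 / k)"
    "\<And>x v. x \<in> {-R0..R0} - Bad \<Longrightarrow> norm (chain_res a b N (of_real x) (site n v) 1) \<le> k * norm v"
proof -
  define l where "l = real CARD('l)"
  have l: "l > 0" by (simp add: l_def)
  define S where "S = (\<lambda>(i,j). {x\<in>{-R0..R0}. norm (chain_res a b N (of_real x) (site n (axis j 1)) 1 $ i) \<ge> k / l^2})"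
  have kl: "k / l^2 > 0" using k l by simp
  have Sm: "S p \<in> sets lborel" for p
    unfolding S_def by (cases p, simp only: prod.case, rule weak_type_entry(1)[OF N n kl])
  have Se: "emeasure lborel (S p) \<le> ennreal (64 * pi / (k / l^2))" for p
    unfolding S_def by (cases p, simp only: prod.case, rule weak_type_entry(2)[OF N n kl])
  show ?thesis
  proof (rule that[of "\<Union>p\<in>(UNIV::('l\<times>'l) set). S p"])
    show "(\<Union>p\<in>(UNIV::('l\<times>'l) set). S p) \<in> sets lborel" using Sm by (intro sets.finite_UN) auto
    have "emeasure lborel (\<Union>p\<in>(UNIV::('l\<times>'l) set). S p) \<le> ennreal (real (card (UNIV::('l\<times>'l) set)) * (64 * pi / (k / l^2)))"
      by (rule emeasure_UN_le_card) (use Sm Se k in auto)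
    also have "real (card (UNIV::('l\<times>'l) set)) * (64 * pi / (k / l^2)) = 64 * pi * l ^ 4 / k"
      by (simp add: l_def card_cartesian_product flip: UNIV_Times_UNIV) (simp add: power_eq_if)
    finally show "emeasure lborel (\<Union>p\<in>(UNIV::('l\<times>'l) set). S p) \<le> ennreal (64 * pi * real CARD('l) ^ 4 / k)"
      by (simp add: l_def)
  next
    fix x v assume x: "x \<in> {-R0..R0} - (\<Union>p\<in>(UNIV::('l\<times>'l) set). S p)"
    let ?G = "\<lambda>j. chain_res a b N (of_real x) (site n (axis j 1)) 1"
    have G: "norm (?G j $ i) \<le> k / l^2" for i j using x by (auto simp: S_def not_le intro: less_imp_le)
    have GG: "norm (?G j) \<le> k / l" for j
    proof -
      have "norm (?G j) \<le> (\<Sum>i\<in>UNIV. norm (?G j $ i))" by (rule norm_vec_le_l1)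
      also have "\<dots> \<le> (\<Sum>i\<in>(UNIV::'l set). k / l^2)" by (intro sum_mono G)
      finally show ?thesis using l by (simp add: l_def power2_eq_square)
    qed
    have "norm (chain_res a b N (of_real x) (site n v) 1) = norm (\<Sum>j\<in>UNIV. v $ j *s ?G j)"
      using chain_res_site_expand[of N "of_real x" 1 n v] N by simp
    also have "\<dots> \<le> (\<Sum>j\<in>UNIV. norm (v $ j *s ?G j))" by (rule norm_sum)
    also have "\<dots> \<le> (\<Sum>j\<in>(UNIV :: 'l set). norm v * (k / l))"
    proof (rule sum_mono)
      fix j
      have "norm (v $ j) * norm (?G j) \<le> norm v * (k / l)"
        by (intro mult_mono GG Finite_Cartesian_Product.norm_nth_le) simp_all
      then show "norm (v $ j *s ?G j) \<le> norm v * (k / l)" by simp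
    qed
    finally show "norm (chain_res a b N (of_real x) (site n v) 1) \<le> k * norm v"
      using l by (simp add: l_def mult.commute)
  qed
qed

text \<open>The matrix orthogonal polynomials of the operator: the matrix solution at energy
  \<open>x\<close> with value 0 at site 0 and the identity at site 1. Every Dirichlet solution is
  obtained from it by its first value (\<open>sol_pm\<close>).\<close>

fun pm :: "nat \<Rightarrow> real \<Rightarrow> real^'l^'l" where
  "pm 0 x = 0"
| "pm (Suc 0) x = mat 1"
| "pm (Suc (Suc n)) x = ai (Suc n) ** (x *\<^sub>R pm (Suc n) x - b (Suc n) ** pm (Suc n) x - a n ** pm n x)"

lemma pm_row: "x *\<^sub>R pm (Suc n) x = a n ** pm n x + a (Suc n) ** pm (Suc (Suc n)) x + b (Suc n) ** pm (Suc n) x"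
  by (simp add: matrix_mul_assoc ai_mult)

lemma pm_poly: "real_polynomial_function (\<lambda>x. pm n x $ i $ j)"
proof (induction n arbitrary: i j rule: induct_nat_012)
  case (ge2 n)
  have "pm (Suc (Suc n)) x $ i $ j = (\<Sum>k\<in>UNIV. ai (Suc n) $ i $ k * (x * pm (Suc n) x $ k $ j
     - (\<Sum>m\<in>UNIV. b (Suc n) $ k $ m * pm (Suc n) x $ m $ j) - (\<Sum>m\<in>UNIV. a n $ k $ m * pm n x $ m $ j)))" for x
    by (simp add: matrix_matrix_mult_def)
  moreover have "real_polynomial_function (\<lambda>x::real. x)" by (rule real_polynomial_function.intros(1)) (rule bounded_linear_ident)
  ultimately show ?case
    by (simp only:) (intro real_polynomial_function_sum real_polynomial_function.intros(2,4) real_polynomial_function_diff ge2 finite)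
qed (auto intro: real_polynomial_function.intros)

lemma sol_pm:
  assumes "y 0 = 0" "\<And>n. n \<in> {1..N} \<Longrightarrow> jrow a b y n = of_real x *s y n" "n \<le> Suc N"
  shows "y n = cmv (pm n x) (y 1)"
  using assms(3)
proof (induction n rule: induct_nat_012)
  case (ge2 n)
  have "jrow a b y (Suc n) = of_real x *s y (Suc n)" using ge2 by (intro assms) auto
  then have "cmv (a (Suc n)) (y (Suc (Suc n))) = of_real x *s y (Suc n) - cmv (b (Suc n)) (y (Suc n)) - cmv (a n) (y n)"
    by (simp add: jrow_def algebra_simps)
  then have "y (Suc (Suc n)) = cmv (ai (Suc n)) (of_real x *s y (Suc n) - cmv (b (Suc n)) (y (Suc n)) - cmv (a n) (y n))"
    by (metis cmv_ai(2))
  moreover have "y (Suc n) = cmv (pm (Suc n) x) (y 1)" "y n = cmv (pm n x) (y 1)" using ge2 by auto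
  ultimately show ?case by (simp add: cmv_mult)
qed (use assms in auto)

lemma pm_sol:
  "jrow a b (\<lambda>n. cmv (pm n x) c) (Suc n) = of_real x *s cmv (pm (Suc n) x) c"
proof -
  have "of_real x *s cmv (pm (Suc n) x) c = cmv (x *\<^sub>R pm (Suc n) x) c" by simp
  also have "\<dots> = jrow a b (\<lambda>n. cmv (pm n x) c) (Suc n)"
    unfolding pm_row by (simp add: jrow_def cmv_mult del: pm.simps)
  finally show ?thesis by simp
qed

text \<open>The block of the Green function between site 1 and site \<open>N\<close>: the amplitude
  arriving at the absorbing end from a source at the first site.\<close>

definition lres :: "nat \<Rightarrow> real \<Rightarrow> complex^'l \<Rightarrow> complex^'l" where
  "lres N x v = chain_res a b N (of_real x) (site 1 v) N"

lemma lres_pair: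
  assumes N: "N \<ge> 1"
  shows "bdot t (lres N x v) = bdot (chain_res a b N (of_real x) (site N t) 1) v"
proof -
  have "bdot t (lres N x v) = (\<Sum>n\<in>{N}. bdot (site N t n) (chain_res a b N (of_real x) (site 1 v) n))"
    by (simp add: lres_def)
  also have "\<dots> = (\<Sum>n=1..N. bdot (site N t n) (chain_res a b N (of_real x) (site 1 v) n))"
    using N by (intro sum.mono_neutral_left) (auto simp: site_def)
  also have "\<dots> = (\<Sum>n=1..N. bdot (chain_res a b N (of_real x) (site N t) n) (site 1 v n))"
    by (rule chain_res_sym) (use N in auto)
  also have "\<dots> = (\<Sum>n\<in>{1}. bdot (chain_res a b N (of_real x) (site N t) n) (site 1 v n))"
    using N by (intro sum.mono_neutral_right) (auto simp: site_def)
  finally show ?thesis by simp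
qed

text \<open>Seen from the absorbing end, a source spread over the chain can be moved to site 1.
  Reciprocity reverses the direction, and a response to a source at site \<open>N\<close> is a
  homogeneous solution in all earlier rows, hence \<open>pm\<close> applied to its first
  value.\<close>

lemma chain_res_last:
  assumes N: "N \<ge> 1"
  shows "chain_res a b N (of_real x) f N = lres N x (\<Sum>n=1..N. cmv (transpose (pm n x)) (f n))"
proof -
  have "bdot t (chain_res a b N (of_real x) f N) = bdot t (lres N x (\<Sum>n=1..N. cmv (transpose (pm n x)) (f n)))" for t
  proof -
    let ?y = "chain_res a b N (of_real x) (site N t)"
    have sol: "chain_sol a b N (of_real x) (site N t) ?y" by (rule chain_res_sol) (use N in auto)
    have y: "?y n = cmv (pm n x) (?y 1)" if "n \<in> {1..N}" for n
    \<comment> \<open>Row \<open>N\<close> carries the source, so only the rows up to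
      \<open>N - 1\<close> are homogeneous; these still determine the entry at
      \<open>N\<close>.\<close>
    proof (rule sol_pm[of _ "N - 1"])
      show "?y 0 = 0" using sol by (simp add: chain_sol_def)
      show "jrow a b ?y k = of_real x *s ?y k" if "k \<in> {1..N - 1}" for k
      proof -
        have "k \<in> {1..N}" "k \<noteq> N" using that by auto
        then have "jrow a b ?y k - of_real x *s ?y k = 0" using sol by (simp add: chain_sol_def)
        then show ?thesis by simp
      qed
    qed (use that in auto)
    have "bdot t (chain_res a b N (of_real x) f N) = (\<Sum>n\<in>{N}. bdot (site N t n) (chain_res a b N (of_real x) f n))"
      by simp
    also have "\<dots> = (\<Sum>n=1..N. bdot (site N t n) (chain_res a b N (of_real x) f n))"
      using N by (intro sum.mono_neutral_left) (auto simp: site_def)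
    also have "\<dots> = (\<Sum>n=1..N. bdot (?y n) (f n))"
      by (rule chain_res_sym) (use N in auto)
    also have "\<dots> = (\<Sum>n=1..N. bdot (cmv (pm n x) (?y 1)) (f n))"
      by (rule sum.cong[OF refl]) (rule arg_cong[where f = "\<lambda>w. bdot w _", OF y])
    also have "\<dots> = bdot (?y 1) (\<Sum>n=1..N. cmv (transpose (pm n x)) (f n))"
      by (simp add: bdot_cmv)
    finally show ?thesis using lres_pair[OF N] by simp
  qed
  then have "chain_res a b N (of_real x) f N $ i = lres N x (\<Sum>n=1..N. cmv (transpose (pm n x)) (f n)) $ i" for i
    by (metis bdot_axis(1))
  then show ?thesis by (simp add: vec_eq_iff)
qed

lemma lres_expand: "N \<ge> 1 \<Longrightarrow> lres N x v = (\<Sum>j\<in>UNIV. v $ j *s lres N x (axis j 1))"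
  unfolding lres_def by (rule chain_res_site_expand) auto

lemma lres_simps [simp]:
  assumes "N \<ge> 1"
  shows "lres N x (u + v) = lres N x u + lres N x v" "lres N x (c *s v) = c *s lres N x v"
    "lres N x 0 = 0" "lres N x (u - v) = lres N x u - lres N x v"
proof -
  have eqI: "w = w'" if "\<And>t. bdot t w = bdot t w'" for w w' :: "complex^'l"
    using that by (metis bdot_axis(1) vec_eq_iff)
  show "lres N x (u + v) = lres N x u + lres N x v" "lres N x (c *s v) = c *s lres N x v"
    "lres N x 0 = 0" "lres N x (u - v) = lres N x u - lres N x v"
    by (rule eqI, simp add: lres_pair[OF assms])+
qed

text \<open>The spectral density of the chain at site 1 as a symmetric bilinear form on real
  vectors. The real part symmetrises it, and \<open>1 / pi\<close> normalises it in accordance with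
  \<open>resolvent_moment\<close>.\<close>

definition dens :: "nat \<Rightarrow> real \<Rightarrow> real^'l \<Rightarrow> real^'l \<Rightarrow> real" where
  "dens N x u v = Re (cdot (lres N x (cvec u)) (lres N x (cvec v))) / pi"

lemma dens_self: "dens N x u u = (norm (lres N x (cvec u)))\<^sup>2 / pi"
  by (simp add: dens_def cdot_self)

lemma dens_commute: "dens N x u v = dens N x v u"
  unfolding dens_def by (subst cdot_commute) simp

lemma dens_simps [simp]:
  assumes "N \<ge> 1"
  shows "dens N x (u + u') v = dens N x u v + dens N x u' v" "dens N x v (u + u') = dens N x v u + dens N x v u'"
    "dens N x (u - u') v = dens N x u v - dens N x u' v" "dens N x v (u - u') = dens N x v u - dens N x v u'"
    "dens N x (r *\<^sub>R u) v = r * dens N x u v" "dens N x u (r *\<^sub>R v) = r * dens N x u v"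
    "dens N x 0 v = 0" "dens N x v 0 = 0"
  using assms by (simp_all add: dens_def add_divide_distrib diff_divide_distrib)

lemma dens_sum:
  assumes "N \<ge> 1"
  shows "dens N x (\<Sum>i\<in>A. f i) v = (\<Sum>i\<in>A. dens N x (f i) v)" "dens N x v (\<Sum>i\<in>A. f i) = (\<Sum>i\<in>A. dens N x v (f i))"
  using assms by (induction A rule: infinite_finite_induct; simp)+

text \<open>The polynomial transform of a real sequence on the sites \<open>1, \<dots>, N\<close>,
  as it arises when all sources are moved to site 1.\<close>

definition pv :: "nat \<Rightarrow> (nat \<Rightarrow> real^'l) \<Rightarrow> real \<Rightarrow> real^'l" where
  "pv N p x = (\<Sum>n=1..N. transpose (pm n x) *v p n)"

lemma pv_add: "pv N (\<lambda>n. p n + q n) x = pv N p x + pv N q x"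
  by (simp add: pv_def matrix_vector_right_distrib sum.distrib)

lemma pv_diff: "pv N (\<lambda>n. p n - q n) x = pv N p x - pv N q x"
  by (simp add: pv_def matrix_vector_mult_diff_distrib sum_subtractf)

lemma lres_cont: "N \<ge> 1 \<Longrightarrow> continuous_on UNIV (\<lambda>x. lres N x v $ i)"
  unfolding lres_def by (rule continuous_on_compose2[OF chain_res_regular(2)]) (auto intro!: continuous_intros)

lemma dens_cont: "N \<ge> 1 \<Longrightarrow> continuous_on UNIV (\<lambda>x. dens N x u v)"
  unfolding dens_def cdot_def by (intro continuous_intros lres_cont) auto

lemma pv_cont: "continuous_on UNIV (\<lambda>x. pv N p x $ i)"
  unfolding pv_def matrix_vector_mult_def transpose_def
  by (simp, intro continuous_on_sum continuous_on_mult continuous_on_const)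
     (use continuous_on_polymonial_function[of "\<lambda>x. pm _ x $ _ $ _"] pm_poly in \<open>auto simp: real_polynomial_function_eq\<close>)

lemma dens_vec_cont:
  fixes f g :: "real \<Rightarrow> real^'l"
  assumes N: "N \<ge> 1" and f: "\<And>i. continuous_on UNIV (\<lambda>x. f x $ i)" and g: "\<And>i. continuous_on UNIV (\<lambda>x. g x $ i)"
  shows "continuous_on UNIV (\<lambda>x. dens N x (f x) (g x))"
proof -
  have "dens N x (f x) (g x) = dens N x (\<Sum>i\<in>UNIV. f x $ i *\<^sub>R axis i 1) (\<Sum>j\<in>UNIV. g x $ j *\<^sub>R axis j 1)" for x
    by (simp add: basis_expansion scalar_mult_eq_scaleR[symmetric])
  also have "\<dots> x = (\<Sum>i\<in>UNIV. \<Sum>j\<in>UNIV. f x $ i * (g x $ j * dens N x (axis i 1) (axis j 1)))" for x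
    using N by (simp add: dens_sum sum_distrib_left, subst sum.swap, simp add: mult.left_commute)
  finally have e: "(\<lambda>x. dens N x (f x) (g x))
      = (\<lambda>x. \<Sum>i\<in>UNIV. \<Sum>j\<in>UNIV. f x $ i * (g x $ j * dens N x (axis i 1) (axis j 1)))" by auto
  show ?thesis unfolding e by (intro continuous_on_sum continuous_on_mult dens_cont N f g)
qed

text \<open>Parseval's identity for the chain. The diagonal case is \<open>resolvent_moment\<close>
  after the source has been moved to site 1; polarisation gives the rest.\<close>

lemma dens_moment:
  assumes N: "N \<ge> 1"
  shows "integrable lborel (\<lambda>x. dens N x (pv N p x) (pv N q x))"
    "(\<integral>x. dens N x (pv N p x) (pv N q x) \<partial>lborel) = (\<Sum>n=1..N. p n \<bullet> q n)"
proof -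
  let ?d = "\<lambda>p x. dens N x (pv N p x) (pv N p x)"
  have dc: "continuous_on UNIV (?d p)" for p by (intro dens_vec_cont N pv_cont)
  have *: "integrable lborel (?d p) \<and> (\<integral>x. ?d p x \<partial>lborel) = (\<Sum>n=1..N. (norm (p n))\<^sup>2)" for p
  proof -
    have "ennreal (?d p x) = ennreal (1/pi) * ennreal ((norm (chain_res a b N (of_real x) (\<lambda>n. cvec (p n)) N))\<^sup>2)" for x
      unfolding dens_self chain_res_last[OF N] pv_def by (simp add: cmv_cvec ennreal_mult[symmetric])
    then have "(\<integral>\<^sup>+x. ennreal (?d p x) \<partial>lborel) = ennreal (1/pi) * (\<integral>\<^sup>+x. ennreal ((norm (chain_res a b N (of_real x) (\<lambda>n. cvec (p n)) N))\<^sup>2) \<partial>lborel)"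
    proof (subst nn_integral_cmult[symmetric])
      have "continuous_on UNIV (\<lambda>x::real. chain_res a b N (of_real x) (\<lambda>n. cvec (p n)) N $ i)" for i
        by (rule continuous_on_compose2[OF chain_res_regular(2)]) (use N in \<open>auto intro!: continuous_intros\<close>)
      then have "continuous_on UNIV (\<lambda>x::real. (norm (chain_res a b N (of_real x) (\<lambda>n. cvec (p n)) N))\<^sup>2)"
        unfolding norm_vec_sq by (intro continuous_on_sum continuous_on_power continuous_on_norm) auto
      then have "(\<lambda>x::real. (norm (chain_res a b N (of_real x) (\<lambda>n. cvec (p n)) N))\<^sup>2) \<in> borel_measurable borel"
        by (rule borel_measurable_continuous_onI)
      then show "(\<lambda>x::real. ennreal ((norm (chain_res a b N (of_real x) (\<lambda>n. cvec (p n)) N))\<^sup>2)) \<in> borel_measurable lborel"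
        by simp
    qed simp
    also have "\<dots> = ennreal (\<Sum>n=1..N. (norm (p n))\<^sup>2)"
      using resolvent_moment[OF N, of "\<lambda>n. cvec (p n)"] by (simp add: ennreal_mult[symmetric] sum_nonneg)
    finally have e: "(\<integral>\<^sup>+x. ennreal (?d p x) \<partial>lborel) = ennreal (\<Sum>n=1..N. (norm (p n))\<^sup>2)" .
    have m: "?d p \<in> borel_measurable lborel" using borel_measurable_continuous_onI[OF dc] by simp
    have "integrable lborel (?d p)"
      by (rule integrableI_nonneg) (use m e in \<open>auto simp: dens_self\<close>)
    moreover have "(\<integral>x. ?d p x \<partial>lborel) = (\<Sum>n=1..N. (norm (p n))\<^sup>2)"
      by (subst integral_eq_nn_integral) (use m e in \<open>auto simp: dens_self sum_nonneg\<close>)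
    ultimately show ?thesis ..
  qed
  have pol: "dens N x (pv N p x) (pv N q x) = (?d (\<lambda>n. p n + q n) x - ?d (\<lambda>n. p n - q n) x) / 4" for x
    using N by (simp add: pv_add pv_diff dens_commute[of N x "pv N q x" "pv N p x"])
  show "integrable lborel (\<lambda>x. dens N x (pv N p x) (pv N q x))"
    unfolding pol using * by (intro integrable_divide_zero integrable_diff) auto
  have "(\<integral>x. dens N x (pv N p x) (pv N q x) \<partial>lborel) = ((\<Sum>n=1..N. (norm (p n + q n))\<^sup>2) - (\<Sum>n=1..N. (norm (p n - q n))\<^sup>2)) / 4"
    unfolding pol using *[of "\<lambda>n. p n + q n"] *[of "\<lambda>n. p n - q n"] by (simp add: Bochner_Integration.integral_diff)
  also have "\<dots> = (\<Sum>n=1..N. p n \<bullet> q n)"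
    unfolding sum_subtractf[symmetric] sum_divide_distrib
    by (intro sum.cong refl) (simp add: power2_norm_eq_inner inner_add_left inner_add_right inner_diff_left inner_diff_right inner_commute)
  finally show "(\<integral>x. dens N x (pv N p x) (pv N q x) \<partial>lborel) = (\<Sum>n=1..N. p n \<bullet> q n)" .
qed

text \<open>The \<open>k\<close>-th power of the half-line operator applied to \<open>v\<close>
  placed at site 1. It spreads by one site per step (\<open>mono_supp\<close>), which is why a cut
  far to the right is invisible to low moments.\<close>

primrec mseq :: "nat \<Rightarrow> real^'l \<Rightarrow> nat \<Rightarrow> real^'l" where
  "mseq 0 v = (\<lambda>n. if n = 1 then v else 0)"
| "mseq (Suc k) v = (\<lambda>n. if n = 0 then 0 else
     a (n - 1) *v mseq k v (n - 1) + a n *v mseq k v (Suc n) + b n *v mseq k v n)"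

lemma mono_supp: "n = 0 \<or> n > Suc k \<Longrightarrow> mseq k v n = 0"
  by (induction k arbitrary: n) auto

lemma mono_l1: "N \<ge> Suc k \<Longrightarrow> (\<Sum>n=1..N. norm (mseq k v n)) \<le> (3 * C) ^ k * norm v"
proof (induction k arbitrary: N)
  case 0
  have "(\<Sum>n=1..N. norm (mseq 0 v n)) = (\<Sum>n\<in>{1}. norm (mseq 0 v n))"
    using 0 by (intro sum.mono_neutral_right) auto
  then show ?case by simp
next
  case (Suc k)
  have ba: "norm (a n *v u) \<le> C * norm u" "norm (b n *v u) \<le> C * norm u" for n u
    using bound_a[of n "cvec u"] bound_b[of n "cvec u"] by (simp_all add: cmv_cvec)
  have "(\<Sum>n=1..N. norm (mseq (Suc k) v n)) \<le> (\<Sum>n=1..N. C * norm (mseq k v (n - 1)) + C * norm (mseq k v (Suc n)) + C * norm (mseq k v n))"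
    by (rule sum_mono, simp, intro order_trans[OF norm_triangle_ineq] add_mono ba order_refl)
  also have "\<dots> = C * ((\<Sum>n=1..N. norm (mseq k v (n - 1))) + (\<Sum>n=1..N. norm (mseq k v (Suc n))) + (\<Sum>n=1..N. norm (mseq k v n)))"
    by (simp add: sum.distrib sum_distrib_left algebra_simps)
  also have "\<dots> \<le> C * (3 * ((3 * C) ^ k * norm v))"
  proof (rule mult_left_mono[OF _ C_nonneg])
    have "(\<Sum>n=1..M. norm (mseq k v (n - 1))) + norm (mseq k v M) = (\<Sum>n=1..M. norm (mseq k v n))" for M
      by (induction M) (simp_all add: mono_supp)
    from this[of N] have "(\<Sum>n=1..N. norm (mseq k v (n - 1))) \<le> (\<Sum>n=1..N. norm (mseq k v n))"
      using norm_ge_zero[of "mseq k v N"] by linarith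
    moreover have "(\<Sum>n=1..N. norm (mseq k v (Suc n))) \<le> (\<Sum>n=1..Suc N. norm (mseq k v n))"
    proof -
      have "(\<Sum>n=1..N. norm (mseq k v (Suc n))) = (\<Sum>n=2..Suc N. norm (mseq k v n))"
        by (simp only: sum.shift_bounds_cl_Suc_ivl numeral_2_eq_2 One_nat_def)
      also have "\<dots> \<le> (\<Sum>n=1..Suc N. norm (mseq k v n))" by (rule sum_mono2) auto
      finally show ?thesis .
    qed
    moreover have "(\<Sum>n=1..N. norm (mseq k v n)) \<le> (3 * C) ^ k * norm v" "(\<Sum>n=1..Suc N. norm (mseq k v n)) \<le> (3 * C) ^ k * norm v"
      using Suc.prems by (intro Suc.IH; simp)+
    ultimately show "(\<Sum>n=1..N. norm (mseq k v (n - 1))) + (\<Sum>n=1..N. norm (mseq k v (Suc n))) + (\<Sum>n=1..N. norm (mseq k v n)) \<le> 3 * ((3 * C) ^ k * norm v)"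
      by linarith
  qed
  finally show ?case by (simp add: mult_ac)
qed

text \<open>The transform turns the operator into multiplication by \<open>x\<close> as long as the
  sequence has not reached the end of the chain.\<close>

lemma pv_mono:
  assumes "N \<ge> Suc k"
  shows "pv N (mseq k v) x = x ^ k *\<^sub>R v"
  using assms
proof (induction k)
  case 0
  have "pv N (mseq 0 v) x = (\<Sum>n\<in>{1}. transpose (pm n x) *v mseq 0 v n)"
    unfolding pv_def using 0 by (intro sum.mono_neutral_right) auto
  then show ?case by simp
next
  case (Suc k)
  let ?m = "mseq k v" and ?P = "\<lambda>n. transpose (pm n x)"
  have tr: "x *\<^sub>R (?P (Suc n) *v w) = ?P n *v (a n *v w) + ?P (Suc (Suc n)) *v (a (Suc n) *v w) + ?P (Suc n) *v (b (Suc n) *v w)" for n w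
  proof -
    have "x *\<^sub>R (?P (Suc n) *v w) = transpose (x *\<^sub>R pm (Suc n) x) *v w"
      by (simp only: scaleR_matrix_vector_assoc transpose_scalar)
    also have "\<dots> = ?P n *v (a n *v w) + ?P (Suc (Suc n)) *v (a (Suc n) *v w) + ?P (Suc n) *v (b (Suc n) *v w)"
    proof -
      have "transpose (A + B) = transpose A + transpose B" for A B :: "real^'l^'l"
        by (simp add: transpose_def vec_eq_iff)
      then show ?thesis unfolding pm_row
        by (simp add: matrix_transpose_mul matrix_vector_mult_add_rdistrib matrix_vector_mul_assoc sym_a sym_b del: pm.simps)
    qed
    finally show ?thesis .
  qed
  \<comment> \<open>Again a telescoping Wronskian. At \<open>M = N\<close> both boundary terms
    vanish because \<open>mseq k v\<close> is supported in the sites up to \<open>Suc k\<close>,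
    which is smaller than \<open>N\<close>.\<close>
  have "(\<Sum>n=1..M. ?P n *v mseq (Suc k) v n) - x *\<^sub>R (\<Sum>n=1..M. ?P n *v ?m n)
     = ?P M *v (a M *v ?m (Suc M)) - ?P (Suc M) *v (a M *v ?m M)" for M
  proof (induction M)
    case 0
    then show ?case by (simp add: mono_supp transpose_def zero_vec_def[symmetric])
  next
    case (Suc M)
    have "(\<Sum>n=1..Suc M. ?P n *v mseq (Suc k) v n) - x *\<^sub>R (\<Sum>n=1..Suc M. ?P n *v ?m n)
      = ((\<Sum>n=1..M. ?P n *v mseq (Suc k) v n) - x *\<^sub>R (\<Sum>n=1..M. ?P n *v ?m n))
        + (?P (Suc M) *v mseq (Suc k) v (Suc M) - x *\<^sub>R (?P (Suc M) *v ?m (Suc M)))"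
      by (simp add: scaleR_add_right del: pm.simps)
    then show ?case unfolding Suc.IH tr
      by (simp add: matrix_vector_right_distrib del: pm.simps)
  qed
  from this[of N] have "pv N (mseq (Suc k) v) x = x *\<^sub>R pv N ?m x"
    using Suc.prems unfolding pv_def by (simp add: mono_supp del: mseq.simps)
  then show ?case using Suc by simp
qed

lemma dens_monomial:
  assumes "N \<ge> Suc j" "N \<ge> Suc k"
  shows "integrable lborel (\<lambda>x. x ^ (j + k) * dens N x u v)"
    "(\<integral>x. x ^ (j + k) * dens N x u v \<partial>lborel) = (\<Sum>n=1..N. mseq j u n \<bullet> mseq k v n)"
proof -
  have N: "N \<ge> 1" using assms by simp
  have "dens N x (pv N (mseq j u) x) (pv N (mseq k v) x) = x ^ (j + k) * dens N x u v" for x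
    using N assms by (simp add: pv_mono power_add)
  then show "integrable lborel (\<lambda>x. x ^ (j + k) * dens N x u v)"
    "(\<integral>x. x ^ (j + k) * dens N x u v \<partial>lborel) = (\<Sum>n=1..N. mseq j u n \<bullet> mseq k v n)"
    using dens_moment[OF N, of "mseq j u" "mseq k v"] by simp_all
qed

definition mom :: "nat \<Rightarrow> real^'l \<Rightarrow> real^'l \<Rightarrow> real" where
  "mom k u v = u \<bullet> mseq k v 1"

text \<open>The right side does not involve \<open>N\<close>: all chains longer than
  \<open>k\<close> share the \<open>k\<close>-th moment of the half-line operator. Here
  \<open>mseq 0 u\<close> picks out the entry at site 1.\<close>

lemma dens_mom:
  assumes "N \<ge> Suc k"
  shows "integrable lborel (\<lambda>x. x ^ k * dens N x u v)" "(\<integral>x. x ^ k * dens N x u v \<partial>lborel) = mom k u v"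
proof -
  have "(\<Sum>n=1..N. mseq 0 u n \<bullet> mseq k v n) = (\<Sum>n\<in>{1}. mseq 0 u n \<bullet> mseq k v n)"
    using assms by (intro sum.mono_neutral_right) auto
  then show "integrable lborel (\<lambda>x. x ^ k * dens N x u v)" "(\<integral>x. x ^ k * dens N x u v \<partial>lborel) = mom k u v"
    using dens_monomial[of 0 N k u v] assms by (simp_all add: mom_def)
qed

lemma mom_even_bound: "mom (2 * k) v v \<le> (3 * C) ^ (2 * k) * (norm v)\<^sup>2"
proof -
  have le: "mom (2 * k) v v \<le> norm v * norm (mseq (2 * k) v 1)"
    unfolding mom_def using norm_cauchy_schwarz by blast
  have "norm (mseq (2 * k) v 1) \<le> (\<Sum>n=1..Suc (2*k). norm (mseq (2 * k) v n))"
    by (rule member_le_sum) auto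
  also have "\<dots> \<le> (3 * C) ^ (2 * k) * norm v" by (rule mono_l1) simp
  finally have "norm v * norm (mseq (2 * k) v 1) \<le> norm v * ((3 * C) ^ (2 * k) * norm v)"
    by (rule mult_left_mono) simp
  then show ?thesis using le by (simp add: power2_eq_square mult_ac)
qed

end

section \<open>Moments, weak limits and polynomial approximation\<close>

definition bdd_measure :: "real \<Rightarrow> real measure \<Rightarrow> bool" where
  "bdd_measure R M \<longleftrightarrow> finite_measure M \<and> sets M = sets borel \<and> (AE x in M. \<bar>x\<bar> \<le> R)"

lemma rpf_cont: "real_polynomial_function f \<Longrightarrow> continuous_on S f"
  using continuous_on_polymonial_function[of f] by (simp add: real_polynomial_function_eq)

lemma rpf_meas: "real_polynomial_function (f :: real \<Rightarrow> real) \<Longrightarrow> f \<in> borel_measurable borel"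
  by (rule borel_measurable_continuous_onI) (rule rpf_cont)

lemma rpf_id: "real_polynomial_function (\<lambda>x::real. x)"
  by (rule real_polynomial_function.intros(1)) (rule bounded_linear_ident)

lemma bdd_integrable:
  fixes f :: "real \<Rightarrow> 'b::euclidean_space"
  assumes M: "bdd_measure R M" and f: "f \<in> borel_measurable borel" and c: "continuous_on {-R..R} f"
  shows "integrable M f"
proof -
  interpret finite_measure M using M by (simp add: bdd_measure_def)
  have [measurable_cong]: "sets M = sets borel" using M by (simp add: bdd_measure_def)
  have "bounded (f ` {-R..R})" by (intro compact_imp_bounded compact_continuous_image c) simp
  then obtain B where B: "\<And>x. x \<in> {-R..R} \<Longrightarrow> norm (f x) \<le> B" unfolding bounded_iff by blast
  have "AE x in M. \<bar>x\<bar> \<le> R" using M by (simp add: bdd_measure_def)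
  then have "AE x in M. norm (f x) \<le> B" by eventually_elim (rule B, auto)
  then show ?thesis using f by (intro integrable_const_bound) auto
qed

lemma bdd_integrable_rpf:
  "bdd_measure R M \<Longrightarrow> real_polynomial_function f \<Longrightarrow> integrable M f"
  by (rule bdd_integrable) (auto intro: rpf_cont rpf_meas)

text \<open>Squares of polynomials replace indicators of compact sets. The square keeps the majorant
  nonnegative on the whole line, where other measures tested against it may have mass although
  \<open>q\<close> is controlled only on a bounded interval.\<close>

lemma polynomial_urysohn:
  assumes M: "bdd_measure R M" and K: "compact K" and e: "e > 0"
  obtains q where "real_polynomial_function q" "\<And>x. x \<in> K \<Longrightarrow> q x \<ge> 1"
    "(\<integral>x. (q x)\<^sup>2 \<partial>M) \<le> measure M K + e"
proof (cases "K = {}")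
  case True
  show ?thesis by (rule that[of "\<lambda>_. 0"]) (use True e in auto)
next
  case False
  interpret finite_measure M using M by (simp add: bdd_measure_def)
  have [measurable_cong]: "sets M = sets borel" using M by (simp add: bdd_measure_def)
  have [measurable]: "K \<in> sets borel" using K by (simp add: borel_compact)
  define g where "g n x = max 0 (1 - real n * infdist x K)" for n x
  have gc: "continuous_on UNIV (g n)" for n unfolding g_def by (intro continuous_intros)
  have g01: "0 \<le> g n x" "g n x \<le> 1" for n x by (auto simp: g_def infdist_nonneg)
  have lim: "(\<lambda>n. \<integral>x. (g n x + 2 / real (Suc n))\<^sup>2 \<partial>M) \<longlonglongrightarrow> (\<integral>x. indicator K x \<partial>M)"
  proof (rule integral_dominated_convergence[where w = "\<lambda>_. 9"])
    show "(\<lambda>x. (g i x + 2 / real (Suc i))\<^sup>2) \<in> borel_measurable M" for i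
      using borel_measurable_continuous_onI[OF gc[of i]] by simp
    have "(g i x + 2 / real (Suc i))\<^sup>2 \<le> 3\<^sup>2" for i x
    proof (rule power_mono)
      have "2 / real (Suc i) \<le> 2" by (simp add: field_simps)
      then show "g i x + 2 / real (Suc i) \<le> 3" using g01(2)[of i x] by linarith
      show "0 \<le> g i x + 2 / real (Suc i)" using g01(1)[of i x] by simp
    qed
    then show "AE x in M. norm ((g i x + 2 / real (Suc i))\<^sup>2) \<le> 9" for i by simp
    show "AE x in M. (\<lambda>i. (g i x + 2 / real (Suc i))\<^sup>2) \<longlonglongrightarrow> indicator K x"
    proof (rule AE_I2)
      fix x
      have l2: "(\<lambda>i. 2 / real (Suc i)) \<longlonglongrightarrow> 0" by real_asymp
      have "(\<lambda>i. g i x) \<longlonglongrightarrow> indicator K x"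
      proof (cases "x \<in> K")
        case True
        then show ?thesis by (simp add: g_def)
      next
        case F: False
        then have d: "infdist x K > 0"
          using K False by (metis compact_imp_closed in_closed_iff_infdist_zero infdist_nonneg less_eq_real_def)
        have "\<forall>\<^sub>F n in sequentially. real n * infdist x K \<ge> 1" using d by real_asymp
        then have "\<forall>\<^sub>F n in sequentially. g n x = indicator K x"
          by (rule eventually_mono) (use F in \<open>auto simp: g_def\<close>)
        then show ?thesis by (rule tendsto_eventually)
      qed
      from tendsto_power[OF tendsto_add[OF this l2], of 2]
      show "(\<lambda>i. (g i x + 2 / real (Suc i))\<^sup>2) \<longlonglongrightarrow> indicator K x" by (cases "x \<in> K") simp_all
    qed
  qed simp_all
  have "measure M K < measure M K + e" using e by simp
  then have "\<forall>\<^sub>F n in sequentially. (\<integral>x. (g n x + 2 / real (Suc n))\<^sup>2 \<partial>M) < measure M K + e"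
    using order_tendstoD(2)[OF lim, of "measure M K + e"] by simp
  then obtain n where n: "(\<integral>x. (g n x + 2 / real (Suc n))\<^sup>2 \<partial>M) < measure M K + e"
    by (auto simp: eventually_sequentially)
  \<comment> \<open>Half of the margin added to \<open>g n\<close>: an approximation of
    \<open>g n + d\<close> within \<open>d\<close> lies between \<open>g n\<close> and
    \<open>g n + 2 * d\<close>, so it is at least 1 on \<open>K\<close>, where \<open>g n\<close>
    equals 1.\<close>
  define d where "d = 1 / real (Suc n)"
  have d: "d > 0" by (simp add: d_def)
  obtain R' where R': "R' \<ge> R" "K \<subseteq> {-R'..R'}"
  proof -
    obtain B where "\<And>x. x \<in> K \<Longrightarrow> norm x \<le> B" using compact_imp_bounded[OF K] by (auto simp: bounded_iff)
    then show ?thesis by (intro that[of "max R B"]) force+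
  qed
  obtain q where q: "real_polynomial_function q" "\<And>x. x \<in> {-R'..R'} \<Longrightarrow> \<bar>(g n x + d) - q x\<bar> < d"
    by (rule Stone_Weierstrass_real_polynomial_function[of "{-R'..R'}" "\<lambda>x. g n x + d" d])
       (use d continuous_on_subset[OF gc] in \<open>auto intro!: continuous_intros\<close>)
  have "AE x in M. (q x)\<^sup>2 \<le> (g n x + 2 / real (Suc n))\<^sup>2"
  proof -
    have "AE x in M. \<bar>x\<bar> \<le> R" using M by (simp add: bdd_measure_def)
    then show ?thesis
    proof eventually_elim
      case (elim x)
      then have "x \<in> {-R'..R'}" using R' by auto
      from q(2)[OF this] have "0 \<le> q x" "q x \<le> g n x + 2 * d" using g01[of n x] by linarith+
      then show ?case unfolding d_def by (intro power_mono) auto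
    qed
  qed
  moreover have "integrable M (\<lambda>x. (q x)\<^sup>2)"
    by (rule bdd_integrable_rpf[OF M]) (intro real_polynomial_function_power q)
  moreover have "integrable M (\<lambda>x. (g n x + 2 / real (Suc n))\<^sup>2)"
    by (rule bdd_integrable[OF M]) (use gc continuous_on_subset[OF gc] in \<open>auto intro!: continuous_intros borel_measurable_continuous_onI\<close>)
  ultimately have "(\<integral>x. (q x)\<^sup>2 \<partial>M) \<le> (\<integral>x. (g n x + 2 / real (Suc n))\<^sup>2 \<partial>M)"
    by (intro integral_mono_AE)
  moreover have "q x \<ge> 1" if "x \<in> K" for x
  proof -
    have "g n x = 1" using that by (simp add: g_def)
    moreover have "x \<in> {-R'..R'}" using R' that by auto
    ultimately show ?thesis using q(2)[of x] by auto
  qed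
  ultimately show ?thesis using q n by (intro that[of q]) auto
qed

text \<open>The Urysohn squares compare the two measures on compact sets up to any error; inner
  regularity extends this to Borel sets. Only \<open>M\<close> is known to have bounded
  support.\<close>

lemma moment_order:
  assumes fin: "finite_measure \<mu>" and sb: "sets \<mu> = sets borel" and M: "bdd_measure R M"
    and le: "\<And>q. real_polynomial_function q \<Longrightarrow> (\<integral>\<^sup>+x. ennreal ((q x)\<^sup>2) \<partial>\<mu>) \<le> (\<integral>\<^sup>+x. ennreal ((q x)\<^sup>2) \<partial>M)"
    and A: "A \<in> sets borel"
  shows "emeasure \<mu> A \<le> emeasure M A"
proof -
  interpret \<mu>: finite_measure \<mu> by fact
  interpret M: finite_measure M using M by (simp add: bdd_measure_def)
  have sM: "sets M = sets borel" using M by (simp add: bdd_measure_def)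
  note [measurable_cong] = sM sb
  have K: "emeasure \<mu> K \<le> emeasure M A" if K: "K \<subseteq> A" "compact K" for K
  proof -
    have [measurable]: "K \<in> sets borel" using K by (simp add: borel_compact)
    have "emeasure \<mu> K \<le> emeasure M K + ennreal e" if e: "e > 0" for e :: real
    proof -
      obtain q where q: "real_polynomial_function q" "\<And>x. x \<in> K \<Longrightarrow> q x \<ge> 1"
        "(\<integral>x. (q x)\<^sup>2 \<partial>M) \<le> measure M K + e"
        using polynomial_urysohn[OF M K(2) e] by blast
      have "emeasure \<mu> K = (\<integral>\<^sup>+x. indicator K x \<partial>\<mu>)" by simp
      also have "\<dots> \<le> (\<integral>\<^sup>+x. ennreal ((q x)\<^sup>2) \<partial>\<mu>)"
      proof (intro nn_integral_mono)
        fix x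
        have "1 \<le> (q x)\<^sup>2" if "x \<in> K" using q(2)[OF that] by (simp add: one_le_power)
        then show "indicator K x \<le> ennreal ((q x)\<^sup>2)"
          by (cases "x \<in> K") (auto simp flip: ennreal_1 intro: ennreal_leI)
      qed
      also have "\<dots> \<le> (\<integral>\<^sup>+x. ennreal ((q x)\<^sup>2) \<partial>M)" by (rule le) (rule q)
      also have "\<dots> = ennreal (\<integral>x. (q x)\<^sup>2 \<partial>M)"
        by (rule nn_integral_eq_integral) (auto intro!: bdd_integrable_rpf[OF M] real_polynomial_function_power q)
      also have "\<dots> \<le> ennreal (measure M K + e)" by (rule ennreal_leI) (rule q)
      also have "\<dots> = emeasure M K + ennreal e" using e by (simp add: M.emeasure_eq_measure)
      finally show ?thesis .
    qed
    then have "emeasure \<mu> K \<le> emeasure M K" by (rule ennreal_le_epsilon)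
    also have "\<dots> \<le> emeasure M A" using K A by (intro emeasure_mono) (auto simp: sM)
    finally show ?thesis .
  qed
  have "emeasure \<mu> A = (SUP K \<in> {K. K \<subseteq> A \<and> compact K}. emeasure \<mu> K)"
    by (rule inner_regular[OF sb _ A]) simp
  also have "\<dots> \<le> emeasure M A" using K by (intro SUP_least) auto
  finally show ?thesis .
qed

lemma rpf_integral_eq:
  assumes "\<And>k. integrable \<mu> (\<lambda>x::real. x ^ k)" "\<And>k. integrable M (\<lambda>x::real. x ^ k)"
    "\<And>k. (\<integral>x. x ^ k \<partial>\<mu>) = (\<integral>x. x ^ k \<partial>M)" and q: "real_polynomial_function q"
  shows "integrable \<mu> q" "integrable M q" "(\<integral>x. q x \<partial>\<mu>) = (\<integral>x. q x \<partial>M)"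
proof -
  obtain a n where q: "q = (\<lambda>x. \<Sum>i\<le>n. a i * x ^ i)" using q by (auto simp: real_polynomial_function_iff_sum)
  show "integrable \<mu> q" "integrable M q" "(\<integral>x. q x \<partial>\<mu>) = (\<integral>x. q x \<partial>M)"
    unfolding q using assms(1-3) by (auto simp: Bochner_Integration.integral_sum)
qed

text \<open>The first comparison already shows that \<open>\<mu>\<close> has no mass outside the
  interval carrying \<open>M\<close>. Then the roles can be exchanged.\<close>

lemma moment_determinate:
  assumes fin: "finite_measure \<mu>" and sb: "sets \<mu> = sets borel" and M: "bdd_measure R M"
    and i: "\<And>k. integrable \<mu> (\<lambda>x::real. x ^ k)" and eq: "\<And>k. (\<integral>x. x ^ k \<partial>\<mu>) = (\<integral>x. x ^ k \<partial>M)"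
  shows "\<mu> = M"
proof -
  have iM: "integrable M (\<lambda>x::real. x ^ k)" for k
    by (rule bdd_integrable_rpf[OF M]) (intro real_polynomial_function_power rpf_id)
  have *: "(\<integral>\<^sup>+x. ennreal ((q x)\<^sup>2) \<partial>\<mu>) = (\<integral>\<^sup>+x. ennreal ((q x)\<^sup>2) \<partial>M)" if "real_polynomial_function q" for q
  proof -
    note q = rpf_integral_eq[OF i iM eq real_polynomial_function_power[OF that, of 2]]
    show ?thesis using q by (simp add: nn_integral_eq_integral)
  qed
  have sM: "sets M = sets borel" using M by (simp add: bdd_measure_def)
  have le: "emeasure \<mu> A \<le> emeasure M A" if "A \<in> sets borel" for A
    by (rule moment_order[OF fin sb M _ that]) (simp add: *)
  have "AE x in M. x \<in> {-R..R}" using M by (auto simp: bdd_measure_def elim!: eventually_mono)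
  then have "emeasure M (- {-R..R}) = 0"
    by (subst (asm) AE_iff_measurable[where N = "- {-R..R}"]) (auto simp: sM sets_eq_imp_space_eq[OF sM])
  then have "emeasure \<mu> (- {-R..R}) = 0" using le[of "- {-R..R}"] by simp
  then have "AE x in \<mu>. x \<in> {-R..R}"
    by (subst AE_iff_measurable[where N = "- {-R..R}"]) (auto simp: sb sets_eq_imp_space_eq[OF sb])
  then have "AE x in \<mu>. \<bar>x\<bar> \<le> R" by (rule eventually_mono) auto
  then have \<mu>: "bdd_measure R \<mu>" using fin sb by (simp add: bdd_measure_def)
  have "emeasure M A \<le> emeasure \<mu> A" if "A \<in> sets borel" for A
    by (rule moment_order[OF _ sM \<mu> _ that]) (use M in \<open>simp_all add: * bdd_measure_def\<close>)
  then show ?thesis using le by (intro measure_eqI) (auto simp: sM sb intro: antisym)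
qed

text \<open>The positive and the negative part of \<open>g\<close> are densities of two measures of
  bounded support with equal moments.\<close>

lemma orthogonal_to_monomials:
  fixes g :: "real \<Rightarrow> real"
  assumes M: "bdd_measure R M" and g: "integrable M g" and z: "\<And>k. (\<integral>x. x ^ k * g x \<partial>M) = 0"
  shows "AE x in M. g x = 0"
proof -
  interpret M: finite_measure M using M by (simp add: bdd_measure_def)
  have sM[measurable_cong]: "sets M = sets borel" using M by (simp add: bdd_measure_def)
  have R: "AE x in M. \<bar>x\<bar> \<le> R" using M by (simp add: bdd_measure_def)
  define p where "p x = max 0 (g x)" for x
  define m where "m x = max 0 (- g x)" for x
  have gm[measurable]: "g \<in> borel_measurable M" using g by auto
  have pm: "integrable M p" "integrable M m" unfolding p_def m_def using g by auto
  have nn: "p x \<ge> 0" "m x \<ge> 0" for x by (auto simp: p_def m_def)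
  have ik: "integrable M (\<lambda>x. x ^ k * h x)" if h: "integrable M h" for h k
  proof (rule Bochner_Integration.integrable_bound)
    show "integrable M (\<lambda>x. \<bar>R\<bar> ^ k * h x)" using h by simp
    show "(\<lambda>x. x ^ k * h x) \<in> borel_measurable M" using h by auto
    show "AE x in M. norm (x ^ k * h x) \<le> norm (\<bar>R\<bar> ^ k * h x)"
      using R by eventually_elim (auto simp: abs_mult power_abs intro!: mult_right_mono power_mono)
  qed
  have dens: "finite_measure (density M h)" "sets (density M h) = sets borel" "bdd_measure R (density M h)"
     "integrable (density M h) (\<lambda>x. x ^ k)" "(\<integral>x. x ^ k \<partial>density M h) = (\<integral>x. x ^ k * h x \<partial>M)"
    if h: "integrable M h" and h0: "\<And>x. h x \<ge> 0" for h :: "real \<Rightarrow> real" and k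
  proof -
    have [measurable]: "h \<in> borel_measurable M" using h by auto
    show f: "finite_measure (density M h)"
      using h h0 by (intro finite_measureI) (auto simp: emeasure_density nn_integral_eq_integral cong: nn_integral_cong)
    show s: "sets (density M h) = sets borel" using sM by simp
    show "bdd_measure R (density M h)" using f s R
      by (auto simp: bdd_measure_def AE_density elim!: eventually_mono)
    show "integrable (density M h) (\<lambda>x. x ^ k)"
      using ik[OF h, of k] h0 by (subst integrable_density) (auto simp: mult.commute)
    show "(\<integral>x. x ^ k \<partial>density M h) = (\<integral>x. x ^ k * h x \<partial>M)"
      using h0 by (subst integral_density) (auto simp: mult.commute)
  qed
  have "density M p = density M m"
  proof (rule moment_determinate[OF dens(1,2)[OF pm(1) nn(1)] dens(3)[OF pm(2) nn(2)]])
    fix k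
    show "integrable (density M p) (\<lambda>x. x ^ k)" by (rule dens(4)[OF pm(1) nn(1)])
    have "(\<integral>x. x ^ k * p x \<partial>M) - (\<integral>x. x ^ k * m x \<partial>M) = (\<integral>x. x ^ k * p x - x ^ k * m x \<partial>M)"
      by (rule Bochner_Integration.integral_diff[symmetric]) (intro ik pm)+
    also have "\<dots> = (\<integral>x. x ^ k * g x \<partial>M)" by (intro Bochner_Integration.integral_cong) (auto simp: p_def m_def max_def)
    finally show "(\<integral>x. x ^ k \<partial>density M p) = (\<integral>x. x ^ k \<partial>density M m)"
      unfolding dens(5)[OF pm(1) nn(1)] dens(5)[OF pm(2) nn(2)] by (simp add: z)
  qed
  then have "AE x in M. ennreal (p x) = ennreal (m x)"
    using pm by (subst (asm) finite_density_unique) (auto simp: nn_integral_eq_integral nn)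
  then show ?thesis
    by eventually_elim (auto simp: nn, auto simp: p_def m_def max_def split: if_splits)
qed

text \<open>Tightness and uniform integrability both come from the stable even moments.\<close>
lemma moment_limit_exists:
  fixes f :: "nat \<Rightarrow> real \<Rightarrow> real" and m :: "nat \<Rightarrow> real"
  assumes meas: "\<And>N. f N \<in> borel_measurable borel" and nn: "\<And>N x. f N x \<ge> 0"
    and int: "\<And>N k. k < N \<Longrightarrow> integrable lborel (\<lambda>x. x ^ k * f N x)"
    and mom: "\<And>N k. k < N \<Longrightarrow> (\<integral>x. x ^ k * f N x \<partial>lborel) = m k" and m0: "m 0 = 1"
  obtains M where "finite_measure M" "sets M = sets borel" "\<And>k. integrable M (\<lambda>x. x ^ k)"
    "\<And>k. (\<integral>x. x ^ k \<partial>M) = m k"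
proof -
  note [measurable] = meas
  \<comment> \<open>The shift by 3 makes the moments of order 0, 1 and 2 available for every
    \<open>n\<close>: order 0 for total mass 1, order 2 for tightness.\<close>
  define \<mu> where "\<mu> n = density lborel (f (n + 3))" for n
  have sets[simp, measurable_cong]: "sets (\<mu> n) = sets borel" for n by (simp add: \<mu>_def)
  have space[simp]: "space (\<mu> n) = UNIV" for n by (simp add: \<mu>_def)
  have ik: "integrable (\<mu> n) (\<lambda>x. x ^ k)" "(\<integral>x. x ^ k \<partial>\<mu> n) = m k" if "k < n + 3" for n k
    using int[OF that] mom[OF that] nn
    by (auto simp: \<mu>_def integrable_density integral_density mult.commute)
  have rd: "real_distribution (\<mu> n)" for n
  proof -
    have "finite_measure (\<mu> n)"
      using int[of 0 "n+3"] nn by (intro finite_measureI) (auto simp: \<mu>_def emeasure_density nn_integral_eq_integral)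
    moreover have "measure (\<mu> n) UNIV = 1" using ik(2)[of 0 n] m0 by simp
    ultimately have "prob_space (\<mu> n)"
      by (intro prob_spaceI) (simp add: finite_measure.emeasure_eq_measure)
    then show ?thesis by (simp add: real_distribution_def real_distribution_axioms_def)
  qed
  interpret \<mu>: real_distribution "\<mu> n" for n by (rule rd)
  have m_even: "m (2 * k) \<ge> 0" for k
  proof -
    have "0 \<le> (\<integral>x. x ^ (2 * k) * f (2*k+1) x \<partial>lborel)" by (intro integral_nonneg_AE) (auto simp: nn)
    then show ?thesis using mom[of "2*k" "2*k+1"] by simp
  qed
  have tail: "measure (\<mu> n) {x. \<bar>x\<bar> \<ge> c} \<le> m 2 / c\<^sup>2" if "c > 0" for n c
  proof -
    have "measure (\<mu> n) {x. \<bar>x\<bar> \<ge> c} = measure (\<mu> n) {x \<in> space (\<mu> n). c\<^sup>2 \<le> x ^ 2}"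
      using that by (simp add: abs_le_square_iff[symmetric])
    also have "\<dots> \<le> (\<integral>x. x ^ 2 \<partial>\<mu> n) / c\<^sup>2"
      by (rule integral_Markov_inequality_measure[where A = "{}"]) (use that ik(1)[of 2 n] in auto)
    finally show ?thesis using ik(2)[of 2 n] by simp
  qed
  have "tight \<mu>"
    unfolding tight_def
  proof (intro conjI allI impI rd)
    fix e :: real assume e: "e > 0"
    define c where "c = max 1 ((m 2 + 1) / e)"
    have c: "c \<ge> 1" "c > 0" by (auto simp: c_def)
    have "m 2 / c\<^sup>2 < e"
    proof -
      have "(m 2 + 1) / e \<le> c" by (simp add: c_def)
      then have "m 2 + 1 \<le> c * e" using e by (simp add: field_simps)
      also have "\<dots> \<le> c\<^sup>2 * e" using c e by (simp add: power2_eq_square)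
      finally show ?thesis using c by (simp add: field_simps)
    qed
    have "measure (\<mu> n) {-c<..c} > 1 - e" for n
    proof -
      have "1 - measure (\<mu> n) {x. \<bar>x\<bar> \<ge> c} = measure (\<mu> n) (UNIV - {x. \<bar>x\<bar> \<ge> c})"
        using \<mu>.prob_compl[of "{x. \<bar>x\<bar> \<ge> c}" n] by simp
      also have "\<dots> \<le> measure (\<mu> n) {-c<..c}" by (intro \<mu>.finite_measure_mono) auto
      finally show ?thesis using tail[OF c(2), of n] \<open>m 2 / c\<^sup>2 < e\<close> by linarith
    qed
    moreover have "-c < c" using c by simp
    ultimately show "\<exists>a b. a < b \<and> (\<forall>n. 1 - e < measure (\<mu> n) {a<..b})" by blast
  qed
  from tight_imp_convergent_subsubsequence[OF this strict_mono_id]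
  obtain r M where r: "strict_mono (r :: nat \<Rightarrow> nat)" "real_distribution M" "weak_conv_m (\<mu> \<circ> r) M" by auto
  interpret M: real_distribution M by (rule r)
  have rn: "n \<le> r n" for n by (rule seq_suble[OF r(1)])
  \<comment> \<open>Monomials are unbounded, so weak convergence is applied to powers of the
    truncated identity and the truncation is removed afterwards.\<close>
  define tr where "tr c x = max (- c) (min c x)" for c x :: real
  have trc: "isCont (tr c) x" for c x unfolding tr_def by (intro continuous_intros)
  have trb: "\<bar>tr c x\<bar> \<le> c" if "c \<ge> 0" for c x using that by (auto simp: tr_def)
  have tra: "\<bar>tr c x\<bar> \<le> \<bar>x\<bar>" if "c \<ge> 0" for c x using that by (auto simp: tr_def)
  have tri: "tr c x = x" if "\<bar>x\<bar> \<le> c" for c x using that by (auto simp: tr_def)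
  have [measurable]: "tr c \<in> borel_measurable borel" for c unfolding tr_def by measurable
  have conv: "(\<lambda>n. \<integral>x. tr c x ^ k \<partial>\<mu> (r n)) \<longlonglongrightarrow> (\<integral>x. tr c x ^ k \<partial>M)" if c: "c \<ge> 0" for c k
  proof -
    have c1: "isCont (\<lambda>x. tr c x ^ k) x" for x by (intro isCont_power trc)
    have c2: "norm (tr c x ^ k) \<le> c ^ k" for x using power_mono[OF trb[OF c, of x], of k] by (simp add: power_abs)
    have "real_distribution ((\<mu> \<circ> r) n)" for n using rd by simp
    from weak_conv_imp_integral_bdd_continuous_conv[OF this r(2,3) c1 c2]
    show ?thesis by (simp add: o_def)
  qed
  have trint: "integrable M (\<lambda>x. tr c x ^ k)" "integrable (\<mu> n) (\<lambda>x. tr c x ^ k)" if c: "c \<ge> 0" for c k n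
    using trb[OF c] by (auto intro!: M.integrable_const_bound[where B = "c ^ k"] \<mu>.integrable_const_bound[where B = "c ^ k"] AE_I2 power_mono simp: power_abs)
  have even_bd: "(\<integral>x. tr c x ^ (2 * k) \<partial>M) \<le> m (2 * k)" if c: "c \<ge> 0" for c k
  proof (rule tendsto_upperbound[OF conv[OF c, of "2*k"]])
    show "\<forall>\<^sub>F n in sequentially. (\<integral>x. tr c x ^ (2 * k) \<partial>\<mu> (r n)) \<le> m (2 * k)"
      using eventually_ge_at_top[of "2 * k"]
    proof eventually_elim
      case (elim n)
      then have k: "2 * k < r n + 3" using rn[of n] by linarith
      have "(\<integral>x. tr c x ^ (2 * k) \<partial>\<mu> (r n)) \<le> (\<integral>x. x ^ (2 * k) \<partial>\<mu> (r n))"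
      proof (rule integral_mono[OF trint(2)[OF c] ik(1)[OF k]])
        fix x
        have "\<bar>tr c x\<bar> ^ (2*k) \<le> \<bar>x\<bar> ^ (2*k)" by (rule power_mono) (use tra[OF c] in auto)
        then show "tr c x ^ (2 * k) \<le> x ^ (2 * k)" by (simp only: power_even_abs[OF dvd_triv_left])
      qed
      then show ?case using ik(2)[OF k] by simp
    qed
  qed simp
  have ieven: "integrable M (\<lambda>x. x ^ (2 * k))" "(\<integral>x. x ^ (2*k) \<partial>M) \<le> m (2 * k)" for k
  proof -
    have "(\<lambda>n. \<integral>\<^sup>+x. ennreal (tr (real n) x ^ (2 * k)) \<partial>M) \<longlonglongrightarrow> (\<integral>\<^sup>+x. ennreal (x ^ (2*k)) \<partial>M)"
    proof (rule nn_integral_LIMSEQ)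
      have "tr (real i) x ^ (2*k) \<le> tr (real j) x ^ (2*k)" if "i \<le> j" for i j x
      proof -
        have "\<bar>tr (real i) x\<bar> ^ (2*k) \<le> \<bar>tr (real j) x\<bar> ^ (2*k)"
          by (rule power_mono) (use that in \<open>auto simp: tr_def\<close>)
        then show ?thesis by (simp only: power_even_abs[OF dvd_triv_left])
      qed
      then show "incseq (\<lambda>i x. ennreal (tr (real i) x ^ (2 * k)))"
        by (auto simp: incseq_def le_fun_def intro!: ennreal_leI)
      fix x
      obtain j where "\<bar>x\<bar> \<le> real j" using real_arch_simple by blast
      then have "ennreal (tr (real i) x ^ (2 * k)) = ennreal (x ^ (2*k))" if "i \<ge> j" for i
        using that tri[of x "real i"] by simp
      then have "\<forall>\<^sub>F i in sequentially. ennreal (tr (real i) x ^ (2 * k)) = ennreal (x ^ (2*k))"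
        unfolding eventually_sequentially by blast
      then show "(\<lambda>i. ennreal (tr (real i) x ^ (2 * k))) \<longlonglongrightarrow> ennreal (x ^ (2*k))" by (rule tendsto_eventually)
    qed simp
    moreover have "(\<integral>\<^sup>+x. ennreal (tr (real n) x ^ (2 * k)) \<partial>M) \<le> ennreal (m (2*k))" for n
      using trint(1)[of "real n" "2*k"] even_bd[of "real n" k] by (subst nn_integral_eq_integral) (auto intro: ennreal_leI)
    ultimately have b: "(\<integral>\<^sup>+x. ennreal (x ^ (2*k)) \<partial>M) \<le> ennreal (m (2*k))"
      by (intro tendsto_upperbound[where F = sequentially]) auto
    then show i: "integrable M (\<lambda>x. x ^ (2 * k))"
      by (intro integrableI_nonneg) (auto simp: le_less_trans)
    show "(\<integral>x. x ^ (2*k) \<partial>M) \<le> m (2 * k)"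
      using b m_even[of k] by (subst (asm) nn_integral_eq_integral[OF i]) auto
  qed
  have iM: "integrable M (\<lambda>x. x ^ k)" for k
  proof (rule Bochner_Integration.integrable_bound)
    show "integrable M (\<lambda>x. 1 + x ^ (2 * k))" using ieven by simp
    have "norm (x ^ k) \<le> norm (1 + x ^ (2 * k))" for x :: real
    proof -
      have e: "x ^ (2 * k) = \<bar>x ^ k\<bar> * \<bar>x ^ k\<bar>" by (simp add: mult_2 power_add flip: abs_mult)
      have "\<bar>x ^ k\<bar> \<le> 1 + \<bar>x ^ k\<bar> * \<bar>x ^ k\<bar>"
      proof (cases "\<bar>x ^ k\<bar> \<le> 1")
        case False
        then have "\<bar>x ^ k\<bar> * 1 \<le> \<bar>x ^ k\<bar> * \<bar>x ^ k\<bar>" by (intro mult_left_mono) auto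
        then show ?thesis by linarith
      qed (simp add: add_increasing2)
      then show ?thesis unfolding e by simp
    qed
    then show "AE x in M. norm (x ^ k) \<le> norm (1 + x ^ (2 * k))" by blast
  qed simp
  \<comment> \<open>The truncation error is bounded by an even moment of higher order divided by
    \<open>c\<close>. Since that moment is the same for all large indices, the error is small
    uniformly along the sequence.\<close>
  have err: "\<bar>x ^ k - tr c x ^ k\<bar> \<le> 2 / c * x ^ (2 * k + 2)" if c: "c \<ge> 1" for c x :: real and k
  proof (cases "\<bar>x\<bar> \<le> c")
    case True
    have "0 \<le> 2 / c * x ^ (2 * k + 2)" by (intro mult_nonneg_nonneg zero_le_even_power) (use c in auto)
    then show ?thesis by (simp only: tri[OF True] diff_self abs_zero)
  next
    case False
    have "\<bar>x ^ k - tr c x ^ k\<bar> \<le> \<bar>x\<bar> ^ k + \<bar>tr c x\<bar> ^ k"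
      using abs_triangle_ineq4[of "x^k" "tr c x ^ k"] by (simp add: power_abs)
    also have "\<dots> \<le> 2 * \<bar>x\<bar> ^ k" using power_mono[OF tra[of c x], of k] c by simp
    also have "\<dots> \<le> 2 * \<bar>x\<bar> ^ (2 * k + 1)" using False c by (intro mult_left_mono power_increasing) auto
    also have "\<dots> \<le> 2 * (\<bar>x\<bar> / c) * \<bar>x\<bar> ^ (2 * k + 1)"
      using False c by (intro mult_right_mono) (auto simp: field_simps)
    also have "\<dots> = 2 / c * \<bar>x\<bar> ^ (2 * k + 2)" by simp
    also have "\<bar>x\<bar> ^ (2 * k + 2) = x ^ (2 * k + 2)" by (rule power_even_abs) simp
    finally show ?thesis .
  qed
  have mM: "(\<integral>x. x ^ k \<partial>M) = m k" for k
  proof -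
    let ?m = "m (2 * k + 2)"
    have m': "?m \<ge> 0" using m_even[of "k + 1"] by simp
    have bd: "\<bar>(\<integral>x. x ^ k \<partial>M) - m k\<bar> \<le> 4 * ?m / c" if c: "c \<ge> 1" for c :: real
    proof -
      have e1: "\<bar>(\<integral>x. x ^ k \<partial>M) - (\<integral>x. tr c x ^ k \<partial>M)\<bar> \<le> 2 / c * ?m"
      proof -
        have "\<bar>(\<integral>x. x ^ k \<partial>M) - (\<integral>x. tr c x ^ k \<partial>M)\<bar> = \<bar>\<integral>x. x ^ k - tr c x ^ k \<partial>M\<bar>"
          using c by (subst Bochner_Integration.integral_diff) (auto intro: iM trint)
        also have "\<dots> \<le> (\<integral>x. \<bar>x ^ k - tr c x ^ k\<bar> \<partial>M)" by (rule integral_abs_bound)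
        also have "\<dots> \<le> (\<integral>x. 2 / c * x ^ (2 * k + 2) \<partial>M)"
          using c by (intro integral_mono err integrable_abs Bochner_Integration.integrable_diff iM trint integrable_mult_right) auto
        also have "\<dots> \<le> 2 / c * ?m" using ieven(2)[of "k+1"] c by (simp add: divide_right_mono)
        finally show ?thesis .
      qed
      have "(\<lambda>n. \<bar>m k - (\<integral>x. tr c x ^ k \<partial>\<mu> (r n))\<bar>) \<longlonglongrightarrow> \<bar>m k - (\<integral>x. tr c x ^ k \<partial>M)\<bar>"
        using c by (intro tendsto_intros conv) auto
      moreover have "\<forall>\<^sub>F n in sequentially. \<bar>m k - (\<integral>x. tr c x ^ k \<partial>\<mu> (r n))\<bar> \<le> 2 / c * ?m"
        using eventually_ge_at_top[of "2 * k + 2"]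
      proof eventually_elim
        case (elim n)
        then have k2: "2 * k + 2 < r n + 3" and k: "k < r n + 3" using rn[of n] by linarith+
        have "\<bar>m k - (\<integral>x. tr c x ^ k \<partial>\<mu> (r n))\<bar> = \<bar>\<integral>x. x ^ k - tr c x ^ k \<partial>\<mu> (r n)\<bar>"
          using c k by (subst Bochner_Integration.integral_diff) (auto intro: ik trint simp: ik(2))
        also have "\<dots> \<le> (\<integral>x. \<bar>x ^ k - tr c x ^ k\<bar> \<partial>\<mu> (r n))" by (rule integral_abs_bound)
        also have "\<dots> \<le> (\<integral>x. 2 / c * x ^ (2 * k + 2) \<partial>\<mu> (r n))"
          using c k k2 by (intro integral_mono err integrable_abs Bochner_Integration.integrable_diff ik trint integrable_mult_right) auto
        also have "\<dots> = 2 / c * ?m" using ik(2)[OF k2] by simp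
        finally show ?case .
      qed
      ultimately have "\<bar>m k - (\<integral>x. tr c x ^ k \<partial>M)\<bar> \<le> 2 / c * ?m"
        by (intro tendsto_upperbound[where F = sequentially]) auto
      then show ?thesis using e1 by (simp add: field_simps)
    qed
    have "(\<lambda>n. 4 * ?m / real (Suc n)) \<longlonglongrightarrow> 0" by real_asymp
    then have "\<bar>(\<integral>x. x ^ k \<partial>M) - m k\<bar> \<le> 0"
      by (rule tendsto_lowerbound) (use bd in auto)
    then show ?thesis by simp
  qed
  show ?thesis by (rule that[of M]) (use iM mM M.finite_measure_axioms in auto)
qed

text \<open>Markov's inequality with exponent \<open>2 * k\<close> at a level \<open>c > B\<close>
  gives a bound \<open>A * (B / c) ^ (2 * k)\<close>, which tends to 0.\<close>

lemma moment_support: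
  assumes fin: "finite_measure M" and sM: "sets M = sets borel" and i: "\<And>k. integrable M (\<lambda>x::real. x ^ k)"
    and bd: "\<And>k. (\<integral>x. x ^ (2 * k) \<partial>M) \<le> B ^ (2 * k) * A" and B: "B \<ge> 0"
  shows "bdd_measure B M"
proof -
  interpret finite_measure M by fact
  note [measurable_cong] = sM
  have sp: "space M = UNIV" using sets_eq_imp_space_eq[OF sM] by simp
  have A: "A \<ge> 0" using bd[of 0] order_trans[OF measure_nonneg, of M UNIV] by (simp add: sp)
  have z: "measure M {x. \<bar>x\<bar> \<ge> c} = 0" if c: "c > B" for c
  proof -
    have "c > 0" using c B by linarith
    have le: "measure M {x. \<bar>x\<bar> \<ge> c} \<le> A * ((B / c)\<^sup>2) ^ k" for k
    proof -
      have "measure M {x. \<bar>x\<bar> \<ge> c} \<le> measure M {x \<in> space M. c ^ (2 * k) \<le> x ^ (2 * k)}"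
      proof (rule finite_measure_mono)
        show "{x. c \<le> \<bar>x\<bar>} \<subseteq> {x \<in> space M. c ^ (2 * k) \<le> x ^ (2 * k)}"
          using power_mono[of c _ "2*k"] \<open>c > 0\<close> by (auto simp: sp) (metis less_eq_real_def power_even_abs dvd_triv_left)
      qed simp
      also have "\<dots> \<le> (\<integral>x. x ^ (2 * k) \<partial>M) / c ^ (2 * k)"
        by (rule integral_Markov_inequality_measure[where A = "{}"]) (use \<open>c > 0\<close> i[of "2*k"] in auto)
      also have "\<dots> \<le> B ^ (2 * k) * A / c ^ (2 * k)" using bd[of k] \<open>c > 0\<close> by (intro divide_right_mono) auto
      also have "\<dots> = A * ((B / c)\<^sup>2) ^ k" by (simp add: power_divide power_mult)
      finally show ?thesis .
    qed
    have "0 \<le> B / c" "B / c < 1" using B c \<open>c > 0\<close> by simp_all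
    then have "(B / c)\<^sup>2 < 1" unfolding abs_square_less_1 by linarith
    then have "(\<lambda>k. A * ((B / c)\<^sup>2) ^ k) \<longlonglongrightarrow> A * 0"
      by (intro tendsto_intros LIMSEQ_power_zero) auto
    then have "measure M {x. \<bar>x\<bar> \<ge> c} \<le> A * 0" by (rule tendsto_lowerbound) (use le in auto)
    then show ?thesis by (simp add: measure_le_0_iff)
  qed
  have "AE x in M. \<bar>x\<bar> < B + 1 / real (Suc n)" for n
  proof -
    have "emeasure M {x. \<bar>x\<bar> \<ge> B + 1 / real (Suc n)} = 0" using z[of "B + 1 / real (Suc n)"] by (simp add: emeasure_eq_measure)
    then show ?thesis by (subst AE_iff_measurable[where N = "{x. \<bar>x\<bar> \<ge> B + 1 / real (Suc n)}"]) (auto simp: sp not_less)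
  qed
  then have "AE x in M. \<forall>n. \<bar>x\<bar> < B + 1 / real (Suc n)" by (simp add: AE_all_countable)
  then have "AE x in M. \<bar>x\<bar> \<le> B"
  proof eventually_elim
    case (elim x)
    have "(\<lambda>n. B + 1 / real (Suc n)) \<longlonglongrightarrow> B" by real_asymp
    then show ?case
    proof (rule tendsto_lowerbound)
      show "\<forall>\<^sub>F n in sequentially. \<bar>x\<bar> \<le> B + 1 / real (Suc n)"
        by (intro always_eventually allI less_imp_le) (use elim in blast)
    qed simp
  qed
  then show ?thesis using fin sM by (simp add: bdd_measure_def)
qed

text \<open>Riesz-Fischer. Along a subsequence the squared distances are at most
  \<open>(1/4) ^ k\<close>, which makes the increments summable in L1 and the subsequence convergent
  almost everywhere; Fatou's lemma then bounds the distance to its limit.\<close>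

lemma L2_complete:
  fixes f :: "nat \<Rightarrow> 'a \<Rightarrow> 'b::{banach, second_countable_topology}"
  assumes fin: "finite_measure M" and meas: "\<And>n. f n \<in> borel_measurable M"
    and cauchy: "\<And>e. e > 0 \<Longrightarrow> \<exists>N. \<forall>m\<ge>N. \<forall>n\<ge>N. (\<integral>\<^sup>+x. ennreal ((norm (f m x - f n x))\<^sup>2) \<partial>M) \<le> ennreal e"
  obtains F where "F \<in> borel_measurable M"
    "\<And>e. e > 0 \<Longrightarrow> \<exists>N. \<forall>n\<ge>N. (\<integral>\<^sup>+x. ennreal ((norm (f n x - F x))\<^sup>2) \<partial>M) \<le> ennreal e"
proof -
  interpret finite_measure M by fact
  note [measurable] = meas
  have "\<forall>k. \<exists>N. \<forall>m\<ge>N. \<forall>n\<ge>N. (\<integral>\<^sup>+x. ennreal ((norm (f m x - f n x))\<^sup>2) \<partial>M) \<le> ennreal ((1/4) ^ k)"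
    by (intro allI cauchy) simp
  from choice[OF this]
  obtain N where N: "\<And>k m n. m \<ge> N k \<Longrightarrow> n \<ge> N k \<Longrightarrow> (\<integral>\<^sup>+x. ennreal ((norm (f m x - f n x))\<^sup>2) \<partial>M) \<le> ennreal ((1/4) ^ k)"
    by blast
  \<comment> \<open>Summing the thresholds makes \<open>r\<close> monotone and at least
    \<open>N k\<close>; the summand \<open>k\<close> makes it unbounded.\<close>
  define r where "r k = (\<Sum>i\<le>k. N i) + k" for k
  have rN: "r k \<ge> N k" for k unfolding r_def by (metis atMost_iff finite_atMost le_add1 le_trans member_le_sum order_refl zero_le)
  have rS: "r (Suc k) \<ge> r k" "r k \<ge> k" for k by (auto simp: r_def)
  define g where "g k x = f (r (Suc k)) x - f (r k) x" for k x
  have gm[measurable]: "g k \<in> borel_measurable M" for k unfolding g_def by measurable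
  have g1: "(\<integral>\<^sup>+x. ennreal (norm (g k x)) \<partial>M) \<le> ennreal ((measure M (space M) + 1) * (1/2) ^ k)" for k
  proof -
    have "(\<integral>\<^sup>+x. ennreal (norm (g k x)) \<partial>M) \<le> (\<integral>\<^sup>+x. ennreal ((1/2) ^ k) + ennreal (2 ^ k) * ennreal ((norm (g k x))\<^sup>2) \<partial>M)"
    proof (intro nn_integral_mono)
      fix x
      let ?t = "2 ^ k * norm (g k x)"
      have "?t \<le> 1 + ?t * ?t"
      proof (cases "?t \<le> 1")
        case False
        then have "?t * 1 \<le> ?t * ?t" by (intro mult_left_mono) auto
        then show ?thesis by linarith
      qed (simp add: add_increasing2)
      then have "norm (g k x) \<le> (1 + ?t * ?t) / 2 ^ k" by (simp add: field_simps)
      also have "\<dots> = (1/2) ^ k + 2 ^ k * (norm (g k x))\<^sup>2" by (simp add: power2_eq_square field_simps)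
      finally show "ennreal (norm (g k x)) \<le> ennreal ((1/2) ^ k) + ennreal (2 ^ k) * ennreal ((norm (g k x))\<^sup>2)"
        by (simp add: ennreal_mult[symmetric] ennreal_plus[symmetric] ennreal_leI del: ennreal_plus)
    qed
    also have "\<dots> = ennreal ((1/2) ^ k) * emeasure M (space M) + ennreal (2 ^ k) * (\<integral>\<^sup>+x. ennreal ((norm (g k x))\<^sup>2) \<partial>M)"
      by (simp add: nn_integral_add nn_integral_cmult)
    also have "\<dots> \<le> ennreal ((1/2) ^ k) * emeasure M (space M) + ennreal (2 ^ k) * ennreal ((1/4) ^ k)"
      unfolding g_def using rN[of k] order_trans[OF rN rS(1), of k] by (intro add_left_mono mult_left_mono N) auto
    also have "\<dots> = ennreal ((measure M (space M) + 1) * (1/2) ^ k)"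
      by (simp add: emeasure_eq_measure ennreal_mult[symmetric] ennreal_plus[symmetric] power_mult_distrib[symmetric] algebra_simps del: ennreal_plus)
    finally show ?thesis .
  qed
  have "(\<integral>\<^sup>+x. (\<Sum>k. ennreal (norm (g k x))) \<partial>M) = (\<Sum>k. \<integral>\<^sup>+x. ennreal (norm (g k x)) \<partial>M)"
    by (rule nn_integral_suminf) simp
  also have "\<dots> \<le> (\<Sum>k. ennreal ((measure M (space M) + 1) * (1/2) ^ k))" by (intro suminf_le g1) auto
  also have "\<dots> < \<infinity>"
    by (subst suminf_ennreal2) (auto intro!: summable_mult)
  finally have "AE x in M. (\<Sum>k. ennreal (norm (g k x))) \<noteq> \<infinity>" by (intro nn_integral_PInf_AE) auto
  then have conv: "AE x in M. convergent (\<lambda>k. f (r k) x)"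
  proof eventually_elim
    case (elim x)
    then have "summable (\<lambda>k. norm (g k x))" by (intro summable_suminf_not_top) auto
    then have "summable (\<lambda>k. g k x)" by (rule summable_norm_cancel)
    then have "convergent (\<lambda>n. \<Sum>k<n. g k x)" by (simp add: summable_iff_convergent)
    moreover have "(\<Sum>k<n. g k x) = f (r n) x - f (r 0) x" for n
      unfolding g_def by (induction n) auto
    ultimately have "convergent (\<lambda>n. f (r n) x - f (r 0) x)" by simp
    then show ?case by (simp add: convergent_diff_const_right_iff)
  qed
  define F where "F x = lim (\<lambda>k. f (r k) x)" for x
  show ?thesis
  proof (rule that)
    show Fm: "F \<in> borel_measurable M" unfolding F_def by measurable
    fix e :: real assume "e > 0"
    then obtain N where N: "\<And>m n. m \<ge> N \<Longrightarrow> n \<ge> N \<Longrightarrow> (\<integral>\<^sup>+x. ennreal ((norm (f m x - f n x))\<^sup>2) \<partial>M) \<le> ennreal e"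
      using cauchy by blast
    have "(\<integral>\<^sup>+x. ennreal ((norm (f n x - F x))\<^sup>2) \<partial>M) \<le> ennreal e" if n: "n \<ge> N" for n
    proof -
      have "(\<integral>\<^sup>+x. ennreal ((norm (f n x - F x))\<^sup>2) \<partial>M) = (\<integral>\<^sup>+x. liminf (\<lambda>k. ennreal ((norm (f n x - f (r k) x))\<^sup>2)) \<partial>M)"
      proof (rule nn_integral_cong_AE)
        show "AE x in M. ennreal ((norm (f n x - F x))\<^sup>2) = liminf (\<lambda>k. ennreal ((norm (f n x - f (r k) x))\<^sup>2))"
          using conv
        proof eventually_elim
          case (elim x)
          then have "(\<lambda>k. f (r k) x) \<longlonglongrightarrow> F x" by (simp add: F_def convergent_LIMSEQ_iff)
          then have "(\<lambda>k. ennreal ((norm (f n x - f (r k) x))\<^sup>2)) \<longlonglongrightarrow> ennreal ((norm (f n x - F x))\<^sup>2)"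
            by (intro tendsto_intros)
          then show ?case by (rule lim_imp_Liminf[OF sequentially_bot, symmetric])
        qed
      qed
      also have "\<dots> \<le> liminf (\<lambda>k. \<integral>\<^sup>+x. ennreal ((norm (f n x - f (r k) x))\<^sup>2) \<partial>M)"
        by (rule nn_integral_liminf) simp
      also have "\<dots> \<le> ennreal e"
      proof (rule Liminf_le)
        show "\<forall>\<^sub>F k in sequentially. (\<integral>\<^sup>+x. ennreal ((norm (f n x - f (r k) x))\<^sup>2) \<partial>M) \<le> ennreal e"
          using eventually_ge_at_top[of N] by eventually_elim (use n N rS(2) le_trans in blast)
      qed simp
      finally show ?thesis .
    qed
    then show "\<exists>N. \<forall>n\<ge>N. (\<integral>\<^sup>+x. ennreal ((norm (f n x - F x))\<^sup>2) \<partial>M) \<le> ennreal e" by blast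
  qed
qed

section \<open>The spectral matrix and its Cholesky factor\<close>

definition psd :: "real^'l^'l \<Rightarrow> bool" where
  "psd A \<longleftrightarrow> transpose A = A \<and> (\<forall>v. 0 \<le> v \<bullet> (A *v v))"

text \<open>The index type carries no order. A fixed enumeration provides a first pivot and lets
  Cholesky vectors and multiplicity levels be numbered by natural numbers.\<close>

definition enum_idx :: "nat \<Rightarrow> 'l::finite" where
  "enum_idx = (SOME h. bij_betw h {..<CARD('l)} (UNIV :: 'l set))"

definition idx_of :: "'l::finite \<Rightarrow> nat" where
  "idx_of = inv_into {..<CARD('l)} enum_idx"

lemma enum_idx_bij: "bij_betw (enum_idx :: nat \<Rightarrow> 'l::finite) {..<CARD('l)} UNIV"
proof -
  have "\<exists>h. bij_betw h {..<CARD('l)} (UNIV :: 'l set)"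
    using ex_bij_betw_nat_finite[of "UNIV :: 'l set"] by (simp add: lessThan_atLeast0)
  then show ?thesis unfolding enum_idx_def by (rule someI_ex)
qed

lemma idx_of_less [simp]: "idx_of (i :: 'l::finite) < CARD('l)"
  and enum_idx_of [simp]: "enum_idx (idx_of i) = (i :: 'l)"
proof -
  have i: "i \<in> enum_idx ` {..<CARD('l)}" using enum_idx_bij[where 'l = 'l] by (auto simp: bij_betw_def)
  show "idx_of i < CARD('l)" "enum_idx (idx_of i) = i"
    using inv_into_into[OF i] f_inv_into_f[OF i] by (simp_all add: idx_of_def)
qed

lemma idx_of_enum [simp]: "k < CARD('l) \<Longrightarrow> idx_of (enum_idx k :: 'l::finite) = k"
  unfolding idx_of_def by (rule inv_into_f_f) (use enum_idx_bij[where 'l = 'l] in \<open>auto simp: bij_betw_def\<close>)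

lemma sum_idx_of: "(\<Sum>i\<in>(UNIV :: 'l::finite set). f (idx_of i)) = (\<Sum>k<CARD('l). f k)"
proof -
  have "(\<Sum>k<CARD('l). f k) = (\<Sum>i\<in>enum_idx ` {..<CARD('l)}. f (idx_of (i :: 'l)))"
    using enum_idx_bij[where 'l = 'l] by (subst sum.reindex) (auto simp: bij_betw_def)
  then show ?thesis using enum_idx_bij[where 'l = 'l] by (simp add: bij_betw_def)
qed

definition pivoted :: "real^'l^'l \<Rightarrow> bool" where
  "pivoted A \<longleftrightarrow> (\<exists>j<CARD('l). A $ (enum_idx j) $ (enum_idx j) > 0)"

definition pivot :: "real^'l^'l \<Rightarrow> 'l" where
  "pivot A = enum_idx (LEAST j. A $ (enum_idx j) $ (enum_idx j) > 0)"

definition chol_vec :: "real^'l^'l \<Rightarrow> real^'l" where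
  "chol_vec A = (if pivoted A then (\<chi> p. A $ p $ pivot A / sqrt (A $ pivot A $ pivot A)) else 0)"

definition chol_step :: "real^'l^'l \<Rightarrow> real^'l^'l" where
  "chol_step A = (\<chi> p q. A $ p $ q - chol_vec A $ p * chol_vec A $ q)"

text \<open>The \<open>k\<close>-th vector of a pivoted Cholesky decomposition. The nonzero vectors
  come first (\<open>chol_initial\<close>) and are independent (\<open>chol_independent\<close>), so
  \<open>chol A j \<noteq> 0\<close> says that the rank of \<open>A\<close> exceeds
  \<open>j\<close>. Unlike a choice of eigenvectors, this factor is given by explicit formulas and
  is plainly measurable in \<open>A\<close>.\<close>

definition chol :: "real^'l^'l \<Rightarrow> nat \<Rightarrow> real^'l" where
  "chol A k = chol_vec ((chol_step ^^ k) A)"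

definition chm :: "real^'l^'l \<Rightarrow> real^'l^'l" where
  "chm A = (\<chi> i. chol A (idx_of i))"

lemma psd_sym: "psd A \<Longrightarrow> A $ p $ q = A $ q $ p"
proof -
  assume "psd A"
  then have "transpose A $ q $ p = A $ q $ p" by (simp add: psd_def)
  then show ?thesis by (simp add: transpose_def)
qed

lemma psd_form:
  fixes A :: "real^'l^'l"
  shows "psd A \<Longrightarrow> (v + t *\<^sub>R axis i 1) \<bullet> (A *v (v + t *\<^sub>R axis i 1))
   = v \<bullet> (A *v v) + 2 * t * (A *v v) $ i + t\<^sup>2 * A $ i $ i"
proof -
  assume A: "psd A"
  have ax: "A *v axis i 1 = (\<chi> p. A $ p $ i)"
    by (simp add: matrix_vector_mult_basis column_def)
  have "v \<bullet> (A *v axis i 1) = (A *v v) $ i"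
    unfolding ax using psd_sym[OF A] by (simp add: inner_vec_def matrix_vector_mult_def mult.commute)
  moreover have "axis i 1 \<bullet> w = w $ i" for w :: "real^'l" by (simp add: inner_axis')
  moreover have "(A *v axis i 1) $ i = A $ i $ i" unfolding ax by simp
  ultimately show ?thesis
    by (simp add: matrix_vector_right_distrib matrix_vector_mult_scaleR inner_add_left inner_add_right power2_eq_square algebra_simps)
qed

lemma psd_diag: "psd A \<Longrightarrow> A $ i $ i \<ge> 0"
  using psd_form[of A 0 1 i] unfolding psd_def by (metis (no_types, lifting) add.left_neutral inner_zero_left matrix_vector_mult_0_right mult_1 one_power2 scaleR_one zero_index mult_zero_right)

text \<open>With a zero diagonal entry the form along \<open>axis i 1\<close> is affine in the
  parameter, and a nonzero slope would make it negative; \<open>t\<close> is chosen to reach the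
  value -1.\<close>

lemma psd_diag_zero:
  assumes A: "psd A" and z: "A $ i $ i = 0"
  shows "(A *v v) $ i = 0"
proof (rule ccontr)
  assume n: "(A *v v) $ i \<noteq> 0"
  define t where "t = - (v \<bullet> (A *v v) + 1) / (2 * (A *v v) $ i)"
  have "0 \<le> v \<bullet> (A *v v) + 2 * t * (A *v v) $ i"
    using psd_form[OF A, of v t i] A z unfolding psd_def by (metis add.right_neutral mult_zero_right)
  also have "\<dots> = -1" using n by (simp add: t_def field_simps)
  finally show False by simp
qed

lemma psd_not_pivoted:
  assumes "psd A" "\<not> pivoted A"
  shows "A = 0"
proof -
  have "A $ i $ i = 0" for i
    using assms(2) psd_diag[OF assms(1), of i] enum_idx_of[of i] idx_of_less[of i] unfolding pivoted_def
    by (metis less_eq_real_def)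
  then have "(A *v axis q 1) $ p = 0" for p q using psd_diag_zero[OF assms(1)] by blast
  then show ?thesis by (simp add: vec_eq_iff matrix_vector_mult_basis column_def)
qed

lemma pivot_pos:
  assumes "pivoted A"
  shows "A $ pivot A $ pivot A > 0"
  using assms unfolding pivoted_def pivot_def by (metis (mono_tags, lifting) LeastI)

lemma chol_vec_pivot: "pivoted A \<Longrightarrow> chol_vec A $ pivot A > 0"
  using pivot_pos[of A] by (simp add: chol_vec_def)

lemma chol_vec_zero_iff: "psd A \<Longrightarrow> chol_vec A = 0 \<longleftrightarrow> A = 0"
proof (cases "pivoted A")
  case True
  then show ?thesis using chol_vec_pivot[OF True] by (auto simp: pivoted_def)
next
  case False
  then show "psd A \<Longrightarrow> ?thesis" using psd_not_pivoted[of A] by (auto simp: chol_vec_def)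
qed

lemma chol_step_nth: "chol_step A $ p $ q = A $ p $ q - chol_vec A $ p * chol_vec A $ q"
  by (simp add: chol_step_def)

text \<open>The step is a Schur complement: its form is the minimum of the form of \<open>A\<close>
  along the pivot direction.\<close>

lemma chol_step_psd:
  assumes A: "psd A"
  shows "psd (chol_step A)"
proof (cases "pivoted A")
  case False
  then show ?thesis using A by (simp add: chol_step_def chol_vec_def)
next
  case True
  let ?i = "pivot A"
  let ?d = "A $ ?i $ ?i"
  have d: "?d > 0" by (rule pivot_pos[OF True])
  have sd: "sqrt ?d * sqrt ?d = ?d" using d by simp
  have vv: "v \<bullet> (chol_step A *v v) = v \<bullet> (A *v v) - (chol_vec A \<bullet> v)\<^sup>2" for v
    unfolding chol_step_def matrix_vector_mult_def inner_vec_def power2_eq_square sum_product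
    by (simp add: left_diff_distrib sum_subtractf right_diff_distrib sum_distrib_left mult_ac)
  have bv: "chol_vec A \<bullet> v = (A *v v) $ ?i / sqrt ?d" for v
    using True psd_sym[OF A] by (simp add: chol_vec_def inner_vec_def matrix_vector_mult_def sum_divide_distrib)
  have "0 \<le> v \<bullet> (chol_step A *v v)" for v
  proof -
    \<comment> \<open>The minimiser of the quadratic polynomial in \<open>t\<close> from
      \<open>psd_form\<close>.\<close>
    define t where "t = - (A *v v) $ ?i / ?d"
    have "0 \<le> v \<bullet> (A *v v) + 2 * t * (A *v v) $ ?i + t\<^sup>2 * ?d"
      using psd_form[OF A, of v t ?i] A unfolding psd_def by metis
    also have "\<dots> = v \<bullet> (A *v v) - ((A *v v) $ ?i)\<^sup>2 / ?d"
      using d by (simp add: t_def power2_eq_square field_simps)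
    finally show ?thesis unfolding vv bv using d by (simp add: power_divide)
  qed
  moreover have "transpose (chol_step A) = chol_step A"
    using psd_sym[OF A] by (simp add: chol_step_def transpose_def vec_eq_iff mult.commute)
  ultimately show ?thesis by (simp add: psd_def)
qed

lemma chol_iter_psd: "psd A \<Longrightarrow> psd ((chol_step ^^ k) A)"
  by (induction k) (auto intro: chol_step_psd)

lemma row_zero_step: "psd A \<Longrightarrow> A $ p = 0 \<Longrightarrow> chol_vec A $ p = 0 \<and> chol_step A $ p = 0"
  by (simp add: chol_step_def chol_vec_def vec_eq_iff)

lemma row_zero_iter: "psd A \<Longrightarrow> A $ p = 0 \<Longrightarrow> chol A k $ p = 0 \<and> (chol_step ^^ k) A $ p = 0"
proof (induction k)
  case 0
  then show ?case using row_zero_step[of A p] by (simp add: chol_def)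
next
  case (Suc k)
  then show ?case using row_zero_step[OF chol_iter_psd[of A k], of p] row_zero_step[OF chol_iter_psd[of A "Suc k"], of p]
    by (simp add: chol_def)
qed

lemma pivot_row_zero: "psd A \<Longrightarrow> pivoted A \<Longrightarrow> chol_step A $ pivot A = 0"
  using pivot_pos[of A] psd_sym[of A] by (simp add: chol_step_def chol_vec_def vec_eq_iff)

text \<open>Each step with a pivot creates a new zero row and keeps the old ones; without a pivot
  the matrix is already 0.\<close>

lemma chol_iter_zero:
  fixes A :: "real^'l^'l"
  assumes A: "psd A"
  shows "(chol_step ^^ CARD('l)) A = 0"
proof -
  define Z where "Z k = {p. (chol_step ^^ k) A $ p = 0}" for k
  have "k \<le> CARD('l) \<Longrightarrow> card (Z k) \<ge> k" for k
  proof (induction k)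
    case (Suc k)
    note B = chol_iter_psd[OF A, of k]
    have sub: "Z k \<subseteq> Z (Suc k)" using row_zero_step[OF B] by (auto simp: Z_def)
    show ?case
    proof (cases "pivoted ((chol_step ^^ k) A)")
      case True
      let ?p = "pivot ((chol_step ^^ k) A)"
      have "?p \<in> Z (Suc k)" using pivot_row_zero[OF B True] by (simp add: Z_def)
      moreover have "?p \<notin> Z k" using pivot_pos[OF True] by (auto simp: Z_def)
      ultimately have "card (Z k) < card (Z (Suc k))" using sub by (intro psubset_card_mono) auto
      then show ?thesis using Suc by simp
    next
      case False
      then have "(chol_step ^^ k) A = 0" by (rule psd_not_pivoted[OF B])
      then have "Z k = UNIV" by (simp add: Z_def)
      then show ?thesis using sub Suc.prems by (simp add: top.extremum_unique)
    qed
  qed simp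
  from this[of "CARD('l)"] have "Z (CARD('l)) = UNIV"
    by (metis card_mono card_subset_eq dual_order.antisym finite order_refl top_greatest)
  then show ?thesis by (auto simp: Z_def vec_eq_iff)
qed

lemma chol_sum:
  fixes A :: "real^'l^'l"
  assumes A: "psd A"
  shows "A $ p $ q = (\<Sum>k<CARD('l). chol A k $ p * chol A k $ q)"
proof -
  have "A $ p $ q = (chol_step ^^ k) A $ p $ q + (\<Sum>j<k. chol A j $ p * chol A j $ q)" for k
    by (induction k) (simp_all add: chol_def chol_step_nth)
  from this[of "CARD('l)"] show ?thesis using chol_iter_zero[OF A] by simp
qed

lemma chol_initial:
  fixes A :: "real^'l^'l"
  assumes A: "psd A" and z: "chol A k = 0" and km: "k \<le> m"
  shows "chol A m = 0"
proof -
  have B: "(chol_step ^^ k) A = 0" using z chol_vec_zero_iff[OF chol_iter_psd[OF A]] by (simp add: chol_def)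
  have cz: "chol_vec (0 :: real^'l^'l) = 0" by (simp add: chol_vec_def pivoted_def)
  then have "chol_step (0 :: real^'l^'l) = 0" by (simp add: chol_step_def vec_eq_iff)
  note cs = this
  have "(chol_step ^^ j) (0 :: real^'l^'l) = 0" for j by (induction j) (simp_all add: cs)
  moreover have "(chol_step ^^ m) A = (chol_step ^^ (m - k)) ((chol_step ^^ k) A)"
    using km by (metis comp_apply funpow_add le_add_diff_inverse2)
  ultimately show ?thesis using B cz by (simp add: chol_def)
qed

text \<open>The system is triangular: in the coordinate of the \<open>k\<close>-th pivot all later
  vectors vanish while the \<open>k\<close>-th is positive. Zero vectors carry no information, so
  their coefficients are assumed to be 0.\<close>

lemma chol_independent:
  fixes A :: "real^'l^'l" and c :: "nat \<Rightarrow> complex"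
  assumes A: "psd A" and z: "\<And>p. (\<Sum>k<n. c k * of_real (chol A k $ p)) = 0"
    and c0: "\<And>k. k < n \<Longrightarrow> chol A k = 0 \<Longrightarrow> c k = 0" and k: "k < n"
  shows "c k = 0"
  using k
proof (induction k rule: less_induct)
  case (less k)
  show ?case
  proof (cases "pivoted ((chol_step ^^ k) A)")
    case False
    then show ?thesis using c0[OF less.prems] by (simp add: chol_def chol_vec_def)
  next
    case True
    let ?p = "pivot ((chol_step ^^ k) A)"
    note B = chol_iter_psd[OF A]
    have row: "chol_step ((chol_step ^^ k) A) $ ?p = 0" by (rule pivot_row_zero[OF B True])
    have later: "chol A m $ ?p = 0" if "m > k" for m
    proof -
      have "(chol_step ^^ m) A = (chol_step ^^ (m - Suc k)) ((chol_step ^^ Suc k) A)"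
        using that by (metis Suc_leI comp_apply funpow_add le_add_diff_inverse2)
      then have "chol A m = chol ((chol_step ^^ Suc k) A) (m - Suc k)" by (simp add: chol_def)
      then show ?thesis using row_zero_iter[OF B[of "Suc k"], of ?p "m - Suc k"] row by simp
    qed
    have "0 = (\<Sum>j<n. c j * of_real (chol A j $ ?p))" using z by simp
    also have "\<dots> = (\<Sum>j\<in>{k}. c j * of_real (chol A j $ ?p))"
      using less later by (intro sum.mono_neutral_right) (auto simp: not_less_iff_gr_or_eq, metis linorder_neqE_nat)
    finally have "c k * of_real (chol A k $ ?p) = 0" by simp
    moreover have "chol A k $ ?p > 0" using chol_vec_pivot[OF True] by (simp add: chol_def)
    ultimately show ?thesis by simp
  qed
qed

lemma chol_measurable:
  fixes A :: "real \<Rightarrow> real^'l^'l"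
  assumes A: "\<And>p q. (\<lambda>x. A x $ p $ q) \<in> borel_measurable borel"
  shows "(\<lambda>x. chol (A x) k $ p) \<in> borel_measurable borel"
proof -
  have vec: "(\<lambda>x. chol_vec (B x) $ p) \<in> borel_measurable borel"
    if B: "\<And>p q. (\<lambda>x. B x $ p $ q) \<in> borel_measurable borel" for B :: "real \<Rightarrow> real^'l^'l" and p
  proof -
    note [measurable] = B
    \<comment> \<open>The pivot position takes countably many values, and for each fixed position
      the quotient is measurable. Without a pivot \<open>LEAST\<close> is arbitrary, a case removed
      by the test of \<open>pivoted\<close>.\<close>
    let ?L = "\<lambda>x. LEAST j. B x $ (enum_idx j) $ (enum_idx j) > 0"
    have L: "?L \<in> measurable borel (count_space UNIV)" by measurable
    have piv: "Measurable.pred borel (\<lambda>x. pivoted (B x))" unfolding pivoted_def by measurable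
    have e: "(\<lambda>x. B x $ p $ enum_idx j / sqrt (B x $ enum_idx j $ enum_idx j)) \<in> borel_measurable borel" for j
      by measurable
    have "(\<lambda>x. (\<lambda>j. B x $ p $ enum_idx j / sqrt (B x $ enum_idx j $ enum_idx j)) (?L x)) \<in> borel_measurable borel"
      by (rule measurable_compose_countable[OF e L])
    then have "(\<lambda>x. if pivoted (B x) then B x $ p $ pivot (B x) / sqrt (B x $ pivot (B x) $ pivot (B x)) else 0) \<in> borel_measurable borel"
      unfolding pivot_def using piv by measurable
    moreover have "chol_vec (B x) $ p = (if pivoted (B x) then B x $ p $ pivot (B x) / sqrt (B x $ pivot (B x) $ pivot (B x)) else 0)" for x
      by (simp add: chol_vec_def)
    ultimately show ?thesis by simp
  qed
  have "(\<lambda>x. (chol_step ^^ k) (A x) $ p $ q) \<in> borel_measurable borel" for p q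
  proof (induction k arbitrary: p q)
    case (Suc k)
    note [measurable] = Suc vec[OF Suc]
    show ?case by (simp add: chol_step_nth)
  qed (simp add: A)
  from vec[OF this] show ?thesis by (simp add: chol_def)
qed

section \<open>Construction of the matrix-valued spectral measure\<close>

context jacobi_coeff
begin

lemma mom_dens: "N \<ge> Suc k \<Longrightarrow> mom k u v = (\<integral>x. x ^ k * dens N x u v \<partial>lborel)"
  by (simp add: dens_mom)

lemma mom_commute: "mom k u v = mom k v u"
  unfolding mom_dens[OF order_refl] by (simp add: dens_commute)

lemma mom_add: "mom k (u + u') v = mom k u v + mom k u' v"
  by (simp add: mom_def inner_add_left)

lemma mom_scale: "mom k (r *\<^sub>R u) v = r * mom k u v"
  by (simp add: mom_def)

lemma mom_sum: "mom k (\<Sum>i\<in>A. f i) v = (\<Sum>i\<in>A. mom k (f i) v)"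
  by (simp add: mom_def inner_sum_left)

lemma mom_expand: "mom k u v = (\<Sum>i\<in>UNIV. \<Sum>j\<in>UNIV. u $ i * v $ j * mom k (axis i 1) (axis j 1))"
proof -
  have e: "mom k w v = (\<Sum>i\<in>UNIV. w $ i * mom k (axis i 1) v)" for w v
  proof -
    have "mom k w v = mom k (\<Sum>i\<in>UNIV. w $ i *\<^sub>R axis i 1) v"
      by (simp add: basis_expansion scalar_mult_eq_scaleR[symmetric])
    then show ?thesis by (simp add: mom_sum mom_scale)
  qed
  show ?thesis
    by (subst e) (simp add: mom_commute[of k "axis _ _" v] e[of v] sum_distrib_left mult.assoc mom_commute[of k "axis _ _" "axis _ _"])
qed

text \<open>The trace dominates all vector measures and serves as the scalar reference measure;
  division by the dimension gives it mass 1, as \<open>moment_limit_exists\<close> demands.\<close>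

lemma trace_measure_exists:
  obtains M where "bdd_measure (3 * C) M" "\<And>k. (\<integral>x. x ^ k \<partial>M) = (\<Sum>i\<in>UNIV. mom k (axis i 1) (axis i 1)) / real CARD('l)"
proof -
  define f where "f N x = (\<Sum>i\<in>UNIV. dens (Suc N) x (axis i 1) (axis i 1)) / real CARD('l)" for N x
  define m where "m k = (\<Sum>i\<in>UNIV. mom k (axis i 1) (axis i (1::real))) / real CARD('l)" for k
  obtain M where M: "finite_measure M" "sets M = sets borel" "\<And>k. integrable M (\<lambda>x. x ^ k)" "\<And>k. (\<integral>x. x ^ k \<partial>M) = m k"
  proof (rule moment_limit_exists[of f m])
    show "f N \<in> borel_measurable borel" for N
      unfolding f_def by (intro borel_measurable_continuous_onI continuous_intros dens_cont) auto
    show "f N x \<ge> 0" for N x unfolding f_def dens_self by (intro divide_nonneg_nonneg sum_nonneg) auto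
    show "integrable lborel (\<lambda>x. x ^ k * f N x)" "(\<integral>x. x ^ k * f N x \<partial>lborel) = m k" if "k < N" for k N
    proof -
      have e: "(\<lambda>x. x ^ k * f N x) = (\<lambda>x. (\<Sum>i\<in>UNIV. x ^ k * dens (Suc N) x (axis i 1) (axis i 1)) / real CARD('l))"
        by (simp add: f_def sum_distrib_left)
      have i: "integrable lborel (\<lambda>x. x ^ k * dens (Suc N) x (axis i 1) (axis i 1))" for i :: 'l
        using that by (intro dens_mom) auto
      show "integrable lborel (\<lambda>x. x ^ k * f N x)" unfolding e by (intro integrable_divide_zero impI Bochner_Integration.integrable_sum i)
      show "(\<integral>x. x ^ k * f N x \<partial>lborel) = m k" unfolding e
        using that by (simp add: Bochner_Integration.integral_sum[OF i] dens_mom m_def)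
    qed
    show "m 0 = 1" by (simp add: m_def mom_def inner_axis_axis)
  qed blast
  have "bdd_measure (3 * C) M"
  proof (rule moment_support[OF M(1-3)])
    fix k
    have "m (2 * k) \<le> (\<Sum>i\<in>(UNIV::'l set). (3 * C) ^ (2 * k)) / real CARD('l)"
      unfolding m_def using mom_even_bound[of k "axis _ 1"] by (intro divide_right_mono sum_mono) (auto simp: norm_axis_1)
    then show "(\<integral>x. x ^ (2 * k) \<partial>M) \<le> (3 * C) ^ (2 * k) * 1" by (simp add: M)
  qed (use C_nonneg in simp)
  then show ?thesis using M(4) by (intro that) (auto simp: m_def)
qed

lemma dens_le_trace:
  assumes N: "N \<ge> 1"
  shows "dens N x v v \<le> (norm v)\<^sup>2 * (\<Sum>i\<in>UNIV. dens N x (axis i 1) (axis i 1))"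
proof -
  have c: "cvec (axis i 1) = axis i 1" for i :: 'l by (simp add: vec_eq_iff axis_def)
  have "norm (lres N x (cvec v)) \<le> (\<Sum>i\<in>UNIV. \<bar>v $ i\<bar> * norm (lres N x (axis i 1)))"
    by (subst lres_expand[OF N]) (rule order_trans[OF norm_sum], simp)
  also have "\<dots> \<le> L2_set (\<lambda>i. v $ i) UNIV * L2_set (\<lambda>i. norm (lres N x (axis i 1))) UNIV"
    using L2_set_mult_ineq[of "\<lambda>i. v $ i" "\<lambda>i. norm (lres N x (axis i 1))" UNIV] by simp
  finally have "(norm (lres N x (cvec v)))\<^sup>2 \<le> (L2_set (\<lambda>i. v $ i) UNIV * L2_set (\<lambda>i. norm (lres N x (axis i 1))) UNIV)\<^sup>2"
    by (rule power_mono) simp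
  also have "\<dots> = (norm v)\<^sup>2 * (\<Sum>i\<in>UNIV. (norm (lres N x (axis i 1)))\<^sup>2)"
    by (simp add: power_mult_distrib norm_vec_def L2_set_def sum_nonneg)
  finally show ?thesis unfolding dens_self c by (simp add: sum_divide_distrib[symmetric] divide_right_mono)
qed

lemma vector_measure_exists:
  obtains M where "bdd_measure (3 * C) M" "\<And>k. (\<integral>x. x ^ k \<partial>M) = mom k v v"
proof (cases "v = 0")
  case True
  have n: "null_measure (borel :: real measure) = density borel (\<lambda>_. 0)"
    by (rule measure_eqI) (auto simp: emeasure_density)
  have "bdd_measure (3 * C) (density borel (\<lambda>_. 0))"
    by (auto simp: bdd_measure_def emeasure_density AE_density intro!: finite_measureI)
  moreover have "(\<integral>x. x ^ k \<partial>density borel (\<lambda>_. 0)) = mom k v v" for k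
    using True integral_null_measure[of borel "\<lambda>x. x ^ k"] by (simp add: mom_def n[symmetric])
  ultimately show ?thesis by (rule that)
next
  case False
  then have nv: "norm v > 0" by simp
  define u where "u = (1 / norm v) *\<^sub>R v"
  have u: "norm u = 1" "v = norm v *\<^sub>R u" using nv by (simp_all add: u_def)
  define f where "f N x = dens (Suc N) x u u" for N x
  obtain M where M: "finite_measure M" "sets M = sets borel" "\<And>k. integrable M (\<lambda>x. x ^ k)" "\<And>k. (\<integral>x. x ^ k \<partial>M) = mom k u u"
  proof (rule moment_limit_exists[of f "\<lambda>k. mom k u u"])
    show "f N \<in> borel_measurable borel" for N
      unfolding f_def by (intro borel_measurable_continuous_onI dens_cont) auto
    show "f N x \<ge> 0" for N x unfolding f_def dens_self by simp
    show "integrable lborel (\<lambda>x. x ^ k * f N x)" "(\<integral>x. x ^ k * f N x \<partial>lborel) = mom k u u" if "k < N" for k N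
      unfolding f_def using that by (auto intro!: dens_mom)
    show "mom 0 u u = 1" using u by (simp add: mom_def power2_norm_eq_inner[symmetric])
  qed blast
  have B: "bdd_measure (3 * C) M"
  proof (rule moment_support[OF M(1-3)])
    show "(\<integral>x. x ^ (2 * k) \<partial>M) \<le> (3 * C) ^ (2 * k) * 1" for k
      using mom_even_bound[of k u] u by (simp add: M)
  qed (use C_nonneg in simp)
  interpret finite_measure M by fact
  define M' where "M' = density M (\<lambda>_. ennreal ((norm v)\<^sup>2))"
  have "finite_measure M'"
    by (intro finite_measureI) (auto simp: M'_def emeasure_density nn_integral_cmult ennreal_mult_eq_top_iff)
  then have "bdd_measure (3 * C) M'" using B by (auto simp: bdd_measure_def M'_def AE_density elim!: eventually_mono)
  moreover have "(\<integral>x. x ^ k \<partial>M') = mom k v v" for k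
  proof -
    have "(\<integral>x. x ^ k \<partial>M') = (norm v)\<^sup>2 * mom k u u"
      unfolding M'_def using M by (subst integral_density) auto
    also have "\<dots> = mom k v v"
      by (subst (2 3) u(2)) (simp add: mom_scale mom_commute[of k u "_ *\<^sub>R u"] power2_eq_square)
    finally show ?thesis .
  qed
  ultimately show ?thesis by (rule that)
qed

text \<open>For finite chains the density of \<open>v\<close> is pointwise at most a multiple of the
  trace. Tested on squares of polynomials this domination passes to the limit measures through
  \<open>moment_order\<close>, and Radon-Nikodym applies.\<close>

lemma vector_density_exists:
  assumes T: "bdd_measure (3 * C) T" and Tm: "\<And>k. (\<integral>x. x ^ k \<partial>T) = (\<Sum>i\<in>UNIV. mom k (axis i 1) (axis i 1)) / real CARD('l)"
  obtains g where "g \<in> borel_measurable borel" "\<And>x. g x \<ge> (0::real)" "integrable T g" "\<And>k. integrable T (\<lambda>x. x ^ k * g x)"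
    "\<And>k. (\<integral>x. x ^ k * g x \<partial>T) = mom k v v"
proof -
  obtain M where M: "bdd_measure (3 * C) M" "\<And>k. (\<integral>x. x ^ k \<partial>M) = mom k v v"
    using vector_measure_exists[of v] by blast
  interpret T: finite_measure T using T by (simp add: bdd_measure_def)
  interpret M: finite_measure M using M by (simp add: bdd_measure_def)
  have sT[measurable_cong]: "sets T = sets borel" and sM[measurable_cong]: "sets M = sets borel"
    using T M by (auto simp: bdd_measure_def)
  define c where "c = (norm v)\<^sup>2 * real CARD('l)"
  define cT where "cT = density T (\<lambda>_. ennreal c)"
  have "finite_measure cT" by (intro finite_measureI) (auto simp: cT_def emeasure_density nn_integral_cmult ennreal_mult_eq_top_iff)
  then have cT: "bdd_measure (3 * C) cT" using T by (auto simp: bdd_measure_def cT_def AE_density elim!: eventually_mono)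
  have le: "emeasure M A \<le> emeasure cT A" if A: "A \<in> sets borel" for A
  proof (rule moment_order[OF M.finite_measure_axioms sM cT _ A])
    fix q :: "real \<Rightarrow> real" assume "real_polynomial_function q"
    then have q2: "real_polynomial_function (\<lambda>x. (q x)\<^sup>2)" by (rule real_polynomial_function_power)
    have mi: "integrable M (\<lambda>x. (q x)\<^sup>2)" "integrable T (\<lambda>x. (q x)\<^sup>2)"
      using bdd_integrable_rpf[OF M(1) q2] bdd_integrable_rpf[OF T q2] by auto
    obtain a n where qa: "(\<lambda>x. (q x)\<^sup>2) = (\<lambda>x. \<Sum>i\<le>n. a i * x ^ i)" using q2 by (auto simp: real_polynomial_function_iff_sum)
    \<comment> \<open>A chain longer than the degree bound \<open>n\<close> of the squared
      polynomial reproduces every moment involved.\<close>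
    let ?N = "Suc n"
    have d: "integrable lborel (\<lambda>x. (q x)\<^sup>2 * dens ?N x u w)" "(\<integral>x. (q x)\<^sup>2 * dens ?N x u w \<partial>lborel) = (\<Sum>i\<le>n. a i * mom i u w)" for u w
    proof -
      have e: "(\<lambda>x. (q x)\<^sup>2 * dens ?N x u w) = (\<lambda>x. \<Sum>i\<le>n. a i * (x ^ i * dens ?N x u w))"
        using qa by (simp add: fun_eq_iff sum_distrib_right mult.assoc)
      have i: "integrable lborel (\<lambda>x. a i * (x ^ i * dens ?N x u w))" if "i \<in> {..n}" for i
        using that by (intro integrable_mult_right dens_mom) auto
      show "integrable lborel (\<lambda>x. (q x)\<^sup>2 * dens ?N x u w)" unfolding e by (intro Bochner_Integration.integrable_sum i)
      show "(\<integral>x. (q x)\<^sup>2 * dens ?N x u w \<partial>lborel) = (\<Sum>i\<le>n. a i * mom i u w)"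
        unfolding e by (subst Bochner_Integration.integral_sum[OF i]) (auto intro!: sum.cong simp: dens_mom)
    qed
    have "(\<integral>x. (q x)\<^sup>2 \<partial>M) = (\<Sum>i\<le>n. a i * mom i v v)"
      unfolding qa using bdd_integrable_rpf[OF M(1) real_polynomial_function_power[OF rpf_id]]
      by (simp add: Bochner_Integration.integral_sum M)
    also have "\<dots> = (\<integral>x. (q x)\<^sup>2 * dens ?N x v v \<partial>lborel)" by (simp add: d)
    also have "\<dots> \<le> (\<integral>x. (norm v)\<^sup>2 * (\<Sum>i\<in>UNIV. (q x)\<^sup>2 * dens ?N x (axis i 1) (axis i 1)) \<partial>lborel)"
    proof (intro integral_mono d integrable_mult_right Bochner_Integration.integrable_sum)
      fix x
      have "(q x)\<^sup>2 * dens ?N x v v \<le> (q x)\<^sup>2 * ((norm v)\<^sup>2 * (\<Sum>i\<in>UNIV. dens ?N x (axis i 1) (axis i 1)))"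
        by (intro mult_left_mono dens_le_trace) auto
      then show "(q x)\<^sup>2 * dens ?N x v v \<le> (norm v)\<^sup>2 * (\<Sum>i\<in>UNIV. (q x)\<^sup>2 * dens ?N x (axis i 1) (axis i 1))"
        by (simp add: sum_distrib_left mult_ac)
    qed
    also have "\<dots> = (norm v)\<^sup>2 * (\<Sum>i\<in>UNIV. \<Sum>j\<le>n. a j * mom j (axis i 1) (axis i 1))"
      using d by (simp add: Bochner_Integration.integral_sum)
    also have "\<dots> = c * (\<Sum>j\<le>n. a j * ((\<Sum>i\<in>UNIV. mom j (axis i 1) (axis i 1)) / real CARD('l)))"
      by (subst sum.swap) (simp add: c_def sum_distrib_left sum_divide_distrib)
    also have "\<dots> = c * (\<integral>x. (q x)\<^sup>2 \<partial>T)"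
      unfolding qa using bdd_integrable_rpf[OF T real_polynomial_function_power[OF rpf_id]]
      by (simp add: Bochner_Integration.integral_sum Tm)
    finally have "ennreal (\<integral>x. (q x)\<^sup>2 \<partial>M) \<le> ennreal (c * (\<integral>x. (q x)\<^sup>2 \<partial>T))" by (rule ennreal_leI)
    then have "(\<integral>\<^sup>+x. ennreal ((q x)\<^sup>2) \<partial>M) \<le> ennreal c * (\<integral>\<^sup>+x. ennreal ((q x)\<^sup>2) \<partial>T)"
      using mi by (simp add: nn_integral_eq_integral ennreal_mult c_def)
    also have "\<dots> = (\<integral>\<^sup>+x. ennreal ((q x)\<^sup>2) \<partial>cT)"
      using rpf_meas[OF q2] unfolding cT_def by (subst nn_integral_density) (auto simp: nn_integral_cmult)
    finally show "(\<integral>\<^sup>+x. ennreal ((q x)\<^sup>2) \<partial>M) \<le> (\<integral>\<^sup>+x. ennreal ((q x)\<^sup>2) \<partial>cT)" .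
  qed
  have ac: "absolutely_continuous T M"
  proof (unfold absolutely_continuous_def, rule subsetI)
    fix A assume A: "A \<in> null_sets T"
    then have "A \<in> sets borel" "emeasure cT A = 0"
      by (auto simp: sT null_sets_def cT_def emeasure_density nn_integral_cmult_indicator)
    then show "A \<in> null_sets M" using le[of A] by (auto simp: sM null_sets_def)
  qed
  obtain g where g: "g \<in> borel_measurable T" "AE x in T. RN_deriv T M x = ennreal (g x)" "\<And>x. 0 \<le> g x"
    using T.real_RN_deriv[OF M.finite_measure_axioms ac] by (metis sM sT)
  have gb[measurable]: "g \<in> borel_measurable borel" using g(1) by (simp cong: measurable_cong_sets add: sT)
  have "M = density T (RN_deriv T M)" using T.density_RN_deriv[OF ac] by (simp add: sM sT)
  also have "\<dots> = density T (\<lambda>x. ennreal (g x))" using g by (intro density_cong) auto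
  finally have Mg: "M = density T (\<lambda>x. ennreal (g x))" .
  have iM: "integrable M (\<lambda>x. x ^ k)" for k by (rule bdd_integrable_rpf[OF M(1) real_polynomial_function_power[OF rpf_id]])
  have ik: "integrable T (\<lambda>x. x ^ k * g x)" for k
    using iM[of k] unfolding Mg using g by (subst (asm) integrable_density) (auto simp: mult.commute)
  show ?thesis
  proof (rule that[OF gb g(3) _ ik])
    show "integrable T g" using ik[of 0] by simp
    fix k
    show "(\<integral>x. x ^ k * g x \<partial>T) = mom k v v"
      using M(2)[of k] unfolding Mg using g by (subst (asm) integral_density) (auto simp: mult.commute)
  qed
qed

text \<open>The densities of the individual vectors are polarised to a matrix. They were chosen
  separately, so its form is nonnegative only almost everywhere for each vector.\<close>

lemma spectral_matrix_exists:
  obtains T and Rm :: "real \<Rightarrow> real^'l^'l" where "bdd_measure (3 * C) T"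
    "\<And>p q. (\<lambda>x. Rm x $ p $ q) \<in> borel_measurable borel" "\<And>x. psd (Rm x)"
    "\<And>p q k. integrable T (\<lambda>x. x ^ k * Rm x $ p $ q)"
    "\<And>p q k. (\<integral>x. x ^ k * Rm x $ p $ q \<partial>T) = mom k (axis p 1) (axis q 1)"
proof -
  obtain T where T: "bdd_measure (3 * C) T" "\<And>k. (\<integral>x. x ^ k \<partial>T) = (\<Sum>i\<in>UNIV. mom k (axis i 1) (axis i 1)) / real CARD('l)"
    using trace_measure_exists by blast
  have sT[measurable_cong]: "sets T = sets borel" using T by (auto simp: bdd_measure_def)
  have "\<forall>v. \<exists>g. g \<in> borel_measurable borel \<and> (\<forall>x. g x \<ge> (0::real)) \<and> (\<forall>k. integrable T (\<lambda>x. x ^ k * g x)) \<and> (\<forall>k. (\<integral>x. x ^ k * g x \<partial>T) = mom k v v)"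
    using vector_density_exists[OF T] by metis
  from choice[OF this] obtain g where g: "\<And>v. g v \<in> borel_measurable borel" "\<And>v x. g v x \<ge> (0::real)"
    "\<And>v k. integrable T (\<lambda>x. x ^ k * g v x)" "\<And>v k. (\<integral>x. x ^ k * g v x \<partial>T) = mom k v v" by blast
  note [measurable] = g(1)
  define S where "S x = (\<chi> p q. (g (axis p 1 + axis q 1) x - g (axis p 1) x - g (axis q 1) x) / 2 :: real^'l^'l)" for x
  have Sm: "(\<lambda>x. S x $ p $ q) \<in> borel_measurable borel" for p q by (simp add: S_def)
  have Ssym: "S x $ p $ q = S x $ q $ p" for x p q by (simp add: S_def add.commute)
  have Si: "integrable T (\<lambda>x. x ^ k * S x $ p $ q)" "(\<integral>x. x ^ k * S x $ p $ q \<partial>T) = mom k (axis p 1) (axis q 1)" for p q k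
  proof -
    have e: "(\<lambda>x. x ^ k * S x $ p $ q) = (\<lambda>x. (x ^ k * g (axis p 1 + axis q 1) x - x ^ k * g (axis p 1) x - x ^ k * g (axis q 1) x) / 2)"
      by (simp add: S_def algebra_simps)
    show "integrable T (\<lambda>x. x ^ k * S x $ p $ q)" unfolding e using g by auto
    show "(\<integral>x. x ^ k * S x $ p $ q \<partial>T) = mom k (axis p 1) (axis q 1)"
      unfolding e using g by (simp add: mom_add mom_commute[of k _ "_ + _"] mom_commute[of k "axis q 1" "axis p 1"])
  qed
  have vSv: "v \<bullet> (S x *v v) = (\<Sum>p\<in>UNIV. \<Sum>q\<in>UNIV. v $ p * v $ q * S x $ p $ q)" for v x
    by (simp add: inner_vec_def matrix_vector_mult_def sum_distrib_left mult_ac)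
  have pos: "AE x in T. 0 \<le> v \<bullet> (S x *v v)" for v
  proof -
    have i: "integrable T (\<lambda>x. x ^ k * (v \<bullet> (S x *v v)))" "(\<integral>x. x ^ k * (v \<bullet> (S x *v v)) \<partial>T) = mom k v v" for k
    proof -
      have e: "(\<lambda>x. x ^ k * (v \<bullet> (S x *v v))) = (\<lambda>x. \<Sum>p\<in>UNIV. \<Sum>q\<in>UNIV. v $ p * v $ q * (x ^ k * S x $ p $ q))"
        unfolding vSv by (simp add: sum_distrib_left mult_ac)
      show "integrable T (\<lambda>x. x ^ k * (v \<bullet> (S x *v v)))"
        unfolding e by (intro Bochner_Integration.integrable_sum integrable_mult_right Si)
      show "(\<integral>x. x ^ k * (v \<bullet> (S x *v v)) \<partial>T) = mom k v v"
        unfolding e mom_expand[of k v v] by (simp add: Bochner_Integration.integral_sum Bochner_Integration.integrable_sum integrable_mult_right Si)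
    qed
    \<comment> \<open>The form and the chosen density of \<open>v\<close> have the same moments,
      hence agree almost everywhere.\<close>
    have "AE x in T. v \<bullet> (S x *v v) - g v x = 0"
    proof (rule orthogonal_to_monomials[OF T(1)])
      show "integrable T (\<lambda>x. v \<bullet> (S x *v v) - g v x)" using i(1)[of 0] g(3)[of 0 v] by simp
      show "(\<integral>x. x ^ k * (v \<bullet> (S x *v v) - g v x) \<partial>T) = 0" for k
        using i[of k] g(3,4)[of k v] by (simp add: right_diff_distrib)
    qed
    then show ?thesis by eventually_elim (use g(2)[of v] in \<open>metis eq_iff_diff_eq_0\<close>)
  qed
  obtain B :: "(real^'l) set" where B: "countable B" "\<And>X. open X \<Longrightarrow> X \<noteq> {} \<Longrightarrow> \<exists>d\<in>B. d \<in> X"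
    using countable_dense_exists[where 'a = "real^'l"] by blast
  define G where "G = {x. \<forall>v\<in>B. 0 \<le> v \<bullet> (S x *v v)}"
  have Gm[measurable]: "G \<in> sets borel"
  proof -
    have "G = (\<Inter>v\<in>B. {x. 0 \<le> v \<bullet> (S x *v v)}) \<inter> UNIV" by (auto simp: G_def)
    moreover have "{x. 0 \<le> v \<bullet> (S x *v v)} \<in> sets borel" for v
    proof -
      note [measurable] = Sm
      show ?thesis unfolding vSv by measurable
    qed
    ultimately show ?thesis using B(1)
      by (cases "B = {}") (auto intro!: sets.countable_INT'')
  qed
  have AEG: "AE x in T. x \<in> G" unfolding G_def mem_Collect_eq using B(1) pos by (simp add: AE_ball_countable)
  have Gpsd: "psd (S x)" if x: "x \<in> G" for x
  proof -
    have "0 \<le> v \<bullet> (S x *v v)" for v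
    proof (rule ccontr)
      assume n: "\<not> ?thesis"
      have "open {v. v \<bullet> (S x *v v) < 0}"
        by (intro open_Collect_less continuous_intros)
      moreover have "v \<in> {v. v \<bullet> (S x *v v) < 0}" using n by simp
      ultimately obtain d where "d \<in> B" "d \<bullet> (S x *v d) < 0" using B(2)[of "{v. v \<bullet> (S x *v v) < 0}"] by blast
      then show False using x by (auto simp: G_def not_le[symmetric])
    qed
    moreover have "transpose (S x) = S x" using Ssym by (simp add: transpose_def vec_eq_iff)
    ultimately show ?thesis by (simp add: psd_def)
  qed
  \<comment> \<open>Testing a countable dense set of vectors leaves one null set, on which the
    matrix is replaced by 0 to be semidefinite everywhere.\<close>
  define Rm where "Rm x = (if x \<in> G then S x else 0)" for x
  have AE: "AE x in T. Rm x = S x" using AEG by eventually_elim (simp add: Rm_def)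
  show ?thesis
  proof (rule that[OF T(1), of Rm])
    show Rmm: "(\<lambda>x. Rm x $ p $ q) \<in> borel_measurable borel" for p q
    proof -
      note [measurable] = Sm
      have "(\<lambda>x. Rm x $ p $ q) = (\<lambda>x. if x \<in> G then S x $ p $ q else 0)" by (auto simp: Rm_def)
      then show ?thesis by simp
    qed
    show "psd (Rm x)" for x
    proof (cases "x \<in> G")
      case False
      then show ?thesis by (simp add: Rm_def psd_def transpose_def vec_eq_iff)
    qed (simp add: Rm_def Gpsd)
    note [measurable] = Sm Rmm
    have "AE x in T. x ^ k * Rm x $ p $ q = x ^ k * S x $ p $ q" for p q k using AE by eventually_elim simp
    then show "integrable T (\<lambda>x. x ^ k * Rm x $ p $ q)" "(\<integral>x. x ^ k * Rm x $ p $ q \<partial>T) = mom k (axis p 1) (axis q 1)" for p q k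
      using integrable_cong_AE[of "\<lambda>x. x ^ k * Rm x $ p $ q" T "\<lambda>x. x ^ k * S x $ p $ q"] Si[of k p q]
        integral_cong_AE[of "\<lambda>x. x ^ k * Rm x $ p $ q" T "\<lambda>x. x ^ k * S x $ p $ q"] by auto
  qed
qed

end

section \<open>The spectral transform\<close>

lemma vec_measurable_iff:
  fixes F :: "'a \<Rightarrow> complex^'l"
  shows "F \<in> borel_measurable M \<longleftrightarrow> (\<forall>i. (\<lambda>x. F x $ i) \<in> borel_measurable M)"
proof
  assume F: "F \<in> borel_measurable M"
  show "\<forall>i. (\<lambda>x. F x $ i) \<in> borel_measurable M"
  proof
    fix i
    have "(\<lambda>v :: complex^'l. v $ i) \<in> borel_measurable borel"
      by (intro borel_measurable_continuous_onI continuous_intros)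
    from measurable_compose[OF F this] show "(\<lambda>x. F x $ i) \<in> borel_measurable M" .
  qed
next
  assume F: "\<forall>i. (\<lambda>x. F x $ i) \<in> borel_measurable M"
  show "F \<in> borel_measurable M"
    unfolding borel_measurable_euclidean_space[of F]
  proof
    fix e :: "complex^'l" assume "e \<in> Basis"
    then obtain i b where e: "e = axis i b" by (auto simp: Basis_vec_def)
    have [measurable]: "(\<lambda>x. F x $ i) \<in> borel_measurable M" using F by blast
    show "(\<lambda>x. F x \<bullet> e) \<in> borel_measurable M" unfolding e inner_axis by measurable
  qed
qed

lemma cdot_young:
  assumes "e > 0"
  shows "2 * norm (cdot X G) \<le> (norm X)\<^sup>2 / e + e * (norm G)\<^sup>2"
proof -
  have "0 \<le> (norm X - e * norm G)\<^sup>2 / e" using assms by simp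
  also have "\<dots> = (norm X)\<^sup>2 / e + e * (norm G)\<^sup>2 - 2 * (norm X * norm G)"
    using assms by (simp add: power2_eq_square field_simps)
  finally show ?thesis using norm_cdot_le[of X G] by linarith
qed

lemma cdot_measurable [measurable]:
  assumes "F \<in> borel_measurable M" "G \<in> borel_measurable M"
  shows "(\<lambda>x. cdot (F x) (G x)) \<in> borel_measurable M"
proof -
  have [measurable]: "(\<lambda>x. F x $ i) \<in> borel_measurable M" "(\<lambda>x. G x $ i) \<in> borel_measurable M" for i
    using assms by (simp_all add: vec_measurable_iff)
  have "(\<lambda>x. cnj (F x $ i)) \<in> borel_measurable M" for i
    by (rule borel_measurable_continuous_on[OF _ , of cnj]) (auto intro!: continuous_intros)
  then show ?thesis unfolding cdot_def by measurable
qed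

lemma cdot_integrable:
  assumes "F \<in> borel_measurable M" "G \<in> borel_measurable M"
    "integrable M (\<lambda>x. (norm (F x))\<^sup>2)" "integrable M (\<lambda>x. (norm (G x))\<^sup>2)"
  shows "integrable M (\<lambda>x. cdot (F x) (G x))"
proof (rule Bochner_Integration.integrable_bound)
  show "integrable M (\<lambda>x. (norm (F x))\<^sup>2 + (norm (G x))\<^sup>2)" using assms by simp
  show "AE x in M. norm (cdot (F x) (G x)) \<le> norm ((norm (F x))\<^sup>2 + (norm (G x))\<^sup>2)"
  proof (intro AE_I2)
    fix x
    have "2 * norm (cdot (F x) (G x)) \<le> (norm (F x))\<^sup>2 + (norm (G x))\<^sup>2"
      using cdot_young[of 1 "F x" "G x"] by simp
    then have "norm (cdot (F x) (G x)) \<le> (norm (F x))\<^sup>2 + (norm (G x))\<^sup>2"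
      using norm_ge_zero[of "cdot (F x) (G x)"] by linarith
    then show "norm (cdot (F x) (G x)) \<le> norm ((norm (F x))\<^sup>2 + (norm (G x))\<^sup>2)"
      by simp
  qed
qed (use assms in measurable)

lemma norm_sq_integrable_add:
  fixes F G :: "'a \<Rightarrow> complex^'l"
  assumes "F \<in> borel_measurable M" "G \<in> borel_measurable M"
    "integrable M (\<lambda>x. (norm (F x))\<^sup>2)" "integrable M (\<lambda>x. (norm (G x))\<^sup>2)"
  shows "integrable M (\<lambda>x. (norm (F x + G x))\<^sup>2)" "integrable M (\<lambda>x. (norm (F x - G x))\<^sup>2)"
proof -
  have b: "norm ((norm (u + v))\<^sup>2) \<le> norm (2 * (norm u)\<^sup>2 + 2 * (norm v)\<^sup>2)" for u v :: "complex^'l"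
  proof -
    have "(norm (u + v))\<^sup>2 \<le> (norm u + norm v)\<^sup>2" by (rule power_mono[OF norm_triangle_ineq]) simp
    also have "\<dots> \<le> 2 * (norm u)\<^sup>2 + 2 * (norm v)\<^sup>2"
      using sum_squares_bound[of "norm u" "norm v"] by (simp add: power2_sum)
    finally show ?thesis by simp
  qed
  have i: "integrable M (\<lambda>x. 2 * (norm (F x))\<^sup>2 + 2 * (norm (G x))\<^sup>2)" using assms by simp
  show "integrable M (\<lambda>x. (norm (F x + G x))\<^sup>2)"
    by (rule Bochner_Integration.integrable_bound[OF i]) (use assms b in auto)
  show "integrable M (\<lambda>x. (norm (F x - G x))\<^sup>2)"
    by (rule Bochner_Integration.integrable_bound[OF i]) (use assms b[of "F _" "- G _"] in auto)
qed

lemma cmv_measurable: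
  fixes A :: "real \<Rightarrow> real^'l^'l" and F :: "real \<Rightarrow> complex^'l"
  assumes "\<And>p q. (\<lambda>x. A x $ p $ q) \<in> borel_measurable borel" "F \<in> borel_measurable borel"
  shows "(\<lambda>x. cmv (A x) (F x)) \<in> borel_measurable borel"
proof -
  have [measurable]: "(\<lambda>x. F x $ i) \<in> borel_measurable borel" for i
    using assms by (simp add: vec_measurable_iff)
  note [measurable] = assms(1)
  show ?thesis unfolding vec_measurable_iff by (simp add: cmv_def)
qed

lemma smult_measurable:
  fixes F :: "real \<Rightarrow> complex^'l"
  assumes "c \<in> borel_measurable borel" "F \<in> borel_measurable borel"
  shows "(\<lambda>x. c x *s F x) \<in> borel_measurable borel"
  using assms unfolding vec_measurable_iff by (auto intro!: borel_measurable_times)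

locale jacobi_spectral = jacobi_coeff a b C
  for a b :: "nat \<Rightarrow> real^'l^'l" and C :: real +
  fixes T :: "real measure" and Rm :: "real \<Rightarrow> real^'l^'l"
  assumes T_bdd: "bdd_measure (3 * C) T"
    and Rm_meas: "(\<lambda>x. Rm x $ p $ q) \<in> borel_measurable borel"
    and Rm_psd: "psd (Rm x)"
    and Rm_int: "integrable T (\<lambda>x. x ^ k * Rm x $ p $ q)"
    and Rm_mom: "(\<integral>x. x ^ k * Rm x $ p $ q \<partial>T) = mom k (axis p 1) (axis q 1)"
begin

sublocale T: finite_measure T using T_bdd by (simp add: bdd_measure_def)

lemma sets_T [simp, measurable_cong]: "sets T = sets borel" using T_bdd by (simp add: bdd_measure_def)

lemma space_T [simp]: "space T = UNIV" using sets_eq_imp_space_eq[OF sets_T] by simp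

lemma T_supp: "AE x in T. \<bar>x\<bar> \<le> 3 * C" using T_bdd by (simp add: bdd_measure_def)

lemma meas_T: "f \<in> borel_measurable T \<longleftrightarrow> f \<in> borel_measurable borel"
  by (simp cong: measurable_cong_sets)

definition sqi :: "(real \<Rightarrow> complex^'l) \<Rightarrow> bool" where
  "sqi F \<longleftrightarrow> F \<in> borel_measurable borel \<and> integrable T (\<lambda>x. (norm (F x))\<^sup>2)"

lemma sqi_add: "sqi F \<Longrightarrow> sqi G \<Longrightarrow> sqi (\<lambda>x. F x + G x)"
  and sqi_diff: "sqi F \<Longrightarrow> sqi G \<Longrightarrow> sqi (\<lambda>x. F x - G x)"
  using norm_sq_integrable_add[of F T G] by (auto simp: sqi_def meas_T)

lemma sqi_smult: "sqi F \<Longrightarrow> sqi (\<lambda>x. c *s F x)"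
  by (auto simp: sqi_def power_mult_distrib intro: smult_measurable[of "\<lambda>_. c"])

lemma sqi_sum: "(\<And>i. i \<in> I \<Longrightarrow> sqi (F i)) \<Longrightarrow> sqi (\<lambda>x. \<Sum>i\<in>I. F i x)"
proof (induction I rule: infinite_finite_induct)
  case (insert i I)
  then show ?case using sqi_add[of "F i" "\<lambda>x. \<Sum>i\<in>I. F i x"] by simp
qed (simp_all add: sqi_def)

lemma sqi_cdot: "sqi F \<Longrightarrow> sqi G \<Longrightarrow> integrable T (\<lambda>x. cdot (F x) (G x))"
  by (rule cdot_integrable) (auto simp: sqi_def meas_T)

lemma sqi_x: "sqi F \<Longrightarrow> sqi (\<lambda>x. of_real x *s F x)"
proof -
  assume F: "sqi F"
  have m: "(\<lambda>x. complex_of_real x *s F x) \<in> borel_measurable borel"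
    using F by (intro smult_measurable) (auto simp: sqi_def)
  have "integrable T (\<lambda>x. (norm (complex_of_real x *s F x))\<^sup>2)"
  proof (rule Bochner_Integration.integrable_bound)
    show "integrable T (\<lambda>x. (3 * C)\<^sup>2 * (norm (F x))\<^sup>2)" using F by (simp add: sqi_def)
    show "(\<lambda>x. (norm (complex_of_real x *s F x))\<^sup>2) \<in> borel_measurable T"
      unfolding meas_T
      by (rule measurable_compose[OF m]) (intro borel_measurable_continuous_onI continuous_intros)
    show "AE x in T. norm ((norm (complex_of_real x *s F x))\<^sup>2) \<le> norm ((3 * C)\<^sup>2 * (norm (F x))\<^sup>2)"
      using T_supp
    proof eventually_elim
      case (elim x)
      have "\<bar>x\<bar>\<^sup>2 \<le> (3 * C)\<^sup>2" by (rule power_mono[OF elim]) simp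
      then have "x\<^sup>2 * (norm (F x))\<^sup>2 \<le> (3 * C)\<^sup>2 * (norm (F x))\<^sup>2" by (intro mult_right_mono) auto
      then show ?case by (simp add: power_mult_distrib)
    qed
  qed
  then show ?thesis using m by (simp add: sqi_def)
qed

lemma rpf_Rm:
  assumes "real_polynomial_function q"
  shows "\<exists>N0. \<forall>N\<ge>N0. integrable lborel (\<lambda>x. q x * dens N x (axis i 1) (axis j 1)) \<and> integrable T (\<lambda>x. q x * Rm x $ i $ j)
     \<and> (\<integral>x. q x * dens N x (axis i 1) (axis j 1) \<partial>lborel) = (\<integral>x. q x * Rm x $ i $ j \<partial>T)"
proof -
  obtain c n where q: "q = (\<lambda>x. \<Sum>k\<le>n. c k * x ^ k)" using assms by (auto simp: real_polynomial_function_iff_sum)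
  show ?thesis
  proof (intro exI[of _ "Suc n"] allI impI conjI)
    fix N assume N: "Suc n \<le> N"
    have e1: "(\<lambda>x. q x * dens N x (axis i 1) (axis j 1)) = (\<lambda>x. \<Sum>k\<le>n. c k * (x ^ k * dens N x (axis i 1) (axis j 1)))"
      by (simp add: q sum_distrib_right mult.assoc)
    have i1: "integrable lborel (\<lambda>x. c k * (x ^ k * dens N x (axis i 1) (axis j 1)))" if "k \<in> {..n}" for k
      using N that by (intro integrable_mult_right dens_mom) auto
    have e2: "(\<lambda>x. q x * Rm x $ i $ j) = (\<lambda>x. \<Sum>k\<le>n. c k * (x ^ k * Rm x $ i $ j))"
      by (simp add: q sum_distrib_right mult.assoc)
    have i2: "integrable T (\<lambda>x. c k * (x ^ k * Rm x $ i $ j))" if "k \<in> {..n}" for k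
      by (intro integrable_mult_right Rm_int)
    show "integrable lborel (\<lambda>x. q x * dens N x (axis i 1) (axis j 1))" unfolding e1 by (intro Bochner_Integration.integrable_sum i1)
    show "integrable T (\<lambda>x. q x * Rm x $ i $ j)" unfolding e2 by (intro Bochner_Integration.integrable_sum i2)
    show "(\<integral>x. q x * dens N x (axis i 1) (axis j 1) \<partial>lborel) = (\<integral>x. q x * Rm x $ i $ j \<partial>T)"
    proof -
      have "(\<integral>x. (\<Sum>k\<le>n. c k * (x ^ k * Rm x $ i $ j)) \<partial>T) = (\<Sum>k\<le>n. \<integral>x. c k * (x ^ k * Rm x $ i $ j) \<partial>T)"
        by (rule Bochner_Integration.integral_sum) (rule i2)
      then show ?thesis
        unfolding e1 e2 Bochner_Integration.integral_sum[OF i1] using N by (simp add: dens_mom Rm_mom)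
    qed
  qed
qed

definition bm :: "real \<Rightarrow> real^'l^'l" where "bm x = chm (Rm x)"

text \<open>By \<open>Rm_bm\<close>, \<open>Rm\<close> is the transpose of \<open>bm\<close> times
  \<open>bm\<close>. Weighting the matrix polynomials by this factor makes each fibre carry the
  standard inner product, and the columns for all sites \<open>n \<ge> 1\<close> become an
  orthonormal system (\<open>E_orth\<close>).\<close>

definition E :: "nat \<Rightarrow> real \<Rightarrow> real^'l^'l" where "E n x = bm x ** transpose (pm n x)"

lemma Rm_bm: "Rm x $ p $ q = (\<Sum>k\<in>UNIV. bm x $ k $ p * bm x $ k $ q)"
  using chol_sum[OF Rm_psd, of x p q] sum_idx_of[of "\<lambda>k. chol (Rm x) k $ p * chol (Rm x) k $ q", where 'l = 'l]
  by (simp add: bm_def chm_def)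

lemma bm_meas [measurable]: "(\<lambda>x. bm x $ p $ q) \<in> borel_measurable borel"
  unfolding bm_def chm_def using chol_measurable[OF Rm_meas] by simp

lemma E_nth: "E n x $ k $ i = (\<Sum>j\<in>UNIV. bm x $ k $ j * pm n x $ i $ j)"
  by (simp add: E_def matrix_matrix_mult_def transpose_def)

lemma E_meas [measurable]: "(\<lambda>x. E n x $ p $ q) \<in> borel_measurable borel"
proof -
  have [measurable]: "(\<lambda>x. pm n x $ i $ j) \<in> borel_measurable borel" for i j by (rule rpf_meas) (rule pm_poly)
  show ?thesis unfolding E_nth by measurable
qed

lemma E_gram: "(\<Sum>k\<in>UNIV. E n x $ k $ i * E m x $ k $ i') = (\<Sum>j\<in>UNIV. \<Sum>j'\<in>UNIV. pm n x $ i $ j * pm m x $ i' $ j' * Rm x $ j $ j')"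
proof -
  have "(\<Sum>k\<in>UNIV. E n x $ k $ i * E m x $ k $ i')
    = (\<Sum>k\<in>UNIV. \<Sum>j\<in>UNIV. \<Sum>j'\<in>UNIV. pm n x $ i $ j * pm m x $ i' $ j' * (bm x $ k $ j * bm x $ k $ j'))"
    unfolding E_nth sum_product by (simp add: mult_ac)
  also have "\<dots> = (\<Sum>j\<in>UNIV. \<Sum>j'\<in>UNIV. \<Sum>k\<in>UNIV. pm n x $ i $ j * pm m x $ i' $ j' * (bm x $ k $ j * bm x $ k $ j'))"
    by (subst sum.swap, rule sum.cong[OF refl], rule sum.swap)
  finally show ?thesis by (simp add: Rm_bm sum_distrib_left)
qed

text \<open>Parseval for a long chain, carried over to \<open>T\<close>: products of entries of
  \<open>pm\<close> are polynomials, on which the density of a sufficiently long chain and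
  \<open>Rm\<close> have equal integrals. \<open>N\<close> is taken beyond all thresholds and beyond
  both sites.\<close>

lemma E_orth_entries:
  assumes n: "n \<ge> 1" and m: "m \<ge> 1"
  shows "integrable T (\<lambda>x. \<Sum>k\<in>UNIV. E n x $ k $ i * E m x $ k $ i')"
    "(\<integral>x. (\<Sum>k\<in>UNIV. E n x $ k $ i * E m x $ k $ i') \<partial>T) = (if n = m \<and> i = i' then 1 else 0)"
proof -
  define q where "q j j' x = pm n x $ i $ j * pm m x $ i' $ j'" for j j' x
  have "\<forall>p. \<exists>N0. \<forall>N\<ge>N0. integrable lborel (\<lambda>x. q (fst p) (snd p) x * dens N x (axis (fst p) 1) (axis (snd p) 1)) \<and> integrable T (\<lambda>x. q (fst p) (snd p) x * Rm x $ (fst p) $ (snd p))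
     \<and> (\<integral>x. q (fst p) (snd p) x * dens N x (axis (fst p) 1) (axis (snd p) 1) \<partial>lborel) = (\<integral>x. q (fst p) (snd p) x * Rm x $ (fst p) $ (snd p) \<partial>T)"
    unfolding q_def by (intro allI rpf_Rm real_polynomial_function.intros(4) pm_poly)
  from choice[OF this] obtain N0 where N0: "\<And>p N. N \<ge> N0 p \<Longrightarrow> integrable lborel (\<lambda>x. q (fst p) (snd p) x * dens N x (axis (fst p) 1) (axis (snd p) 1)) \<and> integrable T (\<lambda>x. q (fst p) (snd p) x * Rm x $ (fst p) $ (snd p))
     \<and> (\<integral>x. q (fst p) (snd p) x * dens N x (axis (fst p) 1) (axis (snd p) 1) \<partial>lborel) = (\<integral>x. q (fst p) (snd p) x * Rm x $ (fst p) $ (snd p) \<partial>T)"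
    by blast
  define N where "N = (\<Sum>p\<in>UNIV. N0 p) + n + m"
  have NN0: "N \<ge> N0 p" for p unfolding N_def using member_le_sum[of p UNIV N0] by simp
  have N: "N \<ge> 1" "N \<ge> n" "N \<ge> m" using n by (auto simp: N_def)
  have A: "integrable lborel (\<lambda>x. q j j' x * dens N x (axis j 1) (axis j' 1))" "integrable T (\<lambda>x. q j j' x * Rm x $ j $ j')"
     "(\<integral>x. q j j' x * Rm x $ j $ j' \<partial>T) = (\<integral>x. q j j' x * dens N x (axis j 1) (axis j' 1) \<partial>lborel)" for j j'
    using N0[of "(j, j')", OF NN0] by auto
  show "integrable T (\<lambda>x. \<Sum>k\<in>UNIV. E n x $ k $ i * E m x $ k $ i')"
    unfolding E_gram using A(2) unfolding q_def by (intro Bochner_Integration.integrable_sum) auto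
  define s :: "nat \<Rightarrow> 'l \<Rightarrow> nat \<Rightarrow> real^'l" where "s n i = (\<lambda>k. if k = n then axis i 1 else 0)" for n i
  have pvs: "pv N (s n i) x = (\<Sum>j\<in>UNIV. pm n x $ i $ j *\<^sub>R axis j 1)" if "n \<ge> 1" "N \<ge> n" for n and i :: 'l and x
  proof -
    have "pv N (s n i) x = (\<Sum>k\<in>{n}. transpose (pm k x) *v s n i k)"
      unfolding pv_def using that by (intro sum.mono_neutral_right) (auto simp: s_def)
    then have "pv N (s n i) x = transpose (pm n x) *v axis i 1" by (simp add: s_def)
    also have "\<dots> = (\<chi> j. pm n x $ i $ j)" by (simp add: matrix_vector_mult_basis column_def transpose_def)
    also have "\<dots> = (\<Sum>j\<in>UNIV. pm n x $ i $ j *\<^sub>R axis j 1)"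
      using basis_expansion[of "\<chi> j. pm n x $ i $ j"] by (simp add: scalar_mult_eq_scaleR)
    finally show ?thesis .
  qed
  have "(\<integral>x. (\<Sum>k\<in>UNIV. E n x $ k $ i * E m x $ k $ i') \<partial>T) = (\<Sum>j\<in>UNIV. \<Sum>j'\<in>UNIV. \<integral>x. q j j' x * Rm x $ j $ j' \<partial>T)"
    unfolding E_gram q_def[symmetric] using A(2) by (simp add: Bochner_Integration.integral_sum Bochner_Integration.integrable_sum)
  also have "\<dots> = (\<integral>x. (\<Sum>j\<in>UNIV. \<Sum>j'\<in>UNIV. q j j' x * dens N x (axis j 1) (axis j' 1)) \<partial>lborel)"
    unfolding A(3) using A(1) by (simp add: Bochner_Integration.integral_sum Bochner_Integration.integrable_sum)
  also have "\<dots> = (\<integral>x. dens N x (pv N (s n i) x) (pv N (s m i') x) \<partial>lborel)"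
    unfolding pvs[OF n N(2)] pvs[OF m N(3)] using N(1) by (simp add: dens_sum sum_distrib_left q_def mult_ac, subst sum.swap, simp)
  also have "\<dots> = (\<Sum>k=1..N. s n i k \<bullet> s m i' k)" by (rule dens_moment(2)[OF N(1)])
  also have "\<dots> = (\<Sum>k\<in>{n}. s n i k \<bullet> s m i' k)"
    using n N by (intro sum.mono_neutral_right) (auto simp: s_def)
  also have "\<dots> = (if n = m \<and> i = i' then 1 else 0)" by (simp add: s_def inner_axis_axis)
  finally show "(\<integral>x. (\<Sum>k\<in>UNIV. E n x $ k $ i * E m x $ k $ i') \<partial>T) = (if n = m \<and> i = i' then 1 else 0)" .
qed

lemma cdot_E: "cdot (cmv (E n x) u) (cmv (E m x) w)
  = (\<Sum>i\<in>UNIV. \<Sum>i'\<in>UNIV. cnj (u $ i) * w $ i' * of_real (\<Sum>k\<in>UNIV. E n x $ k $ i * E m x $ k $ i'))"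
proof -
  have "cdot (cmv (E n x) u) (cmv (E m x) w) = (\<Sum>k\<in>UNIV. \<Sum>i\<in>UNIV. \<Sum>i'\<in>UNIV. cnj (u $ i) * w $ i' * of_real (E n x $ k $ i * E m x $ k $ i'))"
    by (simp add: cdot_def cmv_def sum_product mult_ac, rule sum.cong[OF refl], rule sum.swap)
  also have "\<dots> = (\<Sum>i\<in>UNIV. \<Sum>i'\<in>UNIV. \<Sum>k\<in>UNIV. cnj (u $ i) * w $ i' * of_real (E n x $ k $ i * E m x $ k $ i'))"
    by (subst sum.swap, rule sum.cong[OF refl], rule sum.swap)
  finally show ?thesis by (simp add: sum_distrib_left)
qed

lemma E_orth:
  assumes "n \<ge> 1" "m \<ge> 1"
  shows "integrable T (\<lambda>x. cdot (cmv (E n x) u) (cmv (E m x) w))"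
    "(\<integral>x. cdot (cmv (E n x) u) (cmv (E m x) w) \<partial>T) = (if n = m then cdot u w else 0)"
proof -
  note EE = E_orth_entries[OF assms]
  have i: "integrable T (\<lambda>x. cnj (u $ i) * w $ i' * complex_of_real (\<Sum>k\<in>UNIV. E n x $ k $ i * E m x $ k $ i'))" for i i'
    by (intro integrable_mult_right integrable_of_real EE)
  show "integrable T (\<lambda>x. cdot (cmv (E n x) u) (cmv (E m x) w))"
    unfolding cdot_E by (intro Bochner_Integration.integrable_sum i)
  have "(\<integral>x. cdot (cmv (E n x) u) (cmv (E m x) w) \<partial>T) = (\<Sum>i\<in>UNIV. \<Sum>i'\<in>UNIV. \<integral>x. cnj (u $ i) * w $ i' * complex_of_real (\<Sum>k\<in>UNIV. E n x $ k $ i * E m x $ k $ i') \<partial>T)"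
    unfolding cdot_E using i by (simp add: Bochner_Integration.integral_sum Bochner_Integration.integrable_sum del: of_real_sum)
  also have "\<dots> = (\<Sum>i\<in>UNIV. \<Sum>i'\<in>UNIV. cnj (u $ i) * w $ i' * (if n = m \<and> i = i' then 1 else 0))"
    by (intro sum.cong refl, subst integral_mult_right_zero, subst integral_complex_of_real, subst EE(2)) simp
  also have "\<dots> = (if n = m then cdot u w else 0)"
    by (auto simp: cdot_def if_distrib cong: if_cong)
  finally show "(\<integral>x. cdot (cmv (E n x) u) (cmv (E m x) w) \<partial>T) = (if n = m then cdot u w else 0)" .
qed

lemma E_sqi:
  assumes "n \<ge> 1"
  shows "sqi (\<lambda>x. cmv (E n x) u)"
proof -
  have "integrable T (\<lambda>x. Re (cdot (cmv (E n x) u) (cmv (E n x) u)))"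
    using E_orth(1)[OF assms assms, of u u] by (rule integrable_Re)
  then show ?thesis unfolding sqi_def cdot_self by (simp add: cmv_measurable E_meas del: of_real_power)
qed

lemma E_row: "of_real x *s cmv (E (Suc n) x) u = cmv (E n x) (cmv (a n) u) + cmv (E (Suc (Suc n)) x) (cmv (a (Suc n)) u) + cmv (E (Suc n) x) (cmv (b (Suc n)) u)"
proof -
  have t: "transpose (A + B) = transpose A + transpose B" for A B :: "real^'l^'l"
    by (simp add: transpose_def vec_eq_iff)
  have "x *\<^sub>R transpose (pm (Suc n) x) = transpose (pm n x) ** a n + transpose (pm (Suc (Suc n)) x) ** a (Suc n) + transpose (pm (Suc n) x) ** b (Suc n)"
    unfolding transpose_scalar[symmetric] pm_row t by (simp add: matrix_transpose_mul sym_a sym_b del: pm.simps)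
  then have "cmv (bm x) (cmv (x *\<^sub>R transpose (pm (Suc n) x)) u) = cmv (bm x) (cmv (transpose (pm n x) ** a n + transpose (pm (Suc (Suc n)) x) ** a (Suc n) + transpose (pm (Suc n) x) ** b (Suc n)) u)"
    by (simp only:)
  then show ?thesis by (simp add: E_def cmv_mult del: pm.simps)
qed

lemma E_supp: "bm x $ k = 0 \<Longrightarrow> cmv (E n x) u $ k = 0"
  by (simp add: cmv_def E_nth)

text \<open>\<open>F\<close> is the spectral transform of \<open>\<psi>\<close>, described by its
  coefficients. It is a relation because \<open>F\<close> is determined only almost everywhere. The
  support condition singles out the part of each fibre that the rows of \<open>bm\<close> can
  detect, and thereby gives uniqueness.\<close>

definition tf :: "(nat \<Rightarrow> complex^'l) \<Rightarrow> (real \<Rightarrow> complex^'l) \<Rightarrow> bool" where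
  "tf \<psi> F \<longleftrightarrow> sqi F \<and> (\<forall>x k. bm x $ k = 0 \<longrightarrow> F x $ k = 0) \<and>
     (\<forall>n\<ge>1. \<forall>u. (\<integral>x. cdot (cmv (E n x) u) (F x) \<partial>T) = cdot u (\<psi> n))"

lemma tf_linear:
  assumes "tf \<psi> F" "tf \<phi> G"
  shows "tf (\<lambda>n. c *s \<psi> n + d *s \<phi> n) (\<lambda>x. c *s F x + d *s G x)"
  unfolding tf_def
proof (intro conjI allI impI)
  show "sqi (\<lambda>x. c *s F x + d *s G x)" using assms by (intro sqi_add sqi_smult) (auto simp: tf_def)
  show "bm x $ k = 0 \<Longrightarrow> (c *s F x + d *s G x) $ k = 0" for x k using assms by (simp add: tf_def)
  fix n :: nat and u :: "complex^'l" assume n: "n \<ge> 1"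
  have "integrable T (\<lambda>x. cdot (cmv (E n x) u) (F x))" "integrable T (\<lambda>x. cdot (cmv (E n x) u) (G x))"
    using assms n by (auto intro!: sqi_cdot E_sqi simp: tf_def)
  then show "(\<integral>x. cdot (cmv (E n x) u) (c *s F x + d *s G x) \<partial>T) = cdot u (c *s \<psi> n + d *s \<phi> n)"
    using assms n by (simp add: tf_def)
qed

lemma bm_independent:
  fixes v :: "complex^'l"
  assumes z: "\<And>j. (\<Sum>k\<in>UNIV. of_real (bm x $ k $ j) * v $ k) = 0" and s: "\<And>k. bm x $ k = 0 \<Longrightarrow> v $ k = 0"
  shows "v = 0"
proof -
  define c where "c m = v $ (enum_idx m)" for m
  have "c m = 0" if m: "m < CARD('l)" for m
  proof (rule chol_independent[OF Rm_psd _ _ m])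
    fix p
    have "(\<Sum>k<CARD('l). c k * complex_of_real (chol (Rm x) k $ p)) = (\<Sum>k\<in>UNIV. c (idx_of (k::'l)) * of_real (chol (Rm x) (idx_of k) $ p))"
      by (rule sum_idx_of[symmetric])
    also have "\<dots> = (\<Sum>k\<in>UNIV. of_real (bm x $ k $ p) * v $ k)"
      by (simp add: c_def bm_def chm_def mult.commute)
    finally show "(\<Sum>k<CARD('l). c k * complex_of_real (chol (Rm x) k $ p)) = 0" using z by simp
    fix k assume "k < CARD('l)" "chol (Rm x) k = 0"
    then have "bm x $ (enum_idx k) = 0" by (simp add: bm_def chm_def)
    then show "c k = 0" using s by (simp add: c_def)
  qed
  then have "v $ k = 0" for k using idx_of_less[of k] unfolding c_def by (metis enum_idx_of)
  then show ?thesis by (simp add: vec_eq_iff)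
qed

text \<open>Against \<open>x ^ k\<close> times a column of \<open>bm\<close>, the difference
  integrates to a finite combination of coefficients (\<open>pv_mono\<close>), hence to 0.
  Orthogonality to all monomials makes the pairing with every column vanish, and the support
  condition leaves only 0 on the fibre.\<close>

lemma tf_unique:
  assumes F: "tf \<psi> F" and G: "tf \<phi> G" and eq: "\<And>n. n \<ge> 1 \<Longrightarrow> \<psi> n = \<phi> n"
  shows "AE x in T. F x = G x"
proof -
  define H where "H x = F x - G x" for x
  have H: "sqi H" unfolding H_def using F G by (intro sqi_diff) (auto simp: tf_def)
  have Hm: "(\<lambda>x. H x $ k) \<in> borel_measurable borel" for k using H by (simp add: sqi_def vec_measurable_iff)
  have Hs: "bm x $ k = 0 \<Longrightarrow> H x $ k = 0" for x k using F G by (simp add: tf_def H_def)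
  have Hz: "(\<integral>x. cdot (cmv (E n x) u) (H x) \<partial>T) = 0" if n: "n \<ge> 1" for n u
  proof -
    have "integrable T (\<lambda>x. cdot (cmv (E n x) u) (F x))" "integrable T (\<lambda>x. cdot (cmv (E n x) u) (G x))"
      using F G n by (auto intro!: sqi_cdot E_sqi simp: tf_def)
    then show ?thesis using F G n eq by (simp add: tf_def H_def)
  qed
  define h where "h j x = (\<Sum>k\<in>UNIV. complex_of_real (bm x $ k $ j) * H x $ k)" for j x
  have xk: "integrable T (\<lambda>x. of_real (x ^ k) * h j x)" "(\<integral>x. of_real (x ^ k) * h j x \<partial>T) = 0" for k j
  proof -
    let ?p = "mseq k (axis j 1)"
    have e: "complex_of_real (x ^ k) * h j x = (\<Sum>n=1..Suc k. cdot (cmv (E n x) (cvec (?p n))) (H x))" for x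
    proof -
      have "(\<Sum>n=1..Suc k. cdot (cmv (E n x) (cvec (?p n))) (H x)) = cdot (cmv (bm x) (cvec (pv (Suc k) ?p x))) (H x)"
        by (simp only: E_def cmv_mult cmv_cvec[of "transpose _"] pv_def cvec_sum cmv_sum cdot_sum)
      also have "\<dots> = of_real (x ^ k) * cdot (cmv (bm x) (cvec (axis j 1))) (H x)"
        by (subst pv_mono) simp_all
      also have "cvec (axis j 1) = axis j 1" by (simp add: vec_eq_iff axis_def)
      also have "cmv (bm x) (axis j 1) = (\<chi> k. of_real (bm x $ k $ j))"
        by (simp add: vec_eq_iff cmv_def axis_def if_distrib cong: if_cong)
      finally show ?thesis by (simp add: h_def cdot_def)
    qed
    have i: "integrable T (\<lambda>x. cdot (cmv (E n x) (cvec (?p n))) (H x))" if "n \<in> {1..Suc k}" for n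
      using that by (intro sqi_cdot E_sqi H) auto
    show "integrable T (\<lambda>x. of_real (x ^ k) * h j x)" unfolding e by (intro Bochner_Integration.integrable_sum i)
    show "(\<integral>x. of_real (x ^ k) * h j x \<partial>T) = 0"
      unfolding e by (subst Bochner_Integration.integral_sum[OF i]) (assumption, rule sum.neutral, rule ballI, rule Hz, simp)
  qed
  have hz: "AE x in T. h j x = 0" for j
  proof -
    have ih: "integrable T (h j)" using xk(1)[of 0 j] by simp
    have "AE x in T. Re (h j x) = 0"
    proof (rule orthogonal_to_monomials[OF T_bdd])
      show "integrable T (\<lambda>x. Re (h j x))" using ih by (rule integrable_Re)
      have "(\<integral>x. Re (of_real (x ^ k) * h j x) \<partial>T) = 0" for k using Bochner_Integration.integral_Re[OF xk(1)[of k j]] xk(2)[of k j] by simp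
      then show "(\<integral>x. x ^ k * Re (h j x) \<partial>T) = 0" for k by (simp del: of_real_power)
    qed
    moreover have "AE x in T. Im (h j x) = 0"
    proof (rule orthogonal_to_monomials[OF T_bdd])
      show "integrable T (\<lambda>x. Im (h j x))" using ih by (rule integrable_Im)
      have "(\<integral>x. Im (of_real (x ^ k) * h j x) \<partial>T) = 0" for k using Bochner_Integration.integral_Im[OF xk(1)[of k j]] xk(2)[of k j] by simp
      then show "(\<integral>x. x ^ k * Im (h j x) \<partial>T) = 0" for k by (simp del: of_real_power)
    qed
    ultimately show ?thesis by eventually_elim (simp add: complex_eq_iff)
  qed
  have "AE x in T. \<forall>j. h j x = 0" using hz by (simp add: AE_all_countable)
  then show ?thesis
  proof eventually_elim
    case (elim x)
    have "H x = 0" by (rule bm_independent) (use elim Hs in \<open>auto simp: h_def\<close>)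
    then show ?case by (simp add: H_def)
  qed
qed

lemma tf_jop:
  assumes F: "tf \<psi> F" and 0: "\<psi> 0 = 0"
  shows "tf (jop a b \<psi>) (\<lambda>x. of_real x *s F x)"
  unfolding tf_def
proof (intro conjI allI impI)
  show "sqi (\<lambda>x. of_real x *s F x)" using F by (intro sqi_x) (simp add: tf_def)
  show "bm x $ k = 0 \<Longrightarrow> (of_real x *s F x) $ k = 0" for x k using F by (simp add: tf_def)
  fix n :: nat and u :: "complex^'l" assume "n \<ge> 1"
  then obtain m where n: "n = Suc m" by (cases n) auto
  have sF: "sqi F" using F by (simp add: tf_def)
  have Fn: "integrable T (\<lambda>x. cdot (cmv (E k x) w) (F x)) \<and> (\<integral>x. cdot (cmv (E k x) w) (F x) \<partial>T) = cdot w (\<psi> k)" for k w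
  proof (cases "k = 0")
    case True
    have "E 0 x = 0" for x by (simp add: vec_eq_iff E_nth)
    then show ?thesis using True 0 by simp
  next
    case False
    then show ?thesis using F sqi_cdot[OF E_sqi sF, of k w] by (simp add: tf_def)
  qed
  have "cdot (cmv (E n x) u) (of_real x *s F x) = cdot (of_real x *s cmv (E n x) u) (F x)" for x by simp
  then have "(\<integral>x. cdot (cmv (E n x) u) (of_real x *s F x) \<partial>T) = cdot (cmv (a m) u) (\<psi> m) + cdot (cmv (a (Suc m)) u) (\<psi> (Suc (Suc m))) + cdot (cmv (b (Suc m)) u) (\<psi> (Suc m))"
    unfolding n E_row using Fn by (simp add: Bochner_Integration.integral_add)
  also have "\<dots> = cdot u (jop a b \<psi> n)"
    by (simp add: n jop_def jrow_def cdot_cmv sym_a sym_b)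
  finally show "(\<integral>x. cdot (cmv (E n x) u) (of_real x *s F x) \<partial>T) = cdot u (jop a b \<psi> n)" .
qed

definition psum :: "(nat \<Rightarrow> complex^'l) \<Rightarrow> nat set \<Rightarrow> real \<Rightarrow> complex^'l" where
  "psum \<psi> I x = (\<Sum>n\<in>I. cmv (E n x) (\<psi> n))"

lemma psum_sqi: "I \<subseteq> {1..} \<Longrightarrow> sqi (psum \<psi> I)"
  unfolding psum_def by (intro sqi_sum E_sqi) auto

lemma psum_norm:
  assumes I: "finite I" "I \<subseteq> {1..}"
  shows "(\<integral>x. (norm (psum \<psi> I x))\<^sup>2 \<partial>T) = (\<Sum>n\<in>I. (norm (\<psi> n))\<^sup>2)"
proof -
  have ge: "n \<ge> 1" if "n \<in> I" for n using I that by auto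
  have "complex_of_real (\<integral>x. (norm (psum \<psi> I x))\<^sup>2 \<partial>T) = (\<integral>x. cdot (psum \<psi> I x) (psum \<psi> I x) \<partial>T)"
    by (simp only: cdot_self integral_complex_of_real)
  also have "\<dots> = (\<Sum>n\<in>I. \<Sum>m\<in>I. \<integral>x. cdot (cmv (E n x) (\<psi> n)) (cmv (E m x) (\<psi> m)) \<partial>T)"
  proof -
    have i: "integrable T (\<lambda>x. cdot (cmv (E n x) (\<psi> n)) (cmv (E m x) (\<psi> m)))" if "n \<in> I" "m \<in> I" for n m
      by (rule E_orth(1)) (use ge that in auto)
    have i2: "integrable T (\<lambda>x. \<Sum>m\<in>I. cdot (cmv (E n x) (\<psi> n)) (cmv (E m x) (\<psi> m)))" if "n \<in> I" for n
      by (intro Bochner_Integration.integrable_sum i that)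
    have "cdot (psum \<psi> I x) (psum \<psi> I x) = (\<Sum>n\<in>I. \<Sum>m\<in>I. cdot (cmv (E n x) (\<psi> n)) (cmv (E m x) (\<psi> m)))" for x
      unfolding psum_def by (simp, subst sum.swap, simp)
    then show ?thesis by (simp only:) (simp add: Bochner_Integration.integral_sum[OF i2] Bochner_Integration.integral_sum i)
  qed
  also have "\<dots> = (\<Sum>n\<in>I. \<Sum>m\<in>I. if n = m then of_real ((norm (\<psi> n))\<^sup>2) else 0)"
    by (intro sum.cong refl) (use ge in \<open>auto simp: E_orth(2) cdot_self\<close>)
  also have "\<dots> = of_real (\<Sum>n\<in>I. (norm (\<psi> n))\<^sup>2)" using I by simp
  finally show ?thesis by (simp only: of_real_eq_iff)
qed

lemma psum_inner:
  assumes I: "I \<subseteq> {1..}" and G: "tf \<phi> G"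
  shows "(\<integral>x. cdot (psum \<psi> I x) (G x) \<partial>T) = (\<Sum>n\<in>I. cdot (\<psi> n) (\<phi> n))"
proof -
  have i: "integrable T (\<lambda>x. cdot (cmv (E n x) (\<psi> n)) (G x))" if "n \<in> I" for n
    using I that G by (intro sqi_cdot E_sqi) (auto simp: tf_def)
  show ?thesis unfolding psum_def cdot_sum
    by (subst Bochner_Integration.integral_sum[OF i]) (use I G in \<open>auto simp: tf_def subset_eq intro!: sum.cong\<close>)
qed

lemma cdot_integral_small:
  assumes "sqi X" "sqi G" "e > 0" "(\<integral>x. (norm (X x))\<^sup>2 \<partial>T) \<le> e\<^sup>2"
  shows "norm (\<integral>x. cdot (X x) (G x) \<partial>T) \<le> e * (1 + (\<integral>x. (norm (G x))\<^sup>2 \<partial>T))"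
proof -
  let ?A = "\<integral>x. (norm (X x))\<^sup>2 \<partial>T" and ?B = "\<integral>x. (norm (G x))\<^sup>2 \<partial>T"
  have i: "integrable T (\<lambda>x. (norm (X x))\<^sup>2)" "integrable T (\<lambda>x. (norm (G x))\<^sup>2)" using assms by (auto simp: sqi_def)
  have B: "?B \<ge> 0" by (intro integral_nonneg_AE) auto
  have "norm (\<integral>x. cdot (X x) (G x) \<partial>T) \<le> (\<integral>x. norm (cdot (X x) (G x)) \<partial>T)" by (rule integral_norm_bound)
  also have "\<dots> \<le> (\<integral>x. ((norm (X x))\<^sup>2 / e + e * (norm (G x))\<^sup>2) / 2 \<partial>T)"
    using cdot_young[OF assms(3)] i by (intro integral_mono integrable_norm sqi_cdot assms) (auto simp: field_simps)
  also have "\<dots> = (?A / e + e * ?B) / 2" using i by simp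
  also have "\<dots> \<le> (e + e * ?B) / 2"
    using assms(3,4) by (simp add: power2_eq_square field_simps)
  also have "\<dots> \<le> e * (1 + ?B)" using assms(3) B by (simp add: field_simps)
  finally show ?thesis .
qed

text \<open>Orthonormality turns square summability of \<open>\<psi>\<close> into the Cauchy
  property of the partial sums.\<close>

lemma tf_approx:
  assumes "\<psi> \<in> l2seq"
  obtains F where "tf \<psi> F" "\<And>e. e > 0 \<Longrightarrow> \<exists>N. \<forall>n\<ge>N. (\<integral>x. (norm (psum \<psi> {1..n} x - F x))\<^sup>2 \<partial>T) \<le> e"
proof -
  have summ: "summable (\<lambda>n. (norm (\<psi> n))\<^sup>2)" and p0: "\<psi> 0 = 0" using assms by (auto simp: l2seq_def)
  let ?S = "\<lambda>n. psum \<psi> {1..n}"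
  have Sm: "?S n \<in> borel_measurable T" for n using psum_sqi[of "{1..n}" \<psi>] by (auto simp: sqi_def meas_T)
  have diff: "(\<integral>\<^sup>+x. ennreal ((norm (?S m x - ?S n x))\<^sup>2) \<partial>T) = ennreal (\<Sum>k\<in>{n<..m}. (norm (\<psi> k))\<^sup>2)" if "n \<le> m" for m n
  proof -
    have e: "?S m x - ?S n x = psum \<psi> {n<..m} x" for x
    proof -
      have "{1..m} = {1..n} \<union> {n<..m}" using that by auto
      then have "?S m x = ?S n x + psum \<psi> {n<..m} x"
        unfolding psum_def by (simp only:) (rule sum.union_disjoint, auto)
      then show ?thesis by simp
    qed
    have I: "finite {n<..m}" "{n<..m} \<subseteq> {1..}" by auto
    show ?thesis unfolding e
      by (subst nn_integral_eq_integral) (use psum_sqi[OF I(2)] psum_norm[OF I] in \<open>auto simp: sqi_def\<close>)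
  qed
  have cauchy: "\<exists>N. \<forall>m\<ge>N. \<forall>n\<ge>N. (\<integral>\<^sup>+x. ennreal ((norm (?S m x - ?S n x))\<^sup>2) \<partial>T) \<le> ennreal e" if e: "e > 0" for e
  proof -
    obtain N where N: "\<And>m n. n \<ge> N \<Longrightarrow> norm (\<Sum>k\<in>{n..<m}. (norm (\<psi> k))\<^sup>2) < e"
      using summ[unfolded summable_Cauchy] e by blast
    have main: "(\<integral>\<^sup>+x. ennreal ((norm (?S m x - ?S n x))\<^sup>2) \<partial>T) \<le> ennreal e" if "n \<le> m" "n \<ge> N" for m n
    proof -
      have "{n<..m} = {Suc n..<Suc m}" by auto
      then have "(\<Sum>k\<in>{n<..m}. (norm (\<psi> k))\<^sup>2) < e" using N[of "Suc n" "Suc m"] that by simp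
      then show ?thesis unfolding diff[OF that(1)] by (intro ennreal_leI) simp
    qed
    have "(\<integral>\<^sup>+x. ennreal ((norm (?S m x - ?S n x))\<^sup>2) \<partial>T) \<le> ennreal e" if "n \<ge> N" "m \<ge> N" for m n
    proof (cases "n \<le> m")
      case False
      then show ?thesis using main[of m n] that by (simp add: norm_minus_commute)
    qed (use main that in simp)
    then show ?thesis by blast
  qed
  obtain F0 where F0: "F0 \<in> borel_measurable T"
    "\<And>e. e > 0 \<Longrightarrow> \<exists>N. \<forall>n\<ge>N. (\<integral>\<^sup>+x. ennreal ((norm (?S n x - F0 x))\<^sup>2) \<partial>T) \<le> ennreal e"
    using L2_complete[of T ?S, OF T.finite_measure_axioms Sm cauchy] by blast
  \<comment> \<open>An L2 limit may violate the support condition on a null set. Cutting it off does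
    not increase the distance to the partial sums, which satisfy the condition.\<close>
  define F where "F x = (\<chi> k. if bm x $ k = 0 then 0 else F0 x $ k)" for x
  have bz: "Measurable.pred borel (\<lambda>x. bm x $ k = 0)" for k
    unfolding vec_eq_iff by measurable
  have Fm: "F \<in> borel_measurable borel"
  proof -
    have [measurable]: "(\<lambda>x. F0 x $ k) \<in> borel_measurable borel" for k using F0(1) by (simp add: meas_T vec_measurable_iff)
    show ?thesis unfolding vec_measurable_iff F_def using bz by simp
  qed
  have Ssupp: "bm x $ k = 0 \<Longrightarrow> ?S n x $ k = 0" for n x k by (simp add: psum_def E_supp)
  have le: "norm (?S n x - F x) \<le> norm (?S n x - F0 x)" for n x
    unfolding norm_vec_def by (intro L2_set_mono) (auto simp: F_def Ssupp simp del: One_nat_def)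
  have conv: "\<exists>N. \<forall>n\<ge>N. (\<integral>\<^sup>+x. ennreal ((norm (?S n x - F x))\<^sup>2) \<partial>T) \<le> ennreal e" if e: "e > 0" for e
  proof -
    obtain N where "\<forall>n\<ge>N. (\<integral>\<^sup>+x. ennreal ((norm (?S n x - F0 x))\<^sup>2) \<partial>T) \<le> ennreal e" using F0(2)[OF e] by blast
    moreover have "(\<integral>\<^sup>+x. ennreal ((norm (?S n x - F x))\<^sup>2) \<partial>T) \<le> (\<integral>\<^sup>+x. ennreal ((norm (?S n x - F0 x))\<^sup>2) \<partial>T)" for n
      by (intro nn_integral_mono ennreal_leI power_mono le) simp
    ultimately show ?thesis using order_trans by blast
  qed
  have Ssqi: "sqi (?S n)" for n by (rule psum_sqi) auto
  have Smb: "?S n \<in> borel_measurable borel" for n using Ssqi by (simp add: sqi_def)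
  have Fsqi: "sqi F"
  proof -
    obtain N where N: "(\<integral>\<^sup>+x. ennreal ((norm (?S N x - F x))\<^sup>2) \<partial>T) \<le> ennreal 1" using conv[of 1] by auto
    have "sqi (\<lambda>x. ?S N x - F x)" unfolding sqi_def
    proof
      show m: "(\<lambda>x. ?S N x - F x) \<in> borel_measurable borel" using Smb Fm by (rule borel_measurable_diff)
      show "integrable T (\<lambda>x. (norm (?S N x - F x))\<^sup>2)"
        by (rule integrableI_nonneg) (use m N in \<open>auto simp: meas_T intro: le_less_trans\<close>)
    qed
    from sqi_diff[OF Ssqi[of N] this] show ?thesis by simp
  qed
  have conv': "\<exists>N. \<forall>n\<ge>N. (\<integral>x. (norm (?S n x - F x))\<^sup>2 \<partial>T) \<le> e" if e: "e > 0" for e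
  proof -
    have "integrable T (\<lambda>x. (norm (?S n x - F x))\<^sup>2)" for n using sqi_diff[OF Ssqi Fsqi] by (simp add: sqi_def)
    then have "(\<integral>\<^sup>+x. ennreal ((norm (?S n x - F x))\<^sup>2) \<partial>T) = ennreal (\<integral>x. (norm (?S n x - F x))\<^sup>2 \<partial>T)" for n
      by (intro nn_integral_eq_integral) auto
    then show ?thesis using conv[OF e] e by simp
  qed
  have "tf \<psi> F" unfolding tf_def
  proof (intro conjI allI impI Fsqi)
    show "bm x $ k = 0 \<Longrightarrow> F x $ k = 0" for x k by (simp add: F_def)
    fix n :: nat and u :: "complex^'l" assume n: "n \<ge> 1"
    define G where "G = (\<lambda>x. cmv (E n x) u)"
    have G: "sqi G" unfolding G_def by (rule E_sqi[OF n])
    define B where "B = 1 + (\<integral>x. (norm (G x))\<^sup>2 \<partial>T)"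
    have B: "B \<ge> 1" by (simp add: B_def)
    have Sn: "(\<integral>x. cdot (?S m x) (G x) \<partial>T) = cdot (\<psi> n) u" if "m \<ge> n" for m
    proof -
      have i: "integrable T (\<lambda>x. cdot (cmv (E k x) (\<psi> k)) (G x))" if "k \<in> {1..m}" for k
        using that by (intro sqi_cdot E_sqi G) auto
      have "(\<integral>x. cdot (?S m x) (G x) \<partial>T) = (\<Sum>k=1..m. \<integral>x. cdot (cmv (E k x) (\<psi> k)) (G x) \<partial>T)"
        unfolding psum_def cdot_sum by (rule Bochner_Integration.integral_sum[OF i])
      also have "\<dots> = (\<Sum>k=1..m. if k = n then cdot (\<psi> k) u else 0)"
        unfolding G_def by (intro sum.cong refl) (use n in \<open>auto simp: E_orth(2)\<close>)
      finally show ?thesis using that n by simp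
    qed
    have small: "norm (cdot (\<psi> n) u - (\<integral>x. cdot (F x) (G x) \<partial>T)) \<le> e * B" if e: "e > 0" for e
    proof -
      obtain N where N: "\<forall>n\<ge>N. (\<integral>x. (norm (?S n x - F x))\<^sup>2 \<partial>T) \<le> e\<^sup>2" using conv'[of "e\<^sup>2"] e by auto
      let ?m = "max N n"
      have "(\<integral>x. cdot (?S ?m x - F x) (G x) \<partial>T) = cdot (\<psi> n) u - (\<integral>x. cdot (F x) (G x) \<partial>T)"
        using Sn[of ?m] sqi_cdot[OF Ssqi G] sqi_cdot[OF Fsqi G] by simp
      then show ?thesis using cdot_integral_small[OF sqi_diff[OF Ssqi[of ?m] Fsqi] G e] N by (simp add: B_def)
    qed
    have "norm (cdot (\<psi> n) u - (\<integral>x. cdot (F x) (G x) \<partial>T)) \<le> 0"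
    proof (rule field_le_epsilon)
      fix e :: real assume "e > 0"
      then show "norm (cdot (\<psi> n) u - (\<integral>x. cdot (F x) (G x) \<partial>T)) \<le> 0 + e"
        using small[of "e / B"] B by simp
    qed
    then have "(\<integral>x. cdot (F x) (G x) \<partial>T) = cdot (\<psi> n) u" by simp
    then have "cnj (\<integral>x. cdot (F x) (G x) \<partial>T) = cnj (cdot (\<psi> n) u)" by simp
    then show "(\<integral>x. cdot (cmv (E n x) u) (F x) \<partial>T) = cdot u (\<psi> n)"
      unfolding Bochner_Integration.integral_cnj[symmetric] G_def by (simp add: cdot_commute[symmetric])
  qed
  then show ?thesis using conv' by (rule that)
qed

text \<open>The second vector enters only through its transform, so the formula applies directly to
  the powers \<open>(H ^^ n) \<psi>\<close> in the moments of a spectral measure.\<close>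

lemma tf_inner:
  assumes p: "\<psi> \<in> l2seq" and F: "tf \<psi> F" and G: "tf \<phi> G"
  shows "l2inner \<psi> \<phi> = (\<integral>x. cdot (F x) (G x) \<partial>T)"
proof -
  obtain F' where F': "tf \<psi> F'" "\<And>e. e > 0 \<Longrightarrow> \<exists>N. \<forall>n\<ge>N. (\<integral>x. (norm (psum \<psi> {1..n} x - F' x))\<^sup>2 \<partial>T) \<le> e"
    using tf_approx[OF p] by blast
  have s: "sqi F'" "sqi G" "sqi F" "\<And>n. sqi (psum \<psi> {1..n})" using F' G F by (auto simp: tf_def intro: psum_sqi)
  have eq: "(\<integral>x. cdot (F x) (G x) \<partial>T) = (\<integral>x. cdot (F' x) (G x) \<partial>T)"
  proof (rule integral_cong_AE)
    show "AE x in T. cdot (F x) (G x) = cdot (F' x) (G x)"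
      using tf_unique[OF F F'(1)] by auto
  qed (use s in \<open>auto simp: sqi_def meas_T intro!: cdot_measurable\<close>)
  define B where "B = 1 + (\<integral>x. (norm (G x))\<^sup>2 \<partial>T)"
  have B: "B \<ge> 1" by (simp add: B_def)
  have "(\<lambda>n. \<Sum>k=1..n. cdot (\<psi> k) (\<phi> k)) \<longlonglongrightarrow> (\<integral>x. cdot (F' x) (G x) \<partial>T)"
  proof (rule LIMSEQ_I)
    fix r :: real assume r: "r > 0"
    define e where "e = r / (2 * B)"
    have e: "e > 0" "e * B < r" using r B by (auto simp: e_def)
    obtain N where N: "\<forall>n\<ge>N. (\<integral>x. (norm (psum \<psi> {1..n} x - F' x))\<^sup>2 \<partial>T) \<le> e\<^sup>2" using F'(2)[of "e\<^sup>2"] e by auto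
    have "norm ((\<Sum>k=1..n. cdot (\<psi> k) (\<phi> k)) - (\<integral>x. cdot (F' x) (G x) \<partial>T)) < r" if "n \<ge> N" for n
    proof -
      have "(\<integral>x. cdot (psum \<psi> {1..n} x - F' x) (G x) \<partial>T) = (\<Sum>k=1..n. cdot (\<psi> k) (\<phi> k)) - (\<integral>x. cdot (F' x) (G x) \<partial>T)"
        using psum_inner[of "{1..n}" \<phi> G \<psi>] G sqi_cdot[OF s(4) s(2)] sqi_cdot[OF s(1,2)] by simp
      moreover have "norm (\<integral>x. cdot (psum \<psi> {1..n} x - F' x) (G x) \<partial>T) \<le> e * B"
        unfolding B_def by (rule cdot_integral_small[OF sqi_diff[OF s(4,1)] s(2) e(1)]) (use N that in blast)
      ultimately show ?thesis using e by simp
    qed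
    then show "\<exists>N. \<forall>n\<ge>N. norm ((\<Sum>k=1..n. cdot (\<psi> k) (\<phi> k)) - (\<integral>x. cdot (F' x) (G x) \<partial>T)) < r" by blast
  qed
  moreover have "(\<Sum>k=1..n. cdot (\<psi> k) (\<phi> k)) = (\<Sum>k<Suc n. cdot (\<psi> k) (\<phi> k))" for n
  proof -
    have "{..<Suc n} = insert 0 {1..n}" by auto
    then show ?thesis using p by (simp add: l2seq_def)
  qed
  ultimately have "(\<lambda>n. \<Sum>k<Suc n. cdot (\<psi> k) (\<phi> k)) \<longlonglongrightarrow> (\<integral>x. cdot (F' x) (G x) \<partial>T)"
    by (simp only:)
  then have "(\<lambda>n. cdot (\<psi> n) (\<phi> n)) sums (\<integral>x. cdot (F' x) (G x) \<partial>T)"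
    unfolding sums_def by (rule LIMSEQ_imp_Suc)
  then show ?thesis unfolding eq l2inner_def cdot_def[symmetric] by (rule sums_unique[symmetric])
qed

lemma tf_norm:
  assumes p: "\<psi> \<in> l2seq" and F: "tf \<psi> F"
  shows "l2normsq \<psi> = (\<integral>x. (norm (F x))\<^sup>2 \<partial>T)"
proof -
  have "summable (\<lambda>n. (norm (\<psi> n))\<^sup>2)" using p by (simp add: l2seq_def)
  then have "(\<lambda>n. complex_of_real ((norm (\<psi> n))\<^sup>2)) sums of_real (l2normsq \<psi>)"
    unfolding l2normsq_def by (intro sums_of_real summable_sums)
  then have "of_real (l2normsq \<psi>) = l2inner \<psi> \<psi>"
    unfolding l2inner_def cdot_def[symmetric] cdot_self by (rule sums_unique)
  also have "\<dots> = of_real (\<integral>x. (norm (F x))\<^sup>2 \<partial>T)"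
    unfolding tf_inner[OF p F F] cdot_self integral_complex_of_real ..
  finally show ?thesis by (simp only: of_real_eq_iff)
qed

text \<open>The coefficients of \<open>F\<close> define the vector; Bessel's inequality for the
  system \<open>E\<close> makes them square summable.\<close>

lemma tf_surj:
  assumes F: "sqi F" "\<And>x k. bm x $ k = 0 \<Longrightarrow> F x $ k = 0"
  obtains \<psi> where "\<psi> \<in> l2seq" "tf \<psi> F"
proof -
  define \<psi> where "\<psi> n = (if n = 0 then 0 else \<chi> i. \<integral>x. cdot (cmv (E n x) (axis i 1)) (F x) \<partial>T)" for n
  have tf: "tf \<psi> F" unfolding tf_def
  proof (intro conjI allI impI)
    fix n :: nat and u :: "complex^'l" assume n: "n \<ge> 1"
    have "cmv (E n x) u = (\<Sum>i\<in>UNIV. u $ i *s cmv (E n x) (axis i 1))" for x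
      by (subst vec_expand[of u]) simp
    then have e: "cdot (cmv (E n x) u) (F x) = (\<Sum>i\<in>UNIV. cnj (u $ i) * cdot (cmv (E n x) (axis i 1)) (F x))" for x
      by simp
    have i: "integrable T (\<lambda>x. cdot (cmv (E n x) (axis i 1)) (F x))" for i
      using n F by (intro sqi_cdot E_sqi) auto
    show "(\<integral>x. cdot (cmv (E n x) u) (F x) \<partial>T) = cdot u (\<psi> n)"
      unfolding e using i n by (simp add: Bochner_Integration.integral_sum cdot_def[of u] \<psi>_def)
  qed (use F in auto)
  have bessel: "(\<Sum>n\<in>I. (norm (\<psi> n))\<^sup>2) \<le> (\<integral>x. (norm (F x))\<^sup>2 \<partial>T)" if I: "finite I" "I \<subseteq> {1..}" for I
  proof -
    have s: "sqi (psum \<psi> I)" by (rule psum_sqi[OF I(2)])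
    have i: "integrable T (\<lambda>x. (norm (F x))\<^sup>2)" "integrable T (\<lambda>x. (norm (psum \<psi> I x))\<^sup>2)" "integrable T (\<lambda>x. cdot (psum \<psi> I x) (F x))"
      using F s sqi_cdot[OF s F(1)] by (auto simp: sqi_def)
    have e: "(norm (F x - psum \<psi> I x))\<^sup>2 = (norm (F x))\<^sup>2 - 2 * Re (cdot (psum \<psi> I x) (F x)) + (norm (psum \<psi> I x))\<^sup>2" for x
    proof -
      have "complex_of_real ((norm (F x - psum \<psi> I x))\<^sup>2) = cdot (F x) (F x) - (cdot (psum \<psi> I x) (F x) + cnj (cdot (psum \<psi> I x) (F x))) + cdot (psum \<psi> I x) (psum \<psi> I x)"
        unfolding cdot_self[symmetric] by (simp add: cdot_commute[symmetric])
      also have "\<dots> = complex_of_real ((norm (F x))\<^sup>2 - 2 * Re (cdot (psum \<psi> I x) (F x)) + (norm (psum \<psi> I x))\<^sup>2)"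
        by (simp add: cdot_self complex_add_cnj)
      finally show ?thesis by (simp only: of_real_eq_iff)
    qed
    have "0 \<le> (\<integral>x. (norm (F x - psum \<psi> I x))\<^sup>2 \<partial>T)" by (intro integral_nonneg_AE) auto
    also have "\<dots> = (\<integral>x. (norm (F x))\<^sup>2 \<partial>T) - 2 * Re (\<integral>x. cdot (psum \<psi> I x) (F x) \<partial>T) + (\<integral>x. (norm (psum \<psi> I x))\<^sup>2 \<partial>T)"
      unfolding e using i by simp
    also have "(\<integral>x. cdot (psum \<psi> I x) (F x) \<partial>T) = of_real (\<Sum>n\<in>I. (norm (\<psi> n))\<^sup>2)"
      unfolding psum_inner[OF I(2) tf] by (simp add: cdot_self)
    finally show ?thesis unfolding psum_norm[OF I] by simp
  qed
  have "(\<Sum>n<m. (norm (\<psi> n))\<^sup>2) \<le> (\<integral>x. (norm (F x))\<^sup>2 \<partial>T)" for m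
  proof -
    have "(\<Sum>n<m. (norm (\<psi> n))\<^sup>2) = (\<Sum>n\<in>{1..<m}. (norm (\<psi> n))\<^sup>2)"
      by (rule sum.mono_neutral_right) (auto simp: \<psi>_def)
    also have "\<dots> \<le> (\<integral>x. (norm (F x))\<^sup>2 \<partial>T)" by (rule bessel) auto
    finally show ?thesis .
  qed
  then have "summable (\<lambda>n. (norm (\<psi> n))\<^sup>2)" by (intro summableI_nonneg_bounded) auto
  then have "\<psi> \<in> l2seq" by (simp add: l2seq_def \<psi>_def)
  then show ?thesis using tf by (rule that)
qed

end

section \<open>The absolutely continuous part and its multiplicity\<close>

lemma homogeneous_solution:
  fixes A :: "nat \<Rightarrow> 'i \<Rightarrow> 'f::field"
  assumes "finite I" "n < card I"
  shows "\<exists>c. (\<exists>i\<in>I. c i \<noteq> 0) \<and> (\<forall>k<n. (\<Sum>i\<in>I. c i * A k i) = 0)"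
  using assms
proof (induction n arbitrary: I A)
  case 0
  then have "I \<noteq> {}" by auto
  then show ?case by (intro exI[of _ "\<lambda>_. 1"]) auto
next
  case (Suc n)
  show ?case
  proof (cases "\<forall>i\<in>I. A n i = 0")
    case True
    obtain c where "\<exists>i\<in>I. c i \<noteq> 0" "\<forall>k<n. (\<Sum>i\<in>I. c i * A k i) = 0"
      using Suc.IH[of I A] Suc.prems by auto
    then show ?thesis using True by (intro exI[of _ c]) (auto simp: less_Suc_eq)
  next
    case False
    then obtain p where p: "p \<in> I" "A n p \<noteq> 0" by blast
    define J where "J = I - {p}"
    have J: "finite J" "n < card J" "I = insert p J" "p \<notin> J" using Suc.prems p by (auto simp: J_def)
    obtain c where c: "\<exists>i\<in>J. c i \<noteq> 0" "\<forall>k<n. (\<Sum>i\<in>J. c i * (A k i - A k p * A n i / A n p)) = 0"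
      using Suc.IH[OF J(1,2), of "\<lambda>k i. A k i - A k p * A n i / A n p"] by blast
    define s where "s = (\<Sum>i\<in>J. c i * A n i) / A n p"
    define d where "d i = (if i = p then - s else c i)" for i
    have dJ: "(\<Sum>i\<in>I. d i * A k i) = - s * A k p + (\<Sum>i\<in>J. c i * A k i)" for k
    proof -
      have "(\<Sum>i\<in>J. d i * A k i) = (\<Sum>i\<in>J. c i * A k i)" using J(4) by (intro sum.cong) (auto simp: d_def)
      then show ?thesis unfolding J(3) using J by (simp add: d_def)
    qed
    have "(\<Sum>i\<in>I. d i * A k i) = 0" if "k < Suc n" for k
    proof (cases "k = n")
      case True
      then show ?thesis unfolding dJ using p by (simp add: s_def)
    next
      case False
      then have "(\<Sum>i\<in>J. c i * (A k i - A k p * A n i / A n p)) = 0" using c(2) that by simp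
      then show ?thesis unfolding dJ s_def
        by (simp add: right_diff_distrib sum_subtractf sum_divide_distrib sum_distrib_left sum_distrib_right mult_ac)
    qed
    moreover have "\<exists>i\<in>I. d i \<noteq> 0" using c(1) J by (auto simp: d_def)
    ultimately show ?thesis by blast
  qed
qed

text \<open>\<open>S\<close> is a Lebesgue null set of maximal mass, the union of a maximising
  sequence. A null set with positive mass outside \<open>S\<close> would enlarge it, so the
  remainder is absolutely continuous. Its density is set to 0 on \<open>S\<close>.\<close>

lemma lebesgue_decomposition:
  fixes M :: "real measure"
  assumes fin: "finite_measure M" and sM: "sets M = sets borel"
  obtains S w where "S \<in> sets borel" "emeasure lborel S = 0" "w \<in> borel_measurable borel" "\<And>x. 0 \<le> w x"
    "\<And>x. x \<in> S \<Longrightarrow> w x = 0" "density M (indicator (- S)) = density lborel (\<lambda>x. ennreal (w x))"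
proof -
  interpret finite_measure M by fact
  note [measurable_cong] = sM
  let ?Z = "{A :: real set. A \<in> null_sets lborel}"
  have ne: "?Z \<noteq> {}" by (auto intro: exI[of _ "{}"])
  obtain f :: "nat \<Rightarrow> ennreal" where f: "range f \<subseteq> emeasure M ` ?Z" "Sup (emeasure M ` ?Z) = (SUP n. f n)"
    using ennreal_SUP_countable_SUP[OF ne, of "emeasure M"] by (elim exE conjE)
  have "\<forall>n. \<exists>A. A \<in> null_sets lborel \<and> f n = emeasure M A" using f(1) by auto
  from choice[OF this] obtain A where A: "\<And>n. A n \<in> null_sets lborel" "\<And>n. f n = emeasure M (A n)" by blast
  define S where "S = (\<Union>n. A n)"
  have S: "S \<in> null_sets lborel" unfolding S_def by (intro null_sets_UN A)
  have Ab: "A n \<in> sets borel" for n using A(1)[of n] by (auto simp: null_sets_def)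
  have Sb[measurable]: "S \<in> sets borel" using S by (auto simp: null_sets_def)
  have max: "emeasure M B \<le> emeasure M S" if "B \<in> null_sets lborel" for B
  proof -
    have "emeasure M B \<le> (SUP n. f n)" unfolding f(2)[symmetric] by (rule SUP_upper) (use that in simp)
    also have "\<dots> \<le> emeasure M S" unfolding A(2) by (intro SUP_least emeasure_mono) (auto simp: S_def sM intro: Sb[unfolded S_def])
    finally show ?thesis .
  qed
  define M' where "M' = density M (indicator (- S))"
  have sM': "sets M' = sets borel" by (simp add: M'_def sM)
  have fM': "finite_measure M'"
  proof (rule finite_measureI)
    have "emeasure M' (space M') = (\<integral>\<^sup>+x. indicator (- S) x * indicator (space M) x \<partial>M)"
      unfolding M'_def by (subst emeasure_density) (auto simp: sM sets_eq_imp_space_eq[OF sM])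
    also have "\<dots> \<le> (\<integral>\<^sup>+x. 1 \<partial>M)" by (intro nn_integral_mono) (auto simp: indicator_def)
    finally have "emeasure M' (space M') \<le> emeasure M (space M)" by simp
    then show "emeasure M' (space M') \<noteq> \<infinity>" by (auto simp: top_unique)
  qed
  have ac: "absolutely_continuous lborel M'"
    unfolding absolutely_continuous_def
  proof
    fix B :: "real set" assume B: "B \<in> null_sets lborel"
    then have Bb[measurable]: "B \<in> sets borel" by (auto simp: null_sets_def)
    have "emeasure M (B - S) + emeasure M S = emeasure M (B \<union> S)"
      by (subst plus_emeasure) (auto simp: sM Un_commute)
    also have "\<dots> \<le> emeasure M S" by (rule max) (use B S in auto)
    finally have "emeasure M (B - S) + emeasure M S \<le> 0 + emeasure M S" by simp
    then have "emeasure M (B - S) = 0"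
      using emeasure_eq_measure[of S] emeasure_eq_measure[of "B - S"] measure_nonneg[of M "B - S"] by (simp add: ennreal_plus[symmetric] measure_le_0_iff del: ennreal_plus)
    moreover have "emeasure M' B = emeasure M (B - S)"
    proof -
      have "emeasure M' B = (\<integral>\<^sup>+x. indicator (- S) x * indicator B x \<partial>M)" unfolding M'_def by (rule emeasure_density) (auto simp: sM)
      also have "\<dots> = (\<integral>\<^sup>+x. indicator (B - S) x \<partial>M)" by (intro nn_integral_cong) (auto simp: indicator_def)
      finally show ?thesis by (simp add: sM)
    qed
    ultimately show "B \<in> null_sets M'" by (simp add: null_sets_def sM')
  qed
  define w where "w x = enn2real (RN_deriv lborel M' x)" for x
  interpret M': finite_measure M' by (rule fM')
  have "AE x in lborel. RN_deriv lborel M' x \<noteq> \<infinity>"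
    by (rule sigma_finite_measure.RN_deriv_finite[OF sigma_finite_lborel M'.sigma_finite_measure_axioms ac]) (simp add: sM')
  then have w: "w \<in> borel_measurable lborel" "AE x in lborel. RN_deriv lborel M' x = ennreal (w x)" "\<And>x. 0 \<le> w x"
    by (auto simp: w_def[abs_def] less_top elim!: eventually_mono)
  have "M' = density lborel (RN_deriv lborel M')" using sigma_finite_measure.density_RN_deriv[OF sigma_finite_lborel ac] by (simp add: sM')
  also have "\<dots> = density lborel (\<lambda>x. ennreal (w x))" using w by (intro density_cong) auto
  finally have eq: "M' = density lborel (\<lambda>x. ennreal (w x))" .
  define w' where "w' x = (if x \<in> S then 0 else w x)" for x
  have wm[measurable]: "w \<in> borel_measurable borel" using w(1) by simp
  have w'm: "w' \<in> borel_measurable borel" unfolding w'_def by measurable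
  have "AE x in lborel. x \<notin> S" using S by (rule AE_not_in)
  then have "density lborel (\<lambda>x. ennreal (w x)) = density lborel (\<lambda>x. ennreal (w' x))"
    using w'm by (intro density_cong) (auto simp: w'_def elim!: eventually_mono)
  then show ?thesis using eq S w(3) w'm Sb unfolding M'_def
    by (intro that[of S w']) (auto simp: w'_def null_sets_def)
qed

section \<open>The absolutely continuous subspace under the spectral transform\<close>

locale jacobi_ac = jacobi_spectral a b C T Rm
  for a b :: "nat \<Rightarrow> real^'l^'l" and C T Rm +
  fixes S :: "real set" and w :: "real \<Rightarrow> real"
  assumes S_borel [measurable]: "S \<in> sets borel" and S_null: "emeasure lborel S = 0"
    and w_meas [measurable]: "w \<in> borel_measurable borel" and w_nonneg: "0 \<le> w x"
    and w_S: "x \<in> S \<Longrightarrow> w x = 0"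
    and T_ac: "density T (indicator (- S)) = density lborel (\<lambda>x. ennreal (w x))"
begin

abbreviation "H \<equiv> jop a b"

lemma AE_T_lborel:
  assumes "AE x in T. P x"
  shows "AE x in lborel. w x > 0 \<longrightarrow> P x"
proof -
  have "AE x in density T (indicator (- S)). P x"
    using assms by (subst AE_density) (auto elim!: eventually_mono)
  then show ?thesis unfolding T_ac by (subst (asm) AE_density) auto
qed

lemma nn_T_ac:
  assumes f [measurable]: "f \<in> borel_measurable borel" and z: "AE x in T. x \<in> S \<longrightarrow> f x = 0"
  shows "(\<integral>\<^sup>+x. f x \<partial>T) = (\<integral>\<^sup>+x. ennreal (w x) * f x \<partial>lborel)"
proof -
  have "(\<integral>\<^sup>+x. f x \<partial>T) = (\<integral>\<^sup>+x. indicator (- S) x * f x \<partial>T)"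
    by (rule nn_integral_cong_AE) (use z in \<open>auto simp: indicator_def elim!: eventually_mono\<close>)
  also have "\<dots> = (\<integral>\<^sup>+x. f x \<partial>density T (indicator (- S)))"
    by (subst nn_integral_density) auto
  also have "\<dots> = (\<integral>\<^sup>+x. ennreal (w x) * f x \<partial>lborel)"
    unfolding T_ac by (subst nn_integral_density) auto
  finally show ?thesis .
qed

lemma tf_exists: "\<psi> \<in> l2seq \<Longrightarrow> \<exists>F. tf \<psi> F"
  by (rule tf_approx) (auto intro: exI)

lemma tf_coeff_unique:
  assumes "tf \<psi> F" "tf \<phi> F" "n \<ge> 1"
  shows "\<psi> n = \<phi> n"
proof -
  have "(\<integral>x. cdot (cmv (E n x) (axis i 1)) (F x) \<partial>T) = cdot (axis i 1) (\<psi> n)"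
    "(\<integral>x. cdot (cmv (E n x) (axis i 1)) (F x) \<partial>T) = cdot (axis i 1) (\<phi> n)" for i
    using assms unfolding tf_def by blast+
  then have "cdot (axis i 1) (\<psi> n) = cdot (axis i 1) (\<phi> n)" for i by metis
  then show ?thesis by (simp add: vec_eq_iff)
qed

lemma jop_zero [simp]: "H \<psi> 0 = 0" by (simp add: jop_def)

lemma tf_power:
  assumes F: "tf \<psi> F" and 0: "\<psi> 0 = 0"
  shows "tf ((H ^^ n) \<psi>) (\<lambda>x. of_real (x ^ n) *s F x)"
proof -
  have "tf ((H ^^ n) \<psi>) (\<lambda>x. of_real (x ^ n) *s F x) \<and> (H ^^ n) \<psi> 0 = 0"
  proof (induction n)
    case (Suc n)
    then show ?case using tf_jop[of "(H ^^ n) \<psi>" "\<lambda>x. of_real (x ^ n) *s F x"] by simp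
  qed (use assms in simp)
  then show ?thesis ..
qed

lemma spectral_measure_tf:
  assumes p: "\<psi> \<in> l2seq" and F: "tf \<psi> F"
  shows "spectral_measure_of H \<psi> (density T (\<lambda>x. ennreal ((norm (F x))\<^sup>2)))"
    "bdd_measure (3 * C) (density T (\<lambda>x. ennreal ((norm (F x))\<^sup>2)))"
proof -
  let ?\<nu> = "density T (\<lambda>x. ennreal ((norm (F x))\<^sup>2))"
  have Fm[measurable]: "F \<in> borel_measurable borel" and Fi: "integrable T (\<lambda>x. (norm (F x))\<^sup>2)"
    using F by (auto simp: tf_def sqi_def)
  have fin: "finite_measure ?\<nu>"
    using Fi by (intro finite_measureI) (simp add: emeasure_density nn_integral_eq_integral)
  show bdd: "bdd_measure (3 * C) ?\<nu>"
    using fin T_supp by (auto simp: bdd_measure_def AE_density elim!: eventually_mono)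
  have 0: "\<psi> 0 = 0" using p by (simp add: l2seq_def)
  show "spectral_measure_of H \<psi> ?\<nu>"
    unfolding spectral_measure_of_def
  proof (intro conjI allI fin)
    fix n
    show "integrable ?\<nu> (\<lambda>x. x ^ n)" by (rule bdd_integrable_rpf[OF bdd real_polynomial_function_power[OF rpf_id]])
    have "l2inner \<psi> ((H ^^ n) \<psi>) = (\<integral>x. complex_of_real (x ^ n * (norm (F x))\<^sup>2) \<partial>T)"
      unfolding tf_inner[OF p F tf_power[OF F 0]] by (simp add: cdot_self)
    also have "\<dots> = complex_of_real (\<integral>x. (norm (F x))\<^sup>2 *\<^sub>R x ^ n \<partial>T)"
      by (subst integral_complex_of_real) (simp add: mult.commute)
    also have "(\<integral>x. (norm (F x))\<^sup>2 *\<^sub>R x ^ n \<partial>T) = (\<integral>x. x ^ n \<partial>?\<nu>)"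
      by (subst integral_density) auto
    finally show "l2inner \<psi> ((H ^^ n) \<psi>) = complex_of_real (\<integral>x. x ^ n \<partial>?\<nu>)" .
  qed simp
qed

text \<open>The spectral measure of \<open>\<psi>\<close> is \<open>T\<close> weighted by the
  squared norm of its transform, and moments determine it; so it is absolutely continuous exactly
  when the transform vanishes on the singular set \<open>S\<close>.\<close>

lemma ac_subspace_iff:
  assumes F: "tf \<psi> F" and p: "\<psi> \<in> l2seq"
  shows "\<psi> \<in> ac_subspace H \<longleftrightarrow> (AE x in T. x \<in> S \<longrightarrow> F x = 0)"
proof -
  let ?\<nu> = "density T (\<lambda>x. ennreal ((norm (F x))\<^sup>2))"
  note sp = spectral_measure_tf[OF p F]
  have Fm[measurable]: "F \<in> borel_measurable borel" using F by (auto simp: tf_def sqi_def)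
  show ?thesis
  proof
    assume "\<psi> \<in> ac_subspace H"
    then obtain \<mu> where \<mu>: "spectral_measure_of H \<psi> \<mu>" "absolutely_continuous lborel \<mu>" by (auto simp: ac_subspace_def)
    have "\<mu> = ?\<nu>"
    proof (rule moment_determinate[OF _ _ sp(2)])
      fix k
      have "complex_of_real (\<integral>x. x ^ k \<partial>\<mu>) = complex_of_real (\<integral>x. x ^ k \<partial>?\<nu>)"
        using \<mu>(1) sp(1) unfolding spectral_measure_of_def by metis
      then show "(\<integral>x. x ^ k \<partial>\<mu>) = (\<integral>x. x ^ k \<partial>?\<nu>)" by simp
    qed (use \<mu>(1) in \<open>auto simp: spectral_measure_of_def\<close>)
    then have "emeasure ?\<nu> S = 0"
    proof -
      have "S \<in> null_sets lborel" using S_null by (simp add: null_sets_def)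
      then have "S \<in> null_sets ?\<nu>" using \<mu>(2) \<open>\<mu> = ?\<nu>\<close> unfolding absolutely_continuous_def by blast
      then show ?thesis by (simp add: null_sets_def)
    qed
    then have "(\<integral>\<^sup>+x. ennreal ((norm (F x))\<^sup>2) * indicator S x \<partial>T) = 0"
      by (simp add: emeasure_density)
    then have "AE x in T. ennreal ((norm (F x))\<^sup>2) * indicator S x = 0"
      by (subst (asm) nn_integral_0_iff_AE) auto
    then show "AE x in T. x \<in> S \<longrightarrow> F x = 0" by eventually_elim (auto simp: indicator_def)
  next
    assume z: "AE x in T. x \<in> S \<longrightarrow> F x = 0"
    have "absolutely_continuous lborel ?\<nu>"
      unfolding absolutely_continuous_def
    proof
      fix B :: "real set" assume "B \<in> null_sets lborel"
      then have B[measurable]: "B \<in> sets borel" and B0: "AE x in lborel. x \<notin> B" by (auto simp: null_sets_def intro: AE_not_in)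
      have "emeasure ?\<nu> B = (\<integral>\<^sup>+x. ennreal ((norm (F x))\<^sup>2) * indicator B x \<partial>T)" by (simp add: emeasure_density)
      also have "\<dots> = (\<integral>\<^sup>+x. ennreal (w x) * (ennreal ((norm (F x))\<^sup>2) * indicator B x) \<partial>lborel)"
        by (rule nn_T_ac) (use z in \<open>auto elim!: eventually_mono\<close>)
      also have "\<dots> = (\<integral>\<^sup>+(x::real). 0 \<partial>lborel)"
      proof (rule nn_integral_cong_AE)
        show "AE x in lborel. ennreal (w x) * (ennreal ((norm (F x))\<^sup>2) * indicator B x) = 0"
          using B0 by eventually_elim simp
      qed
      finally show "B \<in> null_sets ?\<nu>" by (simp add: null_sets_def)
    qed
    then show "\<psi> \<in> ac_subspace H" using sp(1) p by (auto simp: ac_subspace_def)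
  qed
qed

text \<open>Membership is defined by existence of a measure, from which linearity is not visible; it
  is visible in the transform. Surjectivity of the transform provides a square-summable vector,
  which has to coincide with the combination.\<close>

lemma ac_linear:
  assumes "\<psi> \<in> ac_subspace H" "\<phi> \<in> ac_subspace H"
  shows "(\<lambda>n. c *s \<psi> n + d *s \<phi> n) \<in> ac_subspace H"
proof -
  have p: "\<psi> \<in> l2seq" "\<phi> \<in> l2seq" using assms by (auto simp: ac_subspace_def)
  obtain F G where F: "tf \<psi> F" and G: "tf \<phi> G" using tf_exists p by meson
  let ?X = "\<lambda>x. c *s F x + d *s G x"
  note t = tf_linear[OF F G, of c d]
  obtain \<xi> where \<xi>: "\<xi> \<in> l2seq" "tf \<xi> ?X" using tf_surj[of ?X] t by (auto simp: tf_def)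
  have "\<xi> n = c *s \<psi> n + d *s \<phi> n" for n
  proof (cases "n = 0")
    case True
    then show ?thesis using \<xi>(1) p by (simp add: l2seq_def)
  next
    case False
    then show ?thesis by (intro tf_coeff_unique[OF \<xi>(2) t]) simp
  qed
  then have e: "(\<lambda>n. c *s \<psi> n + d *s \<phi> n) = \<xi>" by auto
  have "AE x in T. x \<in> S \<longrightarrow> ?X x = 0"
    using assms ac_subspace_iff[OF F p(1)] ac_subspace_iff[OF G p(2)] by (auto elim!: eventually_elim2)
  then show ?thesis unfolding e using ac_subspace_iff[OF \<xi>(2,1)] by simp
qed

lemma ac_jop:
  assumes "\<psi> \<in> ac_subspace H"
  shows "H \<psi> \<in> ac_subspace H"
proof -
  have p: "\<psi> \<in> l2seq" and p0: "\<psi> 0 = 0" using assms by (auto simp: ac_subspace_def l2seq_def)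
  obtain F where F: "tf \<psi> F" using tf_exists[OF p] by blast
  let ?X = "\<lambda>x. of_real x *s F x"
  note t = tf_jop[OF F p0]
  obtain \<xi> where \<xi>: "\<xi> \<in> l2seq" "tf \<xi> ?X" using tf_surj[of ?X] t by (auto simp: tf_def)
  have "\<xi> n = H \<psi> n" for n
  proof (cases "n = 0")
    case True
    then show ?thesis using \<xi>(1) by (simp add: l2seq_def)
  next
    case False
    then show ?thesis by (intro tf_coeff_unique[OF \<xi>(2) t]) simp
  qed
  then have e: "H \<psi> = \<xi>" by auto
  have "AE x in T. x \<in> S \<longrightarrow> ?X x = 0"
    using assms ac_subspace_iff[OF F p] by (auto elim!: eventually_mono)
  then show ?thesis unfolding e using ac_subspace_iff[OF \<xi>(2,1)] by simp
qed

text \<open>The set where the absolutely continuous density matrix, \<open>w\<close> times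
  \<open>Rm\<close>, has rank greater than \<open>j\<close>.\<close>

definition acA :: "nat \<Rightarrow> real set" where
  "acA j = {x. j < CARD('l) \<and> w x > 0 \<and> chol (Rm x) j \<noteq> 0}"

lemma acA_borel [measurable]: "acA j \<in> sets borel"
proof -
  have [measurable]: "(\<lambda>x. chol (Rm x) j $ p) \<in> borel_measurable borel" for p by (rule chol_measurable[OF Rm_meas])
  show ?thesis unfolding acA_def vec_eq_iff by measurable
qed

lemma acA_mono: "acA (Suc j) \<subseteq> acA j"
  using chol_initial[OF Rm_psd, of _ j "Suc j"] by (auto simp: acA_def)

definition tfc :: "(nat \<Rightarrow> complex^'l) \<Rightarrow> real \<Rightarrow> complex^'l" where
  "tfc \<psi> = (SOME F. tf \<psi> F)"

lemma tfc: "tf \<psi> F \<Longrightarrow> tf \<psi> (tfc \<psi>)"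
  unfolding tfc_def by (rule someI[where P = "tf \<psi>"])

text \<open>The factor \<open>sqrt (w x)\<close> converts norms with respect to \<open>T\<close> off
  the singular set into norms with respect to Lebesgue measure.\<close>

definition acU :: "(nat \<Rightarrow> complex^'l) \<Rightarrow> nat \<Rightarrow> real \<Rightarrow> complex" where
  "acU \<psi> j x = (if j < CARD('l) then of_real (sqrt (w x)) * tfc \<psi> x $ enum_idx j else 0)"

lemma sum_enum_idx: "(\<Sum>j<CARD('l). f (enum_idx j :: 'l)) = (\<Sum>i\<in>UNIV. f i)"
  using sum_idx_of[of "\<lambda>j. f (enum_idx j)", where 'l = 'l] by simp

lemma acU_off: "tf \<psi> F \<Longrightarrow> x \<notin> acA j \<Longrightarrow> acU \<psi> j x = 0"
proof -
  assume F: "tf \<psi> F" and x: "x \<notin> acA j"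
  show ?thesis
  proof (cases "j < CARD('l) \<and> w x > 0")
    case True
    then have "chol (Rm x) j = 0" using x by (simp add: acA_def)
    then have "bm x $ enum_idx j = 0" using True by (simp add: bm_def chm_def)
    then have "tfc \<psi> x $ enum_idx j = 0" using tfc[OF F] by (simp add: tf_def)
    then show ?thesis by (simp add: acU_def)
  next
    case False
    then show ?thesis using w_nonneg[of x] by (auto simp: acU_def)
  qed
qed

lemma acU_meas: "tf \<psi> F \<Longrightarrow> acU \<psi> j \<in> borel_measurable borel"
proof -
  assume F: "tf \<psi> F"
  have "(\<lambda>x. tfc \<psi> x $ i) \<in> borel_measurable borel" for i
    using tfc[OF F] by (simp add: tf_def sqi_def vec_measurable_iff)
  then have "(\<lambda>x. of_real (sqrt (w x)) * tfc \<psi> x $ i) \<in> borel_measurable borel" for i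
    by (intro borel_measurable_times) auto
  then show ?thesis by (cases "j < CARD('l)") (simp_all add: acU_def[abs_def])
qed

lemma acU_norm:
  assumes p: "\<psi> \<in> ac_subspace H"
  shows "ennreal (l2normsq \<psi>) = (\<Sum>j. \<integral>\<^sup>+ x. ennreal ((norm (acU \<psi> j x))\<^sup>2) \<partial>lborel)"
proof -
  have pl: "\<psi> \<in> l2seq" using p by (simp add: ac_subspace_def)
  obtain F0 where F0: "tf \<psi> F0" using tf_exists[OF pl] by blast
  note F = tfc[OF F0]
  have Fm[measurable]: "tfc \<psi> \<in> borel_measurable borel" and Fi: "integrable T (\<lambda>x. (norm (tfc \<psi> x))\<^sup>2)"
    using F by (auto simp: tf_def sqi_def)
  note [measurable] = acU_meas[OF F0]
  have "(\<Sum>j. \<integral>\<^sup>+ x. ennreal ((norm (acU \<psi> j x))\<^sup>2) \<partial>lborel) = (\<Sum>j<CARD('l). \<integral>\<^sup>+ x. ennreal ((norm (acU \<psi> j x))\<^sup>2) \<partial>lborel)"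
    by (rule suminf_finite) (auto simp: acU_def)
  also have "\<dots> = (\<integral>\<^sup>+ x. (\<Sum>j<CARD('l). ennreal ((norm (acU \<psi> j x))\<^sup>2)) \<partial>lborel)"
    by (rule nn_integral_sum[symmetric]) simp
  also have "\<dots> = (\<integral>\<^sup>+ x. ennreal (w x) * ennreal ((norm (tfc \<psi> x))\<^sup>2) \<partial>lborel)"
  proof (rule nn_integral_cong)
    fix x
    have "(\<Sum>j<CARD('l). (norm (acU \<psi> j x))\<^sup>2) = (\<Sum>j<CARD('l). w x * (norm (tfc \<psi> x $ enum_idx j))\<^sup>2)"
      using w_nonneg[of x] by (intro sum.cong) (auto simp: acU_def norm_mult power_mult_distrib)
    also have "\<dots> = w x * (norm (tfc \<psi> x))\<^sup>2"
      by (simp add: sum_enum_idx[of "\<lambda>i. w x * (norm (tfc \<psi> x $ i))\<^sup>2"] norm_vec_sq sum_distrib_left)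
    finally show "(\<Sum>j<CARD('l). ennreal ((norm (acU \<psi> j x))\<^sup>2)) = ennreal (w x) * ennreal ((norm (tfc \<psi> x))\<^sup>2)"
      using w_nonneg[of x] by (simp add: ennreal_mult sum_ennreal)
  qed
  also have "\<dots> = (\<integral>\<^sup>+ x. ennreal ((norm (tfc \<psi> x))\<^sup>2) \<partial>T)"
    by (rule nn_T_ac[symmetric]) (use p ac_subspace_iff[OF F pl] in \<open>auto elim!: eventually_mono\<close>)
  also have "\<dots> = ennreal (l2normsq \<psi>)"
    unfolding tf_norm[OF pl F] by (rule nn_integral_eq_integral[OF Fi]) simp
  finally show ?thesis by simp
qed

theorem ac_mult_rep_acA: "ac_mult_rep H acA"
  unfolding ac_mult_rep_def
proof (intro conjI allI exI[of _ acU] ballI)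
  show "acA j \<in> sets borel" "acA (Suc j) \<subseteq> acA j" for j by (rule acA_borel acA_mono)+
next
  fix \<psi> assume p: "\<psi> \<in> ac_subspace H"
  then have pl: "\<psi> \<in> l2seq" by (simp add: ac_subspace_def)
  obtain F0 where F0: "tf \<psi> F0" using tf_exists[OF pl] by blast
  show n: "ennreal (l2normsq \<psi>) = (\<Sum>j. \<integral>\<^sup>+ x. ennreal ((norm (acU \<psi> j x))\<^sup>2) \<partial>lborel)" by (rule acU_norm[OF p])
  show "acU \<psi> \<in> dsum_L2 acA" unfolding dsum_L2_def mem_Collect_eq n[symmetric]
    using acU_meas[OF F0] acU_off[OF F0] by simp
  fix j
  have "AE x in T. tfc (H \<psi>) x = of_real x *s tfc \<psi> x"
    using tf_jop[OF tfc[OF F0]] pl by (intro tf_unique[of "H \<psi>" _ "H \<psi>"] tfc[of "H \<psi>"]) (auto simp: l2seq_def)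
  then have "AE x in lborel. w x > 0 \<longrightarrow> tfc (H \<psi>) x = of_real x *s tfc \<psi> x" by (rule AE_T_lborel)
  then show "AE x in lborel. acU (H \<psi>) j x = of_real x * acU \<psi> j x"
  proof eventually_elim
    case (elim x)
    then show ?case using w_nonneg[of x] by (cases "w x = 0") (auto simp: acU_def)
  qed
next
  fix \<psi> \<phi> c d j assume p: "\<psi> \<in> ac_subspace H" "\<phi> \<in> ac_subspace H"
  then have pl: "\<psi> \<in> l2seq" "\<phi> \<in> l2seq" by (auto simp: ac_subspace_def)
  obtain F0 G0 where F0: "tf \<psi> F0" and G0: "tf \<phi> G0" using tf_exists pl by meson
  let ?X = "\<lambda>n. \<chi> i. c * \<psi> n $ i + d * \<phi> n $ i"
  have X: "?X = (\<lambda>n. c *s \<psi> n + d *s \<phi> n)" by (simp add: fun_eq_iff vec_eq_iff)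
  have "AE x in T. tfc ?X x = c *s tfc \<psi> x + d *s tfc \<phi> x"
    unfolding X using tf_linear[OF tfc[OF F0] tfc[OF G0], of c d]
    by (intro tf_unique[of "\<lambda>n. c *s \<psi> n + d *s \<phi> n" _ "\<lambda>n. c *s \<psi> n + d *s \<phi> n"] tfc) auto
  then have "AE x in lborel. w x > 0 \<longrightarrow> tfc ?X x = c *s tfc \<psi> x + d *s tfc \<phi> x" by (rule AE_T_lborel)
  then show "AE x in lborel. acU ?X j x = c * acU \<psi> j x + d * acU \<phi> j x"
  proof eventually_elim
    case (elim x)
    then show ?case using w_nonneg[of x] by (cases "w x = 0") (auto simp: acU_def algebra_simps)
  qed
next
  fix g assume g: "g \<in> dsum_L2 acA"
  have gm[measurable]: "g j \<in> borel_measurable borel" and g0: "x \<notin> acA j \<Longrightarrow> g j x = 0" for j x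
    using g by (auto simp: dsum_L2_def)
  \<comment> \<open>The inverse of \<open>acU\<close>. It is 0 where \<open>w\<close> vanishes, in
    particular on \<open>S\<close>, so its preimage lies in the absolutely continuous
    subspace.\<close>
  define G :: "real \<Rightarrow> complex^'l" where "G x = (\<chi> i. if w x > 0 then g (idx_of i) x / of_real (sqrt (w x)) else 0)" for x
  have Gm[measurable]: "G \<in> borel_measurable borel"
  proof -
    have "(\<lambda>x. g j x / complex_of_real (sqrt (w x))) \<in> borel_measurable borel" for j
      by (intro borel_measurable_divide) auto
    then have "(\<lambda>x. if w x > 0 then g j x / of_real (sqrt (w x)) else 0) \<in> borel_measurable borel" for j
      by (intro measurable_If) auto
    then show ?thesis unfolding vec_measurable_iff G_def by simp
  qed
  have Gz: "x \<in> S \<Longrightarrow> G x = 0" for x using w_S[of x] by (simp add: G_def vec_eq_iff)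
  have wG: "w x * (norm (G x))\<^sup>2 = (\<Sum>j<CARD('l). (norm (g j x))\<^sup>2)" for x
  proof (cases "w x > 0")
    case True
    then have "w x * (norm (G x))\<^sup>2 = (\<Sum>i\<in>UNIV. (norm (g (idx_of (i::'l)) x))\<^sup>2)"
      by (simp add: norm_vec_sq G_def norm_divide power_divide sum_distrib_left)
    then show ?thesis by (simp add: sum_idx_of[of "\<lambda>j. (norm (g j x))\<^sup>2"])
  next
    case False
    then have "g j x = 0" for j by (intro g0) (simp add: acA_def)
    then show ?thesis using False w_nonneg[of x] by simp
  qed
  have "(\<integral>\<^sup>+x. ennreal ((norm (G x))\<^sup>2) \<partial>T) = (\<integral>\<^sup>+x. ennreal (w x) * ennreal ((norm (G x))\<^sup>2) \<partial>lborel)"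
    by (rule nn_T_ac) (auto simp: Gz)
  also have "\<dots> = (\<integral>\<^sup>+x. (\<Sum>j<CARD('l). ennreal ((norm (g j x))\<^sup>2)) \<partial>lborel)"
    by (rule nn_integral_cong) (simp add: ennreal_mult[symmetric] w_nonneg wG sum_ennreal)
  also have "\<dots> = (\<Sum>j<CARD('l). \<integral>\<^sup>+x. ennreal ((norm (g j x))\<^sup>2) \<partial>lborel)" by (rule nn_integral_sum) simp
  also have "\<dots> \<le> (\<Sum>j. \<integral>\<^sup>+x. ennreal ((norm (g j x))\<^sup>2) \<partial>lborel)" by (rule sum_le_suminf) auto
  also have "\<dots> < \<infinity>" using g by (simp add: dsum_L2_def)
  finally have "integrable T (\<lambda>x. (norm (G x))\<^sup>2)" by (intro integrableI_nonneg) auto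
  then have Gs: "sqi G" by (simp add: sqi_def)
  have Gsupp: "bm x $ k = 0 \<Longrightarrow> G x $ k = 0" for x k
    using g0[of x "idx_of k"] by (simp add: G_def acA_def bm_def chm_def)
  obtain \<psi> where \<psi>: "\<psi> \<in> l2seq" "tf \<psi> G" using tf_surj[OF Gs Gsupp] by blast
  have pac: "\<psi> \<in> ac_subspace H" using ac_subspace_iff[OF \<psi>(2,1)] Gz by auto
  have "AE x in lborel. acU \<psi> j x = g j x" for j
  proof -
    have "AE x in T. tfc \<psi> x = G x" by (rule tf_unique[OF tfc[OF \<psi>(2)] \<psi>(2)]) simp
    then have "AE x in lborel. w x > 0 \<longrightarrow> tfc \<psi> x = G x" by (rule AE_T_lborel)
    then show ?thesis
    proof eventually_elim
      case (elim x)
      show ?case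
      proof (cases "x \<in> acA j")
        case True
        then show ?thesis using elim by (simp add: acA_def acU_def G_def)
      next
        case False
        then show ?thesis using g0 acU_off[OF \<psi>(2)] by simp
      qed
    qed
  qed
  then show "\<exists>\<psi>\<in>ac_subspace H. \<forall>j. AE x in lborel. acU \<psi> j x = g j x" using pac by blast
qed

end

text \<open>An isometry commuting with multiplication by the variable acts fibrewise as an isometry, so
  the fibre dimensions cannot drop.\<close>
lemma ac_mult_rep_le:
  fixes H :: "(nat \<Rightarrow> complex^'l) \<Rightarrow> nat \<Rightarrow> complex^'l"
  assumes lin: "\<And>\<psi> \<phi> c d. \<psi> \<in> ac_subspace H \<Longrightarrow> \<phi> \<in> ac_subspace H \<Longrightarrow> (\<lambda>n. c *s \<psi> n + d *s \<phi> n) \<in> ac_subspace H"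
    and HH: "\<And>\<psi>. \<psi> \<in> ac_subspace H \<Longrightarrow> H \<psi> \<in> ac_subspace H"
    and A: "ac_mult_rep H A" and B: "ac_mult_rep H B"
  shows "AE x in lborel. x \<in> A j \<longrightarrow> x \<in> B j"
proof -
  have Am: "\<And>j. A j \<in> sets borel" "\<And>j. A (Suc j) \<subseteq> A j" and Bm: "\<And>j. B j \<in> sets borel" "\<And>j. B (Suc j) \<subseteq> B j"
    using A B by (auto simp: ac_mult_rep_def)
  have Adec: "A n \<subseteq> A m" "B n \<subseteq> B m" if "m \<le> n" for m n
    using lift_Suc_antimono_le[of A, OF Am(2) that] lift_Suc_antimono_le[of B, OF Bm(2) that] by auto
  have eta: "(\<lambda>n. \<chi> i. c * \<psi> n $ i + d * \<phi> n $ i) = (\<lambda>n. c *s \<psi> n + d *s \<phi> n)" for c d and \<psi> \<phi> :: "nat \<Rightarrow> complex^'l"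
    by (simp add: fun_eq_iff vec_eq_iff)
  obtain U where U0: "\<forall>\<psi>\<in>ac_subspace H. U \<psi> \<in> dsum_L2 A \<and> ennreal (l2normsq \<psi>) = (\<Sum>j. \<integral>\<^sup>+ x. ennreal ((norm (U \<psi> j x))\<^sup>2) \<partial>lborel)"
    "\<forall>\<psi>\<in>ac_subspace H. \<forall>\<phi>\<in>ac_subspace H. \<forall>a b. \<forall>j. AE x in lborel. U (\<lambda>n. \<chi> i. a * \<psi> n $ i + b * \<phi> n $ i) j x = a * U \<psi> j x + b * U \<phi> j x"
    "\<forall>\<psi>\<in>ac_subspace H. \<forall>j. AE x in lborel. U (H \<psi>) j x = complex_of_real x * U \<psi> j x"
    "\<forall>g\<in>dsum_L2 A. \<exists>\<psi>\<in>ac_subspace H. \<forall>j. AE x in lborel. U \<psi> j x = g j x"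
    using A unfolding ac_mult_rep_def by (elim exE conjE)
  have U: "U \<psi> \<in> dsum_L2 A"
    "ennreal (l2normsq \<psi>) = (\<Sum>j. \<integral>\<^sup>+ x. ennreal ((norm (U \<psi> j x))\<^sup>2) \<partial>lborel)"
    "\<phi> \<in> ac_subspace H \<Longrightarrow> AE x in lborel. U (\<lambda>n. c *s \<psi> n + d *s \<phi> n) j x = c * U \<psi> j x + d * U \<phi> j x"
    "AE x in lborel. U (H \<psi>) j x = of_real x * U \<psi> j x"
    "g \<in> dsum_L2 A \<Longrightarrow> \<exists>\<psi>\<in>ac_subspace H. \<forall>j. AE x in lborel. U \<psi> j x = g j x"
    if "\<psi> \<in> ac_subspace H" for \<psi> \<phi> c d j g
    using U0 that unfolding eta by blast+
  obtain V where V0: "\<forall>\<psi>\<in>ac_subspace H. V \<psi> \<in> dsum_L2 B \<and> ennreal (l2normsq \<psi>) = (\<Sum>j. \<integral>\<^sup>+ x. ennreal ((norm (V \<psi> j x))\<^sup>2) \<partial>lborel)"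
    "\<forall>\<psi>\<in>ac_subspace H. \<forall>\<phi>\<in>ac_subspace H. \<forall>a b. \<forall>j. AE x in lborel. V (\<lambda>n. \<chi> i. a * \<psi> n $ i + b * \<phi> n $ i) j x = a * V \<psi> j x + b * V \<phi> j x"
    "\<forall>\<psi>\<in>ac_subspace H. \<forall>j. AE x in lborel. V (H \<psi>) j x = complex_of_real x * V \<psi> j x"
    "\<forall>g\<in>dsum_L2 B. \<exists>\<psi>\<in>ac_subspace H. \<forall>j. AE x in lborel. V \<psi> j x = g j x"
    using B unfolding ac_mult_rep_def by (elim exE conjE)
  have V: "V \<psi> \<in> dsum_L2 B"
    "ennreal (l2normsq \<psi>) = (\<Sum>j. \<integral>\<^sup>+ x. ennreal ((norm (V \<psi> j x))\<^sup>2) \<partial>lborel)"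
    "\<phi> \<in> ac_subspace H \<Longrightarrow> AE x in lborel. V (\<lambda>n. c *s \<psi> n + d *s \<phi> n) j x = c * V \<psi> j x + d * V \<phi> j x"
    "AE x in lborel. V (H \<psi>) j x = of_real x * V \<psi> j x"
    if "\<psi> \<in> ac_subspace H" for \<psi> \<phi> c d j
    using V0 that unfolding eta by blast+
  show ?thesis
  proof (rule ccontr)
    assume neg: "\<not> ?thesis"
    define E0 where "E0 = A j - B j"
    have E0m: "E0 \<in> sets borel" using Am Bm by (auto simp: E0_def)
    have E0p: "emeasure lborel E0 \<noteq> 0"
    proof
      assume "emeasure lborel E0 = 0"
      then have "E0 \<in> null_sets lborel" using E0m by (simp add: null_sets_def)
      then have "AE x in lborel. x \<notin> E0" by (rule AE_not_in)
      then show False using neg by (auto simp: E0_def elim!: eventually_mono)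
    qed
    obtain R :: nat where Rp: "emeasure lborel (E0 \<inter> {-real R..real R}) \<noteq> 0"
    proof (rule ccontr)
      assume "\<not> thesis"
      then have "E0 \<inter> {-real n..real n} \<in> null_sets lborel" for n using that E0m by (auto simp: null_sets_def)
      then have "(\<Union>n. E0 \<inter> {-real n..real n}) \<in> null_sets lborel" by (rule null_sets_UN)
      moreover have "(\<Union>n. E0 \<inter> {-real n..real n}) = E0"
      proof -
        have "\<exists>n. x \<in> {-real n..real n}" for x :: real
        proof -
          obtain n where "\<bar>x\<bar> \<le> real n" using real_arch_simple by blast
          then have "x \<in> {-real n..real n}" by auto
          then show ?thesis by blast
        qed
        then show ?thesis by blast
      qed
      ultimately show False using E0p by (auto simp: null_sets_def)
    qed
    define E where "E = E0 \<inter> {-real R..real R}"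
    have Em[measurable]: "E \<in> sets borel" using E0m by (auto simp: E_def)
    have EA: "E \<subseteq> A i" if "i \<le> j" for i using Adec(1)[OF that] by (auto simp: E_def E0_def)
    have EB: "x \<in> E \<Longrightarrow> x \<notin> B k" if "k \<ge> j" for x k using Adec(2)[OF that] by (auto simp: E_def E0_def)
    have Efin: "emeasure lborel E < \<infinity>"
    proof -
      have "emeasure lborel E \<le> emeasure lborel {-real R..real R}" by (rule emeasure_mono) (auto simp: E_def)
      then show ?thesis using le_less_trans by fastforce
    qed
    \<comment> \<open>Constant orthonormal sections over \<open>E\<close> in the first
      representation: \<open>j + 1\<close> of them, while the fibres of the second have at most
      \<open>j\<close> components over \<open>E\<close>.\<close>
    have "\<forall>i. \<exists>\<psi>. i \<le> j \<longrightarrow> \<psi> \<in> ac_subspace H \<and> (\<forall>k. AE x in lborel. U \<psi> k x = (if k = i then indicator E x else 0))"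
    proof
      fix i
      show "\<exists>\<psi>. i \<le> j \<longrightarrow> \<psi> \<in> ac_subspace H \<and> (\<forall>k. AE x in lborel. U \<psi> k x = (if k = i then indicator E x else 0))"
      proof (cases "i \<le> j")
        case True
        define g :: "nat \<Rightarrow> real \<Rightarrow> complex" where "g k x = (if k = i then indicator E x else 0)" for k x
        have "(\<Sum>k. \<integral>\<^sup>+ x. ennreal ((norm (g k x))\<^sup>2) \<partial>lborel) = (\<Sum>k\<in>{i}. \<integral>\<^sup>+ x. ennreal ((norm (g k x))\<^sup>2) \<partial>lborel)"
          by (rule suminf_finite) (auto simp: g_def)
        also have "\<dots> = (\<integral>\<^sup>+ x. indicator E x \<partial>lborel)"
          by (simp only: sum.insert[OF finite.emptyI] empty_iff not_False_eq_True sum.empty add_0_right, rule nn_integral_cong) (auto simp: g_def indicator_def)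
        also have "\<dots> < \<infinity>" using Efin by simp
        finally have gs: "(\<Sum>k. \<integral>\<^sup>+ x. ennreal ((norm (g k x))\<^sup>2) \<partial>lborel) < \<infinity>" .
        have "g k \<in> borel_measurable lborel" for k by (cases "k = i") (simp_all add: g_def[abs_def])
        moreover have "x \<notin> A k \<Longrightarrow> g k x = 0" for k x using EA[OF True] by (auto simp: g_def indicator_def)
        ultimately have "g \<in> dsum_L2 A" using gs unfolding dsum_L2_def by blast
        from U0(4)[rule_format, OF this] show ?thesis unfolding g_def by blast
      qed simp
    qed
    from choice[OF this] obtain P where P: "\<And>i. i \<le> j \<Longrightarrow> P i \<in> ac_subspace H"
      "\<And>i k. i \<le> j \<Longrightarrow> AE x in lborel. U (P i) k x = (if k = i then indicator E x else 0)" by blast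
    \<comment> \<open>\<open>\<psi>\<close> is represented by \<open>f\<close> and by
      \<open>g\<close> simultaneously. This relation is linear and respects multiplication by the
      variable, so polynomials act on it.\<close>
    define Q where "Q \<psi> f g \<longleftrightarrow> \<psi> \<in> ac_subspace H \<and> (\<forall>k. AE x in lborel. U \<psi> k x = f k x) \<and> (\<forall>k. AE x in lborel. V \<psi> k x = g k x)"
      for \<psi> and f g :: "nat \<Rightarrow> real \<Rightarrow> complex"
    have Qlin: "Q (\<lambda>n. c *s \<psi> n + d *s \<phi> n) (\<lambda>k x. c * f k x + d * f' k x) (\<lambda>k x. c * g k x + d * g' k x)"
      if q: "Q \<psi> f g" "Q \<phi> f' g'" for c d \<psi> \<phi> f g f' g'
      unfolding Q_def
    proof (intro conjI allI)
      have p: "\<psi> \<in> ac_subspace H" "\<phi> \<in> ac_subspace H" using q by (auto simp: Q_def)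
      show "(\<lambda>n. c *s \<psi> n + d *s \<phi> n) \<in> ac_subspace H" by (rule lin[OF p])
      fix k
      have "AE x in lborel. U \<psi> k x = f k x" "AE x in lborel. U \<phi> k x = f' k x" "AE x in lborel. V \<psi> k x = g k x" "AE x in lborel. V \<phi> k x = g' k x"
        using q by (auto simp: Q_def)
      note ae = this
      show "AE x in lborel. U (\<lambda>n. c *s \<psi> n + d *s \<phi> n) k x = c * f k x + d * f' k x"
        using U(3)[OF p, of c d k] ae(1,2) by eventually_elim simp
      show "AE x in lborel. V (\<lambda>n. c *s \<psi> n + d *s \<phi> n) k x = c * g k x + d * g' k x"
        using V(3)[OF p, of c d k] ae(3,4) by eventually_elim simp
    qed
    have QH: "Q (H \<psi>) (\<lambda>k x. of_real x * f k x) (\<lambda>k x. of_real x * g k x)" if q: "Q \<psi> f g" for \<psi> f g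
      unfolding Q_def
    proof (intro conjI allI)
      have p: "\<psi> \<in> ac_subspace H" using q by (auto simp: Q_def)
      show "H \<psi> \<in> ac_subspace H" by (rule HH[OF p])
      fix k
      have "AE x in lborel. U \<psi> k x = f k x" "AE x in lborel. V \<psi> k x = g k x" using q by (auto simp: Q_def)
      note ae = this
      show "AE x in lborel. U (H \<psi>) k x = of_real x * f k x" using U(4)[OF p, of k] ae(1) by eventually_elim simp
      show "AE x in lborel. V (H \<psi>) k x = of_real x * g k x" using V(4)[OF p, of k] ae(2) by eventually_elim simp
    qed
    have Qpoly: "\<exists>\<psi>'. Q \<psi>' (\<lambda>k x. of_real (p x) * f k x) (\<lambda>k x. of_real (p x) * g k x)"
      if "real_polynomial_function p" "Q \<psi> f g" for p :: "real \<Rightarrow> real" and \<psi> f g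
      using that
    proof (induction arbitrary: \<psi> f g)
      case (linear p)
      then obtain c where c: "p = (\<lambda>x. x * c)" using real_bounded_linear by blast
      from Qlin[OF QH[OF linear(2)] QH[OF linear(2)], of "of_real c" 0]
      show ?case unfolding c by (auto simp: mult_ac)
    next
      case (const c)
      from Qlin[OF const const, of "of_real c" 0] show ?case by auto
    next
      case (add p q)
      obtain \<psi>1 \<psi>2 where "Q \<psi>1 (\<lambda>k x. of_real (p x) * f k x) (\<lambda>k x. of_real (p x) * g k x)"
        "Q \<psi>2 (\<lambda>k x. of_real (q x) * f k x) (\<lambda>k x. of_real (q x) * g k x)" using add.IH[OF add.prems] by blast
      from Qlin[OF this, of 1 1] show ?case by (auto simp: distrib_right)
    next
      case (mult p q)
      obtain \<psi>1 where "Q \<psi>1 (\<lambda>k x. of_real (q x) * f k x) (\<lambda>k x. of_real (q x) * g k x)" using mult.IH(2)[OF mult.prems] by blast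
      from mult.IH(1)[OF this] show ?case by (auto simp: mult.assoc)
    qed
    have Qsum: "\<exists>\<psi>. Q \<psi> (\<lambda>k x. \<Sum>i\<in>I. c i * (if k = i then indicator E x else 0)) (\<lambda>k x. \<Sum>i\<in>I. c i * V (P i) k x)"
      if "finite I" "I \<subseteq> {..j}" for I c
      using that
    proof (induction I)
      case empty
      have "Q (P 0) (\<lambda>k x. if k = 0 then indicator E x else 0) (V (P 0))" using P[of 0] by (simp add: Q_def)
      from Qlin[OF this this, of 0 0] show ?case by auto
    next
      case (insert i I)
      then obtain \<psi> where q: "Q \<psi> (\<lambda>k x. \<Sum>i\<in>I. c i * (if k = i then indicator E x else 0)) (\<lambda>k x. \<Sum>i\<in>I. c i * V (P i) k x)" by auto
      have "Q (P i) (\<lambda>k x. if k = i then indicator E x else 0) (V (P i))" using P[of i] insert by (simp add: Q_def)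
      from Qlin[OF this q, of "c i" 1] insert show ?case by (auto simp del: sum.insert simp: sum.insert[OF insert(1,2)])
    qed
    have Vm: "V (P i) k \<in> borel_measurable borel" "x \<notin> B k \<Longrightarrow> V (P i) k x = 0" if "i \<le> j" for i k x
      using V(1)[OF P(1)[OF that]] by (auto simp: dsum_L2_def)
    define h where "h c x = (\<Sum>k. ennreal ((norm (\<Sum>i\<le>j. c i * V (P i) k x))\<^sup>2))" for c x
    define n2 where "n2 c = (\<Sum>i\<le>j. (norm (c i :: complex))\<^sup>2)" for c
    have hm[measurable]: "h c \<in> borel_measurable borel" for c
    proof -
      have "(\<lambda>x. \<Sum>i\<le>j. c i * V (P i) k x) \<in> borel_measurable borel" for k
        by (intro borel_measurable_sum borel_measurable_times Vm) auto
      note [measurable] = this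
      show ?thesis unfolding h_def by measurable
    qed
    \<comment> \<open>Both sides are the squared norm of one vector, the polynomial \<open>p\<close>
      applied to the combination of the sections \<open>P i\<close> with coefficients
      \<open>c\<close>; \<open>h c\<close> is the fibre norm in the second representation.\<close>
    have key: "(\<integral>\<^sup>+x. h c x * ennreal ((p x)\<^sup>2) \<partial>lborel) = (\<integral>\<^sup>+x. ennreal (n2 c) * indicator E x * ennreal ((p x)\<^sup>2) \<partial>lborel)"
      if p: "real_polynomial_function p" for c p
    proof -
      have [measurable]: "p \<in> borel_measurable borel" by (rule rpf_meas[OF p])
      have [measurable]: "(\<lambda>x. \<Sum>i\<le>j. c i * V (P i) k x) \<in> borel_measurable borel" for k
        by (intro borel_measurable_sum borel_measurable_times Vm) auto
      obtain \<psi>0 where "Q \<psi>0 (\<lambda>k x. \<Sum>i\<le>j. c i * (if k = i then indicator E x else 0)) (\<lambda>k x. \<Sum>i\<le>j. c i * V (P i) k x)"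
        using Qsum[of "{..j}" c] by auto
      from Qpoly[OF p this] obtain \<psi> where q: "Q \<psi> (\<lambda>k x. of_real (p x) * (\<Sum>i\<le>j. c i * (if k = i then indicator E x else 0))) (\<lambda>k x. of_real (p x) * (\<Sum>i\<le>j. c i * V (P i) k x))"
        by blast
      then have pac: "\<psi> \<in> ac_subspace H" by (simp add: Q_def)
      have u: "(\<integral>\<^sup>+ x. ennreal ((norm (U \<psi> k x))\<^sup>2) \<partial>lborel) = (\<integral>\<^sup>+ x. (if k \<le> j then ennreal ((norm (c k))\<^sup>2) * indicator E x * ennreal ((p x)\<^sup>2) else 0) \<partial>lborel)" for k
      proof (rule nn_integral_cong_AE)
        have "AE x in lborel. U \<psi> k x = of_real (p x) * (\<Sum>i\<le>j. c i * (if k = i then indicator E x else 0))" using q by (simp add: Q_def)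
        then show "AE x in lborel. ennreal ((norm (U \<psi> k x))\<^sup>2) = (if k \<le> j then ennreal ((norm (c k))\<^sup>2) * indicator E x * ennreal ((p x)\<^sup>2) else 0)"
        proof eventually_elim
          case (elim x)
          have "(\<Sum>i\<le>j. c i * (if k = i then indicator E x else 0)) = (if k \<le> j then c k * indicator E x else 0)"
            by (simp add: if_distrib cong: if_cong)
          then show ?case unfolding elim
            by (auto simp: norm_mult power_mult_distrib indicator_def ennreal_mult[symmetric] mult.commute)
        qed
      qed
      have v: "(\<integral>\<^sup>+ x. ennreal ((norm (V \<psi> k x))\<^sup>2) \<partial>lborel) = (\<integral>\<^sup>+ x. ennreal ((norm (\<Sum>i\<le>j. c i * V (P i) k x))\<^sup>2) * ennreal ((p x)\<^sup>2) \<partial>lborel)" for k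
      proof (rule nn_integral_cong_AE)
        have "AE x in lborel. V \<psi> k x = of_real (p x) * (\<Sum>i\<le>j. c i * V (P i) k x)" using q by (simp add: Q_def)
        then show "AE x in lborel. ennreal ((norm (V \<psi> k x))\<^sup>2) = ennreal ((norm (\<Sum>i\<le>j. c i * V (P i) k x))\<^sup>2) * ennreal ((p x)\<^sup>2)"
          by eventually_elim (simp add: norm_mult power_mult_distrib ennreal_mult[symmetric] mult.commute)
      qed
      have "(\<integral>\<^sup>+x. h c x * ennreal ((p x)\<^sup>2) \<partial>lborel) = (\<integral>\<^sup>+x. (\<Sum>k. ennreal ((norm (\<Sum>i\<le>j. c i * V (P i) k x))\<^sup>2) * ennreal ((p x)\<^sup>2)) \<partial>lborel)"
        unfolding h_def by (simp add: ennreal_suminf_multc)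
      also have "\<dots> = (\<Sum>k. \<integral>\<^sup>+ x. ennreal ((norm (V \<psi> k x))\<^sup>2) \<partial>lborel)"
        unfolding v by (rule nn_integral_suminf) simp
      also have "\<dots> = (\<Sum>k. \<integral>\<^sup>+ x. ennreal ((norm (U \<psi> k x))\<^sup>2) \<partial>lborel)"
        using U(2)[OF pac] V(2)[OF pac] by simp
      also have "\<dots> = (\<Sum>k\<le>j. \<integral>\<^sup>+ x. ennreal ((norm (c k))\<^sup>2) * indicator E x * ennreal ((p x)\<^sup>2) \<partial>lborel)"
        unfolding u by (subst suminf_finite[of "{..j}"]) auto
      also have "\<dots> = (\<integral>\<^sup>+ x. (\<Sum>k\<le>j. ennreal ((norm (c k))\<^sup>2) * indicator E x * ennreal ((p x)\<^sup>2)) \<partial>lborel)"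
        by (rule nn_integral_sum[symmetric]) simp
      also have "\<dots> = (\<integral>\<^sup>+ x. ennreal (n2 c) * indicator E x * ennreal ((p x)\<^sup>2) \<partial>lborel)"
        by (simp add: n2_def sum_distrib_right[symmetric] sum_ennreal)
      finally show ?thesis .
    qed
    \<comment> \<open>Integrals of squares of polynomials determine a finite measure on a bounded
      set, so the equality of norms localises to almost every fibre.\<close>
    have hE: "AE x in lborel. h c x = ennreal (n2 c) * indicator E x" for c
    proof -
      let ?\<mu> = "density lborel (h c)" and ?M = "density lborel (\<lambda>x. ennreal (n2 c) * indicator E x)"
      have n2: "n2 c \<ge> 0" by (simp add: n2_def sum_nonneg)
      have one: "(\<integral>\<^sup>+x. h c x \<partial>lborel) = ennreal (n2 c) * emeasure lborel E"
        using key[of "\<lambda>_. 1" c] by (simp add: real_polynomial_function.intros nn_integral_cmult_indicator)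
      have fin: "ennreal (n2 c) * emeasure lborel E < \<infinity>" using Efin by (simp add: ennreal_mult_less_top)
      have f1: "finite_measure ?\<mu>" using one fin by (intro finite_measureI) (auto simp: emeasure_density)
      have f2: "finite_measure ?M" using fin by (intro finite_measureI) (auto simp: emeasure_density nn_integral_cmult_indicator)
      have bM: "bdd_measure (real R) ?M" unfolding bdd_measure_def
      proof (intro conjI f2)
        have m: "(\<lambda>x. ennreal (n2 c) * indicator E x) \<in> borel_measurable lborel" by measurable
        show "AE x in ?M. \<bar>x\<bar> \<le> real R" unfolding AE_density[OF m]
          by (rule AE_I2) (auto simp: E_def indicator_def)
      qed simp
      have eqp: "(\<integral>\<^sup>+x. ennreal ((p x)\<^sup>2) \<partial>?\<mu>) = (\<integral>\<^sup>+x. ennreal ((p x)\<^sup>2) \<partial>?M)" if p: "real_polynomial_function p" for p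
      proof -
        have [measurable]: "p \<in> borel_measurable borel" by (rule rpf_meas[OF p])
        show ?thesis using key[OF p, of c] by (simp add: nn_integral_density)
      qed
      have le: "emeasure ?\<mu> X \<le> emeasure ?M X" if "X \<in> sets borel" for X
        by (rule moment_order[OF f1 _ bM _ that]) (simp_all add: eqp)
      have "emeasure ?M (- {-real R..real R}) = 0"
      proof -
        have m: "(\<lambda>x. ennreal (n2 c) * indicator E x) \<in> borel_measurable lborel" by measurable
        have "emeasure ?M (- {-real R..real R}) = (\<integral>\<^sup>+(x::real). 0 \<partial>lborel)"
          by (subst emeasure_density[OF m]) (simp, rule nn_integral_cong, auto simp: E_def indicator_def)
        then show ?thesis by simp
      qed
      then have "emeasure ?\<mu> (- {-real R..real R}) = 0" using le[of "- {-real R..real R}"] by simp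
      then have "AE x in ?\<mu>. x \<in> {-real R..real R}"
        by (subst AE_iff_measurable[where N = "- {-real R..real R}"]) auto
      then have "AE x in ?\<mu>. \<bar>x\<bar> \<le> real R" by (rule eventually_mono) auto
      then have b\<mu>: "bdd_measure (real R) ?\<mu>" using f1 by (simp add: bdd_measure_def)
      have ge: "emeasure ?M X \<le> emeasure ?\<mu> X" if "X \<in> sets borel" for X
        by (rule moment_order[OF f2 _ b\<mu> _ that]) (simp_all add: eqp)
      have "?\<mu> = ?M" using le ge by (intro measure_eqI) (auto intro: antisym)
      then show ?thesis using one fin by (subst (asm) finite_density_unique) auto
    qed
    \<comment> \<open>A single null set has to serve all coefficients, so these are first restricted
      to a countable dense set; the sequence \<open>d\<close> below returns to arbitrary
      ones.\<close>
    define CC where "CC = PiE {..j} (\<lambda>_. (\<lambda>(p, q). Complex p q) ` (\<rat> \<times> \<rat>))"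
    have "countable CC" unfolding CC_def by (intro countable_PiE countable_image countable_SIGMA) (auto simp: countable_rat)
    then have "AE x in lborel. \<forall>c\<in>CC. h c x = ennreal (n2 c) * indicator E x"
      using hE by (simp add: AE_ball_countable)
    note good = this
    have notAE: "\<not> (AE x in lborel. x \<notin> E)"
    proof
      assume "AE x in lborel. x \<notin> E"
      then have "emeasure lborel E = 0" by (subst (asm) AE_iff_measurable[of E]) auto
      then show False using Rp by (simp add: E_def)
    qed
    have "\<exists>x\<in>E. \<forall>c\<in>CC. h c x = ennreal (n2 c) * indicator E x"
    proof (rule ccontr)
      assume none: "\<not> ?thesis"
      from good have "AE x in lborel. x \<notin> E" by eventually_elim (use none in blast)
      then show False using notAE by simp
    qed
    then obtain x where x: "x \<in> E" "\<And>c. c \<in> CC \<Longrightarrow> h c x = ennreal (n2 c)" by auto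
    \<comment> \<open>In such a fibre \<open>j + 1\<close> vectors with \<open>j\<close> components
      are dependent, although the map from coefficients to the fibre preserves norms.\<close>
    obtain c where c: "\<exists>i\<in>{..j}. c i \<noteq> 0" "\<And>k. k < j \<Longrightarrow> (\<Sum>i\<in>{..j}. c i * V (P i) k x) = 0"
      using homogeneous_solution[of "{..j}" j "\<lambda>k i. V (P i) k x"] by auto
    have hfin: "h d x = ennreal (\<Sum>k<j. (norm (\<Sum>i\<le>j. d i * V (P i) k x))\<^sup>2)" for d
    proof -
      have "V (P i) k x = 0" if "i \<le> j" "k \<ge> j" for i k using Vm(2)[OF that(1)] EB[OF that(2) x(1)] by simp
      then have "h d x = (\<Sum>k<j. ennreal ((norm (\<Sum>i\<le>j. d i * V (P i) k x))\<^sup>2))"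
        unfolding h_def by (intro suminf_finite) auto
      then show ?thesis by (simp add: sum_ennreal)
    qed
    have eq: "(\<Sum>k<j. (norm (\<Sum>i\<le>j. d i * V (P i) k x))\<^sup>2) = n2 d" if "d \<in> CC" for d
      using x(2)[OF that] unfolding hfin by (subst (asm) ennreal_inj) (auto simp: n2_def intro: sum_nonneg)
    have approx: "\<exists>d\<in>CC. \<forall>i\<le>j. norm (d i - c i) < e" if e: "e > 0" for e
    proof -
      have "\<exists>z \<in> (\<lambda>(p, q). Complex p q) ` (\<rat> \<times> \<rat>). norm (z - y) < e" for y
      proof -
        obtain p where "p \<in> \<rat>" "Re y - e/2 < p" "p < Re y + e/2"
          using Rats_dense_in_real[of "Re y - e/2" "Re y + e/2"] e by auto
        then have p: "p \<in> \<rat>" "\<bar>p - Re y\<bar> < e / 2" by linarith+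
        obtain q where "q \<in> \<rat>" "Im y - e/2 < q" "q < Im y + e/2"
          using Rats_dense_in_real[of "Im y - e/2" "Im y + e/2"] e by auto
        then have q: "q \<in> \<rat>" "\<bar>q - Im y\<bar> < e / 2" by linarith+
        have "norm (Complex p q - y) \<le> \<bar>Re (Complex p q - y)\<bar> + \<bar>Im (Complex p q - y)\<bar>" by (rule cmod_le)
        also have "\<dots> < e" using p q by simp
        finally show ?thesis using p q by force
      qed
      then have "\<forall>i. \<exists>z. z \<in> (\<lambda>(p, q). Complex p q) ` (\<rat> \<times> \<rat>) \<and> norm (z - c i) < e" by blast
      from choice[OF this] obtain d where d: "\<And>i. d i \<in> (\<lambda>(p, q). Complex p q) ` (\<rat> \<times> \<rat>)" "\<And>i. norm (d i - c i) < e" by blast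
      show ?thesis by (intro bexI[of _ "restrict d {..j}"]) (use d in \<open>auto simp: CC_def\<close>)
    qed
    have "\<forall>n. \<exists>d\<in>CC. \<forall>i\<le>j. norm (d i - c i) < 1 / real (Suc n)" by (intro allI approx) simp
    then obtain d where d: "\<And>n. d n \<in> CC" "\<And>n i. i \<le> j \<Longrightarrow> norm (d n i - c i) < 1 / real (Suc n)" by metis
    have dl: "(\<lambda>n. d n i) \<longlonglongrightarrow> c i" if "i \<le> j" for i
    proof -
      have "(\<lambda>n. 1 / real (Suc n)) \<longlonglongrightarrow> 0" by real_asymp
      then have "(\<lambda>n. d n i - c i) \<longlonglongrightarrow> 0"
        by (rule Lim_null_comparison[rotated]) (use d(2)[OF that] in \<open>auto intro!: always_eventually less_imp_le\<close>)
      then show ?thesis by (simp add: LIM_zero_iff)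
    qed
    have "(\<lambda>n. \<Sum>k<j. (norm (\<Sum>i\<le>j. d n i * V (P i) k x))\<^sup>2) \<longlonglongrightarrow> (\<Sum>k<j. (norm (\<Sum>i\<le>j. c i * V (P i) k x))\<^sup>2)"
      by (intro tendsto_intros dl) auto
    moreover have "(\<lambda>n. n2 (d n)) \<longlonglongrightarrow> n2 c" unfolding n2_def by (intro tendsto_intros dl) auto
    ultimately have "(\<Sum>k<j. (norm (\<Sum>i\<le>j. c i * V (P i) k x))\<^sup>2) = n2 c"
      unfolding eq[OF d(1)] by (rule LIMSEQ_unique)
    moreover have "(\<Sum>k<j. (norm (\<Sum>i\<le>j. c i * V (P i) k x))\<^sup>2) = 0" using c(2) by simp
    ultimately have "n2 c = 0" by simp
    then show False using c(1) by (auto simp: n2_def sum_nonneg_eq_0_iff)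
  qed
qed

section \<open>Transmission through a shifted block\<close>

text \<open>A quantitatively independent family. Orthonormal vectors satisfy the inequality with 1
  in place of 4; the slack lets them be moved into a dense set
  (\<open>kernel_frame\<close>).\<close>

definition frame :: "nat \<Rightarrow> (nat \<Rightarrow> real^'l) \<Rightarrow> bool" where
  "frame m v \<longleftrightarrow> (\<forall>\<alpha> :: nat \<Rightarrow> complex. (\<Sum>i<m. (norm (\<alpha> i))\<^sup>2) \<le> 4 * (norm (\<Sum>i<m. \<alpha> i *s cvec (v i)))\<^sup>2)"

lemma vcnj_sum [simp]: "vcnj (\<Sum>i\<in>A. f i) = (\<Sum>i\<in>A. vcnj (f i))"
  by (induction A rule: infinite_finite_induct) auto

lemma dense_complex_vec:
  obtains D :: "(complex^'l) set" where "countable D" "closure D = UNIV"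
proof -
  obtain D :: "(complex^'l) set" where D: "countable D" "\<And>X. open X \<Longrightarrow> X \<noteq> {} \<Longrightarrow> \<exists>d\<in>D. d \<in> X"
    using countable_dense_exists[where 'a = "complex^'l"] by blast
  have "closure D = UNIV"
  proof (rule ccontr)
    assume "closure D \<noteq> UNIV"
    then have "- closure D \<noteq> {}" "open (- closure D)" by auto
    then obtain d where "d \<in> D" "d \<notin> closure D" using D(2)[of "- closure D"] by auto
    then show False using closure_subset[of D] by auto
  qed
  then show ?thesis using D(1) that by blast
qed

text \<open>The solution on the block, extended by 0 to the left, solves the long chain with one
  additional source at site \<open>n\<close>, where \<open>a n\<close> couples to its first value.
  It vanishes at site 1, so the two responses cancel there.\<close>

lemma (in jacobi_coeff) green_factor:
  fixes t :: "complex^'l"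
  assumes n: "n \<ge> 1" and N: "N \<ge> 1" and z: "Im z \<ge> 0"
  defines "u \<equiv> chain_res (\<lambda>k. a (n + k)) (\<lambda>k. b (n + k)) N z (site N t)"
  shows "chain_res a b (n + N) z (site (n + N) t) 1 = - chain_res a b (n + N) z (site n (cmv (a n) (u 1))) 1"
proof -
  interpret sh: jacobi_coeff "\<lambda>k. a (n + k)" "\<lambda>k. b (n + k)" C by (rule jacobi_shift)
  define y where "y k = (if k \<le> n then 0 else u (k - n))" for k
  have sol: "chain_sol (\<lambda>k. a (n + k)) (\<lambda>k. b (n + k)) N z (site N t) u"
    unfolding u_def by (rule sh.chain_res_sol[OF N z])
  have u0: "u 0 = 0" and row: "\<And>k. k \<in> {1..N} \<Longrightarrow> jrow (\<lambda>k. a (n + k)) (\<lambda>k. b (n + k)) u k - z *s u k = site N t k"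
    and bd: "cmv (a (n + N)) (u (Suc N)) = - (\<i> *s u N)"
    using sol by (auto simp: chain_sol_def)
  have "chain_sol a b (n + N) z (\<lambda>k. site (n + N) t k + site n (cmv (a n) (u 1)) k) y"
    unfolding chain_sol_def
  proof (intro conjI ballI)
    show "y 0 = 0" by (simp add: y_def)
    show "cmv (a (n + N)) (y (Suc (n + N))) = - (\<i> *s y (n + N))"
      using bd N by (simp add: y_def Suc_diff_le)
    fix k assume k: "k \<in> {1..n + N}"
    consider "k < n" | "k = n" | "k > n" by linarith
    then show "jrow a b y k - z *s y k = site (n + N) t k + site n (cmv (a n) (u 1)) k"
    proof cases
      case 1
      then show ?thesis using k N by (simp add: jrow_def y_def)
    next
      case 2
      then show ?thesis using n N by (simp add: jrow_def y_def)
    next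
      case 3
      define i where "i = k - n"
      have i: "k = n + i" "i \<in> {1..N}" using 3 k by (auto simp: i_def)
      have y1: "y (k - 1) = u (i - 1)" "y k = u i" "y (Suc k) = u (Suc i)"
        using i u0 by (auto simp: y_def le_Suc_eq intro: arg_cong[of _ _ u])
      have "jrow a b y k = jrow (\<lambda>k. a (n + k)) (\<lambda>k. b (n + k)) u i"
        using i unfolding jrow_def y1 by simp
      then show ?thesis using row[OF i(2)] 3 i y1(2)[unfolded i(1)] by (simp add: site_def)
    qed
  qed
  from chain_res_eqI[OF this _ z, of 1] n N
  have "chain_res a b (n + N) z (\<lambda>k. site (n + N) t k + 1 *s site n (cmv (a n) (u 1)) k) 1 = 0"
    by (simp add: y_def)
  then show ?thesis using n N z by (subst (asm) chain_res_add_smult) (auto simp: add_eq_0_iff2)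
qed

section \<open>Dirichlet solutions normalised in energy and the sets on which they are
  independent\<close>

context jacobi_ac
begin

text \<open>Rows of \<open>E\<close> weighted by the square root of the density
  (\<open>sv_nth\<close>): real Dirichlet solutions whose squares at a site are integrable over all
  energies, uniformly in the site.\<close>

definition sv :: "nat \<Rightarrow> nat \<Rightarrow> real \<Rightarrow> real^'l" where
  "sv k n x = sqrt (w x) *\<^sub>R (pm n x *v chol (Rm x) k)"

lemma sv_nth:
  assumes "k < CARD('l)"
  shows "sv k n x $ i = sqrt (w x) * E n x $ (enum_idx k) $ i"
  using assms by (simp add: sv_def E_nth bm_def chm_def matrix_vector_mult_def mult.commute)

lemma sv_0 [simp]: "sv k 0 x = 0"
  by (simp add: sv_def)

lemma sv_row: "n \<ge> 1 \<Longrightarrow> jrow a b (\<lambda>n. cvec (sv k n x)) n = of_real x *s cvec (sv k n x)"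
proof -
  assume "n \<ge> 1"
  then obtain m where n: "n = Suc m" by (cases n) auto
  have "cvec (sv k n x) = cmv (pm n x) (cvec (sqrt (w x) *\<^sub>R chol (Rm x) k))" for n
    unfolding sv_def cmv_cvec by (simp only: matrix_vector_mult_scaleR)
  then show ?thesis unfolding n by (simp only: pm_sol)
qed

lemma sv_meas [measurable]: "k < CARD('l) \<Longrightarrow> (\<lambda>x. sv k n x $ i) \<in> borel_measurable borel"
  unfolding sv_nth by measurable

lemma norm_real_vec_sq: "(norm (v :: real^'l))\<^sup>2 = (\<Sum>i\<in>UNIV. (v $ i)\<^sup>2)"
  by (simp add: norm_vec_def L2_set_def sum_nonneg)

lemma sv_norm_meas [measurable]: "k < CARD('l) \<Longrightarrow> (\<lambda>x. (norm (sv k n x))\<^sup>2) \<in> borel_measurable borel"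
  unfolding norm_real_vec_sq by measurable

text \<open>Each of the \<open>l\<close> columns of \<open>E\<close> has mass 1 with respect to
  \<open>T\<close>. Keeping a single row and the absolutely continuous part only decreases the
  total.\<close>

lemma sv_bessel:
  assumes n: "n \<ge> 1" and k: "k < CARD('l)"
  shows "(\<integral>\<^sup>+x. ennreal ((norm (sv k n x))\<^sup>2) \<partial>lborel) \<le> ennreal (real CARD('l))"
proof -
  let ?g = "\<lambda>i x. \<Sum>p\<in>UNIV. E n x $ p $ i * E n x $ p $ i"
  have g0: "?g i x \<ge> 0" for i x by (intro sum_nonneg) simp
  have gi: "integrable T (?g i)" "(\<integral>x. ?g i x \<partial>T) = 1" for i using E_orth_entries[OF n n, of i i] by auto
  have gm[measurable]: "?g i \<in> borel_measurable borel" for i by measurable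
  have "(norm (sv k n x))\<^sup>2 \<le> w x * (\<Sum>i\<in>UNIV. ?g i x)" for x
  proof -
    have "(norm (sv k n x))\<^sup>2 = (\<Sum>i\<in>UNIV. w x * (E n x $ (enum_idx k) $ i * E n x $ (enum_idx k) $ i))"
      using w_nonneg[of x] unfolding norm_real_vec_sq sv_nth[OF k]
      by (simp add: power_mult_distrib power2_eq_square[of "E n x $ _ $ _"])
    also have "\<dots> \<le> (\<Sum>i\<in>UNIV. w x * ?g i x)"
      using w_nonneg[of x] by (intro sum_mono mult_left_mono member_le_sum[of "enum_idx k" UNIV "\<lambda>p. E n x $ p $ _ * E n x $ p $ _"]) auto
    finally show ?thesis by (simp add: sum_distrib_left)
  qed
  then have "(\<integral>\<^sup>+x. ennreal ((norm (sv k n x))\<^sup>2) \<partial>lborel) \<le> (\<integral>\<^sup>+x. ennreal (w x) * ennreal (\<Sum>i\<in>UNIV. ?g i x) \<partial>lborel)"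
    by (intro nn_integral_mono) (simp add: ennreal_mult'[symmetric] w_nonneg ennreal_leI)
  also have "\<dots> = (\<integral>\<^sup>+x. ennreal (\<Sum>i\<in>UNIV. ?g i x) \<partial>density lborel (\<lambda>x. ennreal (w x)))"
    by (rule nn_integral_density[symmetric]) (auto intro: borel_measurable_sum)
  also have "\<dots> = (\<integral>\<^sup>+x. indicator (- S) x * ennreal (\<Sum>i\<in>UNIV. ?g i x) \<partial>T)"
    unfolding T_ac[symmetric] by (rule nn_integral_density) (auto intro: borel_measurable_sum)
  also have "\<dots> \<le> (\<integral>\<^sup>+x. ennreal (\<Sum>i\<in>UNIV. ?g i x) \<partial>T)"
    by (intro nn_integral_mono) (auto simp: indicator_def)
  also have "\<dots> = ennreal (\<integral>x. (\<Sum>i\<in>UNIV. ?g i x) \<partial>T)"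
    by (rule nn_integral_eq_integral) (auto intro!: Bochner_Integration.integrable_sum gi sum_nonneg g0)
  also have "(\<integral>x. (\<Sum>i\<in>UNIV. ?g i x) \<partial>T) = (\<Sum>i\<in>UNIV. \<integral>x. ?g i x \<partial>T)"
    by (rule Bochner_Integration.integral_sum) (rule gi)
  finally show ?thesis by (simp add: gi(2))
qed

definition lead_idx :: "nat \<Rightarrow> 'l set" where "lead_idx j = {p. idx_of p \<le> j}"

lemma card_lead_idx: "j < CARD('l) \<Longrightarrow> card (lead_idx j) = Suc j"
proof -
  assume j: "j < CARD('l)"
  have "bij_betw idx_of (lead_idx j) {..j}"
    by (rule bij_betw_byWitness[where f' = enum_idx]) (use j in \<open>auto simp: lead_idx_def\<close>)
  then show ?thesis by (simp add: bij_betw_same_card)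
qed

definition lead_sum :: "nat \<Rightarrow> real \<Rightarrow> complex^'l \<Rightarrow> complex^'l" where
  "lead_sum j x c = (\<Sum>p\<in>lead_idx j. c $ p *s cvec (sv (idx_of p) 1 x))"

text \<open>Independence of the first \<open>j + 1\<close> solutions at site 1 with the constant
  \<open>M\<close>. The coefficients outside \<open>lead_idx j\<close> are added on the right so
  that \<open>c\<close> may range over the whole space.\<close>

definition good_set :: "nat \<Rightarrow> nat \<Rightarrow> real set" where
  "good_set j M = {x\<in>acA j. \<forall>c. (norm c)\<^sup>2 \<le> (real M)\<^sup>2 * ((norm (lead_sum j x c))\<^sup>2 + (\<Sum>p\<in>- lead_idx j. (norm (c $ p))\<^sup>2))}"

lemma lead_sum_cont: "continuous_on UNIV (\<lambda>c. lead_sum j x c)"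
proof -
  have "continuous_on UNIV (\<lambda>c :: complex^'l. c $ p *s v)" for p and v :: "complex^'l"
    unfolding continuous_on_componentwise[of UNIV "\<lambda>c. c $ p *s v"]
  proof
    fix e :: "complex^'l" assume "e \<in> Basis"
    then obtain i u where e: "e = axis i u" by (auto simp: Basis_vec_def)
    show "continuous_on UNIV (\<lambda>c. (c $ p *s v) \<bullet> e)" unfolding e inner_axis by (simp, intro continuous_intros)
  qed
  then show ?thesis unfolding lead_sum_def by (intro continuous_on_sum)
qed

lemma good_set_borel [measurable]: "good_set j M \<in> sets borel"
proof -
  obtain D :: "(complex^'l) set" where D: "countable D" "closure D = UNIV" by (rule dense_complex_vec)
  let ?P = "\<lambda>x c. (norm c)\<^sup>2 \<le> (real M)\<^sup>2 * ((norm (lead_sum j x c))\<^sup>2 + (\<Sum>p\<in>- lead_idx j. (norm (c $ p))\<^sup>2))"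
  have dense: "(\<forall>c. ?P x c) \<longleftrightarrow> (\<forall>c\<in>D. ?P x c)" for x
  proof
    assume d: "\<forall>c\<in>D. ?P x c"
    have "closed {c. ?P x c}"
      by (intro closed_Collect_le continuous_intros lead_sum_cont)
    then have "closure D \<subseteq> {c. ?P x c}" by (rule closure_minimal[rotated]) (use d in auto)
    then show "\<forall>c. ?P x c" using D(2) by auto
  qed auto
  have m: "{x. ?P x c} \<in> sets borel" for c
  proof -
    have "(\<lambda>x. lead_sum j x c $ i) \<in> borel_measurable borel" for i
    proof -
      have "(\<lambda>x. lead_sum j x c $ i) = (\<lambda>x. \<Sum>p\<in>lead_idx j. c $ p * complex_of_real (sv (idx_of p) 1 x $ i))"
        by (simp add: lead_sum_def)
      then show ?thesis by simp
    qed
    then have [measurable]: "(\<lambda>x. lead_sum j x c) \<in> borel_measurable borel" by (simp add: vec_measurable_iff)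
    show ?thesis by measurable
  qed
  have "good_set j M = acA j \<inter> (\<Inter>c\<in>D. {x. ?P x c})" unfolding good_set_def dense by auto
  moreover have "(\<Inter>c\<in>D. {x. ?P x c}) \<in> sets borel"
  proof (rule sets.countable_INT'[OF D(1)])
    show "D \<noteq> {}" using D(2) by auto
    show "(\<lambda>c. {x. ?P x c}) ` D \<subseteq> sets borel" using m by blast
  qed
  ultimately show ?thesis using acA_borel by (simp only: sets.Int)
qed

text \<open>On \<open>acA j\<close> the first \<open>j + 1\<close> Cholesky vectors are independent
  and \<open>w\<close> is positive, so the linear map \<open>f\<close> is injective and, in finite
  dimension, bounded below by a positive constant.\<close>

lemma good_set_cover: "acA j = (\<Union>M. good_set j M)"
proof
  show "(\<Union>M. good_set j M) \<subseteq> acA j" by (auto simp: good_set_def)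
  show "acA j \<subseteq> (\<Union>M. good_set j M)"
  proof
    fix x assume x: "x \<in> acA j"
    define f where "f c = (lead_sum j x c, (\<chi> p. if p \<in> lead_idx j then 0 else c $ p) :: complex^'l)" for c
    have lin: "linear f"
    proof (rule linearI)
      show "f (c + d) = f c + f d" for c d
        by (simp add: f_def lead_sum_def vec_eq_iff sum.distrib distrib_right)
      show "f (r *\<^sub>R c) = r *\<^sub>R f c" for r c
        by (simp add: f_def lead_sum_def vec_eq_iff scaleR_sum_right)
    qed
    have "inj f"
    proof (rule linear_injective_0[OF lin, THEN iffD2], intro allI impI)
      fix c assume c: "f c = 0"
      have off: "c $ p = 0" if "p \<notin> lead_idx j" for p
      proof -
        have "snd (f c) $ p = 0" using c by simp
        then show ?thesis using that by (simp add: f_def)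
      qed
      have ls: "lead_sum j x c = 0" using c by (simp add: f_def zero_prod_def)
      have wx: "sqrt (w x) \<noteq> 0" "j < CARD('l)" "chol (Rm x) j \<noteq> 0" using x by (auto simp: acA_def)
      define d where "d k = (if k \<le> j then c $ enum_idx k else 0)" for k
      have dz: "d k = 0" if k: "k < Suc j" for k
      proof (rule chol_independent[OF Rm_psd _ _ k])
        fix q
        have "0 = lead_sum j x c $ q" using ls by simp
        also have "\<dots> = of_real (sqrt (w x)) * (\<Sum>p\<in>lead_idx j. c $ p * of_real (chol (Rm x) (idx_of p) $ q))"
          by (simp add: lead_sum_def sv_def sum_distrib_left mult_ac)
        also have "(\<Sum>p\<in>lead_idx j. c $ p * complex_of_real (chol (Rm x) (idx_of p) $ q)) = (\<Sum>k<Suc j. d k * of_real (chol (Rm x) k $ q))"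
          by (rule sum.reindex_bij_witness[where i = enum_idx and j = idx_of]) (use wx in \<open>auto simp: lead_idx_def d_def\<close>)
        finally show "(\<Sum>k<Suc j. d k * of_real (chol (Rm x) k $ q)) = 0" using wx by simp
        fix k assume "k < Suc j" "chol (Rm x) k = 0"
        then show "d k = 0" using chol_initial[OF Rm_psd, of x k j] wx by simp
      qed
      have "c $ p = 0" if "p \<in> lead_idx j" for p
        using dz[of "idx_of p"] that by (simp add: lead_idx_def d_def)
      then show "c = 0" using off by (auto simp: vec_eq_iff)
    qed
    then obtain B where B: "B > 0" "\<And>c. B * norm c \<le> norm (f c)"
      using linear_inj_bounded_below_pos[OF lin] by blast
    obtain M :: nat where M: "1 / B \<le> real M" using real_arch_simple by blast
    have "(norm c)\<^sup>2 \<le> (real M)\<^sup>2 * ((norm (lead_sum j x c))\<^sup>2 + (\<Sum>p\<in>- lead_idx j. (norm (c $ p))\<^sup>2))" for c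
    proof -
      have "norm c \<le> 1 / B * norm (f c)" using B by (simp add: field_simps)
      also have "\<dots> \<le> real M * norm (f c)" using M by (intro mult_right_mono) auto
      finally have "(norm c)\<^sup>2 \<le> (real M * norm (f c))\<^sup>2" by (intro power_mono) auto
      also have "\<dots> = (real M)\<^sup>2 * ((norm (lead_sum j x c))\<^sup>2 + (norm ((\<chi> p. if p \<in> lead_idx j then 0 else c $ p) :: complex^'l))\<^sup>2)"
        by (simp add: f_def norm_Pair power_mult_distrib)
      also have "(norm ((\<chi> p. if p \<in> lead_idx j then 0 else c $ p) :: complex^'l))\<^sup>2 = (\<Sum>p\<in>- lead_idx j. (norm (c $ p))\<^sup>2)"
        unfolding norm_vec_sq by (rule sum.mono_neutral_cong_right) auto
      finally show ?thesis .
    qed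
    then show "x \<in> (\<Union>M. good_set j M)" using x by (auto simp: good_set_def)
  qed
qed

text \<open>A Wronskian argument: on a good set the \<open>j + 1\<close> Dirichlet solutions \<open>sv\<close> are controlled at
  both ends of the shifted block, while the resolvent of the long chain connects its left end to
  the site \<open>1\<close>. This bounds the transmission through the block from below on every \<open>l - j\<close>
  dimensional frame.\<close>
lemma shifted_lower_bound_at:
  assumes j: "j < CARD('l)" and x: "x \<in> good_set j M" and n: "n \<ge> 1" and N: "N \<ge> 1"
    and k: "\<And>v. norm (chain_res a b (n + N) (of_real x) (site n v) 1) \<le> k * norm v" and k0: "k \<ge> 0"
    and t: "(\<Sum>p\<in>lead_idx j. (norm (cmv (a (n + N)) (cvec (sv (idx_of p) (Suc (n + N)) x)) + \<i> *s cvec (sv (idx_of p) (n + N) x)))\<^sup>2) \<le> t0"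
    and v: "frame (CARD('l) - j) v"
  shows "1 \<le> 4 * (real M)\<^sup>2 * k\<^sup>2 * C\<^sup>2 * t0 *
    (\<Sum>i<CARD('l) - j. (norm (jacobi_coeff.lres (\<lambda>k. a (n + k)) (\<lambda>k. b (n + k)) N x (cvec (v i))))\<^sup>2)"
proof -
  interpret sh: jacobi_coeff "\<lambda>k. a (n + k)" "\<lambda>k. b (n + k)" C by (rule jacobi_shift)
  define L where "L = n + N"
  define m where "m = CARD('l) - j"
  define J where "J = lead_idx j"
  have L: "L \<ge> 1" using n by (simp add: L_def)
  define y where "y p k = cvec (sv (idx_of p) k x)" for p :: 'l and k
  \<comment> \<open>The defect of a solution in the absorbing boundary condition at
    \<open>L\<close>.\<close>
  define tt where "tt p = cmv (a L) (y p (Suc L)) + \<i> *s y p L" for p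
  define s where "s p = chain_res (\<lambda>k. a (n + k)) (\<lambda>k. b (n + k)) N (of_real x) (site N (- tt p)) 1" for p
  have y1: "y p 1 = - chain_res a b L (of_real x) (site n (cmv (a n) (s p))) 1" for p
  proof -
    \<comment> \<open>Replacing the value after \<open>L\<close> by the one required for absorption
      leaves \<open>- tt p\<close> as a source at site \<open>L\<close>. By
      \<open>green_factor\<close> the value at site 1 is then produced by \<open>s p\<close>, which
      is what the block transmits to its left end.\<close>
    define y' where "y' k = (if k \<le> L then y p k else cmv (ai L) (- (\<i> *s y p L)))" for k
    have row: "jrow a b (y p) k = of_real x *s y p k" if "k \<ge> 1" for k
      using sv_row[OF that, of "idx_of p" x] unfolding y_def by simp
    have "chain_sol a b L (of_real x) (site L (- tt p)) y'"
      unfolding chain_sol_def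
    proof (intro conjI ballI)
      show "y' 0 = 0" by (simp add: y'_def y_def)
      show "cmv (a L) (y' (Suc L)) = - (\<i> *s y' L)" by (simp add: y'_def del: cmv_simps)
      fix k assume k: "k \<in> {1..L}"
      show "jrow a b y' k - of_real x *s y' k = site L (- tt p) k"
      proof (cases "k = L")
        case False
        then have "jrow a b y' k = jrow a b (y p) k" "y' k = y p k" using k by (auto simp: jrow_def y'_def)
        then show ?thesis using row[of k] k False by simp
      next
        case True
        have "jrow a b y' L = jrow a b (y p) L - cmv (a L) (y p (Suc L)) - \<i> *s y p L"
          using L by (simp add: jrow_def y'_def del: cmv_simps) 
        then show ?thesis using row[OF L] True by (simp add: y'_def tt_def)
      qed
    qed
    from chain_res_eqI[OF this L, of 1] L
    have "y p 1 = chain_res a b L (of_real x) (site L (- tt p)) 1" by (simp add: y'_def)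
    then show ?thesis using green_factor[OF n N, of "of_real x" "- tt p"] unfolding L_def s_def by simp
  qed
  have cJ: "finite J" "card J = Suc j" using card_lead_idx[OF j] by (auto simp: J_def)
  \<comment> \<open>\<open>j + 1\<close> solutions and \<open>l - j\<close> frame vectors give
    \<open>l + 1\<close> unknowns for \<open>l\<close> equations.\<close>
  define I where "I = Inl ` J \<union> Inr ` {..<m}"
  have cI: "finite I" "CARD('l) < card I"
  proof -
    show "finite I" by (simp add: I_def)
    have "card I = card (Inl ` J :: ('l + nat) set) + card (Inr ` {..<m} :: ('l + nat) set)"
      unfolding I_def by (rule card_Un_disjoint) auto
    then show "CARD('l) < card I" using cJ j by (simp add: card_image m_def)
  qed
  obtain c where c: "\<exists>i\<in>I. c i \<noteq> 0" "\<And>q. q < CARD('l) \<Longrightarrow> (\<Sum>i\<in>I. c i * (case i of Inl p \<Rightarrow> - (s p $ enum_idx q) | Inr i \<Rightarrow> cvec (v i) $ enum_idx q)) = 0"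
    using homogeneous_solution[OF cI, of "\<lambda>q i. case i of Inl p \<Rightarrow> - (s p $ enum_idx q) | Inr i \<Rightarrow> cvec (v i) $ enum_idx q"] by blast
  \<comment> \<open>A vector in the span of the frame and also in the span of the
    \<open>s p\<close>.\<close>
  define z where "z = (\<Sum>i<m. c (Inr i) *s cvec (v i))"
  have z2: "z = (\<Sum>p\<in>J. c (Inl p) *s s p)"
  proof -
    have "z $ q = (\<Sum>p\<in>J. c (Inl p) *s s p) $ q" for q
    proof -
      have "0 = (\<Sum>i\<in>I. c i * (case i of Inl p \<Rightarrow> - (s p $ q) | Inr i \<Rightarrow> cvec (v i) $ q))"
        using c(2)[OF idx_of_less[of q]] unfolding enum_idx_of by simp
      also have "\<dots> = (\<Sum>i\<in>Inl ` J. c i * (case i of Inl p \<Rightarrow> - (s p $ q) | Inr i \<Rightarrow> cvec (v i) $ q))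
          + (\<Sum>i\<in>Inr ` {..<m}. c i * (case i of Inl p \<Rightarrow> - (s p $ q) | Inr i \<Rightarrow> cvec (v i) $ q))"
        unfolding I_def by (rule sum.union_disjoint) (use cJ in auto)
      also have "\<dots> = - (\<Sum>p\<in>J. c (Inl p) * s p $ q) + (\<Sum>i<m. c (Inr i) * cvec (v i) $ q)"
        by (simp add: sum.reindex sum_negf)
      finally show ?thesis by (simp add: z_def)
    qed
    then show ?thesis by (simp add: vec_eq_iff)
  qed
  define cc where "cc = (\<chi> p. if p \<in> J then c (Inl p) else 0)"
  define \<alpha> where "\<alpha> = L2_set (\<lambda>i. norm (c (Inr i))) {..<m}"
  have al: "\<alpha>\<^sup>2 = (\<Sum>i<m. (norm (c (Inr i)))\<^sup>2)" "\<alpha> \<ge> 0" by (simp_all add: \<alpha>_def L2_set_def sum_nonneg)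
  have a2: "\<alpha> \<le> 2 * norm z"
  proof -
    have "\<alpha>\<^sup>2 \<le> (2 * norm z)\<^sup>2"
      using v unfolding frame_def m_def[symmetric] al z_def by (simp add: power_mult_distrib)
    then show ?thesis by (rule power2_le_imp_le) simp
  qed
  have ls: "lead_sum j x cc = - chain_res a b L (of_real x) (site n (cmv (a n) z)) 1"
  proof -
    have "lead_sum j x cc = (\<Sum>p\<in>J. c (Inl p) *s y p 1)"
      unfolding lead_sum_def J_def[symmetric] by (intro sum.cong) (auto simp: cc_def y_def)
    also have "\<dots> = - (\<Sum>p\<in>J. c (Inl p) *s chain_res a b L (of_real x) (site n (cmv (a n) (s p))) 1)"
      unfolding y1 by (simp add: sum_negf)
    also have "\<dots> = - chain_res a b L (of_real x) (\<lambda>k. \<Sum>p\<in>J. c (Inl p) *s site n (cmv (a n) (s p)) k) 1"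
      using L by (subst chain_res_sum) auto
    also have "(\<lambda>k. \<Sum>p\<in>J. c (Inl p) *s site n (cmv (a n) (s p)) k) = site n (cmv (a n) z)"
      unfolding z2 by (auto simp: site_def fun_eq_iff)
    finally show ?thesis .
  qed
  \<comment> \<open>The good set bounds the coefficients by the combined solution at site 1, and the
    resolvent bound \<open>k\<close> controls this by the data at site \<open>n\<close>.\<close>
  have cz: "norm cc \<le> real M * (k * (C * norm z))"
  proof -
    have "(norm cc)\<^sup>2 \<le> (real M)\<^sup>2 * ((norm (lead_sum j x cc))\<^sup>2 + (\<Sum>p\<in>- lead_idx j. (norm (cc $ p))\<^sup>2))"
      using x by (auto simp: good_set_def)
    also have "(\<Sum>p\<in>- lead_idx j. (norm (cc $ p))\<^sup>2) = 0" by (intro sum.neutral) (auto simp: cc_def J_def)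
    finally have "(norm cc)\<^sup>2 \<le> (real M * norm (lead_sum j x cc))\<^sup>2" by (simp add: power_mult_distrib)
    then have "norm cc \<le> real M * norm (lead_sum j x cc)" by (rule power2_le_imp_le) simp
    also have "\<dots> \<le> real M * (k * norm (cmv (a n) z))"
      unfolding ls L_def using k by (intro mult_left_mono) auto
    also have "\<dots> \<le> real M * (k * (C * norm z))" using k0 by (intro mult_left_mono bound_a) auto
    finally show ?thesis .
  qed
  \<comment> \<open>If \<open>z\<close> were 0, the coefficients of the solutions would vanish by
    \<open>cz\<close> and those of the frame by \<open>a2\<close>.\<close>
  have znz: "norm z > 0"
  proof (rule ccontr)
    assume "\<not> norm z > 0"
    then have z0: "norm z = 0" by simp
    then have "cc = 0" using cz by simp
    then have ccz: "cc $ p = 0" for p by simp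
    have "c (Inl p) = 0" if "p \<in> J" for p using ccz[of p] that by (simp add: cc_def)
    moreover have "\<alpha> = 0" using a2 z0 al(2) by simp
    then have "c (Inr i) = 0" if "i < m" for i using that al(1) by (simp add: sum_nonneg_eq_0_iff)
    ultimately show False using c(1) by (auto simp: I_def)
  qed
  define \<tau> where "\<tau> = (\<Sum>p\<in>J. c (Inl p) *s (- tt p))"
  define \<Lambda> where "\<Lambda> i = sh.lres N x (cvec (v i))" for i
  define Q where "Q = L2_set (\<lambda>i. norm (\<Lambda> i)) {..<m}"
  have Q: "Q\<^sup>2 = (\<Sum>i<m. (norm (\<Lambda> i))\<^sup>2)" "Q \<ge> 0" by (simp_all add: Q_def L2_set_def sum_nonneg)
  have taun: "norm \<tau> \<le> norm cc * sqrt t0"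
  proof -
    have "norm \<tau> \<le> (\<Sum>p\<in>J. \<bar>norm (c (Inl p))\<bar> * \<bar>norm (tt p)\<bar>)"
      unfolding \<tau>_def by (rule order_trans[OF norm_sum]) simp
    also have "\<dots> \<le> L2_set (\<lambda>p. norm (c (Inl p))) J * L2_set (\<lambda>p. norm (tt p)) J" by (rule L2_set_mult_ineq)
    also have "L2_set (\<lambda>p. norm (c (Inl p))) J = norm cc"
      unfolding norm_vec_def L2_set_def by (intro arg_cong[of _ _ sqrt] sum.mono_neutral_cong_left) (auto simp: cc_def)
    also have "L2_set (\<lambda>p. norm (tt p)) J \<le> sqrt t0"
      unfolding L2_set_def using t by (simp add: tt_def y_def L_def J_def)
    finally show ?thesis by (simp add: mult_left_mono)
  qed
  have pair: "bdot (s p) (cvec (v i)) = bdot (- tt p) (\<Lambda> i)" for p i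
    unfolding s_def \<Lambda>_def by (rule sh.lres_pair[OF N, symmetric])
  \<comment> \<open>Both expansions of \<open>z\<close> are used: one factor in the frame, the other
    in the \<open>s p\<close>. Reciprocity moves the latter to the right end, where the defects meet
    the transmitted frame vectors.\<close>
  have "complex_of_real ((norm z)\<^sup>2) = cdot (\<Sum>i<m. c (Inr i) *s cvec (v i)) z"
    unfolding z_def[symmetric] by (simp add: cdot_self)
  also have "\<dots> = (\<Sum>i<m. cnj (c (Inr i)) * bdot z (cvec (v i)))"
    by (simp add: cdot_bdot bdot_commute[of _ z])
  also have "\<dots> = (\<Sum>i<m. cnj (c (Inr i)) * bdot \<tau> (\<Lambda> i))"
    unfolding z2 \<tau>_def by (simp only: bdot_sum bdot_simps(9) pair)
  finally have "(norm z)\<^sup>2 = norm (\<Sum>i<m. cnj (c (Inr i)) * bdot \<tau> (\<Lambda> i))"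
    by (metis norm_of_real abs_of_nonneg zero_le_power2)
  also have "\<dots> \<le> (\<Sum>i<m. norm \<tau> * (\<bar>norm (c (Inr i))\<bar> * \<bar>norm (\<Lambda> i)\<bar>))"
  proof (rule order_trans[OF norm_sum], rule sum_mono)
    fix i
    have "norm (c (Inr i)) * norm (bdot \<tau> (\<Lambda> i)) \<le> norm (c (Inr i)) * (norm \<tau> * norm (\<Lambda> i))"
      by (intro mult_left_mono norm_bdot_le) simp
    then show "norm (cnj (c (Inr i)) * bdot \<tau> (\<Lambda> i)) \<le> norm \<tau> * (\<bar>norm (c (Inr i))\<bar> * \<bar>norm (\<Lambda> i)\<bar>)"
      by (simp add: norm_mult mult_ac)
  qed
  also have "\<dots> \<le> norm \<tau> * (\<alpha> * Q)"
    unfolding sum_distrib_left[symmetric] \<alpha>_def Q_def by (intro mult_left_mono L2_set_mult_ineq) simp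
  also have "\<dots> \<le> (norm cc * sqrt t0) * ((2 * norm z) * Q)"
    using taun a2 Q al order_trans[OF norm_ge_zero taun] by (intro mult_mono) auto
  also have "\<dots> \<le> (real M * (k * (C * norm z)) * sqrt t0) * ((2 * norm z) * Q)"
  proof -
    have "0 \<le> t0" using order_trans[OF _ t] by (simp add: sum_nonneg)
    then show ?thesis using cz Q by (intro mult_right_mono) auto
  qed
  finally have "(norm z)\<^sup>2 * 1 \<le> (norm z)\<^sup>2 * (2 * real M * k * C * sqrt t0 * Q)"
    by (simp add: power2_eq_square mult_ac)
  then have one: "1 \<le> 2 * real M * k * C * sqrt t0 * Q" using znz by (subst (asm) mult_le_cancel_left_pos) auto
  then have "1\<^sup>2 \<le> (2 * real M * k * C * sqrt t0 * Q)\<^sup>2" by (intro power_mono) auto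
  moreover have "0 \<le> t0" using order_trans[OF _ t] by (simp add: sum_nonneg)
  ultimately show ?thesis unfolding m_def[symmetric] by (simp add: power_mult_distrib Q \<Lambda>_def)
qed

text \<open>The two inputs of the pointwise bound hold off small sets: the resolvent bound by the
  weak-type estimate, the bound on the defects by Markov's inequality. Neither set depends on the
  frame, and the constants depend on neither the shift nor the length.\<close>

lemma shifted_lower_bound:
  assumes j: "j < CARD('l)" and e: "e > 0"
  shows "\<exists>Kc>0. \<forall>n\<ge>1. \<forall>N\<ge>1. \<exists>Bad\<in>sets lborel. emeasure lborel Bad \<le> ennreal e \<and>
     (\<forall>x\<in>good_set j M \<inter> {-R0..R0} - Bad. \<forall>v. frame (CARD('l) - j) v \<longrightarrow>
        1 \<le> Kc * (\<Sum>i<CARD('l) - j. (norm (jacobi_coeff.lres (\<lambda>k. a (n + k)) (\<lambda>k. b (n + k)) N x (cvec (v i))))\<^sup>2))"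
proof -
  define l where "l = real CARD('l)"
  have l: "l > 0" by (simp add: l_def)
  \<comment> \<open>Makes the weak-type bound \<open>64 * pi * l ^ 4 / k\<close> equal to
    \<open>e / 2\<close>.\<close>
  define k where "k = 128 * pi * l ^ 4 / e"
  have k: "k > 0" using l e by (simp add: k_def)
  \<comment> \<open>By \<open>sv_bessel\<close> each of at most \<open>l\<close> squared defects has
    integral at most \<open>2 * C\<^sup>2 * l + 2 * l\<close>. Markov's inequality at the level
    \<open>t0 = 2 * A / e\<close> leaves measure \<open>e / 2\<close>.\<close>
  define A where "A = l * (2 * C\<^sup>2 * l + 2 * l)"
  have A: "A > 0" using l by (simp add: A_def add_nonneg_pos)
  define t0 where "t0 = 2 * A / e"
  have t0: "t0 > 0" using A e by (simp add: t0_def)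
  define Kc where "Kc = 4 * (real M)\<^sup>2 * k\<^sup>2 * C\<^sup>2 * t0 + 1"
  have Kc: "Kc > 0" using t0 by (simp add: Kc_def add_nonneg_pos)
  have "\<exists>Bad\<in>sets lborel. emeasure lborel Bad \<le> ennreal e \<and>
     (\<forall>x\<in>good_set j M \<inter> {-R0..R0} - Bad. \<forall>v. frame (CARD('l) - j) v \<longrightarrow>
        1 \<le> Kc * (\<Sum>i<CARD('l) - j. (norm (jacobi_coeff.lres (\<lambda>k. a (n + k)) (\<lambda>k. b (n + k)) N x (cvec (v i))))\<^sup>2))"
    if n: "n \<ge> 1" and N: "N \<ge> 1" for n N
  proof -
    let ?L = "n + N"
    define g where "g p x = (norm (cmv (a ?L) (cvec (sv (idx_of p) (Suc ?L) x)) + \<i> *s cvec (sv (idx_of p) ?L x)))\<^sup>2" for p :: 'l and x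
    define G where "G x = (\<Sum>p\<in>lead_idx j. g p x)" for x
    have g0: "g p x \<ge> 0" for p x by (simp add: g_def)
    have gm[measurable]: "g p \<in> borel_measurable borel" for p
    proof -
      have e: "(\<lambda>x. (cmv (a ?L) (cvec (sv (idx_of p) (Suc ?L) x)) + \<i> *s cvec (sv (idx_of p) ?L x)) $ i)
        = (\<lambda>x. (\<Sum>q\<in>UNIV. complex_of_real (a ?L $ i $ q) * complex_of_real (sv (idx_of p) (Suc ?L) x $ q)) + \<i> * complex_of_real (sv (idx_of p) ?L x $ i))" for i
        by (simp add: cmv_def)
      have "(\<lambda>x. cmv (a ?L) (cvec (sv (idx_of p) (Suc ?L) x)) + \<i> *s cvec (sv (idx_of p) ?L x)) \<in> borel_measurable borel"
        unfolding vec_measurable_iff e by simp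
      then show ?thesis unfolding g_def by measurable
    qed
    have gint: "(\<integral>\<^sup>+x. ennreal (g p x) \<partial>lborel) \<le> ennreal (2 * C\<^sup>2 * l + 2 * l)" for p
    proof -
      have le: "g p x \<le> 2 * C\<^sup>2 * (norm (sv (idx_of p) (Suc ?L) x))\<^sup>2 + 2 * (norm (sv (idx_of p) ?L x))\<^sup>2" for x
      proof -
        let ?u = "cmv (a ?L) (cvec (sv (idx_of p) (Suc ?L) x))" and ?v = "\<i> *s cvec (sv (idx_of p) ?L x)"
        have "(norm (?u + ?v))\<^sup>2 \<le> (norm ?u + norm ?v)\<^sup>2" by (rule power_mono[OF norm_triangle_ineq]) simp
        also have "\<dots> \<le> 2 * (norm ?u)\<^sup>2 + 2 * (norm ?v)\<^sup>2"
          using sum_squares_bound[of "norm ?u" "norm ?v"] by (simp add: power2_sum)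
        also have "(norm ?u)\<^sup>2 \<le> (C * norm (cvec (sv (idx_of p) (Suc ?L) x)))\<^sup>2" by (intro power_mono bound_a) simp
        finally show ?thesis by (simp add: g_def power_mult_distrib)
      qed
      have "(\<integral>\<^sup>+x. ennreal (g p x) \<partial>lborel) \<le> (\<integral>\<^sup>+x. ennreal (2 * C\<^sup>2) * ennreal ((norm (sv (idx_of p) (Suc ?L) x))\<^sup>2) + ennreal 2 * ennreal ((norm (sv (idx_of p) ?L x))\<^sup>2) \<partial>lborel)"
      proof (intro nn_integral_mono)
        fix x
        have "ennreal (g p x) \<le> ennreal (2 * C\<^sup>2 * (norm (sv (idx_of p) (Suc ?L) x))\<^sup>2 + 2 * (norm (sv (idx_of p) ?L x))\<^sup>2)"
          by (rule ennreal_leI[OF le])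
        also have "\<dots> = ennreal (2 * C\<^sup>2 * (norm (sv (idx_of p) (Suc ?L) x))\<^sup>2) + ennreal (2 * (norm (sv (idx_of p) ?L x))\<^sup>2)"
          by (rule ennreal_plus) auto
        also have "\<dots> = ennreal (2 * C\<^sup>2) * ennreal ((norm (sv (idx_of p) (Suc ?L) x))\<^sup>2) + ennreal 2 * ennreal ((norm (sv (idx_of p) ?L x))\<^sup>2)"
          by (subst (1 2) ennreal_mult) auto
        finally show "ennreal (g p x) \<le> ennreal (2 * C\<^sup>2) * ennreal ((norm (sv (idx_of p) (Suc ?L) x))\<^sup>2) + ennreal 2 * ennreal ((norm (sv (idx_of p) ?L x))\<^sup>2)" .
      qed
      also have "\<dots> = ennreal (2 * C\<^sup>2) * (\<integral>\<^sup>+x. ennreal ((norm (sv (idx_of p) (Suc ?L) x))\<^sup>2) \<partial>lborel) + ennreal 2 * (\<integral>\<^sup>+x. ennreal ((norm (sv (idx_of p) ?L x))\<^sup>2) \<partial>lborel)"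
        by (subst nn_integral_add) (auto simp: nn_integral_cmult)
      also have "\<dots> \<le> ennreal (2 * C\<^sup>2) * ennreal l + ennreal 2 * ennreal l"
        unfolding l_def using n by (intro add_mono mult_left_mono sv_bessel) auto
      also have "\<dots> = ennreal (2 * C\<^sup>2 * l + 2 * l)" using l by (subst ennreal_plus) (auto simp: ennreal_mult)
      finally show ?thesis .
    qed
    have Gm[measurable]: "G \<in> borel_measurable borel" unfolding G_def by measurable
    have "ennreal (G x) = (\<Sum>p\<in>lead_idx j. ennreal (g p x))" for x
      unfolding G_def by (rule sum_ennreal[symmetric]) (rule g0)
    then have "(\<integral>\<^sup>+x. ennreal (G x) \<partial>lborel) = (\<integral>\<^sup>+x. (\<Sum>p\<in>lead_idx j. ennreal (g p x)) \<partial>lborel)"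
      by (simp only:)
    also have "\<dots> = (\<Sum>p\<in>lead_idx j. \<integral>\<^sup>+x. ennreal (g p x) \<partial>lborel)"
      by (rule nn_integral_sum) simp
    also have "\<dots> \<le> (\<Sum>p\<in>lead_idx j. ennreal (2 * C\<^sup>2 * l + 2 * l))" by (intro sum_mono gint)
    also have "\<dots> \<le> (\<Sum>p\<in>(UNIV :: 'l set). ennreal (2 * C\<^sup>2 * l + 2 * l))" by (intro sum_mono2) auto
    also have "\<dots> = ennreal A" using l by (simp add: A_def l_def ennreal_of_nat_eq_real_of_nat ennreal_mult)
    finally have Gint: "(\<integral>\<^sup>+x. ennreal (G x) \<partial>lborel) \<le> ennreal A" .
    define B1 where "B1 = {x. G x \<ge> t0}"
    have B1m[measurable]: "B1 \<in> sets borel" unfolding B1_def by measurable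
    have "emeasure lborel B1 \<le> ennreal (e / 2)"
    proof -
      have "emeasure lborel B1 = (\<integral>\<^sup>+x. indicator B1 x \<partial>lborel)" by simp
      also have "\<dots> \<le> (\<integral>\<^sup>+x. ennreal (1 / t0) * ennreal (G x) \<partial>lborel)"
      proof (intro nn_integral_mono)
        fix x
        show "indicator B1 x \<le> ennreal (1 / t0) * ennreal (G x)"
        proof (cases "x \<in> B1")
          case True
          then have "1 \<le> 1 / t0 * G x" using t0 by (simp add: B1_def field_simps)
          then have "ennreal 1 \<le> ennreal (1 / t0 * G x)" by (rule ennreal_leI)
          also have "ennreal (1 / t0 * G x) = ennreal (1 / t0) * ennreal (G x)" using t0 by (intro ennreal_mult') simp
          finally show ?thesis using True by simp
        qed simp
      qed
      also have "\<dots> = ennreal (1 / t0) * (\<integral>\<^sup>+x. ennreal (G x) \<partial>lborel)" by (rule nn_integral_cmult) simp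
      also have "\<dots> \<le> ennreal (1 / t0) * ennreal A" by (intro mult_left_mono Gint) simp
      also have "\<dots> = ennreal (1 / t0 * A)" using A t0 by (intro ennreal_mult'[symmetric]) simp
      also have "1 / t0 * A = e / 2" using A by (simp add: t0_def)
      finally show ?thesis .
    qed
    note B1 = this
    obtain B2 where B2: "B2 \<in> sets lborel" "emeasure lborel B2 \<le> ennreal (64 * pi * real CARD('l) ^ 4 / k)"
      "\<And>x v. x \<in> {-R0..R0} - B2 \<Longrightarrow> norm (chain_res a b ?L (of_real x) (site n v) 1) \<le> k * norm v"
      using weak_type_green[of ?L n k R0] n k by auto
    have "64 * pi * real CARD('l) ^ 4 / k = e / 2" using l e by (simp add: k_def l_def field_simps)
    then have B2e: "emeasure lborel B2 \<le> ennreal (e / 2)" using B2(2) by (simp only:)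
    show ?thesis
    proof (intro bexI[of _ "B1 \<union> B2"] conjI ballI allI impI)
      show "B1 \<union> B2 \<in> sets lborel" using B2(1) by simp
      have "emeasure lborel (B1 \<union> B2) \<le> emeasure lborel B1 + emeasure lborel B2"
        by (rule emeasure_subadditive) (use B2(1) in auto)
      also have "\<dots> \<le> ennreal (e / 2) + ennreal (e / 2)" by (intro add_mono B1 B2e)
      also have "\<dots> = ennreal e" using e by (simp add: ennreal_plus[symmetric] del: ennreal_plus)
      finally show "emeasure lborel (B1 \<union> B2) \<le> ennreal e" .
      fix x v assume x: "x \<in> good_set j M \<inter> {-R0..R0} - (B1 \<union> B2)" and v: "frame (CARD('l) - j) (v :: nat \<Rightarrow> real^'l)"
      let ?Q = "\<Sum>i<CARD('l) - j. (norm (jacobi_coeff.lres (\<lambda>k. a (n + k)) (\<lambda>k. b (n + k)) N x (cvec (v i))))\<^sup>2"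
      have "1 \<le> 4 * (real M)\<^sup>2 * k\<^sup>2 * C\<^sup>2 * t0 * ?Q"
      proof (rule shifted_lower_bound_at[OF j _ n N _ _ _ v])
        show "norm (chain_res a b (n + N) (of_real x) (site n v) 1) \<le> k * norm v" for v using B2(3) x by auto
        show "(\<Sum>p\<in>lead_idx j. (norm (cmv (a (n + N)) (cvec (sv (idx_of p) (Suc (n + N)) x)) + \<i> *s cvec (sv (idx_of p) (n + N) x)))\<^sup>2) \<le> t0"
          using x unfolding B1_def G_def g_def by auto
      qed (use x k in auto)
      also have "\<dots> \<le> Kc * ?Q" unfolding Kc_def by (intro mult_right_mono sum_nonneg) auto
      finally show "1 \<le> Kc * ?Q" .
    qed
  qed
  then show ?thesis using Kc by blast
qed

end

section \<open>Transfer of multiplicity along limits of shifts\<close>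

lemma (in jacobi_coeff) dens_poly_integral:
  assumes N: "N \<ge> Suc d"
  shows "integrable lborel (\<lambda>x. (\<Sum>k\<le>d. c k * x ^ k) * dens N x u v)"
    "(\<integral>x. (\<Sum>k\<le>d. c k * x ^ k) * dens N x u v \<partial>lborel) = (\<Sum>k\<le>d. c k * mom k u v)"
proof -
  have e: "(\<lambda>x. (\<Sum>k\<le>d. c k * x ^ k) * dens N x u v) = (\<lambda>x. \<Sum>k\<le>d. c k * (x ^ k * dens N x u v))"
    by (simp add: sum_distrib_right mult.assoc)
  have i: "integrable lborel (\<lambda>x. c k * (x ^ k * dens N x u v))" if "k \<in> {..d}" for k
    using N that by (intro integrable_mult_right dens_mom) auto
  show "integrable lborel (\<lambda>x. (\<Sum>k\<le>d. c k * x ^ k) * dens N x u v)"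
    unfolding e by (intro Bochner_Integration.integrable_sum i)
  show "(\<integral>x. (\<Sum>k\<le>d. c k * x ^ k) * dens N x u v \<partial>lborel) = (\<Sum>k\<le>d. c k * mom k u v)"
    unfolding e Bochner_Integration.integral_sum[OF i] using N by (simp add: dens_mom)
qed

lemma tendsto_matrix_vector:
  fixes A :: "'a \<Rightarrow> real^'n^'m"
  assumes "(A \<longlongrightarrow> B) F" "(u \<longlongrightarrow> v) F"
  shows "((\<lambda>i. A i *v u i) \<longlongrightarrow> B *v v) F"
proof (rule vec_tendstoI)
  fix p
  show "((\<lambda>i. (A i *v u i) $ p) \<longlongrightarrow> (B *v v) $ p) F"
    unfolding matrix_vector_mult_def using assms by (simp, intro tendsto_intros) auto
qed

text \<open>Each entry of \<open>mseq k\<close> is a polynomial in finitely many coefficients, so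
  convergence at every fixed site suffices.\<close>

lemma mom_tendsto:
  assumes J: "jacobi_coeff a b C" and J': "jacobi_coeff a' b' C"
    and a: "\<And>k. (\<lambda>i. a (n i + k)) \<longlonglongrightarrow> a' k" and b: "\<And>k. (\<lambda>i. b (n i + k)) \<longlonglongrightarrow> b' k"
  shows "(\<lambda>i. jacobi_coeff.mom (\<lambda>k. a (n i + k)) (\<lambda>k. b (n i + k)) k u v) \<longlonglongrightarrow> jacobi_coeff.mom a' b' k u v"
proof -
  interpret A: jacobi_coeff a b C by fact
  interpret B: jacobi_coeff a' b' C by fact
  have sh: "jacobi_coeff (\<lambda>k. a (n i + k)) (\<lambda>k. b (n i + k)) C" for i by (rule A.jacobi_shift)
  let ?m = "\<lambda>i. jacobi_coeff.mseq (\<lambda>k. a (n i + k)) (\<lambda>k. b (n i + k))"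
  have "(\<lambda>i. ?m i k v q) \<longlonglongrightarrow> B.mseq k v q" for q
  proof (induction k arbitrary: q)
    case 0
    then show ?case by (simp add: jacobi_coeff.mseq.simps[OF sh])
  next
    case (Suc k)
    show ?case
    proof (cases "q = 0")
      case True
      then show ?thesis by (simp add: jacobi_coeff.mseq.simps[OF sh])
    next
      case False
      then obtain p where q: "q = Suc p" by (cases q) auto
      show ?thesis
        unfolding jacobi_coeff.mseq.simps(2)[OF sh] B.mseq.simps(2) q
        by simp (intro tendsto_add tendsto_matrix_vector a b a[of "Suc p", simplified] b[of "Suc p", simplified] Suc.IH)
    qed
  qed
  then show ?thesis unfolding jacobi_coeff.mom_def[OF sh] B.mom_def by (intro tendsto_intros)
qed

section \<open>Upper bounds in the limit and frames close to the kernel\<close>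

context jacobi_ac
begin

lemma form_expand: "v \<bullet> (Rm x *v v) = (\<Sum>p\<in>UNIV. \<Sum>q\<in>UNIV. v $ p * v $ q * Rm x $ p $ q)"
  by (simp add: inner_vec_def matrix_vector_mult_def sum_distrib_left mult_ac)

lemma form_meas [measurable]: "(\<lambda>x. v \<bullet> (Rm x *v v)) \<in> borel_measurable borel"
proof -
  note [measurable] = Rm_meas
  show ?thesis unfolding form_expand by measurable
qed

lemma form_nonneg: "0 \<le> v \<bullet> (Rm x *v v)"
  using Rm_psd[of x] by (simp add: psd_def)

lemma form_mom: "integrable T (\<lambda>x. x ^ k * (v \<bullet> (Rm x *v v)))" "(\<integral>x. x ^ k * (v \<bullet> (Rm x *v v)) \<partial>T) = mom k v v"
proof -
  have e: "(\<lambda>x. x ^ k * (v \<bullet> (Rm x *v v))) = (\<lambda>x. \<Sum>p\<in>UNIV. \<Sum>q\<in>UNIV. v $ p * v $ q * (x ^ k * Rm x $ p $ q))"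
    unfolding form_expand by (simp add: sum_distrib_left mult_ac)
  show "integrable T (\<lambda>x. x ^ k * (v \<bullet> (Rm x *v v)))"
    unfolding e by (intro Bochner_Integration.integrable_sum integrable_mult_right Rm_int)
  show "(\<integral>x. x ^ k * (v \<bullet> (Rm x *v v)) \<partial>T) = mom k v v"
    unfolding e mom_expand[of k v v]
    by (simp add: Bochner_Integration.integral_sum Bochner_Integration.integrable_sum integrable_mult_right Rm_int Rm_mom)
qed

text \<open>The first \<open>N\<close> moments of the chain density are polynomials in the coefficients, hence converge
  along the shifts; testing them on a polynomial majorant of the indicator of \<open>K\<close> gives the bound.\<close>
lemma portmanteau_piece:
  assumes J: "jacobi_coeff a0 b0 C"
    and a: "\<And>k. (\<lambda>i. a0 (n i + k)) \<longlonglongrightarrow> a k" and b: "\<And>k. (\<lambda>i. b0 (n i + k)) \<longlonglongrightarrow> b k"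
    and K: "compact K" "K \<inter> S = {}" and e: "e > 0"
  shows "\<exists>N0. \<forall>N\<ge>N0. \<forall>\<^sub>F i in sequentially.
    (\<integral>\<^sup>+x. ennreal (jacobi_coeff.dens (\<lambda>k. a0 (n i + k)) (\<lambda>k. b0 (n i + k)) N x v v) * indicator K x \<partial>lborel)
     \<le> (\<integral>\<^sup>+x. ennreal (w x * (v \<bullet> (Rm x *v v))) * indicator K x \<partial>lborel) + ennreal e"
proof -
  interpret A: jacobi_coeff a0 b0 C by fact
  have Kb[measurable]: "K \<in> sets borel" using K by (simp add: borel_compact)
  \<comment> \<open>The spectral measure of \<open>v\<close> placed at site 1 for the limit
    operator, singular part included. The tolerance \<open>e\<close> is split between the polynomial
    majorant and the convergence of moments.\<close>
  define M where "M = density T (\<lambda>x. ennreal (v \<bullet> (Rm x *v v)))"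
  have fi: "integrable T (\<lambda>x. v \<bullet> (Rm x *v v))" using form_mom(1)[of 0 v] by simp
  have fin: "finite_measure M" using fi form_nonneg
    by (intro finite_measureI) (simp add: M_def emeasure_density nn_integral_eq_integral)
  then interpret M: finite_measure M .
  have bM: "bdd_measure (3 * C) M"
    unfolding bdd_measure_def
  proof (intro conjI fin)
    show "AE x in M. \<bar>x\<bar> \<le> 3 * C" unfolding M_def
      by (subst AE_density) (use T_supp in \<open>auto elim!: eventually_mono\<close>)
  qed (simp add: M_def)
  obtain q where q: "real_polynomial_function q" "\<And>x. x \<in> K \<Longrightarrow> q x \<ge> 1"
    "(\<integral>x. (q x)\<^sup>2 \<partial>M) \<le> measure M K + e / 2"
    using polynomial_urysohn[OF bM K(1), of "e / 2"] e by auto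
  obtain c d where cd: "(\<lambda>x. (q x)\<^sup>2) = (\<lambda>x. \<Sum>k\<le>d. c k * x ^ k)"
    using real_polynomial_function_power[OF q(1), of 2] by (auto simp: real_polynomial_function_iff_sum)
  have cdx: "(q x)\<^sup>2 = (\<Sum>k\<le>d. c k * x ^ k)" for x using cd by meson
  define I where "I = (\<Sum>k\<le>d. c k * mom k v v)"
  have I: "I \<le> measure M K + e / 2"
  proof -
    have e: "(\<lambda>x. (v \<bullet> (Rm x *v v)) *\<^sub>R (q x)\<^sup>2) = (\<lambda>x. \<Sum>k\<le>d. c k * (x ^ k * (v \<bullet> (Rm x *v v))))"
      unfolding cdx by (simp add: sum_distrib_left mult_ac)
    have "(\<integral>x. (q x)\<^sup>2 \<partial>M) = (\<integral>x. (v \<bullet> (Rm x *v v)) *\<^sub>R (q x)\<^sup>2 \<partial>T)"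
      unfolding M_def using rpf_meas[OF q(1)] form_nonneg by (intro integral_density) auto
    also have "\<dots> = I" unfolding e I_def
      using form_mom[of _ v] by (subst Bochner_Integration.integral_sum) auto
    finally show ?thesis using q(3) by simp
  qed
  \<comment> \<open>Since \<open>K\<close> avoids \<open>S\<close>, only the absolutely continuous
    part contributes on it.\<close>
  have mK: "ennreal (measure M K) = (\<integral>\<^sup>+x. ennreal (w x * (v \<bullet> (Rm x *v v))) * indicator K x \<partial>lborel)"
  proof -
    have "ennreal (measure M K) = emeasure M K" by (simp add: M.emeasure_eq_measure)
    also have "\<dots> = (\<integral>\<^sup>+x. ennreal (v \<bullet> (Rm x *v v)) * indicator K x \<partial>T)"
      unfolding M_def by (rule emeasure_density) auto
    also have "\<dots> = (\<integral>\<^sup>+x. ennreal (w x) * (ennreal (v \<bullet> (Rm x *v v)) * indicator K x) \<partial>lborel)"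
      by (rule nn_T_ac) (use K(2) in \<open>auto simp: indicator_def intro!: AE_I2\<close>)
    also have "\<dots> = (\<integral>\<^sup>+x. ennreal (w x * (v \<bullet> (Rm x *v v))) * indicator K x \<partial>lborel)"
      by (intro nn_integral_cong) (simp add: ennreal_mult w_nonneg form_nonneg mult.assoc)
    finally show ?thesis .
  qed
  show ?thesis
  proof (intro exI[of _ "Suc d"] allI impI)
    fix N assume N: "Suc d \<le> N"
    have "(\<lambda>i. \<Sum>k\<le>d. c k * jacobi_coeff.mom (\<lambda>k. a0 (n i + k)) (\<lambda>k. b0 (n i + k)) k v v) \<longlonglongrightarrow> I"
      unfolding I_def by (intro tendsto_intros mom_tendsto[OF J jacobi_coeff_axioms a b])
    then have "\<forall>\<^sub>F i in sequentially. (\<Sum>k\<le>d. c k * jacobi_coeff.mom (\<lambda>k. a0 (n i + k)) (\<lambda>k. b0 (n i + k)) k v v) < measure M K + e"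
      by (rule order_tendstoD(2)) (use I e in simp)
    then show "\<forall>\<^sub>F i in sequentially.
      (\<integral>\<^sup>+x. ennreal (jacobi_coeff.dens (\<lambda>k. a0 (n i + k)) (\<lambda>k. b0 (n i + k)) N x v v) * indicator K x \<partial>lborel)
       \<le> (\<integral>\<^sup>+x. ennreal (w x * (v \<bullet> (Rm x *v v))) * indicator K x \<partial>lborel) + ennreal e"
    proof eventually_elim
      case (elim i)
      interpret sh: jacobi_coeff "\<lambda>k. a0 (n i + k)" "\<lambda>k. b0 (n i + k)" C by (rule A.jacobi_shift)
      have nn: "0 \<le> sh.dens N x v v" for x by (simp add: sh.dens_self)
      have "(\<integral>\<^sup>+x. ennreal (sh.dens N x v v) * indicator K x \<partial>lborel) \<le> (\<integral>\<^sup>+x. ennreal ((\<Sum>k\<le>d. c k * x ^ k) * sh.dens N x v v) \<partial>lborel)"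
      proof (intro nn_integral_mono)
        fix x
        show "ennreal (sh.dens N x v v) * indicator K x \<le> ennreal ((\<Sum>k\<le>d. c k * x ^ k) * sh.dens N x v v)"
        proof (cases "x \<in> K")
          case True
          then have "1 \<le> (q x)\<^sup>2" using q(2)[OF True] by (simp add: one_le_power)
          then have "1 * sh.dens N x v v \<le> (q x)\<^sup>2 * sh.dens N x v v" by (intro mult_right_mono nn)
          then show ?thesis using True unfolding cdx by (simp add: ennreal_leI)
        qed simp
      qed
      also have "\<dots> = ennreal (\<Sum>k\<le>d. c k * sh.mom k v v)"
        using sh.dens_poly_integral[OF N, of c v v] nn
        by (subst nn_integral_eq_integral) (auto simp: cdx[symmetric])
      also have "\<dots> \<le> ennreal (measure M K + e)" using elim by (intro ennreal_leI) simp
      also have "\<dots> = (\<integral>\<^sup>+x. ennreal (w x * (v \<bullet> (Rm x *v v))) * indicator K x \<partial>lborel) + ennreal e"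
        using e by (simp add: mK[symmetric])
      finally show ?case .
    qed
  qed
qed

text \<open>Off \<open>acA j\<close> either \<open>w\<close> vanishes or only the first
  \<open>j\<close> Cholesky vectors can be nonzero. On the orthogonal complement of these, of
  dimension at least \<open>l - j\<close>, the weighted form is 0; an orthonormal family there is
  moved into the dense set \<open>D\<close>.\<close>

lemma kernel_frame:
  assumes j: "j < CARD('l)" and x: "x \<notin> acA j" and D: "closure D = (UNIV :: (real^'l) set)" and e: "e > 0"
  shows "\<exists>v\<in>PiE {..<CARD('l) - j} (\<lambda>_. D). frame (CARD('l) - j) v \<and> (\<Sum>i<CARD('l) - j. w x * (v i \<bullet> (Rm x *v v i))) < e"
proof -
  define m where "m = CARD('l) - j"
  define B where "B = chol (Rm x) ` {..<j}"
  define V where "V = {y. \<forall>u\<in>span B. orthogonal u y}"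
  have "dim V + dim (span B) = dim (UNIV :: (real^'l) set)"
    using dim_subspace_orthogonal_to_vectors[of "span B" UNIV] by (simp add: V_def)
  moreover have "dim (span B) \<le> j"
  proof -
    have "dim (span B) \<le> card B" unfolding dim_span by (rule dim_le_card') (simp add: B_def)
    also have "\<dots> \<le> j" unfolding B_def using card_image_le[of "{..<j}" "chol (Rm x)"] by simp
    finally show ?thesis .
  qed
  ultimately have dV: "dim V \<ge> m" by (simp add: m_def)
  have sV: "subspace V" unfolding V_def subspace_def by (auto simp: orthogonal_clauses)
  obtain W where W: "W \<subseteq> V" "pairwise orthogonal W" "\<And>y. y \<in> W \<Longrightarrow> norm y = 1" "card W = dim V"
    using orthonormal_basis_subspace[OF sV] by metis
  obtain W' where W': "W' \<subseteq> W" "card W' = m" "finite W'" using obtain_subset_with_card_n[of m W] dV W(4) by metis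
  obtain f where f: "bij_betw f {..<m} W'" using ex_bij_betw_nat_finite[OF W'(3)] W'(2) by (auto simp: lessThan_atLeast0)
  have fV: "f i \<in> V" "norm (f i) = 1" if "i < m" for i
  proof -
    have "f i \<in> W'" using f that by (auto simp: bij_betw_def)
    then show "f i \<in> V" "norm (f i) = 1" using W W'(1) by auto
  qed
  have orth: "f i \<bullet> f k = (if i = k then 1 else 0)" if "i < m" "k < m" for i k
  proof (cases "i = k")
    case True
    then show ?thesis using fV(2)[OF that(1)] by (simp add: norm_eq_1)
  next
    case False
    then have "f i \<noteq> f k" using f that by (auto simp: bij_betw_def inj_on_def)
    then show ?thesis using W(2) W'(1) f that False by (auto simp: pairwise_def orthogonal_def bij_betw_def)
  qed
  have fz: "w x * (f i \<bullet> (Rm x *v f i)) = 0" if i: "i < m" for i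
  proof (cases "w x > 0")
    case True
    then have cz: "chol (Rm x) j = 0" using x j by (simp add: acA_def)
    have b0: "chol (Rm x) k \<bullet> f i = 0" if "k < CARD('l)" for k
    proof (cases "k < j")
      case True
      then have "chol (Rm x) k \<in> span B" by (auto simp: B_def intro: span_base)
      then show ?thesis using fV(1)[OF i] by (auto simp: V_def orthogonal_def)
    next
      case False
      then show ?thesis using chol_initial[OF Rm_psd cz, of k] by simp
    qed
    have "f i \<bullet> (Rm x *v f i) = (\<Sum>p\<in>UNIV. \<Sum>q\<in>UNIV. \<Sum>k<CARD('l). (chol (Rm x) k $ p * f i $ p) * (chol (Rm x) k $ q * f i $ q))"
      unfolding form_expand chol_sum[OF Rm_psd] by (simp add: sum_distrib_left mult_ac)
    also have "\<dots> = (\<Sum>k<CARD('l). \<Sum>p\<in>UNIV. \<Sum>q\<in>UNIV. (chol (Rm x) k $ p * f i $ p) * (chol (Rm x) k $ q * f i $ q))"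
    proof -
      have "(\<Sum>p\<in>UNIV. \<Sum>q\<in>UNIV. \<Sum>k<CARD('l). (chol (Rm x) k $ p * f i $ p) * (chol (Rm x) k $ q * f i $ q))
        = (\<Sum>p\<in>UNIV. \<Sum>k<CARD('l). \<Sum>q\<in>UNIV. (chol (Rm x) k $ p * f i $ p) * (chol (Rm x) k $ q * f i $ q))"
        by (rule sum.cong[OF refl], rule sum.swap)
      then show ?thesis by (simp add: sum.swap[of _ "{..<CARD('l)}"])
    qed
    also have "\<dots> = (\<Sum>k<CARD('l). (chol (Rm x) k \<bullet> f i) * (chol (Rm x) k \<bullet> f i))"
      by (simp add: sum_product inner_vec_def)
    also have "\<dots> = 0" by (rule sum.neutral) (simp add: b0)
    finally show ?thesis by simp
  qed (use w_nonneg[of x] in simp)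
  \<comment> \<open>With this tolerance the whole displacement of a combination is at most half of
    its norm, which costs the factor 4 allowed in \<open>frame\<close>; the forms add up to less
    than \<open>e\<close>.\<close>
  have "\<forall>i. \<exists>u. i < m \<longrightarrow> u \<in> D \<and> norm (u - f i) < 1 / (2 * (real m + 1)) \<and> w x * (u \<bullet> (Rm x *v u)) < e / (real m + 1)"
  proof
    fix i
    show "\<exists>u. i < m \<longrightarrow> u \<in> D \<and> norm (u - f i) < 1 / (2 * (real m + 1)) \<and> w x * (u \<bullet> (Rm x *v u)) < e / (real m + 1)"
    proof (cases "i < m")
      case True
      let ?X = "{u. norm (u - f i) < 1 / (2 * (real m + 1))} \<inter> {u. w x * (u \<bullet> (Rm x *v u)) < e / (real m + 1)}"
      have "open ?X" by (intro open_Int open_Collect_less continuous_intros)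
      moreover have "f i \<in> ?X" unfolding Int_iff mem_Collect_eq fz[OF True] using e by (simp add: add_nonneg_pos)
      moreover have "f i \<in> closure D" using D by simp
      ultimately have "D \<inter> ?X \<noteq> {}" using open_Int_closure_eq_empty[of ?X D] by blast
      then show ?thesis by blast
    qed simp
  qed
  from choice[OF this] obtain g where g: "\<And>i. i < m \<Longrightarrow> g i \<in> D" "\<And>i. i < m \<Longrightarrow> norm (g i - f i) < 1 / (2 * (real m + 1))"
    "\<And>i. i < m \<Longrightarrow> w x * (g i \<bullet> (Rm x *v g i)) < e / (real m + 1)" by blast
  define v where "v = restrict g {..<m}"
  have v: "v i = g i" if "i < m" for i using that by (simp add: v_def)
  have "(\<Sum>i<m. w x * (v i \<bullet> (Rm x *v v i))) \<le> (\<Sum>i<m. e / (real m + 1))"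
    using g(3) v by (intro sum_mono) (auto intro: less_imp_le)
  also have "\<dots> < e" using e by (simp add: field_simps)
  finally have s: "(\<Sum>i<m. w x * (v i \<bullet> (Rm x *v v i))) < e" .
  have "frame m v" unfolding frame_def
  proof
    fix \<alpha> :: "nat \<Rightarrow> complex"
    define A where "A = L2_set (\<lambda>i. norm (\<alpha> i)) {..<m}"
    have A: "A\<^sup>2 = (\<Sum>i<m. (norm (\<alpha> i))\<^sup>2)" "A \<ge> 0" by (simp_all add: A_def L2_set_def sum_nonneg)
    have cc: "cdot (cvec p) (cvec q) = of_real (p \<bullet> q)" for p q :: "real^'l" by (simp add: cdot_def inner_vec_def)
    have "complex_of_real ((norm (\<Sum>i<m. \<alpha> i *s cvec (f i)))\<^sup>2) = (\<Sum>i<m. \<Sum>k<m. cnj (\<alpha> i) * (\<alpha> k * of_real (f i \<bullet> f k)))"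
      unfolding cdot_self[symmetric] by (simp add: cc sum_distrib_left, subst sum.swap, simp add: mult_ac)
    also have "\<dots> = (\<Sum>i<m. \<Sum>k<m. if k = i then cnj (\<alpha> i) * \<alpha> i else 0)"
      by (intro sum.cong refl) (auto simp: orth)
    also have "\<dots> = of_real (A\<^sup>2)" unfolding A by (simp add: complex_norm_square mult.commute del: of_real_power)
    finally have nf: "norm (\<Sum>i<m. \<alpha> i *s cvec (f i)) = A" using A(2) by (simp only: of_real_eq_iff power2_eq_iff_nonneg norm_ge_zero)
    have "norm (\<Sum>i<m. \<alpha> i *s cvec (f i) - \<alpha> i *s cvec (v i)) \<le> (\<Sum>i<m. A * (1 / (2 * (real m + 1))))"
    proof (rule order_trans[OF norm_sum], rule sum_mono)
      fix i assume "i \<in> {..<m}"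
      then have i: "i < m" by simp
      have "\<alpha> i *s cvec (f i) - \<alpha> i *s cvec (v i) = \<alpha> i *s cvec (f i - g i)"
        using v[OF i] by (simp add: vector_ssub_ldistrib)
      then have "norm (\<alpha> i *s cvec (f i) - \<alpha> i *s cvec (v i)) = norm (\<alpha> i) * norm (g i - f i)"
        by (simp only: norm_smult_vec norm_cvec norm_minus_commute[of "f i"])
      also have "\<dots> \<le> A * (1 / (2 * (real m + 1)))"
        using g(2)[OF i] A(2) i member_le_L2_set[of "{..<m}" i "\<lambda>i. norm (\<alpha> i)"] by (intro mult_mono) (auto simp: A_def)
      finally show "norm (\<alpha> i *s cvec (f i) - \<alpha> i *s cvec (v i)) \<le> A * (1 / (2 * (real m + 1)))" .
    qed
    also have "\<dots> = A * (real m / (2 * (real m + 1)))" by simp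
    also have "\<dots> \<le> A * (1 / 2)" using A(2) by (intro mult_left_mono) (auto simp: field_simps)
    finally have "norm ((\<Sum>i<m. \<alpha> i *s cvec (f i)) - (\<Sum>i<m. \<alpha> i *s cvec (v i))) \<le> A / 2" by (simp add: sum_subtractf)
    then have "A \<le> 2 * norm (\<Sum>i<m. \<alpha> i *s cvec (v i))"
      using norm_triangle_ineq2[of "\<Sum>i<m. \<alpha> i *s cvec (f i)" "\<Sum>i<m. \<alpha> i *s cvec (v i)"] nf by linarith
    then have "A\<^sup>2 \<le> (2 * norm (\<Sum>i<m. \<alpha> i *s cvec (v i)))\<^sup>2" using A(2) by (intro power_mono) auto
    then show "(\<Sum>i<m. (norm (\<alpha> i))\<^sup>2) \<le> 4 * (norm (\<Sum>i<m. \<alpha> i *s cvec (v i)))\<^sup>2" unfolding A by (simp add: power_mult_distrib)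
  qed
  then show ?thesis using s g(1) unfolding m_def[symmetric]
    by (intro bexI[of _ v]) (auto simp: v_def)
qed

end

lemma not_null_UN:
  fixes E :: "nat \<Rightarrow> real set"
  assumes "\<And>n. E n \<in> sets borel" "emeasure lborel (\<Union>n. E n) \<noteq> 0"
  obtains n where "emeasure lborel (E n) \<noteq> 0"
proof (rule ccontr)
  assume "\<not> thesis"
  then have "E n \<in> null_sets lborel" for n using that assms(1) by (auto simp: null_sets_def)
  then have "(\<Union>n. E n) \<in> null_sets lborel" by (rule null_sets_UN)
  then show False using assms(2) by (auto simp: null_sets_def)
qed

lemma compact_inner_approx:
  assumes M: "finite_measure M" "sets M = sets (borel :: real measure)" and F: "F \<in> sets borel" and d: "d > 0"
  obtains K where "compact K" "K \<subseteq> F" "measure M F - d \<le> measure M K"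
proof (cases "measure M F \<le> d")
  case True
  then show ?thesis using that[of "{}"] by simp
next
  case False
  interpret finite_measure M by fact
  have "emeasure M F = (SUP K \<in> {K. K \<subseteq> F \<and> compact K}. emeasure M K)"
    by (rule inner_regular[OF M(2) _ F]) simp
  moreover have "ennreal (measure M F - d) < emeasure M F"
    using False d by (simp add: emeasure_eq_measure ennreal_less_iff)
  ultimately obtain K where K: "K \<subseteq> F" "compact K" "ennreal (measure M F - d) < emeasure M K"
    by (auto simp: less_SUP_iff)
  then show ?thesis using False by (intro that[of K]) (auto simp: emeasure_eq_measure ennreal_less_iff)
qed

text \<open>The countable cover is made disjoint and cut after finitely many members, losing
  \<open>d / 2\<close>; compact inner approximations of the remaining members lose at most another
  \<open>d / 2\<close> together.\<close>

lemma finite_compact_cover: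
  fixes E :: "real set" and X :: "'v \<Rightarrow> real set"
  assumes E: "E \<in> sets borel" "emeasure lborel E < \<infinity>" and G: "countable G"
    and X: "\<And>v. v \<in> G \<Longrightarrow> X v \<in> sets borel" and EX: "E = (\<Union>v\<in>G. X v)" and d: "d > 0"
  obtains P :: nat and K g where "\<And>p. p < P \<Longrightarrow> g p \<in> G" "\<And>p. p < P \<Longrightarrow> compact (K p)" "\<And>p. p < P \<Longrightarrow> K p \<subseteq> X (g p)"
    "disjoint_family_on K {..<P}" "measure lborel E - d \<le> (\<Sum>p<P. measure lborel (K p))"
proof (cases "G = {}")
  case True
  then show ?thesis using EX d by (intro that[of 0]) (auto simp: disjoint_family_on_def)
next
  case False
  define g where "g = from_nat_into G"
  have gG: "g p \<in> G" for p unfolding g_def by (rule from_nat_into[OF False])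
  have rg: "range g = G" unfolding g_def by (rule range_from_nat_into[OF False G])
  define F where "F = disjointed (\<lambda>p. X (g p))"
  have F: "disjoint_family F" "F p \<subseteq> X (g p)" "(\<Union>p. F p) = E" for p
    using disjointed_subset[of "\<lambda>p. X (g p)"] rg
    by (simp_all only: F_def disjoint_family_disjointed UN_disjointed_eq EX) auto
  have Fb: "F p \<in> sets borel" for p
    using sets.range_disjointed_sets[of "\<lambda>p. X (g p)" borel] X gG by (auto simp: F_def)
  have FE: "F p \<subseteq> E" for p using F(3) by blast
  \<comment> \<open>Lebesgue measure is restricted to \<open>E\<close> so that inner regularity and
    countable additivity are used for a finite measure.\<close>
  define M where "M = density lborel (indicator E)"
  have eM: "emeasure M Y = emeasure lborel Y" if "Y \<subseteq> E" "Y \<in> sets borel" for Y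
  proof -
    have "emeasure M Y = (\<integral>\<^sup>+x. indicator E x * indicator Y x \<partial>lborel)"
      unfolding M_def using E(1) that by (intro emeasure_density) auto
    also have "\<dots> = (\<integral>\<^sup>+x. indicator Y x \<partial>lborel)"
      using that by (intro nn_integral_cong) (auto simp: indicator_def)
    finally show ?thesis using that by simp
  qed
  have mM: "measure M Y = measure lborel Y" if "Y \<subseteq> E" "Y \<in> sets borel" for Y
    using eM[OF that] by (simp add: measure_def)
  have sM: "sets M = sets borel" by (simp add: M_def)
  have fin: "finite_measure M"
  proof (rule finite_measureI)
    have "emeasure M (space M) = emeasure lborel E"
      unfolding M_def using E(1) by (simp add: emeasure_density)
    then show "emeasure M (space M) \<noteq> \<infinity>" using E(2) by auto
  qed
  interpret M: finite_measure M by fact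
  have "(\<lambda>p. measure M (F p)) sums measure M (\<Union>p. F p)"
    by (rule M.finite_measure_UNION) (use Fb F(1) sM in auto)
  then have "(\<lambda>P. \<Sum>p<P. measure M (F p)) \<longlonglongrightarrow> measure lborel E" using F(3) mM[of E] E(1) by (simp add: sums_def)
  then have "\<forall>\<^sub>F P in sequentially. (\<Sum>p<P. measure M (F p)) > measure lborel E - d / 2"
    by (rule order_tendstoD(1)) (use d in simp)
  then obtain P where P: "(\<Sum>p<P. measure M (F p)) > measure lborel E - d / 2" by (auto simp: eventually_sequentially)
  have "\<forall>p. \<exists>K. compact K \<and> K \<subseteq> F p \<and> measure M (F p) - d / (2 * (real P + 1)) \<le> measure M K"
  proof
    fix p
    have "d / (2 * (real P + 1)) > 0" using d by (simp add: add_nonneg_pos)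
    from compact_inner_approx[OF fin sM Fb[of p] this] show "\<exists>K. compact K \<and> K \<subseteq> F p \<and> measure M (F p) - d / (2 * (real P + 1)) \<le> measure M K"
      by metis
  qed
  from choice[OF this] obtain K where K: "\<And>p. compact (K p)" "\<And>p. K p \<subseteq> F p"
    "\<And>p. measure M (F p) - d / (2 * (real P + 1)) \<le> measure M (K p)" by blast
  have "(\<Sum>p<P. measure M (F p)) - d / 2 \<le> (\<Sum>p<P. measure M (F p)) - real P * (d / (2 * (real P + 1)))"
    using d by (simp add: field_simps)
  also have "\<dots> = (\<Sum>p<P. measure M (F p) - d / (2 * (real P + 1)))" by (simp add: sum_subtractf)
  also have "\<dots> \<le> (\<Sum>p<P. measure M (K p))" by (intro sum_mono K(3))
  also have "\<dots> = (\<Sum>p<P. measure lborel (K p))"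
    by (rule sum.cong[OF refl], rule mM[OF order_trans[OF K(2) FE] borel_compact[OF K(1)]])
  finally have "measure lborel E - d \<le> (\<Sum>p<P. measure lborel (K p))" using P by linarith
  moreover have "disjoint_family_on K {..<P}"
    unfolding disjoint_family_on_def
  proof (intro ballI impI)
    fix p q :: nat assume "p \<noteq> q"
    then have "F p \<inter> F q = {}" using F(1) by (simp add: disjoint_family_on_def)
    then show "K p \<inter> K q = {}" using K(2)[of p] K(2)[of q] by blast
  qed
  ultimately show ?thesis by (rule that[OF gG K(1) order_trans[OF K(2) F(2)], rotated 1])
qed

lemma transfer_multiplicity:
  fixes a b a' b' :: "nat \<Rightarrow> real^'l^'l"
  assumes A: "jacobi_ac a b C T Rm S w" and A': "jacobi_ac a' b' C T' Rm' S' w'"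
    and n: "\<And>i. n i \<ge> 1"
    and lim: "\<And>k. (\<lambda>i. a (n i + k)) \<longlonglongrightarrow> a' k" "\<And>k. (\<lambda>i. b (n i + k)) \<longlonglongrightarrow> b' k"
    and j: "j < CARD('l)"
  shows "AE x in lborel. x \<in> jacobi_ac.acA Rm w j \<longrightarrow> x \<in> jacobi_ac.acA Rm' w' j"
proof (rule ccontr)
  interpret A: jacobi_ac a b C T Rm S w by fact
  interpret B: jacobi_ac a' b' C T' Rm' S' w' by fact
  assume notAE: "\<not> (AE x in lborel. x \<in> A.acA j \<longrightarrow> x \<in> B.acA j)"
  \<comment> \<open>The null set \<open>S'\<close> is removed so that compact subsets of
    \<open>E0\<close> meet the disjointness condition of \<open>portmanteau_piece\<close>.\<close>
  define E0 where "E0 = A.acA j - B.acA j - S'"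
  have E0b[measurable]: "E0 \<in> sets borel" by (simp add: E0_def)
  have "emeasure lborel E0 \<noteq> 0"
  proof
    assume "emeasure lborel E0 = 0"
    then have "AE x in lborel. x \<notin> E0" by (intro AE_not_in) (simp add: null_sets_def)
    moreover have "AE x in lborel. x \<notin> S'" using B.S_null by (intro AE_not_in) (simp add: null_sets_def)
    ultimately have "AE x in lborel. x \<in> A.acA j \<longrightarrow> x \<in> B.acA j" by eventually_elim (auto simp: E0_def)
    then show False using notAE by blast
  qed
  moreover have "E0 = (\<Union>M. E0 \<inter> A.good_set j M)" using A.good_set_cover[of j] by (auto simp: E0_def)
  ultimately obtain M where M: "emeasure lborel (E0 \<inter> A.good_set j M) \<noteq> 0"
    using not_null_UN[of "\<lambda>M. E0 \<inter> A.good_set j M"] by auto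
  have "E0 \<inter> A.good_set j M = (\<Union>R::nat. E0 \<inter> A.good_set j M \<inter> {-real R..real R})"
  proof -
    have "\<exists>R::nat. - real R \<le> x \<and> x \<le> real R" for x
      using real_arch_simple[of "\<bar>x\<bar>"] by (auto simp: abs_le_iff) (meson minus_le_iff)
    then show ?thesis by auto
  qed
  then obtain R where R: "emeasure lborel (E0 \<inter> A.good_set j M \<inter> {-real R..real R}) \<noteq> 0"
    using M not_null_UN[of "\<lambda>R. E0 \<inter> A.good_set j M \<inter> {-real R..real R}"] by auto
  define E where "E = E0 \<inter> A.good_set j M \<inter> {-real R..real R}"
  have Eb[measurable]: "E \<in> sets borel" by (simp add: E_def)
  have "emeasure lborel E \<le> emeasure lborel {-real R..real R}" by (rule emeasure_mono) (auto simp: E_def)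
  then have Efin: "emeasure lborel E < \<infinity>" by (simp add: le_less_trans)
  define \<eta> where "\<eta> = measure lborel E"
  have eE: "emeasure lborel E = ennreal \<eta>" using Efin by (simp add: \<eta>_def emeasure_eq_ennreal_measure)
  have \<eta>: "\<eta> > 0" using R eE unfolding E_def[symmetric] by (cases "\<eta> > 0") (auto simp: ennreal_neg)
  define m where "m = CARD('l) - j"
  \<comment> \<open>\<open>Kc\<close> is fixed before the length and the shift, so the tolerances
    and the compact pieces may depend on it and \<open>N\<close> and \<open>\<iota>\<close> on all
    of these.\<close>
  obtain Kc where Kc: "Kc > 0" and lb: "\<And>n N. n \<ge> 1 \<Longrightarrow> N \<ge> 1 \<Longrightarrow> \<exists>Bad\<in>sets lborel. emeasure lborel Bad \<le> ennreal (\<eta> / 4) \<and>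
     (\<forall>x\<in>A.good_set j M \<inter> {-real R..real R} - Bad. \<forall>v. frame m v \<longrightarrow>
        1 \<le> Kc * (\<Sum>i<m. (norm (jacobi_coeff.lres (\<lambda>k. a (n + k)) (\<lambda>k. b (n + k)) N x (cvec (v i))))\<^sup>2))"
    using A.shifted_lower_bound[OF j, of "\<eta> / 4" M "real R"] \<eta> unfolding m_def by auto
  \<comment> \<open>Chosen so that
    \<open>Kc * pi * (\<epsilon> * \<eta> + \<epsilon>) = \<eta> / 8\<close>. The upper estimate
    \<open>\<eta> / 4 + \<eta> / 8\<close> then falls short of the mass of the pieces, which is at
    least \<open>\<eta> - \<eta> / 4\<close>.\<close>
  define \<epsilon> where "\<epsilon> = \<eta> / (8 * (Kc * pi) * (\<eta> + 1))"
  have \<epsilon>: "\<epsilon> > 0" using \<eta> Kc by (simp add: \<epsilon>_def)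
  obtain D :: "(real^'l) set" where D: "countable D" "UNIV \<subseteq> closure D" using separable[of UNIV] by metis
  define G where "G = {v \<in> PiE {..<m} (\<lambda>_. D). frame m v}"
  have cG: "countable G" unfolding G_def by (rule countable_subset[OF _ countable_PiE[of "{..<m}" "\<lambda>_. D"]]) (use D in auto)
  define q where "q x v = w' x * (v \<bullet> (Rm' x *v v))" for x v
  have q[measurable]: "(\<lambda>x. q x v) \<in> borel_measurable borel" "q x v \<ge> 0" for x v
    unfolding q_def using B.form_meas[of v] B.form_nonneg B.w_nonneg by auto
  define X where "X v = {x\<in>E. (\<Sum>i<m. q x (v i)) < \<epsilon>}" for v
  have Xb: "X v \<in> sets borel" for v unfolding X_def by measurable
  have EX: "E = (\<Union>v\<in>G. X v)"
  proof
    show "E \<subseteq> (\<Union>v\<in>G. X v)"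
    proof
      fix x assume x: "x \<in> E"
      then have "x \<notin> B.acA j" by (auto simp: E_def E0_def)
      then obtain v where "v \<in> G" "(\<Sum>i<m. q x (v i)) < \<epsilon>"
        using B.kernel_frame[OF j _ _ \<epsilon>, of x D] D unfolding m_def[symmetric] G_def q_def by auto
      then show "x \<in> (\<Union>v\<in>G. X v)" using x by (auto simp: X_def)
    qed
  qed (auto simp: X_def)
  obtain P :: nat and K g where P: "\<And>p. p < P \<Longrightarrow> g p \<in> G" "\<And>p. p < P \<Longrightarrow> compact (K p)" "\<And>p. p < P \<Longrightarrow> K p \<subseteq> X (g p)"
    and disj: "disjoint_family_on K {..<P}" and mK: "\<eta> - \<eta> / 4 \<le> (\<Sum>p<P. measure lborel (K p))"
  proof -
    have "\<eta> / 4 > 0" using \<eta> by simp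
    then show ?thesis
      by (rule finite_compact_cover[OF Eb Efin cG Xb EX, folded \<eta>_def]) (rule that)
  qed
  have Kb: "K p \<in> sets borel" if "p < P" for p using P(2)[OF that] by (simp add: borel_compact)
  have KE: "K p \<subseteq> E" if "p < P" for p using P(3)[OF that] by (auto simp: X_def)
  \<comment> \<open>The errors of \<open>P\<close> pieces with \<open>m\<close> vectors each add up
    to at most \<open>\<epsilon>\<close>.\<close>
  define \<delta> where "\<delta> = \<epsilon> / ((real P + 1) * (real m + 1))"
  have \<delta>: "\<delta> > 0" using \<epsilon> by (simp add: \<delta>_def add_nonneg_pos)
  let ?dens = "\<lambda>i. jacobi_coeff.dens (\<lambda>k. a (n i + k)) (\<lambda>k. b (n i + k))"
  have "\<exists>N0. \<forall>N\<ge>N0. \<forall>\<^sub>F \<iota> in sequentially.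
      (\<integral>\<^sup>+x. ennreal (?dens \<iota> N x (g p i) (g p i)) * indicator (K p) x \<partial>lborel)
      \<le> (\<integral>\<^sup>+x. ennreal (q x (g p i)) * indicator (K p) x \<partial>lborel) + ennreal \<delta>" if "p < P" for p i
    unfolding q_def
    by (rule B.portmanteau_piece[OF A.jacobi_coeff_axioms lim P(2)[OF that] _ \<delta>])
      (use KE[OF that] in \<open>auto simp: E_def E0_def\<close>)
  then have "\<forall>pi. \<exists>N0. fst pi < P \<longrightarrow> (\<forall>N\<ge>N0. \<forall>\<^sub>F \<iota> in sequentially.
      (\<integral>\<^sup>+x. ennreal (?dens \<iota> N x (g (fst pi) (snd pi)) (g (fst pi) (snd pi))) * indicator (K (fst pi)) x \<partial>lborel)
      \<le> (\<integral>\<^sup>+x. ennreal (q x (g (fst pi) (snd pi))) * indicator (K (fst pi)) x \<partial>lborel) + ennreal \<delta>)" by blast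
  from choice[OF this] obtain N0 where N0: "\<And>p i N. p < P \<Longrightarrow> N \<ge> N0 (p, i) \<Longrightarrow> \<forall>\<^sub>F \<iota> in sequentially.
      (\<integral>\<^sup>+x. ennreal (?dens \<iota> N x (g p i) (g p i)) * indicator (K p) x \<partial>lborel)
      \<le> (\<integral>\<^sup>+x. ennreal (q x (g p i)) * indicator (K p) x \<partial>lborel) + ennreal \<delta>" by auto
  \<comment> \<open>One length beyond the thresholds of all pieces and vectors; \<open>Suc\<close>
    keeps it positive.\<close>
  define N where "N = Suc (\<Sum>z\<in>{..<P} \<times> {..<m}. N0 z)"
  have NN: "N0 (p, i) \<le> N" if "p < P" "i < m" for p i
    unfolding N_def using that by (intro le_SucI member_le_sum) auto
  have "\<forall>\<^sub>F \<iota> in sequentially. \<forall>z\<in>{..<P} \<times> {..<m}.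
      (\<integral>\<^sup>+x. ennreal (?dens \<iota> N x (g (fst z) (snd z)) (g (fst z) (snd z))) * indicator (K (fst z)) x \<partial>lborel)
      \<le> (\<integral>\<^sup>+x. ennreal (q x (g (fst z) (snd z))) * indicator (K (fst z)) x \<partial>lborel) + ennreal \<delta>"
    by (intro eventually_ball_finite) (auto intro: N0 NN)
  then obtain \<iota> where \<iota>: "\<And>p i. p < P \<Longrightarrow> i < m \<Longrightarrow>
      (\<integral>\<^sup>+x. ennreal (?dens \<iota> N x (g p i) (g p i)) * indicator (K p) x \<partial>lborel)
      \<le> (\<integral>\<^sup>+x. ennreal (q x (g p i)) * indicator (K p) x \<partial>lborel) + ennreal \<delta>"
    by (auto simp: eventually_sequentially)
  interpret sh: jacobi_coeff "\<lambda>k. a (n \<iota> + k)" "\<lambda>k. b (n \<iota> + k)" C by (rule A.jacobi_shift)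
  have N1: "N \<ge> 1" by (simp add: N_def)
  have dm[measurable]: "(\<lambda>x. sh.dens N x v v) \<in> borel_measurable borel" for v
    by (rule borel_measurable_continuous_onI[OF sh.dens_cont[OF N1]])
  have dn: "0 \<le> sh.dens N x v v" for x v by (simp add: sh.dens_self)
  obtain Bad where Bad: "Bad \<in> sets borel" "emeasure lborel Bad \<le> ennreal (\<eta> / 4)"
    "\<And>x v. x \<in> A.good_set j M \<Longrightarrow> x \<in> {-real R..real R} \<Longrightarrow> x \<notin> Bad \<Longrightarrow> frame m v \<Longrightarrow>
      1 \<le> Kc * (\<Sum>i<m. (norm (sh.lres N x (cvec (v i))))\<^sup>2)"
    using lb[OF n[of \<iota>] N1] by auto
  note [measurable] = Bad(1)
  have kp: "Kc * pi \<ge> 0" using Kc by simp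
  have low: "ennreal (\<eta> - \<eta> / 4) \<le> emeasure lborel (\<Union>p<P. K p)"
  proof -
    have fK: "emeasure lborel (K p) = ennreal (measure lborel (K p))" if "p < P" for p
      using emeasure_mono[OF KE[OF that], of lborel] Efin by (intro emeasure_eq_ennreal_measure) (auto simp: top_unique)
    have "(\<Sum>p<P. emeasure lborel (K p)) = emeasure lborel (\<Union>p<P. K p)"
      by (rule sum_emeasure) (use Kb disj in auto)
    moreover have "(\<Sum>p<P. emeasure lborel (K p)) = ennreal (\<Sum>p<P. measure lborel (K p))"
      by (simp add: fK)
    ultimately show ?thesis using mK by (metis ennreal_leI)
  qed
  have UE: "emeasure lborel (\<Union>p<P. K p) \<le> ennreal \<eta>"
    unfolding eE[symmetric] using KE by (intro emeasure_mono) auto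
  have piece: "(\<Sum>i<m. \<integral>\<^sup>+x. ennreal (sh.dens N x (g p i) (g p i)) * indicator (K p) x \<partial>lborel)
      \<le> ennreal \<epsilon> * emeasure lborel (K p) + ennreal (real m * \<delta>)" if p: "p < P" for p
  proof -
    note [measurable] = Kb[OF p]
    have "(\<Sum>i<m. \<integral>\<^sup>+x. ennreal (sh.dens N x (g p i) (g p i)) * indicator (K p) x \<partial>lborel)
      \<le> (\<Sum>i<m. (\<integral>\<^sup>+x. ennreal (q x (g p i)) * indicator (K p) x \<partial>lborel) + ennreal \<delta>)"
      by (intro sum_mono \<iota> p) simp
    also have "\<dots> = (\<integral>\<^sup>+x. (\<Sum>i<m. ennreal (q x (g p i)) * indicator (K p) x) \<partial>lborel) + ennreal (real m * \<delta>)"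
      using \<delta> by (subst nn_integral_sum) (auto simp: sum.distrib ennreal_mult ennreal_of_nat_eq_real_of_nat)
    also have "(\<integral>\<^sup>+x. (\<Sum>i<m. ennreal (q x (g p i)) * indicator (K p) x) \<partial>lborel) \<le> (\<integral>\<^sup>+x. ennreal \<epsilon> * indicator (K p) x \<partial>lborel)"
    proof (intro nn_integral_mono)
      fix x
      show "(\<Sum>i<m. ennreal (q x (g p i)) * indicator (K p) x) \<le> ennreal \<epsilon> * indicator (K p) x"
        using P(3)[OF p] q(2) by (cases "x \<in> K p") (auto simp: X_def subset_iff intro!: ennreal_leI[OF less_imp_le])
    qed
    also have "(\<integral>\<^sup>+x. ennreal \<epsilon> * indicator (K p) x \<partial>lborel) = ennreal \<epsilon> * emeasure lborel (K p)" by (rule nn_integral_cmult_indicator) simp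
    finally show ?thesis by (simp add: add_right_mono)
  qed
  have "emeasure lborel (\<Union>p<P. K p) = (\<integral>\<^sup>+x. indicator (\<Union>p<P. K p) x \<partial>lborel)"
    using Kb by (intro nn_integral_indicator[symmetric]) auto
  \<comment> \<open>Off \<open>Bad\<close>, a point of the piece \<open>p\<close> is tested with the
    frame \<open>g p\<close> of that piece, whose densities sum to at least
    \<open>1 / (Kc * pi)\<close> there.\<close>
  also have "\<dots> \<le> (\<integral>\<^sup>+x. indicator Bad x + ennreal (Kc * pi) * (\<Sum>p<P. \<Sum>i<m. ennreal (sh.dens N x (g p i) (g p i)) * indicator (K p) x) \<partial>lborel)"
  proof (intro nn_integral_mono)
    fix x
    let ?s = "\<lambda>p. \<Sum>i<m. ennreal (sh.dens N x (g p i) (g p i)) * indicator (K p) x"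
    show "indicator (\<Union>p<P. K p) x \<le> indicator Bad x + ennreal (Kc * pi) * (\<Sum>p<P. ?s p)"
    proof (cases "x \<in> (\<Union>p<P. K p) \<and> x \<notin> Bad")
      case True
      then obtain p where p: "p < P" "x \<in> K p" by blast
      have "x \<in> E" using KE p by blast
      then have "1 \<le> Kc * (\<Sum>i<m. (norm (sh.lres N x (cvec (g p i))))\<^sup>2)"
        using P(1)[OF p(1)] True by (intro Bad(3)) (auto simp: E_def G_def)
      also have "\<dots> = (Kc * pi) * (\<Sum>i<m. sh.dens N x (g p i) (g p i))"
        by (simp add: sh.dens_self sum_divide_distrib[symmetric])
      finally have "ennreal 1 \<le> ennreal (Kc * pi) * ennreal (\<Sum>i<m. sh.dens N x (g p i) (g p i))"
        using kp dn by (simp add: ennreal_mult[symmetric] sum_nonneg del: ennreal_1 sum_ennreal)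
      also have "ennreal (\<Sum>i<m. sh.dens N x (g p i) (g p i)) = ?s p" using p dn by simp
      also have "?s p \<le> (\<Sum>p<P. ?s p)" using p by (intro member_le_sum) auto
      finally show ?thesis using True by (simp add: mult_left_mono)
    qed (auto simp: indicator_def)
  qed
  also have "\<dots> = emeasure lborel Bad + ennreal (Kc * pi) * (\<Sum>p<P. \<Sum>i<m. \<integral>\<^sup>+x. ennreal (sh.dens N x (g p i) (g p i)) * indicator (K p) x \<partial>lborel)"
  proof -
    have [measurable]: "(\<lambda>x. ennreal (sh.dens N x (g p i) (g p i)) * indicator (K p) x) \<in> borel_measurable borel" if "p \<in> {..<P}" for p i
    proof -
      have [measurable]: "K p \<in> sets borel" using Kb[of p] that by simp
      show ?thesis by measurable
    qed
    have "(\<integral>\<^sup>+x. (\<Sum>p<P. \<Sum>i<m. ennreal (sh.dens N x (g p i) (g p i)) * indicator (K p) x) \<partial>lborel)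
      = (\<Sum>p<P. \<Sum>i<m. \<integral>\<^sup>+x. ennreal (sh.dens N x (g p i) (g p i)) * indicator (K p) x \<partial>lborel)"
    proof (subst nn_integral_sum)
      show "(\<Sum>p<P. \<integral>\<^sup>+x. (\<Sum>i<m. ennreal (sh.dens N x (g p i) (g p i)) * indicator (K p) x) \<partial>lborel)
        = (\<Sum>p<P. \<Sum>i<m. \<integral>\<^sup>+x. ennreal (sh.dens N x (g p i) (g p i)) * indicator (K p) x \<partial>lborel)"
        by (intro sum.cong refl nn_integral_sum) simp
    qed measurable
    note eq = this
    have add: "(\<integral>\<^sup>+x. indicator Bad x + c * F x \<partial>lborel) = emeasure lborel Bad + c * (\<integral>\<^sup>+x. F x \<partial>lborel)"
      if "F \<in> borel_measurable lborel" for F and c :: ennreal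
      using that by (subst nn_integral_add) (auto simp: nn_integral_cmult)
    have m: "(\<lambda>x. \<Sum>p<P. \<Sum>i<m. ennreal (sh.dens N x (g p i) (g p i)) * indicator (K p) x) \<in> borel_measurable lborel"
      by measurable
    show ?thesis unfolding add[OF m] eq ..
  qed
  also have "\<dots> \<le> ennreal (\<eta> / 4) + ennreal (Kc * pi) * (\<Sum>p<P. ennreal \<epsilon> * emeasure lborel (K p) + ennreal (real m * \<delta>))"
    by (intro add_mono Bad(2) mult_left_mono sum_mono piece) auto
  also have "(\<Sum>p<P. ennreal \<epsilon> * emeasure lborel (K p) + ennreal (real m * \<delta>)) = ennreal \<epsilon> * emeasure lborel (\<Union>p<P. K p) + ennreal (real P * (real m * \<delta>))"
  proof -
    have "(\<Sum>p<P. emeasure lborel (K p)) = emeasure lborel (\<Union>p<P. K p)"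
      by (rule sum_emeasure) (use Kb disj in auto)
    then show ?thesis using \<delta> by (simp add: sum.distrib sum_distrib_left[symmetric] ennreal_mult ennreal_of_nat_eq_real_of_nat)
  qed
  also have "ennreal (\<eta> / 4) + ennreal (Kc * pi) * (ennreal \<epsilon> * emeasure lborel (\<Union>p<P. K p) + ennreal (real P * (real m * \<delta>)))
    \<le> ennreal (\<eta> / 4) + ennreal (Kc * pi) * (ennreal \<epsilon> * ennreal \<eta> + ennreal \<epsilon>)"
  proof (intro add_mono mult_left_mono order_refl UE ennreal_leI)
    have "real P * real m \<le> (real P + 1) * (real m + 1)" by (simp add: algebra_simps)
    then have "real P * real m * \<epsilon> \<le> (real P + 1) * (real m + 1) * \<epsilon>" using \<epsilon> by (intro mult_right_mono) auto
    moreover have "0 < (real P + 1) * (real m + 1)" by simp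
    ultimately show "real P * (real m * \<delta>) \<le> \<epsilon>" unfolding \<delta>_def
      by (simp add: pos_divide_le_eq mult_ac)
  qed auto
  also have "\<dots> = ennreal (\<eta> / 4 + Kc * pi * (\<epsilon> * \<eta> + \<epsilon>))"
    using \<eta> \<epsilon> kp by (simp add: ennreal_mult[symmetric] ennreal_plus[symmetric] del: ennreal_plus)
  also have "Kc * pi * (\<epsilon> * \<eta> + \<epsilon>) = \<eta> / 8"
  proof -
    have "Kc * pi > 0" "\<eta> + 1 > 0" using Kc \<eta> by auto
    moreover have "\<epsilon> * \<eta> + \<epsilon> = \<epsilon> * (\<eta> + 1)" by (simp add: algebra_simps)
    ultimately show ?thesis using Kc unfolding \<epsilon>_def by simp
  qed
  finally have "ennreal (\<eta> - \<eta> / 4) \<le> ennreal (\<eta> / 4 + \<eta> / 8)" using low by (rule order_trans[rotated])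
  then show False using \<eta> by (simp add: ennreal_le_iff)
qed

section \<open>Minimality and the main theorem\<close>

lemma (in jacobi_coeff) jacobi_ac_exists: "\<exists>T Rm S w. jacobi_ac a b C T Rm S w"
proof -
  obtain T and Rm :: "real \<Rightarrow> real^'l^'l" where T: "bdd_measure (3 * C) T"
    "\<And>p q. (\<lambda>x. Rm x $ p $ q) \<in> borel_measurable borel" "\<And>x. psd (Rm x)"
    "\<And>p q k. integrable T (\<lambda>x. x ^ k * Rm x $ p $ q)"
    "\<And>p q k. (\<integral>x. x ^ k * Rm x $ p $ q \<partial>T) = mom k (axis p 1) (axis q 1)"
    using spectral_matrix_exists by blast
  have T': "finite_measure T" "sets T = sets borel" using T(1) by (auto simp: bdd_measure_def)
  interpret jacobi_spectral a b C T Rm by unfold_locales (fact T)+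
  obtain S w where S: "S \<in> sets borel" "emeasure lborel S = 0" "w \<in> borel_measurable borel" "\<And>x. 0 \<le> w x"
    "\<And>x. x \<in> S \<Longrightarrow> w x = 0" "density T (indicator (- S)) = density lborel (\<lambda>x. ennreal (w x))"
    using lebesgue_decomposition[OF T'] by blast
  have "jacobi_ac a b C T Rm S w" by unfold_locales (fact S)+
  then show ?thesis by blast
qed

text \<open>For a decreasing sequence the levels containing \<open>x\<close> form an initial
  segment, so their number is read off at two neighbouring levels.\<close>

lemma mult_fun_eq_iff:
  assumes A: "\<And>j. A (Suc j) \<subseteq> A j" and k: "1 \<le> k"
  shows "mult_fun A x = enat k \<longleftrightarrow> x \<in> A (k - 1) \<and> x \<notin> A k"
proof -
  have dec: "A n \<subseteq> A m" if "m \<le> n" for m n by (rule lift_Suc_antimono_le[of A, OF A that])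
  show ?thesis
  proof
    assume "mult_fun A x = enat k"
    then have f: "finite {j. x \<in> A j}" and c: "card {j. x \<in> A j} = k" by (auto simp: mult_fun_def split: if_splits)
    have "x \<in> A (k - 1)"
    proof (rule ccontr)
      assume n: "x \<notin> A (k - 1)"
      then have "{j. x \<in> A j} \<subseteq> {..<k - 1}" using dec[of "k - 1"] by (auto simp: subset_iff not_less[symmetric])
      from card_mono[OF _ this] have "k \<le> k - 1" using c by simp
      then show False using k by simp
    qed
    moreover have "x \<notin> A k"
    proof
      assume n: "x \<in> A k"
      then have "{..k} \<subseteq> {j. x \<in> A j}" using dec[of _ k] by auto
      from card_mono[OF f this] show False using c by simp
    qed
    ultimately show "x \<in> A (k - 1) \<and> x \<notin> A k" ..
  next
    assume x: "x \<in> A (k - 1) \<and> x \<notin> A k"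
    have "{j. x \<in> A j} = {..<k}"
    proof (intro equalityI subsetI)
      fix j assume "j \<in> {..<k}"
      then have "A (k - 1) \<subseteq> A j" by (intro dec) auto
      then show "j \<in> {j. x \<in> A j}" using x by auto
    next
      fix j assume "j \<in> {j. x \<in> A j}"
      then show "j \<in> {..<k}" using x dec[of k j] by (cases "j < k") auto
    qed
    then show "mult_fun A x = enat k" by (simp add: mult_fun_def)
  qed
qed

lemma sigma_ac_cong:
  assumes A: "\<And>j. (SOME A. ac_mult_rep H A) j \<in> sets borel" "\<And>j. (SOME A. ac_mult_rep H A) (Suc j) \<subseteq> (SOME A. ac_mult_rep H A) j"
    and B: "\<And>j. (SOME A. ac_mult_rep H' A) j \<in> sets borel" "\<And>j. (SOME A. ac_mult_rep H' A) (Suc j) \<subseteq> (SOME A. ac_mult_rep H' A) j"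
    and AB: "\<And>j. AE x in lborel. x \<in> (SOME A. ac_mult_rep H A) j \<longleftrightarrow> x \<in> (SOME A. ac_mult_rep H' A) j"
    and k: "1 \<le> k"
  shows "sigma_ac H (enat k) = sigma_ac H' (enat k)"
proof -
  define P Q where "P = (SOME A. ac_mult_rep H A)" and "Q = (SOME A. ac_mult_rep H' A)"
  note A = A[folded P_def] and B = B[folded Q_def] and AB = AB[folded P_def Q_def]
  have "{y. mult_fun P y = enat k} = P (k - 1) - P k" "{y. mult_fun Q y = enat k} = Q (k - 1) - Q k"
    using mult_fun_eq_iff[of P k] mult_fun_eq_iff[of Q k] A(2) B(2) k by auto
  moreover have "emeasure lborel ({x - e<..<x + e} \<inter> (P (k - 1) - P k)) = emeasure lborel ({x - e<..<x + e} \<inter> (Q (k - 1) - Q k))" for x e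
  proof (rule emeasure_eq_AE)
    show "AE y in lborel. y \<in> {x - e<..<x + e} \<inter> (P (k - 1) - P k) \<longleftrightarrow> y \<in> {x - e<..<x + e} \<inter> (Q (k - 1) - Q k)"
      using AB[of k] AB[of "k - 1"] by eventually_elim auto
  qed (use A(1) B(1) in auto)
  ultimately show ?thesis unfolding sigma_ac_def P_def[symmetric] Q_def[symmetric] by simp
qed

context jacobi_ac
begin

lemma ac_mult_rep_SOME: "ac_mult_rep H (SOME A. ac_mult_rep H A)"
  by (rule someI[of "ac_mult_rep H", OF ac_mult_rep_acA])

lemma SOME_borel: "(SOME A. ac_mult_rep H A) j \<in> sets borel"
  and SOME_mono: "(SOME A. ac_mult_rep H A) (Suc j) \<subseteq> (SOME A. ac_mult_rep H A) j"
  using ac_mult_rep_SOME unfolding ac_mult_rep_def by blast+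

text \<open>\<open>sigma_ac\<close> uses an arbitrarily chosen representation; comparison with the
  explicit one in both directions shows that the choice matters only on null sets.\<close>

lemma SOME_acA: "AE x in lborel. x \<in> (SOME A. ac_mult_rep H A) j \<longleftrightarrow> x \<in> acA j"
proof -
  have "AE x in lborel. x \<in> (SOME A. ac_mult_rep H A) j \<longrightarrow> x \<in> acA j"
    by (rule ac_mult_rep_le[OF ac_linear ac_jop ac_mult_rep_SOME ac_mult_rep_acA])
  moreover have "AE x in lborel. x \<in> acA j \<longrightarrow> x \<in> (SOME A. ac_mult_rep H A) j"
    by (rule ac_mult_rep_le[OF ac_linear ac_jop ac_mult_rep_acA ac_mult_rep_SOME])
  ultimately show ?thesis by eventually_elim blast
qed

end

lemma sigma_ac_eq_limit:
  fixes a b a' b' :: "nat \<Rightarrow> real^'l^'l"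
  assumes J: "jacobi_coeff a b C" and J': "jacobi_coeff a' b' C"
    and n: "\<And>i. n i \<ge> 1" and n': "\<And>i. n' i \<ge> 1"
    and lim: "\<And>k. (\<lambda>i. a (n i + k)) \<longlonglongrightarrow> a' k" "\<And>k. (\<lambda>i. b (n i + k)) \<longlonglongrightarrow> b' k"
    and lim': "\<And>k. (\<lambda>i. a' (n' i + k)) \<longlonglongrightarrow> a k" "\<And>k. (\<lambda>i. b' (n' i + k)) \<longlonglongrightarrow> b k"
    and k: "1 \<le> k"
  shows "sigma_ac (jop a b) (enat k) = sigma_ac (jop a' b') (enat k)"
proof -
  obtain T Rm S w where A: "jacobi_ac a b C T Rm S w" using jacobi_coeff.jacobi_ac_exists[OF J] by blast
  obtain T' Rm' S' w' where B: "jacobi_ac a' b' C T' Rm' S' w'" using jacobi_coeff.jacobi_ac_exists[OF J'] by blast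
  interpret A: jacobi_ac a b C T Rm S w by fact
  interpret B: jacobi_ac a' b' C T' Rm' S' w' by fact
  have AB: "AE x in lborel. x \<in> A.acA j \<longleftrightarrow> x \<in> B.acA j" for j
  \<comment> \<open>Levels from \<open>CARD('l)\<close> on are empty by definition of
    \<open>acA\<close>; the level \<open>CARD('l)\<close> enters when \<open>k\<close> has its
    maximal value.\<close>
  proof (cases "j < CARD('l)")
    case True
    show ?thesis
      using transfer_multiplicity[OF A B n lim True] transfer_multiplicity[OF B A n' lim' True]
      by eventually_elim blast
  qed (simp add: A.acA_def B.acA_def)
  show ?thesis
  proof (rule sigma_ac_cong[OF A.SOME_borel A.SOME_mono B.SOME_borel B.SOME_mono _ k])
    show "AE x in lborel. x \<in> (SOME A. ac_mult_rep (jop a b) A) j \<longleftrightarrow> x \<in> (SOME A. ac_mult_rep (jop a' b') A) j" for j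
      using A.SOME_acA[of j] B.SOME_acA[of j] AB[of j] by eventually_elim blast
  qed
qed

lemma cmv_norm_le: "norm (cmv M u) \<le> (\<Sum>i\<in>UNIV. \<Sum>j\<in>UNIV. \<bar>M $ i $ j\<bar>) * norm u"
proof -
  have "norm (cmv M u) \<le> (\<Sum>i\<in>UNIV. norm (cmv M u $ i))" unfolding norm_vec_def by (rule L2_set_le_sum) simp
  also have "\<dots> \<le> (\<Sum>i\<in>UNIV. \<Sum>j\<in>UNIV. \<bar>M $ i $ j\<bar> * norm u)"
  proof (rule sum_mono)
    fix i
    have "norm (cmv M u $ i) \<le> (\<Sum>j\<in>UNIV. norm (complex_of_real (M $ i $ j) * u $ j))"
      unfolding cmv_def by (simp only: vec_lambda_beta norm_sum)
    also have "\<dots> \<le> (\<Sum>j\<in>UNIV. \<bar>M $ i $ j\<bar> * norm u)"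
      by (intro sum_mono) (simp add: norm_mult mult_left_mono Finite_Cartesian_Product.norm_nth_le)
    finally show "norm (cmv M u $ i) \<le> (\<Sum>j\<in>UNIV. \<bar>M $ i $ j\<bar> * norm u)" .
  qed
  finally show ?thesis by (simp add: sum_distrib_right)
qed

lemma cmv_uniform_bound:
  fixes D :: "'a::topological_space \<Rightarrow> real^'l^'l"
  assumes "compact \<Omega>" "continuous_on \<Omega> D"
  obtains C where "\<And>\<omega> u. \<omega> \<in> \<Omega> \<Longrightarrow> norm (cmv (D \<omega>) u) \<le> C * norm u" "C \<ge> 0"
proof -
  let ?f = "\<lambda>\<omega>. \<Sum>i\<in>UNIV. \<Sum>j\<in>UNIV. \<bar>D \<omega> $ i $ j\<bar>"
  have "continuous_on \<Omega> ?f" by (intro continuous_intros assms)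
  then have "compact (?f ` \<Omega>)" using assms(1) by (rule compact_continuous_image)
  from bounded_imp_bdd_above[OF compact_imp_bounded[OF this]]
  obtain C where C: "\<And>\<omega>. \<omega> \<in> \<Omega> \<Longrightarrow> ?f \<omega> \<le> C" by (auto simp: bdd_above_def)
  show ?thesis
  proof (rule that[of "max C 0"])
    fix \<omega> and u :: "complex^'l" assume "\<omega> \<in> \<Omega>"
    then have "?f \<omega> * norm u \<le> max C 0 * norm u" using C by (intro mult_right_mono) (auto simp: le_max_iff_disj)
    then show "norm (cmv (D \<omega>) u) \<le> max C 0 * norm u" using cmv_norm_le order_trans by blast
  qed simp
qed

text \<open>One sequence of times serves all \<open>k\<close>: the iterates \<open>T ^^ k\<close>
  are continuous on \<open>\<Omega>\<close>, so convergence to \<open>y\<close> carries along to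
  every later point of the orbit and then to the coefficients there.\<close>

lemma minimal_orbit_recurrence:
  fixes \<Omega> :: "'a::metric_space set" and D :: "'a \<Rightarrow> 'b::topological_space" and V :: "'a \<Rightarrow> 'c::topological_space"
  assumes T: "T ` \<Omega> \<subseteq> \<Omega>" "continuous_on \<Omega> T" and min: "minimal_on \<Omega> T"
    and D: "continuous_on \<Omega> D" and V: "continuous_on \<Omega> V" and x: "x \<in> \<Omega>" and y: "y \<in> \<Omega>"
  obtains n where "\<And>i. n i \<ge> 1" "\<And>k. (\<lambda>i. D ((T ^^ (n i + k)) x)) \<longlonglongrightarrow> D ((T ^^ k) y)"
    "\<And>k. (\<lambda>i. V ((T ^^ (n i + k)) x)) \<longlonglongrightarrow> V ((T ^^ k) y)"
proof -
  have orb: "(T ^^ k) z \<in> \<Omega>" if "z \<in> \<Omega>" for k z using that T(1) by (induction k) auto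
  have cont: "continuous_on \<Omega> (T ^^ k)" for k
  proof (induction k)
    case 0
    show ?case by (simp add: continuous_on_id)
  next
    case (Suc k)
    show ?case unfolding funpow.simps
      by (intro continuous_on_compose[OF Suc] continuous_on_subset[OF T(2)]) (use orb in auto)
  qed
  \<comment> \<open>Density of the orbit of \<open>T x\<close> instead of \<open>x\<close> makes
    every time at least 1.\<close>
  have "y \<in> closure (range (\<lambda>n. (T ^^ n) (T x)))"
    using min y orb[OF x, of 1] unfolding minimal_on_def by simp
  then obtain s where s: "\<And>i. s i \<in> range (\<lambda>n. (T ^^ n) (T x))" "s \<longlonglongrightarrow> y" unfolding closure_sequential by blast
  have "\<forall>i. \<exists>m. s i = (T ^^ m) (T x)" using s(1) by blast
  from choice[OF this] obtain m where m: "\<And>i. s i = (T ^^ m i) (T x)" by blast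
  define n where "n i = Suc (m i)" for i
  have lim: "(\<lambda>i. (T ^^ n i) x) \<longlonglongrightarrow> y" using s(2) by (simp add: m[abs_def] n_def funpow_swap1 fun_eq_iff)
  have "(\<lambda>i. (T ^^ k) ((T ^^ n i) x)) \<longlonglongrightarrow> (T ^^ k) y" for k
    by (rule continuous_on_tendsto_compose[OF cont lim y]) (simp add: orb x)
  then have lim': "(\<lambda>i. (T ^^ (n i + k)) x) \<longlonglongrightarrow> (T ^^ k) y" for k by (simp add: add.commute[of "n _" k] funpow_add)
  show ?thesis
  proof (rule that[of n])
    show "(\<lambda>i. D ((T ^^ (n i + k)) x)) \<longlonglongrightarrow> D ((T ^^ k) y)" for k
      by (rule continuous_on_tendsto_compose[OF D lim' orb[OF y]]) (simp add: orb x)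
    show "(\<lambda>i. V ((T ^^ (n i + k)) x)) \<longlonglongrightarrow> V ((T ^^ k) y)" for k
      by (rule continuous_on_tendsto_compose[OF V lim' orb[OF y]]) (simp add: orb x)
  qed (simp add: n_def)
qed

theorem mainTheorem9:
  fixes \<Omega> :: "'a::metric_space set" and T :: "'a \<Rightarrow> 'a"
    and D V :: "'a \<Rightarrow> real^'l^'l" and \<omega>0 \<omega>1 :: 'a and k :: nat
  assumes "compact \<Omega>"
    and "\<exists>S. homeomorphism \<Omega> \<Omega> T S"
    and "minimal_on \<Omega> T"
    and "continuous_on \<Omega> D" and "continuous_on \<Omega> V"
    and "\<forall>\<omega>\<in>\<Omega>. transpose (D \<omega>) = D \<omega> \<and> transpose (V \<omega>) = V \<omega>"
    and "\<forall>\<omega>\<in>\<Omega>. det (D \<omega>) \<noteq> 0"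
    and "\<omega>0 \<in> \<Omega>" and "\<omega>1 \<in> \<Omega>"
    and "1 \<le> k" and "k \<le> CARD('l)"
  shows "sigma_ac (jacobi_half D V T \<omega>0) (enat k) = sigma_ac (jacobi_half D V T \<omega>1) (enat k)"
proof -
  obtain C1 where C1: "\<And>\<omega> u. \<omega> \<in> \<Omega> \<Longrightarrow> norm (cmv (D \<omega>) u) \<le> C1 * norm u" "C1 \<ge> 0"
    using cmv_uniform_bound[OF assms(1,4)] by blast
  obtain C2 where C2: "\<And>\<omega> u. \<omega> \<in> \<Omega> \<Longrightarrow> norm (cmv (V \<omega>) u) \<le> C2 * norm u" "C2 \<ge> 0"
    using cmv_uniform_bound[OF assms(1,5)] by blast
  have T: "T ` \<Omega> \<subseteq> \<Omega>" "continuous_on \<Omega> T" using assms(2) by (auto simp: homeomorphism_def)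
  have orb: "(T ^^ k) z \<in> \<Omega>" if "z \<in> \<Omega>" for k z using that T(1) by (induction k) auto
  \<comment> \<open>The sum of the two bounds serves \<open>D\<close> and \<open>V\<close> along
    every orbit, so both operators share the constant on which the support bound
    \<open>3 * C\<close> of their measures rests.\<close>
  have J: "jacobi_coeff (\<lambda>n. D ((T ^^ n) \<omega>)) (\<lambda>n. V ((T ^^ n) \<omega>)) (C1 + C2)" if "\<omega> \<in> \<Omega>" for \<omega>
  proof
    show "norm (cmv (D ((T ^^ n) \<omega>)) u) \<le> (C1 + C2) * norm u" "norm (cmv (V ((T ^^ n) \<omega>)) u) \<le> (C1 + C2) * norm u" for n u
      using C1(1)[OF orb[OF that], of n u] C2(1)[OF orb[OF that], of n u] 
        mult_nonneg_nonneg[OF C1(2) norm_ge_zero[of u]] mult_nonneg_nonneg[OF C2(2) norm_ge_zero[of u]]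
      unfolding distrib_right by linarith+
  qed (use assms(6,7) orb[OF that] in auto)
  obtain n where n: "\<And>i. n i \<ge> 1" "\<And>k. (\<lambda>i. D ((T ^^ (n i + k)) \<omega>0)) \<longlonglongrightarrow> D ((T ^^ k) \<omega>1)"
    "\<And>k. (\<lambda>i. V ((T ^^ (n i + k)) \<omega>0)) \<longlonglongrightarrow> V ((T ^^ k) \<omega>1)"
    using minimal_orbit_recurrence[OF T assms(3-5,8,9)] by blast
  obtain n' where n': "\<And>i. n' i \<ge> 1" "\<And>k. (\<lambda>i. D ((T ^^ (n' i + k)) \<omega>1)) \<longlonglongrightarrow> D ((T ^^ k) \<omega>0)"
    "\<And>k. (\<lambda>i. V ((T ^^ (n' i + k)) \<omega>1)) \<longlonglongrightarrow> V ((T ^^ k) \<omega>0)"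
    using minimal_orbit_recurrence[OF T assms(3-5,9,8)] by blast
  show ?thesis unfolding jacobi_half_jop
    by (rule sigma_ac_eq_limit[OF J[OF assms(8)] J[OF assms(9)] n(1) n'(1) n(2,3) n'(2,3) assms(10)])
qed

end
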